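(* Let $\mathbb{T}$ and $\mathbb{T}'$ be T-Morita equivalent coherent theories. Then $\mathbb{T}$ and $\mathbb{T}'$ are J-Morita equivalent, i.e. they have equivalent classifying toposes.
   Context: Signatures are many-sorted. A coherent formula is built from atomic formulas (including equalities) using $\top,\bot,\wedge$, finite $\vee$ and $\exists$; a coherent theory over a signature $\Sigma$ is a set of sequents $\phi\vdash_{\vec x}\psi$ between coherent $\Sigma$-formulas, with derivability in (intuitionistic) coherent sequent logic. Standing assumption: every theory considered has at least one sort $S$ with $\mathbb{T}\models \top\vdash\exists x{:}S\,(\top)$. Let $\mathbb{T}_1$ be a coherent theory over $\Sigma_1$ and $\mathbb{T}_2$ a theory over $\Sigma_2\supseteq\Sigma_1$. $\mathbb{T}_2$ is a Morita extension of $\mathbb{T}_1$ if $\mathbb{T}_2$ consists of $\mathbb{T}_1$ together with, for each symbol of $\Sigma_2\setminus\Sigma_1$, sequents defining it in one of the following ways (new sorts are only built from sorts $S$ for which $\mathbb{T}_1\models\top\vdash\exists x{:}S\,(\top)$): (a) a new function symbol $f$ or relation symbol $R$ explicitly defined by a coherent $\Sigma_1$-formula: $f(\vec x)=y\dashv\vdash\phi(\vec x,y)$ with $\phi$ $\mathbb{T}_1$-provably functional, or $R(\vec x)\dashv\vdash\phi(\vec x)$; (b) a product sort $S_1\times\dots\times S_n$ with projections $\pi_i$, with axioms $\top\vdash_{x_1,\dots,x_n}\exists x\,(\bigwedge_i\pi_i(x)=x_i)$ and $\bigwedge_i\pi_i(x)=x_i\wedge\bigwedge_i\pi_i(z)=x_i\vdash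 x=z$; (c) a coproduct sort $S_1\amalg\dots\amalg S_n$ with injections $\rho_i$, with axioms $\top\vdash_x\bigvee_i\exists x_i{:}S_i\,(\rho_i(x_i)=x)$, $\rho_i(x_i)=x\wedge\rho_i(x_i')=x\vdash x_i=x_i'$ for each $i$, and $\rho_i(x_i)=x\wedge\rho_j(x_j)=x\vdash\bot$ for $i\neq j$; (d) a subsort $S$ of a sort $T$ given by a coherent $\Sigma_1$-formula $\phi(x)$ (possibly $\bot$) with function symbol $i:S\to T$, with axioms $\phi(x)\dashv\vdash_{x:T}\exists y{:}S\,(i(y)=x)$ and $i(x)=i(y)\vdash_{x,y:S}x=y$; (e) a quotient sort $S$ of a sort $T$ by a $\mathbb{T}_1$-provable equivalence relation $\phi(x,y)$ with function symbol $\epsilon:T\to S$, with axioms $\epsilon(x)=\epsilon(y)\dashv\vdash_{x,y:T}\phi(x,y)$ and $\top\vdash_{x:S}\exists y{:}T\,(\epsilon(y)=x)$. A Morita chain from $\mathbb{T}$ is a finite sequence $\mathbb{T}=\mathbb{T}_0,\dots,\mathbb{T}_n$ with each $\mathbb{T}_k$ a Morita extension of $\mathbb{T}_{k-1}$. $\mathbb{T}$ and $\mathbb{T}'$ are pre-T-Morita equivalent if there are Morita chains from $\mathbb{T}$ to some $\mathbb{T}_n$ and from $\mathbb{T}'$ to some $\mathbb{T}'_m$ with $\mathbb{T}_n$ and $\mathbb{T}'_m$ logically equivalent. T-Morita equivalence is the transitive closure of pre-T-Morita equivalence (where a theory may first be replaced by a copy whose signature symbols are renamed). Two coherent theories are J-Morita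 equivalent if their classifying toposes are equivalent. *)

theory Defs
  imports Main "HOL-Library.FuncSet" "HOL-Library.Equipollence"
begin

section \<open>Many-sorted coherent logic\<close>

record ('s, 'f, 'r) signature =
  sorts :: "'s set"
  funs :: "'f set"
  rels :: "'r set"
  fdom :: "'f \<Rightarrow> 's list"
  fcod :: "'f \<Rightarrow> 's"
  rdom :: "'r \<Rightarrow> 's list"

definition wf_signature :: "('s, 'f, 'r) signature \<Rightarrow> bool" where
  "wf_signature \<Sigma> \<longleftrightarrow>
     (\<forall>f\<in>funs \<Sigma>. set (fdom \<Sigma> f) \<subseteq> sorts \<Sigma> \<and> fcod \<Sigma> f \<in> sorts \<Sigma>) \<and>
     (\<forall>R\<in>rels \<Sigma>. set (rdom \<Sigma> R) \<subseteq> sorts \<Sigma>)"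

text \<open>The arity functions are only meaningful on the symbols of the signature, so inclusion of
  signatures compares them only there.\<close>

definition subsignature :: "('s, 'f, 'r) signature \<Rightarrow> ('s, 'f, 'r) signature \<Rightarrow> bool" where
  "subsignature \<Sigma> \<Sigma>' \<longleftrightarrow>
     sorts \<Sigma> \<subseteq> sorts \<Sigma>' \<and> funs \<Sigma> \<subseteq> funs \<Sigma>' \<and> rels \<Sigma> \<subseteq> rels \<Sigma>' \<and>
     (\<forall>f\<in>funs \<Sigma>. fdom \<Sigma>' f = fdom \<Sigma> f \<and> fcod \<Sigma>' f = fcod \<Sigma> f) \<and>
     (\<forall>R\<in>rels \<Sigma>. rdom \<Sigma>' R = rdom \<Sigma> R)"

text \<open>Variables are de Bruijn indices, so formulas are taken up to renaming of bound variables.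
  A context is the list of the sorts of its variables: in context \<open>\<Gamma>\<close>, the term \<open>Var i\<close> is a
  variable of sort \<open>\<Gamma> ! i\<close>. The formula \<open>Ex S \<phi>\<close> binds the variable \<open>Var 0\<close> of \<open>\<phi>\<close>, so that it
  lives in context \<open>\<Gamma>\<close> when \<open>\<phi>\<close> lives in context \<open>S # \<Gamma>\<close>.\<close>

datatype 'f tm = Var nat | Fn 'f "'f tm list"

datatype ('s, 'f, 'r) fm =
    Eq "'f tm" "'f tm"
  | Rel 'r "'f tm list"
  | Top
  | Bot
  | And "('s, 'f, 'r) fm" "('s, 'f, 'r) fm"
  | Or "('s, 'f, 'r) fm" "('s, 'f, 'r) fm"
  | Ex 's "('s, 'f, 'r) fm"

inductive wt :: "('s, 'f, 'r) signature \<Rightarrow> 's list \<Rightarrow> 'f tm \<Rightarrow> 's \<Rightarrow> bool"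
  for \<Sigma> \<Gamma> where
  Var: "i < length \<Gamma> \<Longrightarrow> wt \<Sigma> \<Gamma> (Var i) (\<Gamma> ! i)"
| Fn: "f \<in> funs \<Sigma> \<Longrightarrow> list_all2 (wt \<Sigma> \<Gamma>) ts (fdom \<Sigma> f) \<Longrightarrow> wt \<Sigma> \<Gamma> (Fn f ts) (fcod \<Sigma> f)"

primrec wf_fm :: "('s, 'f, 'r) signature \<Rightarrow> 's list \<Rightarrow> ('s, 'f, 'r) fm \<Rightarrow> bool" where
  "wf_fm \<Sigma> \<Gamma> (Eq t u) \<longleftrightarrow> (\<exists>S. wt \<Sigma> \<Gamma> t S \<and> wt \<Sigma> \<Gamma> u S)"
| "wf_fm \<Sigma> \<Gamma> (Rel R ts) \<longleftrightarrow> R \<in> rels \<Sigma> \<and> list_all2 (wt \<Sigma> \<Gamma>) ts (rdom \<Sigma> R)"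
| "wf_fm \<Sigma> \<Gamma> Top \<longleftrightarrow> True"
| "wf_fm \<Sigma> \<Gamma> Bot \<longleftrightarrow> True"
| "wf_fm \<Sigma> \<Gamma> (And \<phi> \<psi>) \<longleftrightarrow> wf_fm \<Sigma> \<Gamma> \<phi> \<and> wf_fm \<Sigma> \<Gamma> \<psi>"
| "wf_fm \<Sigma> \<Gamma> (Or \<phi> \<psi>) \<longleftrightarrow> wf_fm \<Sigma> \<Gamma> \<phi> \<and> wf_fm \<Sigma> \<Gamma> \<psi>"
| "wf_fm \<Sigma> \<Gamma> (Ex S \<phi>) \<longleftrightarrow> S \<in> sorts \<Sigma> \<and> wf_fm \<Sigma> (S # \<Gamma>) \<phi>"

text \<open>Formulas in context: the sorts of the context must belong to the signature.\<close>

definition fm_in_ctx :: "('s, 'f, 'r) signature \<Rightarrow> 's list \<Rightarrow> ('s, 'f, 'r) fm \<Rightarrow> bool" where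
  "fm_in_ctx \<Sigma> \<Gamma> \<phi> \<longleftrightarrow> set \<Gamma> \<subseteq> sorts \<Sigma> \<and> wf_fm \<Sigma> \<Gamma> \<phi>"

primrec tsubst :: "(nat \<Rightarrow> 'f tm) \<Rightarrow> 'f tm \<Rightarrow> 'f tm" where
  "tsubst \<sigma> (Var i) = \<sigma> i"
| "tsubst \<sigma> (Fn f ts) = Fn f (map (tsubst \<sigma>) ts)"

text \<open>Substitution under a quantifier: the bound variable is kept, the rest is weakened by it.\<close>

definition lift :: "(nat \<Rightarrow> 'f tm) \<Rightarrow> nat \<Rightarrow> 'f tm" where
  "lift \<sigma> = case_nat (Var 0) (\<lambda>i. tsubst (\<lambda>j. Var (Suc j)) (\<sigma> i))"

primrec fsubst :: "(nat \<Rightarrow> 'f tm) \<Rightarrow> ('s, 'f, 'r) fm \<Rightarrow> ('s, 'f, 'r) fm" where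
  "fsubst \<sigma> (Eq t u) = Eq (tsubst \<sigma> t) (tsubst \<sigma> u)"
| "fsubst \<sigma> (Rel R ts) = Rel R (map (tsubst \<sigma>) ts)"
| "fsubst \<sigma> Top = Top"
| "fsubst \<sigma> Bot = Bot"
| "fsubst \<sigma> (And \<phi> \<psi>) = And (fsubst \<sigma> \<phi>) (fsubst \<sigma> \<psi>)"
| "fsubst \<sigma> (Or \<phi> \<psi>) = Or (fsubst \<sigma> \<phi>) (fsubst \<sigma> \<psi>)"
| "fsubst \<sigma> (Ex S \<phi>) = Ex S (fsubst (lift \<sigma>) \<phi>)"

text \<open>\<open>inst \<phi> ts\<close> is \<open>\<phi>[ts]\<close>, for \<open>\<phi>\<close> in a context of length \<open>length ts\<close>; the list \<open>vars k n\<close> is a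
  block of \<open>n\<close> consecutive variables of a context, starting at position \<open>k\<close>.\<close>

definition inst :: "('s, 'f, 'r) fm \<Rightarrow> 'f tm list \<Rightarrow> ('s, 'f, 'r) fm" where
  "inst \<phi> ts = fsubst (\<lambda>i. ts ! i) \<phi>"

definition vars :: "nat \<Rightarrow> nat \<Rightarrow> 'f tm list" where
  "vars k n = map Var [k..<k + n]"

definition conj :: "('s, 'f, 'r) fm list \<Rightarrow> ('s, 'f, 'r) fm" where
  "conj \<phi>s = foldr And \<phi>s Top"

definition disj :: "('s, 'f, 'r) fm list \<Rightarrow> ('s, 'f, 'r) fm" where
  "disj \<phi>s = foldr Or \<phi>s Bot"

definition eqs :: "'f tm list \<Rightarrow> 'f tm list \<Rightarrow> ('s, 'f, 'r) fm" where
  "eqs ts us = conj (map2 Eq ts us)"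

text \<open>Quantification over a block of variables: if \<open>\<phi>\<close> lives in context \<open>\<Delta> @ \<Gamma>\<close>, then \<open>exs \<Delta> \<phi>\<close>
  lives in context \<open>\<Gamma>\<close>.\<close>

definition exs :: "'s list \<Rightarrow> ('s, 'f, 'r) fm \<Rightarrow> ('s, 'f, 'r) fm" where
  "exs \<Delta> \<phi> = fold Ex \<Delta> \<phi>"

type_synonym ('s, 'f, 'r) sequent = "'s list \<times> ('s, 'f, 'r) fm \<times> ('s, 'f, 'r) fm"

record ('s, 'f, 'r) coh_theory =
  sig :: "('s, 'f, 'r) signature"
  axs :: "('s, 'f, 'r) sequent set"

text \<open>\<open>prov T \<Gamma> \<phi> \<psi>\<close>: the sequent \<open>\<phi> \<turnstile>\<^sub>\<Gamma> \<psi>\<close> is derivable from \<open>T\<close> in coherent logic. The calculus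
  keeps track of contexts, so no sort is presupposed to be inhabited.\<close>

inductive prov ::
  "('s, 'f, 'r) coh_theory \<Rightarrow> 's list \<Rightarrow> ('s, 'f, 'r) fm \<Rightarrow> ('s, 'f, 'r) fm \<Rightarrow> bool"
  for T where
  ax: "(\<Gamma>, \<phi>, \<psi>) \<in> axs T \<Longrightarrow> prov T \<Gamma> \<phi> \<psi>"
| ident: "fm_in_ctx (sig T) \<Gamma> \<phi> \<Longrightarrow> prov T \<Gamma> \<phi> \<phi>"
| subst: "prov T \<Gamma> \<phi> \<psi> \<Longrightarrow> set \<Delta> \<subseteq> sorts (sig T) \<Longrightarrow>
    (\<And>i. i < length \<Gamma> \<Longrightarrow> wt (sig T) \<Delta> (\<sigma> i) (\<Gamma> ! i)) \<Longrightarrow>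
    prov T \<Delta> (fsubst \<sigma> \<phi>) (fsubst \<sigma> \<psi>)"
| cut: "prov T \<Gamma> \<phi> \<psi> \<Longrightarrow> prov T \<Gamma> \<psi> \<chi> \<Longrightarrow> prov T \<Gamma> \<phi> \<chi>"
| eq_refl: "set \<Gamma> \<subseteq> sorts (sig T) \<Longrightarrow> wt (sig T) \<Gamma> t S \<Longrightarrow> prov T \<Gamma> Top (Eq t t)"
| eq_subst: "fm_in_ctx (sig T) (S # \<Gamma>) \<phi> \<Longrightarrow>
    wt (sig T) \<Gamma> t S \<Longrightarrow> wt (sig T) \<Gamma> u S \<Longrightarrow>
    prov T \<Gamma> (And (Eq t u) (fsubst (case_nat t Var) \<phi>)) (fsubst (case_nat u Var) \<phi>)"
| topI: "fm_in_ctx (sig T) \<Gamma> \<phi> \<Longrightarrow> prov T \<Gamma> \<phi> Top"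
| conjE1: "fm_in_ctx (sig T) \<Gamma> (And \<phi> \<psi>) \<Longrightarrow> prov T \<Gamma> (And \<phi> \<psi>) \<phi>"
| conjE2: "fm_in_ctx (sig T) \<Gamma> (And \<phi> \<psi>) \<Longrightarrow> prov T \<Gamma> (And \<phi> \<psi>) \<psi>"
| conjI: "prov T \<Gamma> \<phi> \<psi> \<Longrightarrow> prov T \<Gamma> \<phi> \<chi> \<Longrightarrow> prov T \<Gamma> \<phi> (And \<psi> \<chi>)"
| botE: "fm_in_ctx (sig T) \<Gamma> \<phi> \<Longrightarrow> prov T \<Gamma> Bot \<phi>"
| disjI1: "fm_in_ctx (sig T) \<Gamma> (Or \<phi> \<psi>) \<Longrightarrow> prov T \<Gamma> \<phi> (Or \<phi> \<psi>)"
| disjI2: "fm_in_ctx (sig T) \<Gamma> (Or \<phi> \<psi>) \<Longrightarrow> prov T \<Gamma> \<psi> (Or \<phi> \<psi>)"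
| disjE: "prov T \<Gamma> \<phi> \<chi> \<Longrightarrow> prov T \<Gamma> \<psi> \<chi> \<Longrightarrow> prov T \<Gamma> (Or \<phi> \<psi>) \<chi>"
| exE: "prov T (S # \<Gamma>) \<phi> (fsubst (\<lambda>i. Var (Suc i)) \<psi>) \<Longrightarrow> fm_in_ctx (sig T) \<Gamma> \<psi> \<Longrightarrow>
    prov T \<Gamma> (Ex S \<phi>) \<psi>"
| exD: "prov T \<Gamma> (Ex S \<phi>) \<psi> \<Longrightarrow> prov T (S # \<Gamma>) \<phi> (fsubst (\<lambda>i. Var (Suc i)) \<psi>)"
| distrib: "fm_in_ctx (sig T) \<Gamma> (And \<phi> (Or \<psi> \<chi>)) \<Longrightarrow>
    prov T \<Gamma> (And \<phi> (Or \<psi> \<chi>)) (Or (And \<phi> \<psi>) (And \<phi> \<chi>))"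
| frobenius: "fm_in_ctx (sig T) \<Gamma> (And \<phi> (Ex S \<psi>)) \<Longrightarrow>
    prov T \<Gamma> (And \<phi> (Ex S \<psi>)) (Ex S (And (fsubst (\<lambda>i. Var (Suc i)) \<phi>) \<psi>))"

definition inhabited :: "('s, 'f, 'r) coh_theory \<Rightarrow> 's \<Rightarrow> bool" where
  "inhabited T S \<longleftrightarrow> S \<in> sorts (sig T) \<and> prov T [] Top (Ex S Top)"

text \<open>The last conjunct is the standing assumption on theories.\<close>

definition coherent_theory :: "('s, 'f, 'r) coh_theory \<Rightarrow> bool" where
  "coherent_theory T \<longleftrightarrow>
     wf_signature (sig T) \<and>
     (\<forall>(\<Gamma>, \<phi>, \<psi>)\<in>axs T. fm_in_ctx (sig T) \<Gamma> \<phi> \<and> fm_in_ctx (sig T) \<Gamma> \<psi>) \<and>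
     (\<exists>S. inhabited T S)"

definition logically_equivalent :: "('s, 'f, 'r) coh_theory \<Rightarrow> ('s, 'f, 'r) coh_theory \<Rightarrow> bool" where
  "logically_equivalent T T' \<longleftrightarrow>
     subsignature (sig T) (sig T') \<and> subsignature (sig T') (sig T) \<and>
     (\<forall>\<Gamma> \<phi> \<psi>. prov T \<Gamma> \<phi> \<psi> \<longleftrightarrow> prov T' \<Gamma> \<phi> \<psi>)"


section \<open>Morita extensions and T-Morita equivalence\<close>

text \<open>A definition block introduces a new sort together with its structure maps, or a single new
  function or relation symbol. The defining formula of a function symbol \<open>f\<close> lives in the context
  \<open>fdom f @ [fcod f]\<close>.\<close>

datatype ('s, 'f, 'r) block =
    DefFun 'f "('s, 'f, 'r) fm"
  | DefRel 'r "('s, 'f, 'r) fm"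
  | DefProd 's "'s list" "'f list"
  | DefCoprod 's "'s list" "'f list"
  | DefSub 's 's "('s, 'f, 'r) fm" 'f
  | DefQuot 's 's "('s, 'f, 'r) fm" 'f

primrec new_sorts :: "('s, 'f, 'r) block \<Rightarrow> 's set" where
  "new_sorts (DefFun f \<phi>) = {}"
| "new_sorts (DefRel R \<phi>) = {}"
| "new_sorts (DefProd P Ss ps) = {P}"
| "new_sorts (DefCoprod P Ss rs) = {P}"
| "new_sorts (DefSub S S' \<phi> i) = {S}"
| "new_sorts (DefQuot S S' \<phi> e) = {S}"

primrec new_funs :: "('s, 'f, 'r) block \<Rightarrow> 'f set" where
  "new_funs (DefFun f \<phi>) = {f}"
| "new_funs (DefRel R \<phi>) = {}"
| "new_funs (DefProd P Ss ps) = set ps"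
| "new_funs (DefCoprod P Ss rs) = set rs"
| "new_funs (DefSub S S' \<phi> i) = {i}"
| "new_funs (DefQuot S S' \<phi> e) = {e}"

primrec new_rels :: "('s, 'f, 'r) block \<Rightarrow> 'r set" where
  "new_rels (DefFun f \<phi>) = {}"
| "new_rels (DefRel R \<phi>) = {R}"
| "new_rels (DefProd P Ss ps) = {}"
| "new_rels (DefCoprod P Ss rs) = {}"
| "new_rels (DefSub S S' \<phi> i) = {}"
| "new_rels (DefQuot S S' \<phi> e) = {}"

definition provably_functional ::
  "('s, 'f, 'r) coh_theory \<Rightarrow> 's list \<Rightarrow> 's \<Rightarrow> ('s, 'f, 'r) fm \<Rightarrow> bool" where
  "provably_functional T Ss S \<phi> \<longleftrightarrow>
     (let n = length Ss in
       prov T Ss Top (Ex S (inst \<phi> (vars 1 n @ [Var 0]))) \<and>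
       prov T (Ss @ [S, S])
         (And (inst \<phi> (vars 0 n @ [Var n])) (inst \<phi> (vars 0 n @ [Var (n + 1)])))
         (Eq (Var n) (Var (n + 1))))"

definition provable_equivalence ::
  "('s, 'f, 'r) coh_theory \<Rightarrow> 's \<Rightarrow> ('s, 'f, 'r) fm \<Rightarrow> bool" where
  "provable_equivalence T S \<phi> \<longleftrightarrow>
     prov T [S] Top (inst \<phi> [Var 0, Var 0]) \<and>
     prov T [S, S] \<phi> (inst \<phi> [Var 1, Var 0]) \<and>
     prov T [S, S, S]
       (And (inst \<phi> [Var 0, Var 1]) (inst \<phi> [Var 1, Var 2])) (inst \<phi> [Var 0, Var 2])"

text \<open>\<open>valid_block T \<Sigma> d\<close>: the block \<open>d\<close>, whose new symbols have their arities in the larger signature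
  \<open>\<Sigma>\<close>, is built from the sorts and formulas of \<open>T\<close> and meets the provability conditions over \<open>T\<close>.\<close>

fun valid_block ::
  "('s, 'f, 'r) coh_theory \<Rightarrow> ('s, 'f, 'r) signature \<Rightarrow> ('s, 'f, 'r) block \<Rightarrow> bool" where
  "valid_block T \<Sigma> (DefFun f \<phi>) \<longleftrightarrow>
     fm_in_ctx (sig T) (fdom \<Sigma> f @ [fcod \<Sigma> f]) \<phi> \<and>
     provably_functional T (fdom \<Sigma> f) (fcod \<Sigma> f) \<phi>"
| "valid_block T \<Sigma> (DefRel R \<phi>) \<longleftrightarrow> fm_in_ctx (sig T) (rdom \<Sigma> R) \<phi>"
| "valid_block T \<Sigma> (DefProd P Ss ps) \<longleftrightarrow>
     Ss \<noteq> [] \<and> (\<forall>S\<in>set Ss. inhabited T S) \<and> length ps = length Ss \<and> distinct ps \<and>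
     (\<forall>i<length Ss. fdom \<Sigma> (ps ! i) = [P] \<and> fcod \<Sigma> (ps ! i) = Ss ! i)"
| "valid_block T \<Sigma> (DefCoprod P Ss rs) \<longleftrightarrow>
     Ss \<noteq> [] \<and> (\<forall>S\<in>set Ss. inhabited T S) \<and> length rs = length Ss \<and> distinct rs \<and>
     (\<forall>i<length Ss. fdom \<Sigma> (rs ! i) = [Ss ! i] \<and> fcod \<Sigma> (rs ! i) = P)"
| "valid_block T \<Sigma> (DefSub S S' \<phi> i) \<longleftrightarrow>
     inhabited T S' \<and> fm_in_ctx (sig T) [S'] \<phi> \<and> fdom \<Sigma> i = [S] \<and> fcod \<Sigma> i = S'"
| "valid_block T \<Sigma> (DefQuot S S' \<phi> e) \<longleftrightarrow>
     inhabited T S' \<and> fm_in_ctx (sig T) [S', S'] \<phi> \<and> provable_equivalence T S' \<phi> \<and>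
     fdom \<Sigma> e = [S'] \<and> fcod \<Sigma> e = S"

fun block_axioms ::
  "('s, 'f, 'r) signature \<Rightarrow> ('s, 'f, 'r) block \<Rightarrow> ('s, 'f, 'r) sequent set" where
  "block_axioms \<Sigma> (DefFun f \<phi>) =
     (let \<Gamma> = fdom \<Sigma> f @ [fcod \<Sigma> f]; n = length (fdom \<Sigma> f); \<psi> = Eq (Fn f (vars 0 n)) (Var n) in
       {(\<Gamma>, \<psi>, \<phi>), (\<Gamma>, \<phi>, \<psi>)})"
| "block_axioms \<Sigma> (DefRel R \<phi>) =
     (let \<Gamma> = rdom \<Sigma> R; \<psi> = Rel R (vars 0 (length \<Gamma>)) in {(\<Gamma>, \<psi>, \<phi>), (\<Gamma>, \<phi>, \<psi>)})"
| "block_axioms \<Sigma> (DefProd P Ss ps) =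
     (let n = length Ss in
       {(Ss, Top, Ex P (conj (map (\<lambda>i. Eq (Fn (ps ! i) [Var 0]) (Var (Suc i))) [0..<n]))),
        (Ss @ [P, P],
           And (conj (map (\<lambda>i. Eq (Fn (ps ! i) [Var n]) (Var i)) [0..<n]))
               (conj (map (\<lambda>i. Eq (Fn (ps ! i) [Var (n + 1)]) (Var i)) [0..<n])),
           Eq (Var n) (Var (n + 1)))})"
| "block_axioms \<Sigma> (DefCoprod P Ss rs) =
     (let n = length Ss in
       {([P], Top, disj (map (\<lambda>i. Ex (Ss ! i) (Eq (Fn (rs ! i) [Var 0]) (Var 1))) [0..<n]))} \<union>
       {([Ss ! i, Ss ! i, P],
           And (Eq (Fn (rs ! i) [Var 0]) (Var 2)) (Eq (Fn (rs ! i) [Var 1]) (Var 2)),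
           Eq (Var 0) (Var 1)) | i. i < n} \<union>
       {([Ss ! i, Ss ! j, P],
           And (Eq (Fn (rs ! i) [Var 0]) (Var 2)) (Eq (Fn (rs ! j) [Var 1]) (Var 2)),
           Bot) | i j. i < n \<and> j < n \<and> i \<noteq> j})"
| "block_axioms \<Sigma> (DefSub S S' \<phi> i) =
     (let \<psi> = Ex S (Eq (Fn i [Var 0]) (Var 1)) in
       {([S'], \<phi>, \<psi>), ([S'], \<psi>, \<phi>),
        ([S, S], Eq (Fn i [Var 0]) (Fn i [Var 1]), Eq (Var 0) (Var 1))})"
| "block_axioms \<Sigma> (DefQuot S S' \<phi> e) =
     (let \<psi> = Eq (Fn e [Var 0]) (Fn e [Var 1]) in
       {([S', S'], \<psi>, \<phi>), ([S', S'], \<phi>, \<psi>),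
        ([S], Top, Ex S' (Eq (Fn e [Var 0]) (Var 1)))})"

text \<open>The blocks partition the new symbols: each of them is defined exactly once.\<close>

definition morita_extension :: "('s, 'f, 'r) coh_theory \<Rightarrow> ('s, 'f, 'r) coh_theory \<Rightarrow> bool" where
  "morita_extension T1 T2 \<longleftrightarrow>
     coherent_theory T1 \<and> coherent_theory T2 \<and> subsignature (sig T1) (sig T2) \<and>
     (\<exists>D.
       (\<forall>d\<in>D. valid_block T1 (sig T2) d) \<and>
       (\<forall>d\<in>D. new_sorts d \<subseteq> sorts (sig T2) - sorts (sig T1) \<and>
               new_funs d \<subseteq> funs (sig T2) - funs (sig T1) \<and>
               new_rels d \<subseteq> rels (sig T2) - rels (sig T1)) \<and>
       (\<forall>S\<in>sorts (sig T2) - sorts (sig T1). \<exists>!d. d \<in> D \<and> S \<in> new_sorts d) \<and>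
       (\<forall>f\<in>funs (sig T2) - funs (sig T1). \<exists>!d. d \<in> D \<and> f \<in> new_funs d) \<and>
       (\<forall>R\<in>rels (sig T2) - rels (sig T1). \<exists>!d. d \<in> D \<and> R \<in> new_rels d) \<and>
       axs T2 = axs T1 \<union> (\<Union>d\<in>D. block_axioms (sig T2) d))"

text \<open>Reflexive-transitive closure: a Morita chain is a finite, possibly trivial, sequence of Morita
  extensions.\<close>

definition pre_t_morita_equivalent ::
  "('s, 'f, 'r) coh_theory \<Rightarrow> ('s, 'f, 'r) coh_theory \<Rightarrow> bool" where
  "pre_t_morita_equivalent T T' \<longleftrightarrow>
     coherent_theory T \<and> coherent_theory T' \<and>
     (\<exists>Tn Tm. morita_extension\<^sup>*\<^sup>* T Tn \<and> morita_extension\<^sup>*\<^sup>* T' Tm \<and> logically_equivalent Tn Tm)"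

text \<open>\<open>T'\<close> is a copy of \<open>T\<close> with renamed symbols; the symbols may come from other types.\<close>

definition renamed_copy ::
  "('s1, 'f1, 'r1) coh_theory \<Rightarrow> ('s2, 'f2, 'r2) coh_theory \<Rightarrow> bool" where
  "renamed_copy T T' \<longleftrightarrow>
     (\<exists>hs hf hr.
       bij_betw hs (sorts (sig T)) (sorts (sig T')) \<and>
       bij_betw hf (funs (sig T)) (funs (sig T')) \<and>
       bij_betw hr (rels (sig T)) (rels (sig T')) \<and>
       (\<forall>f\<in>funs (sig T). fdom (sig T') (hf f) = map hs (fdom (sig T) f) \<and>
                          fcod (sig T') (hf f) = hs (fcod (sig T) f)) \<and>
       (\<forall>R\<in>rels (sig T). rdom (sig T') (hr R) = map hs (rdom (sig T) R)) \<and>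
       axs T' = (\<lambda>(\<Gamma>, \<phi>, \<psi>). (map hs \<Gamma>, map_fm hs hf hr \<phi>, map_fm hs hf hr \<psi>)) ` axs T)"

definition t_morita_step :: "('s, 'f, 'r) coh_theory \<Rightarrow> ('s, 'f, 'r) coh_theory \<Rightarrow> bool" where
  "t_morita_step T T' \<longleftrightarrow>
     coherent_theory T \<and> coherent_theory T' \<and>
     (renamed_copy T T' \<or> pre_t_morita_equivalent T T')"

text \<open>The two theories may use symbols of different types; the comparison takes place between
  renamed copies with symbols in common types \<open>'s\<close>, \<open>'f\<close> and \<open>'r\<close>, given as the first
  argument, which can be chosen large enough to have room for new symbols. Renaming is also allowed
  between any two steps of the transitive closure.\<close>

definition t_morita_equivalent ::
  "('s \<times> 'f \<times> 'r) itself \<Rightarrow> ('s1, 'f1, 'r1) coh_theory \<Rightarrow> ('s2, 'f2, 'r2) coh_theory \<Rightarrow> bool" where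
  "t_morita_equivalent _ T T' \<longleftrightarrow>
     (\<exists>(A :: ('s, 'f, 'r) coh_theory) A'.
        renamed_copy T A \<and> renamed_copy T' A' \<and> t_morita_step\<^sup>+\<^sup>+ A A')"


section \<open>Categories and their equivalence\<close>

record ('o, 'm) category =
  Ob :: "'o set"
  Ar :: "'m set"
  Dom :: "'m \<Rightarrow> 'o"
  Cod :: "'m \<Rightarrow> 'o"
  Ident :: "'o \<Rightarrow> 'm"
  Cmp :: "'m \<Rightarrow> 'm \<Rightarrow> 'm"

text \<open>\<open>Cmp C g f\<close> is \<open>g \<circ> f\<close>.\<close>

definition hom :: "('o, 'm) category \<Rightarrow> 'o \<Rightarrow> 'o \<Rightarrow> 'm set" where
  "hom C a b = {f \<in> Ar C. Dom C f = a \<and> Cod C f = b}"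

definition is_category :: "('o, 'm) category \<Rightarrow> bool" where
  "is_category C \<longleftrightarrow>
     (\<forall>f\<in>Ar C. Dom C f \<in> Ob C \<and> Cod C f \<in> Ob C) \<and>
     (\<forall>a\<in>Ob C. Ident C a \<in> hom C a a) \<and>
     (\<forall>f\<in>Ar C. \<forall>g\<in>Ar C. Cod C f = Dom C g \<longrightarrow> Cmp C g f \<in> hom C (Dom C f) (Cod C g)) \<and>
     (\<forall>f\<in>Ar C. Cmp C f (Ident C (Dom C f)) = f \<and> Cmp C (Ident C (Cod C f)) f = f) \<and>
     (\<forall>f\<in>Ar C. \<forall>g\<in>Ar C. \<forall>h\<in>Ar C. Cod C f = Dom C g \<and> Cod C g = Dom C h \<longrightarrow>
        Cmp C h (Cmp C g f) = Cmp C (Cmp C h g) f)"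

record ('o1, 'm1, 'o2, 'm2) functr =
  fob :: "'o1 \<Rightarrow> 'o2"
  far :: "'m1 \<Rightarrow> 'm2"

definition is_functor ::
  "('o1, 'm1) category \<Rightarrow> ('o2, 'm2) category \<Rightarrow> ('o1, 'm1, 'o2, 'm2) functr \<Rightarrow> bool" where
  "is_functor C D F \<longleftrightarrow>
     (\<forall>a\<in>Ob C. fob F a \<in> Ob D) \<and>
     (\<forall>f\<in>Ar C. far F f \<in> hom D (fob F (Dom C f)) (fob F (Cod C f))) \<and>
     (\<forall>a\<in>Ob C. far F (Ident C a) = Ident D (fob F a)) \<and>
     (\<forall>f\<in>Ar C. \<forall>g\<in>Ar C. Cod C f = Dom C g \<longrightarrow>
        far F (Cmp C g f) = Cmp D (far F g) (far F f))"

definition id_functor :: "('o, 'm, 'o, 'm) functr" where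
  "id_functor = \<lparr>fob = id, far = id\<rparr>"

definition comp_functor ::
  "('o2, 'm2, 'o3, 'm3) functr \<Rightarrow> ('o1, 'm1, 'o2, 'm2) functr \<Rightarrow> ('o1, 'm1, 'o3, 'm3) functr" where
  "comp_functor G F = \<lparr>fob = fob G \<circ> fob F, far = far G \<circ> far F\<rparr>"

definition is_iso :: "('o, 'm) category \<Rightarrow> 'm \<Rightarrow> bool" where
  "is_iso C f \<longleftrightarrow> f \<in> Ar C \<and>
     (\<exists>g\<in>hom C (Cod C f) (Dom C f).
        Cmp C g f = Ident C (Dom C f) \<and> Cmp C f g = Ident C (Cod C f))"

definition naturally_isomorphic ::
  "('o1, 'm1) category \<Rightarrow> ('o2, 'm2) category \<Rightarrow>
   ('o1, 'm1, 'o2, 'm2) functr \<Rightarrow> ('o1, 'm1, 'o2, 'm2) functr \<Rightarrow> bool" where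
  "naturally_isomorphic C D F G \<longleftrightarrow>
     (\<exists>\<eta>. (\<forall>a\<in>Ob C. \<eta> a \<in> hom D (fob F a) (fob G a) \<and> is_iso D (\<eta> a)) \<and>
          (\<forall>f\<in>Ar C. Cmp D (\<eta> (Cod C f)) (far F f) = Cmp D (far G f) (\<eta> (Dom C f))))"

definition equivalent_categories :: "('o1, 'm1) category \<Rightarrow> ('o2, 'm2) category \<Rightarrow> bool" where
  "equivalent_categories C D \<longleftrightarrow>
     is_category C \<and> is_category D \<and>
     (\<exists>F G. is_functor C D F \<and> is_functor D C G \<and>
        naturally_isomorphic C C id_functor (comp_functor G F) \<and>
        naturally_isomorphic D D (comp_functor F G) id_functor)"


section \<open>Sheaves on a site\<close>

text \<open>There is no set of all sets in HOL, so "small set" means: member of a collection \<open>U\<close> of sets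
  over some type \<open>'u\<close>. The following closure properties hold, up to bijection, for every Grothendieck
  universe, e.g. for the sets of cardinality less than \<open>card_of UNIV\<close> if that is an inaccessible
  cardinal. They are also satisfied by the set of all subsets of an infinite type; requiring closure
  under powersets as well would leave no provable instance with an infinite member.\<close>

definition small_sets :: "'u set set \<Rightarrow> bool" where
  "small_sets U \<longleftrightarrow>
     (\<exists>A\<in>U. A \<noteq> {}) \<and>
     (\<forall>A\<in>U. \<forall>B. B \<subseteq> A \<longrightarrow> B \<in> U) \<and>
     (\<forall>A\<in>U. \<forall>B\<in>U. \<exists>C\<in>U. C \<approx> A \<times> B)"

text \<open>Presheaves and natural transformations consist of \<open>extensional\<close> functions, so that they are
  determined by their values on the relevant sets. The map \<open>restr P f\<close> goes from \<open>sects P (Cod C f)\<close>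
  to \<open>sects P (Dom C f)\<close>.\<close>

record ('o, 'm, 'u) presheaf =
  sects :: "'o \<Rightarrow> 'u set"
  restr :: "'m \<Rightarrow> 'u \<Rightarrow> 'u"

definition is_presheaf ::
  "'u set set \<Rightarrow> ('o, 'm) category \<Rightarrow> ('o, 'm, 'u) presheaf \<Rightarrow> bool" where
  "is_presheaf U C P \<longleftrightarrow>
     sects P \<in> (\<Pi>\<^sub>E a\<in>Ob C. U) \<and>
     restr P \<in> (\<Pi>\<^sub>E f\<in>Ar C. sects P (Cod C f) \<rightarrow>\<^sub>E sects P (Dom C f)) \<and>
     (\<forall>a\<in>Ob C. \<forall>x\<in>sects P a. restr P (Ident C a) x = x) \<and>
     (\<forall>f\<in>Ar C. \<forall>g\<in>Ar C. Cod C f = Dom C g \<longrightarrow>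
        (\<forall>x\<in>sects P (Cod C g). restr P (Cmp C g f) x = restr P f (restr P g x)))"

definition is_sieve :: "('o, 'm) category \<Rightarrow> 'o \<Rightarrow> 'm set \<Rightarrow> bool" where
  "is_sieve C a S \<longleftrightarrow>
     S \<subseteq> {f \<in> Ar C. Cod C f = a} \<and>
     (\<forall>f\<in>S. \<forall>g\<in>Ar C. Cod C g = Dom C f \<longrightarrow> Cmp C f g \<in> S)"

definition matching_family ::
  "('o, 'm) category \<Rightarrow> ('o, 'm, 'u) presheaf \<Rightarrow> 'm set \<Rightarrow> ('m \<Rightarrow> 'u) \<Rightarrow> bool" where
  "matching_family C P S x \<longleftrightarrow>
     (\<forall>f\<in>S. x f \<in> sects P (Dom C f)) \<and>
     (\<forall>f\<in>S. \<forall>g\<in>Ar C. Cod C g = Dom C f \<longrightarrow> restr P g (x f) = x (Cmp C f g))"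

text \<open>A Grothendieck topology is given by the collection \<open>J a\<close> of covering sieves of each object \<open>a\<close>.\<close>

definition is_sheaf ::
  "'u set set \<Rightarrow> ('o, 'm) category \<Rightarrow> ('o \<Rightarrow> 'm set set) \<Rightarrow> ('o, 'm, 'u) presheaf \<Rightarrow> bool" where
  "is_sheaf U C J P \<longleftrightarrow>
     is_presheaf U C P \<and>
     (\<forall>a\<in>Ob C. \<forall>S\<in>J a. \<forall>x. matching_family C P S x \<longrightarrow>
        (\<exists>!y. y \<in> sects P a \<and> (\<forall>f\<in>S. restr P f y = x f)))"

definition is_nat_trans ::
  "('o, 'm) category \<Rightarrow> ('o, 'm, 'u) presheaf \<Rightarrow> ('o, 'm, 'u) presheaf \<Rightarrow>
   ('o \<Rightarrow> 'u \<Rightarrow> 'u) \<Rightarrow> bool" where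
  "is_nat_trans C P Q \<alpha> \<longleftrightarrow>
     \<alpha> \<in> (\<Pi>\<^sub>E a\<in>Ob C. sects P a \<rightarrow>\<^sub>E sects Q a) \<and>
     (\<forall>f\<in>Ar C. \<forall>x\<in>sects P (Cod C f).
        \<alpha> (Dom C f) (restr P f x) = restr Q f (\<alpha> (Cod C f) x))"

definition Sh ::
  "'u set set \<Rightarrow> ('o, 'm) category \<Rightarrow> ('o \<Rightarrow> 'm set set) \<Rightarrow>
   (('o, 'm, 'u) presheaf,
    ('o, 'm, 'u) presheaf \<times> ('o \<Rightarrow> 'u \<Rightarrow> 'u) \<times> ('o, 'm, 'u) presheaf) category" where
  "Sh U C J =
     \<lparr>Ob = {P. is_sheaf U C J P},
      Ar = {(P, \<alpha>, Q). is_sheaf U C J P \<and> is_sheaf U C J Q \<and> is_nat_trans C P Q \<alpha>},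
      Dom = (\<lambda>(P, \<alpha>, Q). P),
      Cod = (\<lambda>(P, \<alpha>, Q). Q),
      Ident = (\<lambda>P. (P, \<lambda>a\<in>Ob C. \<lambda>x\<in>sects P a. x, P)),
      Cmp = (\<lambda>(Q, \<beta>, R) (P, \<alpha>, Q'). (P, \<lambda>a\<in>Ob C. compose (sects P a) (\<beta> a) (\<alpha> a), R))\<rparr>"


section \<open>The classifying topos of a coherent theory\<close>

text \<open>An object of the syntactic category is a formula in context. An arrow from \<open>(\<Gamma>, \<phi>)\<close> to
  \<open>(\<Delta>, \<psi>)\<close> is a provable-equivalence class of provably functional formulas in context \<open>\<Gamma> @ \<Delta>\<close>.\<close>

type_synonym ('s, 'f, 'r) syn_ob = "'s list \<times> ('s, 'f, 'r) fm"
type_synonym ('s, 'f, 'r) syn_ar =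
  "('s, 'f, 'r) syn_ob \<times> ('s, 'f, 'r) fm set \<times> ('s, 'f, 'r) syn_ob"

definition functional_fm ::
  "('s, 'f, 'r) coh_theory \<Rightarrow> ('s, 'f, 'r) syn_ob \<Rightarrow> ('s, 'f, 'r) fm \<Rightarrow> ('s, 'f, 'r) syn_ob \<Rightarrow> bool"
  where
  "functional_fm T A \<theta> B \<longleftrightarrow>
     (case (A, B) of ((\<Gamma>, \<phi>), (\<Delta>, \<psi>)) \<Rightarrow>
       let n = length \<Gamma>; m = length \<Delta> in
       fm_in_ctx (sig T) (\<Gamma> @ \<Delta>) \<theta> \<and>
       prov T (\<Gamma> @ \<Delta>) \<theta> (And (inst \<phi> (vars 0 n)) (inst \<psi> (vars n m))) \<and>
       prov T \<Gamma> \<phi> (exs \<Delta> (inst \<theta> (vars m n @ vars 0 m))) \<and>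
       prov T (\<Gamma> @ \<Delta> @ \<Delta>)
         (And (inst \<theta> (vars 0 n @ vars n m)) (inst \<theta> (vars 0 n @ vars (n + m) m)))
         (eqs (vars n m) (vars (n + m) m)))"

definition syn_arrow ::
  "('s, 'f, 'r) coh_theory \<Rightarrow> ('s, 'f, 'r) syn_ob \<Rightarrow> ('s, 'f, 'r) fm \<Rightarrow> ('s, 'f, 'r) syn_ob \<Rightarrow>
   ('s, 'f, 'r) syn_ar" where
  "syn_arrow T A \<theta> B =
     (A, {\<theta>'. prov T (fst A @ fst B) \<theta> \<theta>' \<and> prov T (fst A @ fst B) \<theta>' \<theta>}, B)"

text \<open>The composite of \<open>\<theta>(x, y)\<close> and \<open>\<chi>(y, z)\<close> is \<open>\<exists>y. \<theta>(x, y) \<and> \<chi>(y, z)\<close>; below the quantifiers the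
  context is \<open>\<Delta> @ \<Gamma> @ E\<close>.\<close>

definition comp_fm ::
  "'s list \<Rightarrow> 's list \<Rightarrow> 's list \<Rightarrow> ('s, 'f, 'r) fm \<Rightarrow> ('s, 'f, 'r) fm \<Rightarrow> ('s, 'f, 'r) fm" where
  "comp_fm \<Gamma> \<Delta> E \<theta> \<chi> =
     (let n = length \<Gamma>; m = length \<Delta>; k = length E in
       exs \<Delta> (And (inst \<theta> (vars m n @ vars 0 m)) (inst \<chi> (vars 0 m @ vars (m + n) k))))"

text \<open>The classes in composable arrows \<open>(A, p, B)\<close> and \<open>(B, q, D)\<close> are nonempty, and the class of the
  composite does not depend on the representatives, so the union in the definition of
  composition is a single class.\<close>

definition syn_cat ::
  "('s, 'f, 'r) coh_theory \<Rightarrow> (('s, 'f, 'r) syn_ob, ('s, 'f, 'r) syn_ar) category" where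
  "syn_cat T =
     \<lparr>Ob = {(\<Gamma>, \<phi>). fm_in_ctx (sig T) \<Gamma> \<phi>},
      Ar = {syn_arrow T (\<Gamma>, \<phi>) \<theta> (\<Delta>, \<psi>) | \<Gamma> \<phi> \<theta> \<Delta> \<psi>.
              fm_in_ctx (sig T) \<Gamma> \<phi> \<and> fm_in_ctx (sig T) \<Delta> \<psi> \<and> functional_fm T (\<Gamma>, \<phi>) \<theta> (\<Delta>, \<psi>)},
      Dom = (\<lambda>(A, p, B). A),
      Cod = (\<lambda>(A, p, B). B),
      Ident = (\<lambda>(\<Gamma>, \<phi>). let n = length \<Gamma> in
                 syn_arrow T (\<Gamma>, \<phi>)
                   (And (inst \<phi> (vars 0 n)) (eqs (vars 0 n) (vars n n))) (\<Gamma>, \<phi>)),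
      Cmp = (\<lambda>(B, q, D) (A, p, B').
               (A, \<Union>\<theta>\<in>p. \<Union>\<chi>\<in>q.
                     fst (snd (syn_arrow T A (comp_fm (fst A) (fst B) (fst D) \<theta> \<chi>) D)), D))\<rparr>"

text \<open>The coherent topology: a sieve on \<open>(\<Delta>, \<psi>)\<close> covers if it contains a finite family of arrows
  \<open>[\<theta>\<^sub>i] : (\<Gamma>\<^sub>i, \<phi>\<^sub>i) \<rightarrow> (\<Delta>, \<psi>)\<close> that is jointly covering, i.e. \<open>T\<close> proves \<open>\<psi> \<turnstile> \<Or>\<^sub>i \<exists>x\<^sub>i. \<theta>\<^sub>i(x\<^sub>i, y)\<close>.
  The empty family is allowed.\<close>

definition coherent_topology ::
  "('s, 'f, 'r) coh_theory \<Rightarrow> ('s, 'f, 'r) syn_ob \<Rightarrow> ('s, 'f, 'r) syn_ar set set" where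
  "coherent_topology T B =
     {S. is_sieve (syn_cat T) B S \<and>
         (\<exists>fam. (\<forall>(A, \<theta>)\<in>set fam. functional_fm T A \<theta> B \<and> syn_arrow T A \<theta> B \<in> S) \<and>
                prov T (fst B) (snd B) (disj (map (\<lambda>(A, \<theta>). exs (fst A) \<theta>) fam)))}"

definition classifying_topos ::
  "'u set set \<Rightarrow> ('s, 'f, 'r) coh_theory \<Rightarrow>
   ((('s, 'f, 'r) syn_ob, ('s, 'f, 'r) syn_ar, 'u) presheaf,
    (('s, 'f, 'r) syn_ob, ('s, 'f, 'r) syn_ar, 'u) presheaf \<times>
    (('s, 'f, 'r) syn_ob \<Rightarrow> 'u \<Rightarrow> 'u) \<times>
    (('s, 'f, 'r) syn_ob, ('s, 'f, 'r) syn_ar, 'u) presheaf) category" where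
  "classifying_topos U T = Sh U (syn_cat T) (coherent_topology T)"

definition j_morita_equivalent ::
  "'u set set \<Rightarrow> ('s1, 'f1, 'r1) coh_theory \<Rightarrow> ('s2, 'f2, 'r2) coh_theory \<Rightarrow> bool" where
  "j_morita_equivalent U T T' \<longleftrightarrow>
     equivalent_categories (classifying_topos U T) (classifying_topos U T')"

end

theory Submission
  imports Defs
begin

text \<open>Each single step of a T-Morita equivalence is a translation of theories that is conservative, that is
  surjective on formulas in translated contexts, and under which every object of the larger syntactic
  category is covered by finitely many translated objects. The induced functor of syntactic categories
  is then fully faithful, reflects coherent covers, and is dense, so restriction of sheaves along it is
  an equivalence by the comparison lemma.

  For a Morita extension all this is checked semantically, by Henkin's completeness theorem for
  coherent logic: conservativity holds because every model of the smaller theory expands to one of the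
  larger theory, and the other two properties hold because every new sort is covered by finitely
  many definable partial maps from lists of old sorts, along which every formula can be pulled back to
  a formula of the smaller theory.\<close>

text \<open>Coherent sequents have no negation and no sort need be inhabited, so completeness cannot
  start from a Boolean complete theory over a fixed supply of constants: the available constants,
  the true instances and the false instances are maximised together. The payoff is that derivability
  becomes truth in all models over one fixed element type, and arrows of the syntactic category
  become uniformly definable families of functions; set-theoretic checks then replace formal
  derivations with de Bruijn indices. Conservativity needs models over a different element type,
  which soundness permits because it is polymorphic in the elements. The second obstacle is size:
  \<open>small_sets\<close> gives closure under subsets and, up to bijection, binary products, while
  the right Kan extension is a limit over a possibly large comma category. Its elements must be
  pinned down by finitely many values. This is why density is demanded with finite covers, which
  exist here because a list of sorts admits only finitely many choices of charts.\<close>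

hide_fact (open) prov.conjI prov.disjI1 prov.disjI2 prov.disjE prov.exE

section \<open>Substitution and well-formedness\<close>

lemma tsubst_tsubst: "tsubst \<sigma> (tsubst \<tau> t) = tsubst (\<lambda>i. tsubst \<sigma> (\<tau> i)) t"
  by (induction t) auto

text \<open>The commutation under a binder that carries \<open>fsubst_fsubst\<close> through the
  quantifier case.\<close>

lemma lift_lift: "(\<lambda>i. tsubst (lift \<sigma>) (lift \<tau> i)) = lift (\<lambda>i. tsubst \<sigma> (\<tau> i))"
  by (auto simp: lift_def fun_eq_iff tsubst_tsubst split: nat.split)

lemma fsubst_fsubst: "fsubst \<sigma> (fsubst \<tau> \<phi>) = fsubst (\<lambda>i. tsubst \<sigma> (\<tau> i)) \<phi>"
  by (induction \<phi> arbitrary: \<sigma> \<tau>) (auto simp: tsubst_tsubst lift_lift)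

lemma tsubst_Var [simp]: "tsubst Var t = t"
  by (induction t) (auto simp: map_idI)

lemma lift_Var [simp]: "lift Var = Var"
  by (auto simp: lift_def fun_eq_iff split: nat.split)

lemma fsubst_Var [simp]: "fsubst Var \<phi> = \<phi>"
  by (induction \<phi>) (auto simp: map_idI)

lemma fsubst_conj: "fsubst \<sigma> (conj \<phi>s) = conj (map (fsubst \<sigma>) \<phi>s)"
  by (induction \<phi>s) (auto simp: conj_def)

lemma fsubst_disj: "fsubst \<sigma> (disj \<phi>s) = disj (map (fsubst \<sigma>) \<phi>s)"
  by (induction \<phi>s) (auto simp: disj_def)

lemma tsubst_cong:
  "wt \<Sigma> \<Gamma> t S \<Longrightarrow> (\<And>i. i < length \<Gamma> \<Longrightarrow> \<sigma> i = \<tau> i) \<Longrightarrow> tsubst \<sigma> t = tsubst \<tau> t"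
proof (induction rule: wt.induct)
  case (Fn f ts)
  then show ?case
    by (auto simp: list_all2_conv_all_nth in_set_conv_nth)
qed auto

lemma tsubst_cong_list:
  "list_all2 (wt \<Sigma> \<Gamma>) ts Ss \<Longrightarrow> (\<And>i. i < length \<Gamma> \<Longrightarrow> \<sigma> i = \<tau> i) \<Longrightarrow>
   map (tsubst \<sigma>) ts = map (tsubst \<tau>) ts"
  by (induction rule: list_all2_induct) (auto intro: tsubst_cong)

text \<open>Substitutions are total functions on indices, but only their values on the context
  matter. This absorbs the unspecified entries \<open>ts ! i\<close> beyond the end of the list in
  \<open>inst\<close> and the arbitrary values of renamings outside a context.\<close>

lemma fsubst_cong:
  "wf_fm \<Sigma> \<Gamma> \<phi> \<Longrightarrow> (\<And>i. i < length \<Gamma> \<Longrightarrow> \<sigma> i = \<tau> i) \<Longrightarrow> fsubst \<sigma> \<phi> = fsubst \<tau> \<phi>"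
proof (induction \<phi> arbitrary: \<Gamma> \<sigma> \<tau>)
  case (Eq t u)
  then show ?case by simp (metis tsubst_cong)
next
  case (Rel R ts)
  then show ?case using tsubst_cong_list[of \<Sigma> \<Gamma> ts "rdom \<Sigma> R" \<sigma> \<tau>] by simp
next
  case (Ex S \<phi>)
  have "fsubst (lift \<sigma>) \<phi> = fsubst (lift \<tau>) \<phi>"
    using Ex.prems by (intro Ex.IH[of "S # \<Gamma>"]) (auto simp: lift_def split: nat.split)
  then show ?case by simp
next
  case (And \<phi> \<psi>)
  then show ?case by simp metis
next
  case (Or \<phi> \<psi>)
  then show ?case by simp metis
qed auto

section \<open>Typing of terms and formulas in context\<close>

lemma wt_Var_iff: "wt \<Sigma> \<Gamma> (Var i) S \<longleftrightarrow> i < length \<Gamma> \<and> S = \<Gamma> ! i"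
  by (auto elim: wt.cases intro: wt.Var)

lemma wt_Fn_iff:
  "wt \<Sigma> \<Gamma> (Fn f ts) S \<longleftrightarrow> f \<in> funs \<Sigma> \<and> list_all2 (wt \<Sigma> \<Gamma>) ts (fdom \<Sigma> f) \<and> S = fcod \<Sigma> f"
  by (auto elim: wt.cases intro: wt.Fn)

lemma wt_tsubst:
  "wt \<Sigma> \<Gamma> t S \<Longrightarrow> (\<And>i. i < length \<Gamma> \<Longrightarrow> wt \<Sigma> \<Delta> (\<sigma> i) (\<Gamma> ! i)) \<Longrightarrow> wt \<Sigma> \<Delta> (tsubst \<sigma> t) S"
proof (induction rule: wt.induct)
  case (Fn f ts)
  then show ?case
    by (auto simp: wt_Fn_iff list_all2_conv_all_nth)
qed auto

lemma wf_fsubst: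
  "wf_fm \<Sigma> \<Gamma> \<phi> \<Longrightarrow> (\<And>i. i < length \<Gamma> \<Longrightarrow> wt \<Sigma> \<Delta> (\<sigma> i) (\<Gamma> ! i)) \<Longrightarrow> wf_fm \<Sigma> \<Delta> (fsubst \<sigma> \<phi>)"
proof (induction \<phi> arbitrary: \<Gamma> \<Delta> \<sigma>)
  case (Eq t u)
  then show ?case by (auto intro: wt_tsubst)
next
  case (Rel R ts)
  then show ?case by (auto simp: list_all2_conv_all_nth intro!: wt_tsubst)
next
  case (Ex S \<phi>)
  have "wt \<Sigma> (S # \<Delta>) (lift \<sigma> i) ((S # \<Gamma>) ! i)" if "i < length (S # \<Gamma>)" for i
    using that Ex.prems(2)
    by (cases i) (auto simp: lift_def wt_Var_iff intro!: wt_tsubst[of _ \<Delta>])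
  then show ?case
    using Ex.prems(1) Ex.IH[of "S # \<Gamma>" "S # \<Delta>" "lift \<sigma>"] by auto
qed auto

lemma wf_fsubst_Var:
  "wf_fm \<Sigma> \<Gamma> \<phi> \<Longrightarrow> (\<And>i. i < length \<Gamma> \<Longrightarrow> \<rho> i < length \<Delta> \<and> \<Delta> ! \<rho> i = \<Gamma> ! i) \<Longrightarrow>
   wf_fm \<Sigma> \<Delta> (fsubst (\<lambda>i. Var (\<rho> i)) \<phi>)"
  by (erule wf_fsubst) (auto simp: wt_Var_iff)

lemma wt_sort: "wf_signature \<Sigma> \<Longrightarrow> set \<Gamma> \<subseteq> sorts \<Sigma> \<Longrightarrow> wt \<Sigma> \<Gamma> t S \<Longrightarrow> S \<in> sorts \<Sigma>"
  by (cases t) (auto simp: wt_Var_iff wt_Fn_iff wf_signature_def)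

lemma wt_mono: "wt \<Sigma> \<Gamma> t S \<Longrightarrow> subsignature \<Sigma> \<Sigma>' \<Longrightarrow> wt \<Sigma>' \<Gamma> t S"
proof (induction rule: wt.induct)
  case (Fn f ts)
  then show ?case
    by (auto simp: wt_Fn_iff subsignature_def list_all2_conv_all_nth)
qed (auto simp: wt_Var_iff)

lemma wf_fm_mono: "wf_fm \<Sigma> \<Gamma> \<phi> \<Longrightarrow> subsignature \<Sigma> \<Sigma>' \<Longrightarrow> wf_fm \<Sigma>' \<Gamma> \<phi>"
proof (induction \<phi> arbitrary: \<Gamma>)
  case (Eq t u)
  then show ?case by (auto intro: wt_mono)
next
  case (Rel R ts)
  have "wt \<Sigma> \<Gamma> t S \<Longrightarrow> wt \<Sigma>' \<Gamma> t S" for t S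
    by (erule wt_mono) (rule Rel.prems(2))
  then show ?case using Rel by (auto simp: subsignature_def list_all2_conv_all_nth)
qed (auto simp: subsignature_def)

lemma fm_in_ctx_mono: "fm_in_ctx \<Sigma> \<Gamma> \<phi> \<Longrightarrow> subsignature \<Sigma> \<Sigma>' \<Longrightarrow> fm_in_ctx \<Sigma>' \<Gamma> \<phi>"
  unfolding fm_in_ctx_def by (meson subsetD subsetI subsignature_def wf_fm_mono)

text \<open>Only the axiom rule could bring in an ill-formed formula, and
  \<open>coherent_theory\<close> excludes that; the other rules carry side conditions or inherit
  well-formedness from their premises.\<close>

lemma prov_fm_in_ctx:
  assumes "coherent_theory T" "prov T \<Gamma> \<phi> \<psi>"
  shows "fm_in_ctx (sig T) \<Gamma> \<phi> \<and> fm_in_ctx (sig T) \<Gamma> \<psi>"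
  using assms(2)
proof (induction rule: prov.induct)
  case (ax \<Gamma> \<phi> \<psi>)
  then show ?case using assms(1) by (auto simp: coherent_theory_def)
next
  case (subst \<Gamma> \<phi> \<psi> \<Delta> \<sigma>)
  then show ?case by (auto simp: fm_in_ctx_def intro: wf_fsubst)
next
  case (eq_subst S \<Gamma> \<phi> t u)
  have "wf_fm (sig T) \<Gamma> (fsubst (case_nat v Var) \<phi>)" if "wt (sig T) \<Gamma> v S" for v
    using eq_subst(1) that
    by (auto simp: fm_in_ctx_def wt_Var_iff split: nat.split intro!: wf_fsubst[of _ "S # \<Gamma>"])
  then show ?case using eq_subst by (auto simp: fm_in_ctx_def)
next
  case (exD \<Gamma> S \<phi> \<psi>)
  then show ?case
    by (auto simp: fm_in_ctx_def wt_Var_iff intro!: wf_fsubst[of _ \<Gamma>])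
next
  case (frobenius \<Gamma> \<phi> S \<psi>)
  then show ?case
    by (auto simp: fm_in_ctx_def wt_Var_iff intro!: wf_fsubst[of _ \<Gamma>])
qed (auto simp: fm_in_ctx_def)

section \<open>Set-valued models and soundness\<close>

text \<open>Carriers may be empty, as in the calculus. The element type is a parameter, since the
  expansion of a model changes it.\<close>

record ('s, 'f, 'r, 'm) struct =
  car :: "'s \<Rightarrow> 'm set"
  fint :: "'f \<Rightarrow> 'm list \<Rightarrow> 'm"
  rint :: "'r \<Rightarrow> 'm list \<Rightarrow> bool"

primrec eval :: "('s, 'f, 'r, 'm) struct \<Rightarrow> (nat \<Rightarrow> 'm) \<Rightarrow> 'f tm \<Rightarrow> 'm" where
  "eval M e (Var i) = e i"
| "eval M e (Fn f ts) = fint M f (map (eval M e) ts)"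

primrec sat :: "('s, 'f, 'r, 'm) struct \<Rightarrow> (nat \<Rightarrow> 'm) \<Rightarrow> ('s, 'f, 'r) fm \<Rightarrow> bool" where
  "sat M e (Eq t u) \<longleftrightarrow> eval M e t = eval M e u"
| "sat M e (Rel R ts) \<longleftrightarrow> rint M R (map (eval M e) ts)"
| "sat M e Top \<longleftrightarrow> True"
| "sat M e Bot \<longleftrightarrow> False"
| "sat M e (And \<phi> \<psi>) \<longleftrightarrow> sat M e \<phi> \<and> sat M e \<psi>"
| "sat M e (Or \<phi> \<psi>) \<longleftrightarrow> sat M e \<phi> \<or> sat M e \<psi>"
| "sat M e (Ex S \<phi>) \<longleftrightarrow> (\<exists>x\<in>car M S. sat M (case_nat x e) \<phi>)"

definition tup :: "('s, 'f, 'r, 'm) struct \<Rightarrow> 's list \<Rightarrow> 'm list set" where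
  "tup M \<Gamma> = {a. list_all2 (\<lambda>x S. x \<in> car M S) a \<Gamma>}"

definition is_struct :: "('s, 'f, 'r) signature \<Rightarrow> ('s, 'f, 'r, 'm) struct \<Rightarrow> bool" where
  "is_struct \<Sigma> M \<longleftrightarrow> (\<forall>f\<in>funs \<Sigma>. \<forall>xs\<in>tup M (fdom \<Sigma> f). fint M f xs \<in> car M (fcod \<Sigma> f))"

definition model :: "('s, 'f, 'r) coh_theory \<Rightarrow> ('s, 'f, 'r, 'm) struct \<Rightarrow> bool" where
  "model T M \<longleftrightarrow> is_struct (sig T) M \<and>
     (\<forall>(\<Gamma>, \<phi>, \<psi>)\<in>axs T. \<forall>a\<in>tup M \<Gamma>. sat M ((!) a) \<phi> \<longrightarrow> sat M ((!) a) \<psi>)"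

lemma eval_tsubst: "eval M e (tsubst \<sigma> t) = eval M (\<lambda>i. eval M e (\<sigma> i)) t"
  by (induction t) (auto cong: map_cong simp: comp_def)

lemma sat_fsubst: "sat M e (fsubst \<sigma> \<phi>) \<longleftrightarrow> sat M (\<lambda>i. eval M e (\<sigma> i)) \<phi>"
proof (induction \<phi> arbitrary: e \<sigma>)
  case (Ex S \<phi>)
  have "(\<lambda>i. eval M (case_nat x e) (lift \<sigma> i)) = case_nat x (\<lambda>i. eval M e (\<sigma> i))" for x
    by (auto simp: lift_def fun_eq_iff eval_tsubst split: nat.split)
  then show ?case using Ex by simp
qed (auto simp: eval_tsubst comp_def)

lemma eval_cong:
  "wt \<Sigma> \<Gamma> t S \<Longrightarrow> (\<And>i. i < length \<Gamma> \<Longrightarrow> e i = e' i) \<Longrightarrow> eval M e t = eval M e' t"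
proof (induction rule: wt.induct)
  case (Fn f ts)
  then have "map (eval M e) ts = map (eval M e') ts"
    by (auto simp: list_all2_conv_all_nth in_set_conv_nth)
  then show ?case by (simp del: map_eq_conv)
qed auto

lemma sat_cong:
  "wf_fm \<Sigma> \<Gamma> \<phi> \<Longrightarrow> (\<And>i. i < length \<Gamma> \<Longrightarrow> e i = e' i) \<Longrightarrow> sat M e \<phi> \<longleftrightarrow> sat M e' \<phi>"
proof (induction \<phi> arbitrary: \<Gamma> e e')
  case (Eq t u)
  then obtain S where "wt \<Sigma> \<Gamma> t S" "wt \<Sigma> \<Gamma> u S" by auto
  then have "eval M e t = eval M e' t" "eval M e u = eval M e' u"
    using Eq.prems(2) by (auto intro: eval_cong)
  then show ?case by simp
next
  case (Rel R ts)
  then have "eval M e (ts ! i) = eval M e' (ts ! i)" if "i < length ts" for i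
    using that by (intro eval_cong[of \<Sigma> \<Gamma> _ "rdom \<Sigma> R ! i"]) (auto simp: list_all2_conv_all_nth)
  then have "map (eval M e) ts = map (eval M e') ts"
    by (auto simp: in_set_conv_nth)
  then show ?case by (simp del: map_eq_conv)
next
  case (Ex S \<phi>)
  have "sat M (case_nat x e) \<phi> \<longleftrightarrow> sat M (case_nat x e') \<phi>" for x
    using Ex.prems by (intro Ex.IH[of "S # \<Gamma>"]) (auto split: nat.split)
  then show ?case by simp
next
  case (And \<phi> \<psi>)
  then show ?case by (metis sat.simps(5) wf_fm.simps(5))
next
  case (Or \<phi> \<psi>)
  then show ?case by (metis sat.simps(6) wf_fm.simps(6))
qed auto

lemma eval_in_car:
  assumes "is_struct \<Sigma> M" "wt \<Sigma> \<Gamma> t S" "\<And>i. i < length \<Gamma> \<Longrightarrow> e i \<in> car M (\<Gamma> ! i)"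
  shows "eval M e t \<in> car M S"
  using assms(2)
proof (induction rule: wt.induct)
  case (Fn f ts)
  then have "map (eval M e) ts \<in> tup M (fdom \<Sigma> f)"
    by (auto simp: tup_def list_all2_conv_all_nth)
  then show ?case using assms(1) Fn by (auto simp: is_struct_def)
qed (use assms(3) in auto)

lemma nth_Cons_fun: "(!) (x # a) = case_nat x ((!) a)"
  by (auto simp: fun_eq_iff nth_Cons)

lemma tup_nth: "a \<in> tup M \<Gamma> \<Longrightarrow> i < length \<Gamma> \<Longrightarrow> a ! i \<in> car M (\<Gamma> ! i)"
  by (auto simp: tup_def list_all2_conv_all_nth)

lemma tup_length: "a \<in> tup M \<Gamma> \<Longrightarrow> length a = length \<Gamma>"
  by (auto simp: tup_def list_all2_conv_all_nth)

lemma tup_env: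
  assumes "\<And>i. i < length \<Gamma> \<Longrightarrow> e i \<in> car M (\<Gamma> ! i)"
  shows "map e [0..<length \<Gamma>] \<in> tup M \<Gamma>"
  using assms by (auto simp: tup_def list_all2_conv_all_nth)

text \<open>Environments are used instead of tuples because the quantifier rules shift them by one
  and the substitution rule composes them with terms; their values beyond the context are
  arbitrary.\<close>

lemma soundness_env:
  assumes T: "coherent_theory T" and M: "model T M" and "prov T \<Gamma> \<phi> \<psi>"
    and "\<And>i. i < length \<Gamma> \<Longrightarrow> e i \<in> car M (\<Gamma> ! i)" "sat M e \<phi>"
  shows "sat M e \<psi>"
  using assms(3-5)
proof (induction arbitrary: e rule: prov.induct)
  case (ax \<Gamma> \<phi> \<psi>)
  \<comment> \<open>Axioms are tested at tuples, so the environment is cut off at the end of the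
    context; well-formed formulas do not see the rest.\<close>
  let ?a = "map e [0..<length \<Gamma>]"
  have "?a \<in> tup M \<Gamma>" using ax by (intro tup_env) auto
  moreover have "wf_fm (sig T) \<Gamma> \<phi>" "wf_fm (sig T) \<Gamma> \<psi>"
    using T ax(1) by (auto simp: coherent_theory_def fm_in_ctx_def)
  then have "sat M ((!) ?a) \<phi> = sat M e \<phi>" "sat M ((!) ?a) \<psi> = sat M e \<psi>"
    by (auto intro!: sat_cong)
  ultimately show ?case
    using ax M by (auto simp: model_def)
next
  case (subst \<Gamma> \<phi> \<psi> \<Delta> \<sigma>)
  have "sat M (\<lambda>i. eval M e (\<sigma> i)) \<psi>"
  proof (rule subst.IH)
    show "eval M e (\<sigma> i) \<in> car M (\<Gamma> ! i)" if "i < length \<Gamma>" for i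
      using M subst.hyps(3)[OF that] subst.prems(1) by (auto simp: model_def intro: eval_in_car)
  qed (use subst.prems in \<open>simp add: sat_fsubst\<close>)
  then show ?case by (simp add: sat_fsubst)
next
  case (eq_subst S \<Gamma> \<phi> t u)
  have *: "(\<lambda>i. eval M e (case_nat v Var i)) = case_nat (eval M e v) e" for v
    by (auto simp: fun_eq_iff split: nat.split)
  show ?case using eq_subst.prems(2) by (auto simp: sat_fsubst *)
next
  case (exE S \<Gamma> \<phi> \<psi>)
  from exE.prems obtain x where x: "x \<in> car M S" "sat M (case_nat x e) \<phi>" by auto
  have "sat M (case_nat x e) (fsubst (\<lambda>i. Var (Suc i)) \<psi>)"
    using exE x by (intro exE.IH) (auto simp: nth_Cons split: nat.split)
  then show ?case by (simp add: sat_fsubst)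
next
  case (exD \<Gamma> S \<phi> \<psi>)
  have "sat M (\<lambda>i. e (Suc i)) \<psi>"
  proof (rule exD.IH)
    show "e (Suc i) \<in> car M (\<Gamma> ! i)" if "i < length \<Gamma>" for i
      using exD.prems(1)[of "Suc i"] that by auto
    have "case_nat (e 0) (\<lambda>i. e (Suc i)) = e"
      by (auto simp: fun_eq_iff split: nat.split)
    then show "sat M (\<lambda>i. e (Suc i)) (Ex S \<phi>)"
      using exD.prems(1)[of 0] exD.prems(2) by (auto intro!: bexI[of _ "e 0"])
  qed
  then show ?case by (simp add: sat_fsubst)
next
  case (frobenius \<Gamma> \<phi> S \<psi>)
  then show ?case by (auto simp: sat_fsubst)
qed auto

lemma soundness:
  "coherent_theory T \<Longrightarrow> model T M \<Longrightarrow> prov T \<Gamma> \<phi> \<psi> \<Longrightarrow> a \<in> tup M \<Gamma> \<Longrightarrow>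
   sat M ((!) a) \<phi> \<Longrightarrow> sat M ((!) a) \<psi>"
  by (rule soundness_env[of T M \<Gamma> \<phi>]) (auto simp: tup_nth)

section \<open>Completeness\<close>

locale coherent =
  fixes T :: "('s, 'f, 'r) coh_theory"
  assumes coherent: "coherent_theory T"
begin

abbreviation "\<Sigma> \<equiv> sig T"

lemma wf_sig: "wf_signature \<Sigma>"
  using coherent by (simp add: coherent_theory_def)

lemma prov_ctx: "prov T \<Gamma> \<phi> \<psi> \<Longrightarrow> set \<Gamma> \<subseteq> sorts \<Sigma>"
  and prov_wf1: "prov T \<Gamma> \<phi> \<psi> \<Longrightarrow> wf_fm \<Sigma> \<Gamma> \<phi>"
  and prov_wf2: "prov T \<Gamma> \<phi> \<psi> \<Longrightarrow> wf_fm \<Sigma> \<Gamma> \<psi>"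
  using prov_fm_in_ctx[OF coherent] by (auto simp: fm_in_ctx_def)

end

section \<open>Derived rules of the calculus\<close>

lemma length_vars [simp]: "length (vars k n) = n"
  by (simp add: vars_def)

lemma nth_vars [simp]: "i < n \<Longrightarrow> vars k n ! i = Var (k + i)"
  by (simp add: vars_def)

lemma wf_conj: "wf_fm \<Sigma> \<Gamma> (conj \<phi>s) \<longleftrightarrow> (\<forall>\<phi>\<in>set \<phi>s. wf_fm \<Sigma> \<Gamma> \<phi>)"
  by (induction \<phi>s) (auto simp: conj_def)

lemma wf_disj: "wf_fm \<Sigma> \<Gamma> (disj \<phi>s) \<longleftrightarrow> (\<forall>\<phi>\<in>set \<phi>s. wf_fm \<Sigma> \<Gamma> \<phi>)"
  by (induction \<phi>s) (auto simp: disj_def)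

lemma prov_conjD:
  "fm_in_ctx (sig T) \<Gamma> (conj \<phi>s) \<Longrightarrow> \<phi> \<in> set \<phi>s \<Longrightarrow> prov T \<Gamma> (conj \<phi>s) \<phi>"
proof (induction \<phi>s)
  case (Cons \<psi> \<phi>s)
  then show ?case
    by (auto simp: conj_def fm_in_ctx_def intro: prov.conjE1 prov.cut[OF prov.conjE2])
qed simp

lemma prov_conj:
  "fm_in_ctx (sig T) \<Gamma> \<alpha> \<Longrightarrow> (\<And>\<phi>. \<phi> \<in> set \<phi>s \<Longrightarrow> prov T \<Gamma> \<alpha> \<phi>) \<Longrightarrow> prov T \<Gamma> \<alpha> (conj \<phi>s)"
  by (induction \<phi>s) (auto simp: conj_def intro: prov.topI prov.conjI)

lemma prov_disjI:
  "fm_in_ctx (sig T) \<Gamma> (disj \<phi>s) \<Longrightarrow> \<phi> \<in> set \<phi>s \<Longrightarrow> prov T \<Gamma> \<phi> (disj \<phi>s)"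
proof (induction \<phi>s)
  case (Cons \<psi> \<phi>s)
  then show ?case
    by (auto simp: disj_def fm_in_ctx_def intro: prov.disjI1 prov.cut[OF _ prov.disjI2])
qed simp

lemma prov_disjE:
  "fm_in_ctx (sig T) \<Gamma> \<beta> \<Longrightarrow> (\<And>\<phi>. \<phi> \<in> set \<phi>s \<Longrightarrow> prov T \<Gamma> \<phi> \<beta>) \<Longrightarrow> prov T \<Gamma> (disj \<phi>s) \<beta>"
  by (induction \<phi>s) (auto simp: disj_def intro: prov.botE prov.disjE)

lemma fsubst_idI: "(\<And>i. \<sigma> i = Var i) \<Longrightarrow> fsubst \<sigma> \<phi> = \<phi>"
  using fsubst_Var[of \<phi>] by (metis ext)

lemma map_tsubst_Var [simp]: "map (tsubst Var) ts = ts"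
  by (simp add: map_idI)

lemma fsubst_case_shift: "fsubst (case_nat t Var) (fsubst (\<lambda>i. Var (Suc i)) \<psi>) = \<psi>"
  by (simp add: fsubst_fsubst)

context coherent
begin

text \<open>\<open>exD\<close> applied to the identity sequent on \<open>Ex S \<phi>\<close> gives
  the rule for a generic variable; substituting \<open>t\<close> for that variable gives the
  instance, and the weakening of the conclusion cancels.\<close>

lemma prov_exI:
  assumes "fm_in_ctx \<Sigma> \<Gamma> (Ex S \<phi>)" "wt \<Sigma> \<Gamma> t S"
  shows "prov T \<Gamma> (fsubst (case_nat t Var) \<phi>) (Ex S \<phi>)"
proof -
  have "prov T (S # \<Gamma>) \<phi> (fsubst (\<lambda>i. Var (Suc i)) (Ex S \<phi>))"
    using assms(1) by (intro prov.exD prov.ident)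
  then have "prov T \<Gamma> (fsubst (case_nat t Var) \<phi>)
      (fsubst (case_nat t Var) (fsubst (\<lambda>i. Var (Suc i)) (Ex S \<phi>)))"
    by (rule prov.subst)
      (use assms in \<open>auto simp: fm_in_ctx_def wt_Var_iff nth_Cons split: nat.split\<close>)
  then show ?thesis by (simp only: fsubst_case_shift)
qed

text \<open>Existential elimination in the presence of a side formula \<open>\<alpha>\<close>:
  \<open>exE\<close> admits none, so the Frobenius rule first moves \<open>\<alpha>\<close> under
  the quantifier.\<close>

lemma prov_ex_frobenius:
  assumes "prov T (S # \<Gamma>) (And (fsubst (\<lambda>i. Var (Suc i)) \<alpha>) \<phi>) (fsubst (\<lambda>i. Var (Suc i)) \<beta>)"
    and "fm_in_ctx \<Sigma> \<Gamma> \<alpha>" "fm_in_ctx \<Sigma> \<Gamma> \<beta>"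
  shows "prov T \<Gamma> (And \<alpha> (Ex S \<phi>)) \<beta>"
proof (rule prov.cut[OF prov.frobenius])
  show "fm_in_ctx \<Sigma> \<Gamma> (And \<alpha> (Ex S \<phi>))"
    using assms prov_ctx[OF assms(1)] prov_wf1[OF assms(1)] by (auto simp: fm_in_ctx_def)
qed (use assms in \<open>auto intro: prov.exE\<close>)

text \<open>The replacement rule for the formula \<open>x = w\<close> with \<open>x\<close> a fresh
  variable. Symmetry is the case where \<open>w\<close> is \<open>t\<close>.\<close>

lemma prov_eq_euclid:
  assumes "set \<Gamma> \<subseteq> sorts \<Sigma>" "wt \<Sigma> \<Gamma> t S" "wt \<Sigma> \<Gamma> u S" "wt \<Sigma> \<Gamma> w S"
  shows "prov T \<Gamma> (And (Eq t u) (Eq t w)) (Eq u w)"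
proof -
  let ?\<phi> = "Eq (Var 0) (tsubst (\<lambda>i. Var (Suc i)) w)"
  have "wt \<Sigma> (S # \<Gamma>) (tsubst (\<lambda>i. Var (Suc i)) w) S"
    using assms(4) by (rule wt_tsubst) (auto simp: wt_Var_iff)
  then have "fm_in_ctx \<Sigma> (S # \<Gamma>) ?\<phi>"
    using assms wt_sort[OF wf_sig] by (auto simp: fm_in_ctx_def wt_Var_iff)
  from prov.eq_subst[OF this assms(2,3)] show ?thesis
    by (simp add: tsubst_tsubst)
qed

lemma prov_eq_sym:
  assumes "set \<Gamma> \<subseteq> sorts \<Sigma>" "wt \<Sigma> \<Gamma> t S" "wt \<Sigma> \<Gamma> u S"
  shows "prov T \<Gamma> (Eq t u) (Eq u t)"
proof (rule prov.cut[OF prov.conjI prov_eq_euclid])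
  show "prov T \<Gamma> (Eq t u) (Eq t u)"
    using assms by (intro prov.ident) (auto simp: fm_in_ctx_def)
  show "prov T \<Gamma> (Eq t u) (Eq t t)"
    using assms by (intro prov.cut[OF prov.topI prov.eq_refl]) (auto simp: fm_in_ctx_def)
qed (use assms in auto)

end

text \<open>\<open>H \<phi> ks\<close> says that \<open>\<phi>\<close> holds of the constants \<open>ks\<close>. Elements of the model are constants chosen
  as representatives of the classes of provably equal constants.\<close>

locale henkin = coherent T for T :: "('s, 'f, 'r) coh_theory" +
  fixes K :: "'k set" and srt :: "'k \<Rightarrow> 's" and H :: "('s, 'f, 'r) fm \<Rightarrow> 'k list \<Rightarrow> bool"
  assumes K_sorts: "k \<in> K \<Longrightarrow> srt k \<in> sorts \<Sigma>"
    and H_K: "H \<phi> ks \<Longrightarrow> set ks \<subseteq> K"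
    and H_wf: "H \<phi> ks \<Longrightarrow> wf_fm \<Sigma> (map srt ks) \<phi>"
    and H_cl: "H \<phi> ks \<Longrightarrow> prov T (map srt ks) \<phi> \<psi> \<Longrightarrow> H \<psi> ks"
    and H_And: "H \<phi> ks \<Longrightarrow> H \<psi> ks \<Longrightarrow> H (And \<phi> \<psi>) ks"
    and H_Top: "set ks \<subseteq> K \<Longrightarrow> H Top ks"
    and H_Or: "H (Or \<phi> \<psi>) ks \<Longrightarrow> H \<phi> ks \<or> H \<psi> ks"
    and H_Bot: "\<not> H Bot ks"
    and H_Ex: "H (Ex S \<phi>) ks \<Longrightarrow> \<exists>c\<in>K. srt c = S \<and> H \<phi> (c # ks)"
    and H_re: "wf_fm \<Sigma> (map srt ls) \<phi> \<Longrightarrow> set ks \<subseteq> K \<Longrightarrow>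
      (\<And>i. i < length ls \<Longrightarrow> \<rho> i < length ks \<and> ks ! \<rho> i = ls ! i) \<Longrightarrow>
      H (fsubst (\<lambda>i. Var (\<rho> i)) \<phi>) ks \<longleftrightarrow> H \<phi> ls"
begin

lemma ctx_K: "set ks \<subseteq> K \<Longrightarrow> set (map srt ks) \<subseteq> sorts \<Sigma>"
  using K_sorts by auto

definition eqv :: "'k \<Rightarrow> 'k \<Rightarrow> bool" where
  "eqv c d \<longleftrightarrow> H (Eq (Var 0) (Var 1)) [c, d]"

lemma eqv_D: "eqv c d \<Longrightarrow> c \<in> K \<and> d \<in> K \<and> srt c = srt d"
  using H_K[of _ "[c, d]"] H_wf[of _ "[c, d]"]
  unfolding eqv_def by (fastforce simp: wt_Var_iff)

text \<open>\<open>H_re\<close> pulls the equation back along the map of positions 0, 1 to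
  \<open>i\<close>, \<open>j\<close>. This needs equal sorts; for different sorts both sides fail by
  typing.\<close>

lemma H_Eq:
  assumes "i < length ks" "j < length ks" "set ks \<subseteq> K"
  shows "H (Eq (Var i) (Var j)) ks \<longleftrightarrow> eqv (ks ! i) (ks ! j)"
proof (cases "srt (ks ! i) = srt (ks ! j)")
  case True
  have "H (fsubst (\<lambda>l. Var (case_nat i (\<lambda>_. j) l)) (Eq (Var 0) (Var 1))) ks \<longleftrightarrow>
      H (Eq (Var 0) (Var 1)) [ks ! i, ks ! j]"
    by (rule H_re) (use assms True in \<open>auto simp: wt_Var_iff less_Suc_eq\<close>)
  then show ?thesis by (simp add: eqv_def)
next
  case False
  then show ?thesis
    using eqv_D[of "ks ! i" "ks ! j"] H_wf[of "Eq (Var i) (Var j)" ks] assms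
    by (auto simp: wt_Var_iff)
qed

lemma eqv_refl: "c \<in> K \<Longrightarrow> eqv c c"
proof -
  assume c: "c \<in> K"
  have "H (Eq (Var 0) (Var 0)) [c]"
    by (rule H_cl[OF H_Top prov.eq_refl]) (use c K_sorts in \<open>auto simp: wt_Var_iff\<close>)
  then show ?thesis
    using c H_Eq[of 0 "[c]" 0] by simp
qed

text \<open>The replacement rule of the calculus needs both constants in the context, whereas
  \<open>\<phi>\<close> mentions only one of them. Weakening to \<open>c # d # ks\<close> and
  returning by \<open>H_re\<close> bridges the gap.\<close>

lemma H_replace:
  assumes "eqv c d" "H \<phi> (c # ks)"
  shows "H \<phi> (d # ks)"
proof -
  \<comment> \<open>Over \<open>c # d # ks\<close>, \<open>?\<phi>1\<close> reads its first variable
    as \<open>c\<close> and \<open>?\<phi>2\<close> reads it as \<open>d\<close>;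
    \<open>?\<phi>'\<close> keeps a fresh variable in front, at which the replacement rule
    substitutes either one.\<close>
  let ?\<phi>1 = "fsubst (\<lambda>i. Var (case i of 0 \<Rightarrow> 0 | Suc j \<Rightarrow> Suc (Suc j))) \<phi>"
  let ?\<phi>2 = "fsubst (\<lambda>i. Var (case i of 0 \<Rightarrow> 1 | Suc j \<Rightarrow> Suc (Suc j))) \<phi>"
  let ?\<phi>' = "fsubst (\<lambda>i. Var (case i of 0 \<Rightarrow> 0 | Suc j \<Rightarrow> Suc (Suc (Suc j)))) \<phi>"
  let ?\<Gamma> = "map srt (c # d # ks)"
  have K: "set (c # d # ks) \<subseteq> K" and S: "srt d = srt c"
    using eqv_D[OF assms(1)] H_K[OF assms(2)] by auto
  have wf: "wf_fm \<Sigma> (srt c # map srt ks) \<phi>" using H_wf[OF assms(2)] by simp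
  have "H ?\<phi>1 (c # d # ks) \<longleftrightarrow> H \<phi> (c # ks)"
    by (rule H_re) (use wf K in \<open>auto split: nat.split\<close>)
  moreover have "H (Eq (Var 0) (Var 1)) (c # d # ks)"
    using H_Eq[of 0 "c # d # ks" 1] K assms(1) by auto
  moreover have 1: "?\<phi>1 = fsubst (case_nat (Var 0) Var) ?\<phi>'"
    by (auto simp: fsubst_fsubst intro!: arg_cong[of _ _ "\<lambda>\<sigma>. fsubst \<sigma> \<phi>"] split: nat.split)
  moreover have 2: "?\<phi>2 = fsubst (case_nat (Var 1) Var) ?\<phi>'"
    by (auto simp: fsubst_fsubst intro!: arg_cong[of _ _ "\<lambda>\<sigma>. fsubst \<sigma> \<phi>"] split: nat.split)
  moreover have "prov T ?\<Gamma> (And (Eq (Var 0) (Var 1)) (fsubst (case_nat (Var 0) Var) ?\<phi>'))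
      (fsubst (case_nat (Var 1) Var) ?\<phi>')"
  proof (rule prov.eq_subst)
    show "fm_in_ctx \<Sigma> (srt c # ?\<Gamma>) ?\<phi>'"
      using ctx_K[OF K] wf S
      by (auto simp: fm_in_ctx_def intro!: wf_fsubst_Var[of _ "srt c # map srt ks"] split: nat.split)
  qed (use S in \<open>auto simp: wt_Var_iff\<close>)
  ultimately have "H ?\<phi>2 (c # d # ks)"
    using H_cl H_And assms(2) by metis
  moreover have "H ?\<phi>2 (c # d # ks) \<longleftrightarrow> H \<phi> (d # ks)"
    by (rule H_re) (use wf K S in \<open>auto split: nat.split\<close>)
  ultimately show ?thesis by simp
qed

lemma eqv_sym: "eqv c d \<Longrightarrow> eqv d c"
  using H_replace[of c d "Eq (Var 0) (Var 1)" "[c]"] eqv_refl eqv_D[of c d]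
  by (auto simp: eqv_def)

lemma eqv_trans: "eqv c d \<Longrightarrow> eqv d e \<Longrightarrow> eqv c e"
  using H_replace[of d c "Eq (Var 0) (Var 1)" "[e]"] eqv_sym
  by (auto simp: eqv_def)

text \<open>A term may be traded for a constant that \<open>H\<close> equates with it: over the
  context extended by \<open>d\<close>, the replacement rule exchanges the weakened term and the
  variable for \<open>d\<close> in both directions.\<close>

lemma H_subst1:
  assumes t: "wt \<Sigma> (map srt ks) t (srt d)" and d: "H (Eq (tsubst (\<lambda>i. Var (Suc i)) t) (Var 0)) (d # ks)"
    and wf: "wf_fm \<Sigma> (srt d # map srt ks) \<phi>"
  shows "H (fsubst (case_nat t Var) \<phi>) ks \<longleftrightarrow> H \<phi> (d # ks)"
proof -
  let ?t = "tsubst (\<lambda>i. Var (Suc i)) t"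
  let ?\<phi>' = "fsubst (\<lambda>i. Var (case i of 0 \<Rightarrow> 0 | Suc j \<Rightarrow> Suc (Suc j))) \<phi>"
  let ?\<Gamma> = "map srt (d # ks)"
  have K: "set (d # ks) \<subseteq> K" using H_K[OF d] .
  have t': "wt \<Sigma> ?\<Gamma> ?t (srt d)"
    using t by (rule wt_tsubst) (auto simp: wt_Var_iff)
  have v0: "wt \<Sigma> ?\<Gamma> (Var 0) (srt d)" by (auto simp: wt_Var_iff)
  have wf': "fm_in_ctx \<Sigma> (srt d # ?\<Gamma>) ?\<phi>'"
    using ctx_K[OF K] wf
    by (auto simp: fm_in_ctx_def intro!: wf_fsubst_Var[of _ "srt d # map srt ks"] split: nat.split)
  have 1: "fsubst (case_nat ?t Var) ?\<phi>' = fsubst (\<lambda>i. Var (Suc i)) (fsubst (case_nat t Var) \<phi>)"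
    by (auto simp: fsubst_fsubst intro!: arg_cong[of _ _ "\<lambda>\<sigma>. fsubst \<sigma> \<phi>"] split: nat.split)
  have 2: "fsubst (case_nat (Var 0) Var) ?\<phi>' = \<phi>"
    unfolding fsubst_fsubst by (rule fsubst_idI) (simp split: nat.split)
  have "H (fsubst (\<lambda>i. Var (Suc i)) (fsubst (case_nat t Var) \<phi>)) (d # ks) \<longleftrightarrow>
      H (fsubst (case_nat t Var) \<phi>) ks"
  proof (rule H_re)
    show "wf_fm \<Sigma> (map srt ks) (fsubst (case_nat t Var) \<phi>)"
      by (rule wf_fsubst[OF wf]) (use t in \<open>auto simp: wt_Var_iff nth_Cons split: nat.split\<close>)
  qed (use K in auto)
  moreover have "H (fsubst (case_nat ?t Var) ?\<phi>') (d # ks) \<longleftrightarrow> H \<phi> (d # ks)"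
  proof
    assume "H (fsubst (case_nat ?t Var) ?\<phi>') (d # ks)"
    from H_cl[OF H_And[OF d this] prov.eq_subst[OF wf' t' v0]] show "H \<phi> (d # ks)"
      by (simp only: 2)
  next
    assume *: "H \<phi> (d # ks)"
    have "H (Eq (Var 0) ?t) (d # ks)"
      by (rule H_cl[OF d prov_eq_sym[OF ctx_K[OF K] t' v0]])
    moreover have "H (fsubst (case_nat (Var 0) Var) ?\<phi>') (d # ks)" using * by (simp only: 2)
    ultimately show "H (fsubst (case_nat ?t Var) ?\<phi>') (d # ks)"
      by (rule H_cl[OF H_And prov.eq_subst[OF wf' v0 t']])
  qed
  ultimately show ?thesis by (simp only: 1)
qed

text \<open>Every term is named by a constant: \<open>t\<close> itself witnesses that something
  equals \<open>t\<close>, and \<open>H_Ex\<close> supplies a constant for it.\<close>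

lemma ex_val:
  assumes "set ks \<subseteq> K" "wt \<Sigma> (map srt ks) t S"
  shows "\<exists>d\<in>K. srt d = S \<and> H (Eq (tsubst (\<lambda>i. Var (Suc i)) t) (Var 0)) (d # ks)"
proof -
  let ?t = "tsubst (\<lambda>i. Var (Suc i)) t"
  have "wt \<Sigma> (S # map srt ks) ?t S"
    using assms(2) by (rule wt_tsubst) (auto simp: wt_Var_iff)
  then have "fm_in_ctx \<Sigma> (map srt ks) (Ex S (Eq ?t (Var 0)))"
    using ctx_K[OF assms(1)] wt_sort[OF wf_sig _ assms(2)] by (auto simp: fm_in_ctx_def wt_Var_iff)
  from prov_exI[OF this assms(2)]
  have "prov T (map srt ks) (Eq t t) (Ex S (Eq ?t (Var 0)))"
    by (simp add: tsubst_tsubst)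
  moreover have "H (Eq t t) ks"
    by (rule H_cl[OF H_Top prov.eq_refl]) (use assms ctx_K in auto)
  ultimately show ?thesis
    using H_cl H_Ex by blast
qed

text \<open>Fills in the first variables and lowers the others, passing from formulas over
  \<open>ds @ ks\<close> to formulas over \<open>ks\<close>.\<close>

definition subs :: "'f tm list \<Rightarrow> nat \<Rightarrow> 'f tm" where
  "subs ts i = (if i < length ts then ts ! i else Var (i - length ts))"

text \<open>\<open>H_subst1\<close> iterated. The first term is weakened past the constants that
  name the remaining terms, so that it can be eliminated while these are still variables.\<close>

lemma H_subs:
  assumes "list_all2 (wt \<Sigma> (map srt ks)) ts (map srt ds)"
    and "list_all2 (\<lambda>t d. H (Eq (tsubst (\<lambda>i. Var (Suc i)) t) (Var 0)) (d # ks)) ts ds"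
    and "wf_fm \<Sigma> (map srt (ds @ ks)) \<phi>" "set ks \<subseteq> K"
  shows "H (fsubst (subs ts) \<phi>) ks \<longleftrightarrow> H \<phi> (ds @ ks)"
  using assms(1-3)
proof (induction ts arbitrary: ds \<phi>)
  case Nil
  have "subs [] = (Var :: nat \<Rightarrow> 'f tm)" by (auto simp: subs_def fun_eq_iff)
  then show ?case using Nil by simp
next
  case (Cons t ts)
  then obtain d ds' where ds: "ds = d # ds'" by (cases ds) auto
  let ?n = "length ts"
  let ?t = "tsubst (\<lambda>i. Var (i + ?n)) t"
  let ?\<phi> = "fsubst (case_nat ?t Var) \<phi>"
  have n: "length ds' = ?n" using Cons.prems(1) ds by (auto dest: list_all2_lengthD)
  have "\<exists>t. H (Eq (tsubst (\<lambda>i. Var (Suc i)) t) (Var 0)) (k # ks)" if "k \<in> set (d # ds')" for k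
    using Cons.prems(2) that unfolding ds by (metis in_set_conv_nth list_all2_conv_all_nth)
  then have dK: "set (d # ks) \<subseteq> K" "set ds' \<subseteq> K"
    using H_K by fastforce+
  have t: "wt \<Sigma> (map srt (ds' @ ks)) ?t (srt d)"
    using Cons.prems(1) ds
    by (auto simp: wt_Var_iff nth_append n intro!: wt_tsubst[of _ "map srt ks"])
  have wf: "wf_fm \<Sigma> (srt d # map srt (ds' @ ks)) \<phi>" using Cons.prems(3) ds by simp
  have wf': "wf_fm \<Sigma> (map srt (ds' @ ks)) ?\<phi>"
    by (rule wf_fsubst[OF wf]) (use t in \<open>auto simp: wt_Var_iff nth_Cons split: nat.split\<close>)
  have "(\<lambda>i. subs ts (i + ?n)) = Var" by (auto simp: subs_def fun_eq_iff)
  then have "fsubst (subs (t # ts)) \<phi> = fsubst (subs ts) ?\<phi>"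
    by (auto simp: fsubst_fsubst tsubst_tsubst subs_def nth_Cons
        intro!: arg_cong[of _ _ "\<lambda>\<sigma>. fsubst \<sigma> \<phi>"] split: nat.split)
  also have "H (fsubst (subs ts) ?\<phi>) ks \<longleftrightarrow> H ?\<phi> (ds' @ ks)"
    using Cons.prems ds wf' by (intro Cons.IH) auto
  also have "\<dots> \<longleftrightarrow> H \<phi> (d # ds' @ ks)"
  proof (rule H_subst1[OF t _ wf])
    let ?E = "Eq (tsubst (\<lambda>i. Var (Suc i)) t) (Var 0)"
    have d: "H ?E (d # ks)" using Cons.prems(2) ds by simp
    have "H (fsubst (\<lambda>i. Var (case i of 0 \<Rightarrow> 0 | Suc j \<Rightarrow> Suc (j + ?n))) ?E) (d # ds' @ ks) \<longleftrightarrow> H ?E (d # ks)"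
      by (rule H_re) (use H_wf[OF d] dK n assms(4) in \<open>auto simp: nth_append split: nat.split\<close>)
    then show "H (Eq (tsubst (\<lambda>i. Var (Suc i)) ?t) (Var 0)) (d # ds' @ ks)"
      using d by (simp add: tsubst_tsubst)
  qed
  finally show ?case by (simp add: ds)
qed

text \<open>Equivalent constants \<open>c\<close> and \<open>d\<close> have equal predicates
  \<open>eqv c\<close> and \<open>eqv d\<close>, so the choice operator returns the same constant
  for both; this is what makes it a choice of representatives.\<close>

definition rep :: "'k \<Rightarrow> 'k" where
  "rep c = (SOME d. eqv c d)"

lemma eqv_rep: "c \<in> K \<Longrightarrow> eqv c (rep c)"
  unfolding rep_def using eqv_refl by (rule someI)

lemma rep_eq: "eqv c d \<Longrightarrow> rep c = rep d"
proof -
  assume "eqv c d"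
  then have "eqv c = eqv d" by (auto simp: fun_eq_iff dest: eqv_sym eqv_trans)
  then show "rep c = rep d" by (simp add: rep_def)
qed

lemma rep_rep: "c \<in> K \<Longrightarrow> rep (rep c) = rep c"
  using eqv_rep rep_eq by metis

text \<open>The elements are constants that represent themselves. Equality of elements is therefore
  equality in HOL, and a tuple of elements is still an argument for \<open>H\<close>. A function
  value is the representative of some constant that \<open>H\<close> equates with the
  application.\<close>

definition term_model :: "('s, 'f, 'r, 'k) struct" where
  "term_model = \<lparr>car = (\<lambda>S. {c \<in> K. srt c = S \<and> rep c = c}),
     fint = (\<lambda>f xs. rep (SOME d. d \<in> K \<and> H (Eq (Fn f (vars 1 (length xs))) (Var 0)) (d # xs))),
     rint = (\<lambda>R xs. H (Rel R (vars 0 (length xs))) xs)\<rparr>"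

abbreviation "M \<equiv> term_model"

lemma term_model_rint: "rint M R xs \<longleftrightarrow> H (Rel R (vars 0 (length xs))) xs"
  by (simp add: term_model_def)

lemma shift_vars: "map (tsubst (\<lambda>i. Var (Suc i))) (vars k n) = vars (Suc k) n"
  by (rule nth_equalityI) auto

lemma wt_vars0: "list_all2 (wt \<Sigma>' (\<Delta> @ \<Gamma>)) (vars 0 (length \<Delta>)) \<Delta>"
  by (auto simp: list_all2_conv_all_nth wt_Var_iff nth_append)

lemma subs_vars: "n = length ts \<Longrightarrow> map (tsubst (subs ts)) (vars 0 n) = ts"
  by (rule nth_equalityI) (auto simp: subs_def)

lemma term_model_fint:
  assumes "f \<in> funs \<Sigma>" "set xs \<subseteq> K" "map srt xs = fdom \<Sigma> f"
  shows "fint M f xs \<in> car M (fcod \<Sigma> f)"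
    and "H (Eq (Fn f (vars 1 (length xs))) (Var 0)) (fint M f xs # xs)"
proof -
  let ?P = "\<lambda>d. d \<in> K \<and> H (Eq (Fn f (vars 1 (length xs))) (Var 0)) (d # xs)"
  have len: "length xs = length (fdom \<Sigma> f)" using assms(3) by (metis length_map)
  have "wt \<Sigma> (map srt xs) (Fn f (vars 0 (length xs))) (fcod \<Sigma> f)"
    using assms wt_vars0[of \<Sigma> "fdom \<Sigma> f" "[]"] by (simp add: wt_Fn_iff len)
  from ex_val[OF assms(2) this] have "\<exists>d. ?P d"
    by (auto simp: shift_vars)
  then have d: "?P (Eps ?P)" by (rule someI_ex)
  have eq: "fint M f xs = rep (Eps ?P)" by (simp add: term_model_def)
  have "eqv (Eps ?P) (rep (Eps ?P))" using d eqv_rep by blast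
  from H_replace[OF this] d show H: "H (Eq (Fn f (vars 1 (length xs))) (Var 0)) (fint M f xs # xs)"
    unfolding eq by blast
  have "srt (fint M f xs) = fcod \<Sigma> f"
    using H_wf[OF H] by (auto simp: wt_Fn_iff wt_Var_iff)
  then show "fint M f xs \<in> car M (fcod \<Sigma> f)"
    using H_K[OF H] d by (simp add: eq term_model_def rep_rep)
qed

text \<open>The value of a term is described inside \<open>H\<close>, by the equation of the term
  with the constant that is its value. At a function symbol \<open>H_subs\<close> trades the
  arguments for the constants that name them.\<close>

lemma term_model_eval:
  assumes "wt \<Sigma> (map srt ks) t S" "set ks \<subseteq> {c \<in> K. rep c = c}"
  shows "eval M ((!) ks) t \<in> car M S \<and>
    H (Eq (tsubst (\<lambda>i. Var (Suc i)) t) (Var 0)) (eval M ((!) ks) t # ks)"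
  using assms(1)
proof (induction rule: wt.induct)
  case (Var i)
  then have "ks ! i \<in> {c \<in> K. rep c = c}" using assms(2) by (auto dest: nth_mem)
  then show ?case
    using Var assms(2) H_Eq[of "Suc i" "ks ! i # ks" 0] eqv_refl[of "ks ! i"]
    by (auto simp: term_model_def)
next
  case (Fn f ts)
  let ?es = "map (eval M ((!) ks)) ts"
  let ?n = "length ts"
  let ?d = "fint M f ?es"
  let ?ts = "map (tsubst (\<lambda>i. Var (Suc i))) ts"
  have n: "?n = length (fdom \<Sigma> f)" using Fn by (auto dest: list_all2_lengthD)
  have es: "set ?es \<subseteq> K" "map srt ?es = fdom \<Sigma> f"
    using Fn by (auto simp: term_model_def list_all2_conv_all_nth in_set_conv_nth list_eq_iff_nth_eq)
  note d = term_model_fint[OF Fn(1) es]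
  have dK: "?d \<in> K" using d by (auto simp: term_model_def)
  have sd: "srt ?d = fcod \<Sigma> f" using d by (auto simp: term_model_def)
  have ksK: "set ks \<subseteq> K" using assms(2) by auto
  \<comment> \<open>The argument constants sit at positions below \<open>?n\<close> and the value at
    position \<open>?n\<close>; \<open>subs ?ts\<close> turns this into the equation for the
    compound term, with the value at position 0.\<close>
  let ?E = "Eq (Fn f (vars 0 ?n)) (Var ?n)"
  have "H (fsubst (subs ?ts) ?E) (?d # ks) \<longleftrightarrow> H ?E (?es @ ?d # ks)"
  proof (rule H_subs)
    show "list_all2 (wt \<Sigma> (map srt (?d # ks))) ?ts (map srt ?es)"
      using Fn(2) es(2)
      by (auto simp: list_all2_conv_all_nth wt_Var_iff intro!: wt_tsubst[of _ "map srt ks"])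
    have *: "H (Eq (tsubst (\<lambda>i. Var (Suc i)) (tsubst (\<lambda>i. Var (Suc i)) t)) (Var 0)) (e # ?d # ks)"
      if "H (Eq (tsubst (\<lambda>i. Var (Suc i)) t) (Var 0)) (e # ks)" for t e
    proof -
      let ?F = "Eq (tsubst (\<lambda>i. Var (Suc i)) t) (Var 0)"
      have "H (fsubst (\<lambda>i. Var (case i of 0 \<Rightarrow> 0 | Suc j \<Rightarrow> Suc (Suc j))) ?F) (e # ?d # ks) \<longleftrightarrow> H ?F (e # ks)"
        by (rule H_re) (use that H_wf[OF that] H_K[OF that] dK in \<open>auto split: nat.split\<close>)
      then show ?thesis using that by (simp add: tsubst_tsubst)
    qed
    show "list_all2 (\<lambda>t d. H (Eq (tsubst (\<lambda>i. Var (Suc i)) t) (Var 0)) (d # ?d # ks)) ?ts ?es"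
      using Fn(2) by (auto simp: list_all2_conv_all_nth intro!: *)
    show "wf_fm \<Sigma> (map srt (?es @ ?d # ks)) ?E"
      using Fn(1) es sd wt_vars0[of \<Sigma> "fdom \<Sigma> f" "srt ?d # map srt ks"]
      by (simp add: wt_Fn_iff wt_Var_iff nth_append n)
  qed (use dK ksK in auto)
  moreover have "fsubst (subs ?ts) ?E = Eq (Fn f ?ts) (Var 0)"
    using subs_vars[of ?n ?ts] by (simp add: subs_def)
  moreover have "H ?E (?es @ ?d # ks)"
  proof -
    let ?F = "Eq (Fn f (vars 1 ?n)) (Var 0)"
    let ?\<rho> = "\<lambda>i. case i of 0 \<Rightarrow> ?n | Suc j \<Rightarrow> j"
    have F: "H ?F (?d # ?es)" using d by simp
    have "H (fsubst (\<lambda>i. Var (?\<rho> i)) ?F) (?es @ ?d # ks) \<longleftrightarrow> H ?F (?d # ?es)"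
      by (rule H_re) (use H_wf[OF F] es dK ksK in \<open>auto simp: nth_append split: nat.split\<close>)
    moreover have "map (tsubst (\<lambda>i. Var (?\<rho> i))) (vars 1 ?n) = (vars 0 ?n :: 'f tm list)"
      by (rule nth_equalityI) auto
    ultimately show ?thesis using F by simp
  qed
  ultimately show ?case using d by simp
qed

text \<open>The truth lemma. Disjunctions rest on primeness (\<open>H_Or\<close>), existentials on
  witnesses (\<open>H_Ex\<close>); a witness is replaced by its representative in order to lie in
  the carrier.\<close>

lemma term_model_sat:
  assumes "wf_fm \<Sigma> (map srt ks) \<phi>" "set ks \<subseteq> {c \<in> K. rep c = c}"
  shows "sat M ((!) ks) \<phi> \<longleftrightarrow> H \<phi> ks"
  using assms
proof (induction \<phi> arbitrary: ks)
  case (Eq t u)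
  then obtain S where tu: "wt \<Sigma> (map srt ks) t S" "wt \<Sigma> (map srt ks) u S" by auto
  let ?d = "eval M ((!) ks) t" let ?e = "eval M ((!) ks) u"
  note d = term_model_eval[OF tu(1) Eq(2)] and e = term_model_eval[OF tu(2) Eq(2)]
  have "H (fsubst (subs [t, u]) (Eq (Var 0) (Var 1))) ks \<longleftrightarrow> H (Eq (Var 0) (Var 1)) ([?d, ?e] @ ks)"
    by (rule H_subs) (use d e tu Eq in \<open>auto simp: term_model_def wt_Var_iff\<close>)
  moreover have "H (Eq (Var 0) (Var 1)) ([?d, ?e] @ ks) \<longleftrightarrow> eqv ?d ?e"
    using H_Eq[of 0 "[?d, ?e] @ ks" 1] d e Eq(2) by (auto simp: term_model_def)
  moreover have "?d \<in> K" "rep ?d = ?d" "rep ?e = ?e"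
    using d e unfolding term_model_def by auto
  then have "eqv ?d ?e \<longleftrightarrow> ?d = ?e"
    using rep_eq[of ?d ?e] eqv_refl[of ?d] by auto
  ultimately show ?case by (simp add: subs_def)
next
  case (Rel R ts)
  let ?es = "map (eval M ((!) ks)) ts"
  let ?n = "length ts"
  have wt: "list_all2 (wt \<Sigma> (map srt ks)) ts (rdom \<Sigma> R)" "R \<in> rels \<Sigma>" using Rel by auto
  have n: "?n = length (rdom \<Sigma> R)" using wt by (auto dest: list_all2_lengthD)
  have ev: "eval M ((!) ks) (ts ! i) \<in> car M (rdom \<Sigma> R ! i) \<and>
    H (Eq (tsubst (\<lambda>i. Var (Suc i)) (ts ! i)) (Var 0)) (eval M ((!) ks) (ts ! i) # ks)"
    if "i < length ts" for i
    by (rule term_model_eval[OF _ Rel(2)]) (use that wt in \<open>auto simp: list_all2_conv_all_nth\<close>)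
  have es: "set ?es \<subseteq> K" "map srt ?es = rdom \<Sigma> R"
    using ev n by (auto simp: term_model_def in_set_conv_nth list_eq_iff_nth_eq)
  have wfR: "wf_fm \<Sigma> (map srt ?es @ \<Delta>) (Rel R (vars 0 ?n))" for \<Delta>
    using wt es wt_vars0[of \<Sigma> "rdom \<Sigma> R" \<Delta>] by (simp add: n)
  have "H (fsubst (subs ts) (Rel R (vars 0 ?n))) ks \<longleftrightarrow> H (Rel R (vars 0 ?n)) (?es @ ks)"
    by (rule H_subs) (use ev wt es wfR Rel(2) in \<open>auto simp: list_all2_conv_all_nth\<close>)
  moreover have "fsubst (subs ts) (Rel R (vars 0 ?n)) = Rel R ts"
    using subs_vars[of ?n ts] by simp
  moreover have "H (fsubst Var (Rel R (vars 0 ?n))) (?es @ ks) \<longleftrightarrow> H (Rel R (vars 0 ?n)) ?es"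
    by (rule H_re) (use es Rel(2) wfR[of "[]"] in \<open>auto simp: nth_append\<close>)
  ultimately show ?case by (simp add: term_model_rint)
next
  case Top
  then show ?case using H_Top by auto
next
  case Bot
  then show ?case using H_Bot by auto
next
  case (And \<phi> \<psi>)
  have "H (And \<phi> \<psi>) ks \<longleftrightarrow> H \<phi> ks \<and> H \<psi> ks"
  proof
    assume *: "H (And \<phi> \<psi>) ks"
    have "fm_in_ctx \<Sigma> (map srt ks) (And \<phi> \<psi>)"
      using H_wf[OF *] ctx_K[OF H_K[OF *]] by (simp add: fm_in_ctx_def)
    then show "H \<phi> ks \<and> H \<psi> ks" using H_cl[OF *] prov.conjE1 prov.conjE2 by blast
  qed (use H_And in auto)
  then show ?case using And by auto
next
  case (Or \<phi> \<psi>)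
  have "fm_in_ctx \<Sigma> (map srt ks) (Or \<phi> \<psi>)"
    using Or(3,4) ctx_K[of ks] by (auto simp: fm_in_ctx_def)
  then have "H (Or \<phi> \<psi>) ks \<longleftrightarrow> H \<phi> ks \<or> H \<psi> ks"
    using H_Or H_cl prov.disjI1 prov.disjI2 by metis
  then show ?case using Or by auto
next
  case (Ex S \<phi>)
  have ctx: "fm_in_ctx \<Sigma> (map srt ks) (Ex S \<phi>)"
    using Ex(2,3) ctx_K[of ks] by (auto simp: fm_in_ctx_def)
  have IH: "sat M ((!) (c # ks)) \<phi> \<longleftrightarrow> H \<phi> (c # ks)" if "c \<in> car M S" for c
    using that Ex(2,3) by (intro Ex.IH) (auto simp: term_model_def)
  show ?case
  proof
    assume "sat M ((!) ks) (Ex S \<phi>)"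
    then obtain c where c: "c \<in> car M S" "H \<phi> (c # ks)" using IH by (auto simp: nth_Cons_fun)
    then have "map srt (c # ks) = S # map srt ks" by (auto simp: term_model_def)
    then have "H (fsubst (\<lambda>i. Var (Suc i)) (Ex S \<phi>)) (c # ks)"
      using H_cl[OF c(2)] prov.exD[OF prov.ident[OF ctx]] by metis
    moreover have "H (fsubst (\<lambda>i. Var (Suc i)) (Ex S \<phi>)) (c # ks) \<longleftrightarrow> H (Ex S \<phi>) ks"
      by (rule H_re) (use Ex(2) H_K[OF c(2)] in auto)
    ultimately show "H (Ex S \<phi>) ks" by blast
  next
    assume "H (Ex S \<phi>) ks"
    then obtain c where c: "c \<in> K" "srt c = S" "H \<phi> (c # ks)" using H_Ex by blast
    have "H \<phi> (rep c # ks)" using H_replace[OF eqv_rep[OF c(1)] c(3)] .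
    moreover have "rep c \<in> car M S"
      using eqv_D[OF eqv_rep[OF c(1)]] c rep_rep by (auto simp: term_model_def)
    ultimately show "sat M ((!) ks) (Ex S \<phi>)"
      using IH[of "rep c"] by (auto simp: nth_Cons_fun)
  qed
qed

lemma term_model_tup: "ks \<in> tup M \<Gamma> \<longleftrightarrow> set ks \<subseteq> {c \<in> K. rep c = c} \<and> map srt ks = \<Gamma>"
  by (auto simp: tup_def term_model_def list_all2_conv_all_nth in_set_conv_nth list_eq_iff_nth_eq
      subset_iff)

lemma term_model_model: "model T M"
  unfolding model_def is_struct_def
proof safe
  fix f xs assume "f \<in> funs \<Sigma>" "xs \<in> tup M (fdom \<Sigma> f)"
  then show "fint M f xs \<in> car M (fcod \<Sigma> f)"
    by (intro term_model_fint) (auto simp: term_model_tup)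
next
  fix \<Gamma> \<phi> \<psi> a assume "(\<Gamma>, \<phi>, \<psi>) \<in> axs T" and a: "a \<in> tup M \<Gamma>" and sat: "sat M ((!) a) \<phi>"
  then have p: "prov T (map srt a) \<phi> \<psi>" by (auto simp: term_model_tup intro: prov.ax)
  have "H \<phi> a" using sat a prov_wf1[OF p] by (auto simp: term_model_tup term_model_sat)
  then have "H \<psi> a" using p H_cl by blast
  then show "sat M ((!) a) \<psi>"
    using a prov_wf2[OF p] by (auto simp: term_model_tup term_model_sat)
qed

text \<open>The prefix \<open>us\<close> holds the constants already replaced. To replace the next
  one, it is moved to the front, where \<open>H_replace\<close> acts, and then moved back.\<close>

lemma H_eqv:
  assumes "list_all2 eqv ks ls" "H \<phi> (us @ ks)"
  shows "H \<phi> (us @ ls)"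
  using assms
proof (induction arbitrary: us rule: list_all2_induct)
  case (Cons k ks l ls)
  let ?\<rho> = "\<lambda>i. if i < length us then Suc i else if i = length us then 0 else i"
  have K: "set (us @ k # ks) \<subseteq> K" using H_K[OF Cons.prems] .
  have re: "H (fsubst (\<lambda>i. Var (?\<rho> i)) \<phi>) (c # us @ ks) \<longleftrightarrow> H \<phi> (us @ c # ks)"
    if "c \<in> K" "srt c = srt k" for c
  proof (rule H_re)
    show "wf_fm \<Sigma> (map srt (us @ c # ks)) \<phi>"
      using H_wf[OF Cons.prems] that by simp
  qed (use that K in \<open>auto simp: nth_append nth_Cons'\<close>)
  have "H \<phi> (us @ l # ks)"
    using re[of k] re[of l] Cons.prems H_replace[OF Cons.hyps(1)] eqv_D[OF Cons.hyps(1)] by auto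
  then show ?case using Cons.IH[of "us @ [l]"] by simp
qed simp

lemma H_rep:
  assumes "set ks \<subseteq> K"
  shows "H \<phi> (map rep ks) \<longleftrightarrow> H \<phi> ks"
proof -
  have "list_all2 eqv ks (map rep ks)" "list_all2 eqv (map rep ks) ks"
    using assms by (induction ks) (auto intro: eqv_rep eqv_sym)
  then show ?thesis
    using H_eqv[of ks "map rep ks" \<phi> "[]"] H_eqv[of "map rep ks" ks \<phi> "[]"] by auto
qed

end

section \<open>Constants, instances and Henkin states\<close>

text \<open>Parameters name the free variables of the sequent to be refuted. A witness constant
  contains the existential formula and the constants it was instantiated at, so one datatype is
  closed under adding witnesses and the language need not be extended in stages.\<close>

datatype ('s, 'f, 'r) const =
    Param nat 's
  | Witness 's "('s, 'f, 'r) fm" "('s, 'f, 'r) const list"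

primrec const_sort :: "('s, 'f, 'r) const \<Rightarrow> 's" where
  "const_sort (Param i S) = S"
| "const_sort (Witness S \<phi> ks) = S"

type_synonym ('s, 'f, 'r) instance_fm = "('s, 'f, 'r) fm \<times> ('s, 'f, 'r) const list"

definition index :: "'a list \<Rightarrow> 'a \<Rightarrow> nat" where
  "index cs k = (LEAST i. i < length cs \<and> cs ! i = k)"

lemma index: "k \<in> set cs \<Longrightarrow> index cs k < length cs \<and> cs ! index cs k = k"
  unfolding index_def by (rule LeastI_ex) (auto simp: in_set_conv_nth)

lemma index_distinct: "distinct cs \<Longrightarrow> i < length cs \<Longrightarrow> index cs (cs ! i) = i"
  by (metis index nth_eq_iff_index_eq nth_mem)

text \<open>Constants become variables: each one is read as its first position in \<open>cs\<close>,
  which may contain repetitions and constants foreign to the instance.\<close>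

definition named :: "('s, 'f, 'r) const list \<Rightarrow> ('s, 'f, 'r) instance_fm \<Rightarrow> ('s, 'f, 'r) fm" where
  "named cs p = fsubst (\<lambda>i. Var (index cs (snd p ! i))) (fst p)"

definition wf_inst ::
  "('s, 'f, 'r) signature \<Rightarrow> ('s, 'f, 'r) const set \<Rightarrow> ('s, 'f, 'r) instance_fm \<Rightarrow> bool" where
  "wf_inst \<Sigma> K p \<longleftrightarrow> set (snd p) \<subseteq> K \<and> wf_fm \<Sigma> (map const_sort (snd p)) (fst p)"

lemma wf_inst_mono: "wf_inst \<Sigma> K p \<Longrightarrow> K \<subseteq> K' \<Longrightarrow> wf_inst \<Sigma> K' p"
  by (auto simp: wf_inst_def)

lemma wf_named: "wf_inst \<Sigma> (set cs) p \<Longrightarrow> wf_fm \<Sigma> (map const_sort cs) (named cs p)"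
  unfolding named_def wf_inst_def
  by (rule wf_fsubst_Var) (auto simp: index subset_iff)

lemma named_named:
  assumes "wf_inst \<Sigma> (set cs) p"
  shows "fsubst (\<lambda>i. Var (index cs' (cs ! i))) (named cs p) = named cs' p"
  unfolding named_def fsubst_fsubst tsubst.simps
  by (rule fsubst_cong[of \<Sigma> "map const_sort (snd p)"])
    (use assms in \<open>auto simp: wf_inst_def index subset_iff\<close>)

text \<open>The context \<open>cs\<close> is an explicit argument because sorts may be empty: an
  entailment that is derivable with more constants at hand may be underivable with fewer.\<close>

definition entails ::
  "('s, 'f, 'r) coh_theory \<Rightarrow> ('s, 'f, 'r) const list \<Rightarrow>
   ('s, 'f, 'r) instance_fm list \<Rightarrow> ('s, 'f, 'r) instance_fm list \<Rightarrow> bool" where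
  "entails T cs as bs \<longleftrightarrow> (\<forall>p\<in>set as \<union> set bs. wf_inst (sig T) (set cs) p) \<and>
     prov T (map const_sort cs) (conj (map (named cs) as)) (disj (map (named cs) bs))"

text \<open>False instances need a tag of their own, since coherent logic cannot negate. Putting
  constants, true and false instances into one set lets Zorn's lemma for inclusion treat all three
  at once.\<close>

datatype ('k, 'p) tag = Exists 'k | Holds 'p | Fails 'p

type_synonym ('s, 'f, 'r) state = "(('s, 'f, 'r) const, ('s, 'f, 'r) instance_fm) tag set"

context coherent
begin

text \<open>Weakening is the substitution rule for the map that sends each position in
  \<open>cs\<close> to the position of the same constant in \<open>cs'\<close>.\<close>

lemma entails_weaken:
  assumes "entails T cs as bs" "set cs \<subseteq> set cs'" "const_sort ` set cs' \<subseteq> sorts \<Sigma>"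
  shows "entails T cs' as bs"
proof -
  have wf: "\<forall>p\<in>set as \<union> set bs. wf_inst \<Sigma> (set cs) p" using assms by (simp add: entails_def)
  let ?\<sigma> = "\<lambda>i. Var (index cs' (cs ! i))"
  have "prov T (map const_sort cs') (fsubst ?\<sigma> (conj (map (named cs) as)))
     (fsubst ?\<sigma> (disj (map (named cs) bs)))"
  proof (rule prov.subst)
    show "prov T (map const_sort cs) (conj (map (named cs) as)) (disj (map (named cs) bs))"
      using assms(1) by (simp add: entails_def)
    show "wt \<Sigma> (map const_sort cs') (Var (index cs' (cs ! i))) (map const_sort cs ! i)"
      if "i < length (map const_sort cs)" for i
    proof -
      have "cs ! i \<in> set cs'" using that assms(2) by auto
      from index[OF this] show ?thesis using that by (auto simp: wt_Var_iff)
    qed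
  qed (use assms in auto)
  moreover have "fsubst ?\<sigma> (named cs p) = named cs' p" if "p \<in> set as \<union> set bs" for p
    by (rule named_named[of \<Sigma>]) (use wf that in blast)
  then have "map (\<lambda>p. fsubst ?\<sigma> (named cs p)) as = map (named cs') as"
    "map (\<lambda>p. fsubst ?\<sigma> (named cs p)) bs = map (named cs') bs"
    by (auto intro!: map_cong)
  ultimately show ?thesis
    using wf assms(2) by (auto simp: entails_def fsubst_conj fsubst_disj comp_def intro: wf_inst_mono)
qed

definition consistent :: "('s, 'f, 'r) state \<Rightarrow> bool" where
  "consistent Z \<longleftrightarrow> (\<forall>cs as bs. Exists ` set cs \<subseteq> Z \<longrightarrow> Holds ` set as \<subseteq> Z \<longrightarrow> Fails ` set bs \<subseteq> Z \<longrightarrow>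
     \<not> entails T cs as bs)"

abbreviation "consts Z \<equiv> {k. Exists k \<in> Z}"

text \<open>The last clause ties a witness constant to its purpose: as soon as the constant is
  available, the instance that it witnesses holds.\<close>

definition good :: "('s, 'f, 'r) state \<Rightarrow> bool" where
  "good Z \<longleftrightarrow> consistent Z \<and> (\<forall>k. Exists k \<in> Z \<longrightarrow> const_sort k \<in> sorts \<Sigma>) \<and>
     (\<forall>p. Holds p \<in> Z \<or> Fails p \<in> Z \<longrightarrow> wf_inst \<Sigma> (consts Z) p) \<and>
     (\<forall>S \<phi> ks. Exists (Witness S \<phi> ks) \<in> Z \<longrightarrow> Holds (\<phi>, Witness S \<phi> ks # ks) \<in> Z)"

text \<open>An entailment involves finitely many tags, so an inconsistency of the union of a chain
  already occurs in a member. The other clauses concern single tags.\<close>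

lemma good_Union:
  assumes "\<C> \<noteq> {}" "subset.chain (Collect good) \<C>"
  shows "good (\<Union>\<C>)"
proof -
  have g: "good Z" if "Z \<in> \<C>" for Z
    using assms(2) that by (auto simp: subset_chain_def)
  have "consistent (\<Union>\<C>)"
    unfolding consistent_def
  proof (intro allI impI)
    fix cs as bs
    assume "Exists ` set cs \<subseteq> \<Union>\<C>" "Holds ` set as \<subseteq> \<Union>\<C>" "Fails ` set bs \<subseteq> \<Union>\<C>"
    then have "Exists ` set cs \<union> Holds ` set as \<union> Fails ` set bs \<subseteq> \<Union>\<C>" by auto
    from finite_subset_Union_chain[OF _ this assms] obtain Z
      where "Z \<in> \<C>" "Exists ` set cs \<union> Holds ` set as \<union> Fails ` set bs \<subseteq> Z" by auto
    then show "\<not> entails T cs as bs"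
      using g by (auto simp: good_def consistent_def)
  qed
  moreover have "wf_inst \<Sigma> (consts (\<Union>\<C>)) p" if p: "Holds p \<in> \<Union>\<C> \<or> Fails p \<in> \<Union>\<C>" for p
  proof -
    obtain Z where "Z \<in> \<C>" "Holds p \<in> Z \<or> Fails p \<in> Z" using p by blast
    then have "wf_inst \<Sigma> (consts Z) p" using g[of Z] unfolding good_def by blast
    then show ?thesis using \<open>Z \<in> \<C>\<close> by (elim wf_inst_mono) auto
  qed
  moreover have "Holds (\<phi>, Witness S \<phi> ks # ks) \<in> \<Union>\<C>" if ex: "Exists (Witness S \<phi> ks) \<in> \<Union>\<C>" for S \<phi> ks
  proof -
    obtain Z where "Z \<in> \<C>" "Exists (Witness S \<phi> ks) \<in> Z" using ex by blast
    then show ?thesis using g[of Z] unfolding good_def by blast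
  qed
  moreover have "const_sort k \<in> sorts \<Sigma>" if ex: "Exists k \<in> \<Union>\<C>" for k
  proof -
    obtain Z where "Z \<in> \<C>" "Exists k \<in> Z" using ex by blast
    then show ?thesis using g[of Z] unfolding good_def by blast
  qed
  ultimately show ?thesis
    unfolding good_def by blast
qed

end

text \<open>A maximal good state is prime, and contains a witness for each existential formula that holds.\<close>

locale maximal = coherent T for T :: "('s, 'f, 'r) coh_theory" +
  fixes Z :: "('s, 'f, 'r) state"
  assumes good: "good Z" and max: "good Z' \<Longrightarrow> Z \<subseteq> Z' \<Longrightarrow> Z' = Z"
begin

lemma consistent: "entails T cs as bs \<Longrightarrow> set cs \<subseteq> consts Z \<Longrightarrow> Holds ` set as \<subseteq> Z \<Longrightarrow>
   Fails ` set bs \<subseteq> Z \<Longrightarrow> False"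
  using good unfolding good_def consistent_def by blast

lemma sort: "k \<in> consts Z \<Longrightarrow> const_sort k \<in> sorts \<Sigma>"
  using good by (auto simp: good_def)

lemma wf: "Holds p \<in> Z \<or> Fails p \<in> Z \<Longrightarrow> wf_inst \<Sigma> (consts Z) p"
  using good unfolding good_def by blast

text \<open>Such a tag adds no constant, so consistency is the only clause of \<open>good\<close>
  that can fail.\<close>

lemma inconsistent_insert:
  assumes "\<not> good (insert t Z)" "t = Holds p \<or> t = Fails p" "wf_inst \<Sigma> (consts Z) p"
  obtains cs as bs where "entails T cs as bs" "set cs \<subseteq> consts Z"
    "Holds ` set as \<subseteq> insert t Z" "Fails ` set bs \<subseteq> insert t Z"
proof -
  have c: "consts (insert t Z) = consts Z" using assms(2) by auto
  have "\<not> consistent (insert t Z)"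
    using assms good unfolding good_def c by auto
  then obtain cs as bs where *: "entails T cs as bs" "Exists ` set cs \<subseteq> insert t Z"
    "Holds ` set as \<subseteq> insert t Z" "Fails ` set bs \<subseteq> insert t Z"
    by (auto simp: consistent_def)
  from *(2) have "set cs \<subseteq> consts Z" using assms(2) by auto
  from that[OF *(1) this *(3,4)] show ?thesis .
qed

text \<open>The cut rule. If \<open>p\<close> could be declared neither true nor false, there would
  be an entailment with \<open>p\<close> as a premise and another with \<open>p\<close> as a
  conclusion; cutting \<open>p\<close> out contradicts the consistency of \<open>Z\<close>.\<close>

lemma prime:
  assumes p: "wf_inst \<Sigma> (consts Z) p" and "Holds p \<notin> Z"
  shows "Fails p \<in> Z"
proof (rule ccontr)
  assume "Fails p \<notin> Z"
  then have ng: "\<not> good (insert (Holds p) Z)" "\<not> good (insert (Fails p) Z)"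
    using max[of "insert (Holds p) Z"] max[of "insert (Fails p) Z"] assms(2) by auto
  from inconsistent_insert[OF ng(1) _ p] obtain cs as bs where
    1: "entails T cs as bs" "set cs \<subseteq> consts Z" "Holds ` set as \<subseteq> insert (Holds p) Z"
      "Fails ` set bs \<subseteq> insert (Holds p) Z"
    by blast
  from inconsistent_insert[OF ng(2) _ p] obtain cs' as' bs' where
    2: "entails T cs' as' bs'" "set cs' \<subseteq> consts Z" "Holds ` set as' \<subseteq> insert (Fails p) Z"
      "Fails ` set bs' \<subseteq> insert (Fails p) Z"
    by blast
  \<comment> \<open>A common context for both entailments; the constants of \<open>p\<close> are
    included so that \<open>p\<close> makes sense over it in any case.\<close>
  define ds where "ds = cs @ cs' @ snd p"
  have ds: "set ds \<subseteq> consts Z" using 1 2 p by (auto simp: ds_def wf_inst_def)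
  have dsS: "const_sort ` set ds \<subseteq> sorts \<Sigma>" using ds sort by blast
  have e1: "entails T ds as bs"
    by (rule entails_weaken[OF 1(1) _ dsS]) (simp add: ds_def)
  have e2: "entails T ds as' bs'"
    by (rule entails_weaken[OF 2(1) _ dsS]) (auto simp: ds_def)
  define as0 where "as0 = filter (\<lambda>a. a \<noteq> p) as @ as'"
  define bs0 where "bs0 = bs @ filter (\<lambda>b. b \<noteq> p) bs'"
  let ?\<Gamma> = "map const_sort ds"
  let ?a = "conj (map (named ds) as0)" and ?b = "disj (map (named ds) bs0)" and ?p = "named ds p"
  have wfs: "wf_inst \<Sigma> (set ds) q" if "q \<in> set as \<union> set bs \<union> set as' \<union> set bs'" for q
    using e1 e2 that by (auto simp: entails_def)
  have wfp: "wf_inst \<Sigma> (set ds) p" using p by (auto simp: ds_def wf_inst_def)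
  have ctx: "set ?\<Gamma> \<subseteq> sorts \<Sigma>" using ds sort by auto
  have fa: "fm_in_ctx \<Sigma> ?\<Gamma> ?a" and fb: "fm_in_ctx \<Sigma> ?\<Gamma> ?b" and fp: "fm_in_ctx \<Sigma> ?\<Gamma> ?p"
    using ctx by (auto simp: fm_in_ctx_def wf_conj wf_disj as0_def bs0_def intro!: wf_named wfs wfp)
  \<comment> \<open>From the failure to declare \<open>p\<close> true: all premises other than
    \<open>p\<close> are in \<open>?a\<close>.\<close>
  have 3: "prov T ?\<Gamma> (And ?a ?p) ?b"
  proof (rule prov.cut)
    show "prov T ?\<Gamma> (And ?a ?p) (conj (map (named ds) as))"
    proof (rule prov_conj)
      fix \<phi> assume "\<phi> \<in> set (map (named ds) as)"
      then obtain q where q: "q \<in> set as" "\<phi> = named ds q" by auto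
      show "prov T ?\<Gamma> (And ?a ?p) \<phi>"
      proof (cases "q = p")
        case True
        then show ?thesis using q fa fp by (auto intro!: prov.conjE2 simp: fm_in_ctx_def)
      next
        case False
        then show ?thesis using q fa fp
          by (intro prov.cut[OF prov.conjE1 prov_conjD]) (auto simp: fm_in_ctx_def as0_def)
      qed
    qed (use fa fp in \<open>auto simp: fm_in_ctx_def\<close>)
    show "prov T ?\<Gamma> (conj (map (named ds) as)) ?b"
    proof (rule prov.cut)
      show "prov T ?\<Gamma> (conj (map (named ds) as)) (disj (map (named ds) bs))"
        using e1 by (simp add: entails_def)
      show "prov T ?\<Gamma> (disj (map (named ds) bs)) ?b"
        using fb by (intro prov_disjE prov_disjI) (auto simp: bs0_def)
    qed
  qed
  \<comment> \<open>From the failure to declare \<open>p\<close> false: all conclusions other than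
    \<open>p\<close> are in \<open>?b\<close>.\<close>
  have 4: "prov T ?\<Gamma> ?a (Or ?p ?b)"
  proof (rule prov.cut)
    show "prov T ?\<Gamma> ?a (conj (map (named ds) as'))"
      using fa by (intro prov_conj prov_conjD) (auto simp: as0_def)
    have or: "fm_in_ctx \<Sigma> ?\<Gamma> (Or ?p ?b)" using fp fb by (simp add: fm_in_ctx_def)
    have "prov T ?\<Gamma> (disj (map (named ds) bs')) (Or ?p ?b)"
    proof (rule prov_disjE[OF or])
      fix \<phi> assume "\<phi> \<in> set (map (named ds) bs')"
      then obtain q where q: "q \<in> set bs'" "\<phi> = named ds q" by auto
      show "prov T ?\<Gamma> \<phi> (Or ?p ?b)"
      proof (cases "q = p")
        case True
        then show ?thesis using q prov.disjI1[OF or] by simp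
      next
        case False
        then show ?thesis using q fb
          by (intro prov.cut[OF prov_disjI prov.disjI2[OF or]]) (auto simp: bs0_def)
      qed
    qed
    then show "prov T ?\<Gamma> (conj (map (named ds) as')) (Or ?p ?b)"
      using e2 prov.cut by (auto simp: entails_def)
  qed
  have "prov T ?\<Gamma> ?a ?b"
  proof (rule prov.cut)
    show "prov T ?\<Gamma> ?a (And ?a (Or ?p ?b))"
      using 4 fa by (intro prov.conjI prov.ident)
    \<comment> \<open>Distributivity keeps \<open>?a\<close> in both cases of the disjunction; the
      first case is sequent 3, the second a projection.\<close>
    show "prov T ?\<Gamma> (And ?a (Or ?p ?b)) ?b"
      using fa fb fp 3
      by (intro prov.cut[OF prov.distrib] prov.disjE prov.conjE2) (auto simp: fm_in_ctx_def)
  qed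
  then have "entails T ds as0 bs0"
    using wfs by (auto simp: entails_def as0_def bs0_def)
  then show False
  proof (rule consistent[OF _ ds])
    show "Holds ` set as0 \<subseteq> Z" using 1(3) 2(3) by (auto simp: as0_def)
    show "Fails ` set bs0 \<subseteq> Z" using 1(4) 2(4) by (auto simp: bs0_def)
  qed
qed

text \<open>If no conclusion held, \<open>prime\<close> would declare all of them false, and the
  derivation would be an entailment contradicting consistency.\<close>

lemma closed:
  assumes "\<forall>p\<in>set ps. Holds p \<in> Z" "\<forall>q\<in>set qs. wf_inst \<Sigma> (consts Z) q"
    "set cs \<subseteq> consts Z" "\<forall>p\<in>set ps \<union> set qs. set (snd p) \<subseteq> set cs"
    "prov T (map const_sort cs) (conj (map (named cs) ps)) (disj (map (named cs) qs))"
  shows "\<exists>q\<in>set qs. Holds q \<in> Z"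
proof (rule ccontr)
  assume "\<not> ?thesis"
  then have q: "Fails q \<in> Z" if "q \<in> set qs" for q using assms(2) prime that by blast
  have "entails T cs ps qs"
    using assms(1,2,4,5) wf unfolding entails_def wf_inst_def by blast
  then show False
    using consistent[OF _ assms(3)] assms(1) q by blast
qed

lemma prov_named:
  assumes "prov T (map const_sort ks) \<phi> \<psi>" "set ks \<subseteq> consts Z"
  shows "prov T (map const_sort ks) (named ks (\<phi>, ks)) (named ks (\<psi>, ks))"
  unfolding named_def fst_conv snd_conv
proof (rule prov.subst[OF assms(1)])
  show "wt \<Sigma> (map const_sort ks) (Var (index ks (ks ! i))) (map const_sort ks ! i)"
    if "i < length (map const_sort ks)" for i
    using that index[of "ks ! i" ks] by (auto simp: wt_Var_iff)
qed (use assms(2) sort in auto)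

lemma named_ctx: "wf_inst \<Sigma> (consts Z) (\<phi>, ks) \<Longrightarrow> set ks \<subseteq> set cs \<Longrightarrow> set cs \<subseteq> consts Z \<Longrightarrow>
    fm_in_ctx \<Sigma> (map const_sort cs) (named cs (\<phi>, ks))"
  using wf_named[of \<Sigma> cs "(\<phi>, ks)"] sort by (auto simp: fm_in_ctx_def wf_inst_def)

text \<open>Adding the constant together with its instance can only fail by an inconsistency. The
  constant is fresh, hence acts as a variable, and existential elimination turns that inconsistency
  into one of \<open>Z\<close>, where the existential formula holds.\<close>

lemma witness:
  assumes H: "Holds (Ex S \<phi>, ks) \<in> Z"
  shows "Exists (Witness S \<phi> ks) \<in> Z"
proof (rule ccontr)
  let ?c = "Witness S \<phi> ks"
  let ?p = "(\<phi>, ?c # ks)"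
  assume c: "Exists ?c \<notin> Z"
  let ?Z = "insert (Exists ?c) (insert (Holds ?p) Z)"
  have wfH: "wf_inst \<Sigma> (consts Z) (Ex S \<phi>, ks)" using wf H by blast
  then have S: "S \<in> sorts \<Sigma>" and wfp: "wf_inst \<Sigma> (consts ?Z) ?p"
    by (auto simp: wf_inst_def)
  have "\<not> good ?Z" using max[of ?Z] c by auto
  moreover have "wf_inst \<Sigma> (consts ?Z) p" if "Holds p \<in> ?Z \<or> Fails p \<in> ?Z" for p
  proof (cases "p = ?p")
    case False
    then have "Holds p \<in> Z \<or> Fails p \<in> Z" using that by auto
    from wf[OF this] show ?thesis by (rule wf_inst_mono) auto
  qed (use wfp in simp)
  ultimately have "\<not> consistent ?Z"
    using good S unfolding good_def by auto
  then obtain cs as bs where e: "entails T cs as bs" and cs: "set cs \<subseteq> insert ?c (consts Z)"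
    and as: "Holds ` set as \<subseteq> insert (Holds ?p) Z" and bs: "Fails ` set bs \<subseteq> Z"
    by (fastforce simp: consistent_def)
  \<comment> \<open>The new constant is removed and later put in front, so that it becomes variable
    0, the one bound by the quantifier. The constants \<open>ks\<close> are added for the sake of
    the existential instance.\<close>
  define ds where "ds = filter (\<lambda>k. k \<noteq> ?c) cs @ ks"
  have ksZ: "set ks \<subseteq> consts Z" using wfH by (simp add: wf_inst_def)
  have ds: "set ds \<subseteq> consts Z" "?c \<notin> set ds" using cs ksZ c by (auto simp: ds_def)
  have e': "entails T (?c # ds) as bs"
    by (rule entails_weaken[OF e]) (use cs S ds sort in \<open>auto simp: ds_def\<close>)
  define as0 where "as0 = filter (\<lambda>a. a \<noteq> ?p) as"
  let ?\<Gamma> = "map const_sort ds"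
  \<comment> \<open>For instances that avoid the new constant, putting it in front is plain
    weakening by one variable.\<close>
  have shift: "named (?c # ds) q = fsubst (\<lambda>i. Var (Suc i)) (named ds q)"
    if "wf_inst \<Sigma> (set ds) q" for q
  proof -
    have "index (?c # ds) k = Suc (index ds k)" if "k \<in> set ds" for k
    proof -
      have "(LEAST i. i < length (?c # ds) \<and> (?c # ds) ! i = k) = Suc (LEAST i. Suc i < length (?c # ds) \<and> (?c # ds) ! Suc i = k)"
        by (rule Least_Suc[of _ "Suc (index ds k)"]) (use ds(2) that index[OF that] in auto)
      then show ?thesis by (simp add: index_def)
    qed
    then show ?thesis
      unfolding named_def fsubst_fsubst tsubst.simps using that
      by (intro fsubst_cong[of \<Sigma> "map const_sort (snd q)"]) (auto simp: wf_inst_def subset_iff)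
  qed
  have wfds: "wf_inst \<Sigma> (set ds) q" if "q \<in> set as0 \<union> set bs" for q
  proof -
    have "Holds q \<in> Z \<or> Fails q \<in> Z" using that as bs by (auto simp: as0_def)
    then have "wf_inst \<Sigma> (consts Z) q" by (rule wf)
    moreover have "wf_inst \<Sigma> (set (?c # ds)) q" using e' that by (auto simp: entails_def as0_def)
    ultimately show ?thesis using c by (auto simp: wf_inst_def)
  qed
  have fc: "fm_in_ctx \<Sigma> ?\<Gamma> (conj (map (named ds) as0))" "fm_in_ctx \<Sigma> ?\<Gamma> (disj (map (named ds) bs))"
    using ds(1) sort by (auto simp: fm_in_ctx_def wf_conj wf_disj intro!: wf_named wfds)
  have p: "named (?c # ds) ?p = fsubst (lift (\<lambda>i. Var (index ds (ks ! i)))) \<phi>"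
    unfolding named_def fst_conv snd_conv
  proof (rule fsubst_cong)
    show "wf_fm \<Sigma> (S # map const_sort ks) \<phi>" using wfH by (simp add: wf_inst_def)
    fix i assume i: "i < length (S # map const_sort ks)"
    show "Var (index (?c # ds) ((?c # ks) ! i)) = lift (\<lambda>i. Var (index ds (ks ! i))) i"
    proof (cases i)
      case 0
      then show ?thesis by (auto simp: lift_def index_def Least_eq_0)
    next
      case (Suc j)
      then have k: "ks ! j \<in> set ds" using i by (auto simp: ds_def)
      have "(LEAST i. i < length (?c # ds) \<and> (?c # ds) ! i = ks ! j) = Suc (LEAST i. Suc i < length (?c # ds) \<and> (?c # ds) ! Suc i = ks ! j)"
        by (rule Least_Suc[of _ "Suc (index ds (ks ! j))"]) (use ds(2) k index[OF k] in auto)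
      then show ?thesis using Suc by (simp add: index_def lift_def)
    qed
  qed
  have "fm_in_ctx \<Sigma> ?\<Gamma> (named ds (Ex S \<phi>, ks))"
    using wfH ds by (intro named_ctx) (auto simp: ds_def)
  then have wfE: "wf_fm \<Sigma> (S # ?\<Gamma>) (named (?c # ds) ?p)"
    unfolding p by (simp add: fm_in_ctx_def named_def)
  have wfa: "wf_fm \<Sigma> (S # ?\<Gamma>) (fsubst (\<lambda>i. Var (Suc i)) (conj (map (named ds) as0)))"
    using fc(1) by (auto simp: fm_in_ctx_def intro!: wf_fsubst_Var[of _ ?\<Gamma>])
  have ctxc: "set (S # ?\<Gamma>) \<subseteq> sorts \<Sigma>" using S ds sort by auto
  have "prov T ?\<Gamma> (And (conj (map (named ds) as0)) (Ex S (named (?c # ds) ?p))) (disj (map (named ds) bs))"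
  proof (rule prov_ex_frobenius[OF prov.cut fc])
    let ?L = "And (fsubst (\<lambda>i. Var (Suc i)) (conj (map (named ds) as0))) (named (?c # ds) ?p)"
    have L: "fm_in_ctx \<Sigma> (S # ?\<Gamma>) ?L" using wfE wfa ctxc by (simp add: fm_in_ctx_def)
    have eq: "fsubst (\<lambda>i. Var (Suc i)) (conj (map (named ds) as0)) = conj (map (named (?c # ds)) as0)"
      using shift wfds by (auto simp: fsubst_conj intro!: arg_cong[of _ _ conj])
    show "prov T (S # ?\<Gamma>) ?L (conj (map (named (?c # ds)) as))"
    proof (rule prov_conj[OF L])
      fix \<chi> assume "\<chi> \<in> set (map (named (?c # ds)) as)"
      then obtain q where q: "q \<in> set as" "\<chi> = named (?c # ds) q" by auto
      show "prov T (S # ?\<Gamma>) ?L \<chi>"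
      proof (cases "q = ?p")
        case True
        then show ?thesis using q L by (auto intro: prov.conjE2)
      next
        case False
        then show ?thesis using q L unfolding eq
          by (intro prov.cut[OF prov.conjE1 prov_conjD]) (auto simp: fm_in_ctx_def as0_def)
      qed
    qed
    have eq': "fsubst (\<lambda>i. Var (Suc i)) (disj (map (named ds) bs)) = disj (map (named (?c # ds)) bs)"
      using shift wfds by (auto simp: fsubst_disj intro!: arg_cong[of _ _ disj])
    show "prov T (S # ?\<Gamma>) (conj (map (named (?c # ds)) as)) (fsubst (\<lambda>i. Var (Suc i)) (disj (map (named ds) bs)))"
      using e' unfolding eq' entails_def by simp
  qed
  moreover have "Ex S (named (?c # ds) ?p) = named ds (Ex S \<phi>, ks)"
    by (simp add: p) (simp add: named_def)
  ultimately have pr: "prov T ?\<Gamma> (And (conj (map (named ds) as0)) (named ds (Ex S \<phi>, ks))) (disj (map (named ds) bs))"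
    by simp
  have "prov T ?\<Gamma> (conj (map (named ds) ((Ex S \<phi>, ks) # as0))) (disj (map (named ds) bs))"
  proof (rule prov.cut[OF prov.conjI pr])
    have f: "fm_in_ctx \<Sigma> ?\<Gamma> (And (named ds (Ex S \<phi>, ks)) (conj (map (named ds) as0)))"
      using prov_wf1[OF pr] prov_ctx[OF pr] by (simp add: fm_in_ctx_def)
    show "prov T ?\<Gamma> (conj (map (named ds) ((Ex S \<phi>, ks) # as0))) (conj (map (named ds) as0))"
      "prov T ?\<Gamma> (conj (map (named ds) ((Ex S \<phi>, ks) # as0))) (named ds (Ex S \<phi>, ks))"
      using prov.conjE1[OF f] prov.conjE2[OF f] by (simp_all add: conj_def)
  qed
  then have "entails T ds ((Ex S \<phi>, ks) # as0) bs"
    using wfds wfH by (auto simp: entails_def wf_inst_def ds_def)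
  then show False
  proof (rule consistent[OF _ ds(1)])
    show "Holds ` set ((Ex S \<phi>, ks) # as0) \<subseteq> Z" using H as by (auto simp: as0_def)
  qed (rule bs)
qed

text \<open>Each closure property is a one-step derivation fed into \<open>closed\<close>; primeness
  is the case of two conclusions and the exclusion of \<open>Bot\<close> the case of none.\<close>

sublocale henkin T "consts Z" const_sort "\<lambda>\<phi> ks. Holds (\<phi>, ks) \<in> Z"
proof
  show "const_sort k \<in> sorts \<Sigma>" if "k \<in> consts Z" for k using that sort by simp
  show K: "set ks \<subseteq> consts Z" and wff: "wf_fm \<Sigma> (map const_sort ks) \<phi>"
    if "Holds (\<phi>, ks) \<in> Z" for \<phi> ks
    using wf[of "(\<phi>, ks)"] that by (auto simp: wf_inst_def)
  \<comment> \<open>The case of one premise and one conclusion, whose constants may differ and are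
    compared over a common list \<open>cs\<close>.\<close>
  have one: "Holds (\<psi>, ls) \<in> Z"
    if "Holds (\<phi>, ks) \<in> Z" "set cs \<subseteq> consts Z" "set ks \<subseteq> set cs" "set ls \<subseteq> set cs"
      "wf_fm \<Sigma> (map const_sort ls) \<psi>"
      "prov T (map const_sort cs) (named cs (\<phi>, ks)) (named cs (\<psi>, ls))" for \<phi> ks \<psi> ls cs
  proof -
    have "prov T (map const_sort cs) (conj (map (named cs) [(\<phi>, ks)])) (disj (map (named cs) [(\<psi>, ls)]))"
    proof (rule prov.cut[OF prov_conjD prov.cut[OF that(6) prov_disjI]])
      show "fm_in_ctx \<Sigma> (map const_sort cs) (conj (map (named cs) [(\<phi>, ks)]))"
        "fm_in_ctx \<Sigma> (map const_sort cs) (disj (map (named cs) [(\<psi>, ls)]))"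
        using prov_wf1[OF that(6)] prov_wf2[OF that(6)] prov_ctx[OF that(6)]
        by (auto simp: fm_in_ctx_def conj_def disj_def)
    qed auto
    from closed[OF _ _ that(2) _ this] show ?thesis
      using that by (auto simp: wf_inst_def)
  qed
  show "Holds (\<psi>, ks) \<in> Z" if "Holds (\<phi>, ks) \<in> Z" "prov T (map const_sort ks) \<phi> \<psi>" for \<phi> ks \<psi>
    by (rule one[OF that(1) K[OF that(1)] order_refl order_refl prov_wf2[OF that(2)]
          prov_named[OF that(2) K[OF that(1)]]])
  show "Holds (And \<phi> \<psi>, ks) \<in> Z" if "Holds (\<phi>, ks) \<in> Z" "Holds (\<psi>, ks) \<in> Z" for \<phi> \<psi> ks
  proof -
    let ?\<Gamma> = "map const_sort ks" and ?ps = "[(\<phi>, ks), (\<psi>, ks)]"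
    have ks: "set ks \<subseteq> consts Z" using K that by blast
    have f: "fm_in_ctx \<Sigma> ?\<Gamma> (named ks (\<phi>, ks))" "fm_in_ctx \<Sigma> ?\<Gamma> (named ks (\<psi>, ks))"
      using named_ctx ks wff that by (auto simp: wf_inst_def)
    then have c: "fm_in_ctx \<Sigma> ?\<Gamma> (conj (map (named ks) ?ps))"
      by (auto simp: fm_in_ctx_def conj_def)
    have "prov T ?\<Gamma> (conj (map (named ks) ?ps)) (And (named ks (\<phi>, ks)) (named ks (\<psi>, ks)))"
      by (intro prov.conjI prov_conjD[OF c]) simp_all
    then have "prov T ?\<Gamma> (conj (map (named ks) ?ps)) (named ks (And \<phi> \<psi>, ks))"
      by (simp add: named_def)
    then have "prov T ?\<Gamma> (conj (map (named ks) ?ps)) (disj (map (named ks) [(And \<phi> \<psi>, ks)]))"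
      using f by (elim prov.cut, intro prov_disjI) (auto simp: fm_in_ctx_def disj_def named_def)
    from closed[OF _ _ ks _ this] show ?thesis
      using that ks wff by (auto simp: wf_inst_def)
  qed
  show "Holds (Top, ks) \<in> Z" if "set ks \<subseteq> consts Z" for ks
  proof -
    let ?\<Gamma> = "map const_sort ks"
    have "const_sort ` set ks \<subseteq> sorts \<Sigma>" using that sort by blast
    then have "prov T ?\<Gamma> (conj (map (named ks) [])) (disj (map (named ks) [(Top, ks)]))"
      by (auto simp: conj_def disj_def named_def fm_in_ctx_def intro!: prov.disjI1)
    from closed[OF _ _ that _ this] show ?thesis
      using that by (auto simp: wf_inst_def)
  qed
  show "Holds (\<phi>, ks) \<in> Z \<or> Holds (\<psi>, ks) \<in> Z" if "Holds (Or \<phi> \<psi>, ks) \<in> Z" for \<phi> \<psi> ks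
  proof -
    let ?\<Gamma> = "map const_sort ks" and ?qs = "[(\<phi>, ks), (\<psi>, ks)]"
    have ks: "set ks \<subseteq> consts Z" using K that by blast
    have wfs: "wf_fm \<Sigma> ?\<Gamma> \<phi>" "wf_fm \<Sigma> ?\<Gamma> \<psi>" using wff[OF that] by auto
    have f: "fm_in_ctx \<Sigma> ?\<Gamma> (named ks (\<phi>, ks))" "fm_in_ctx \<Sigma> ?\<Gamma> (named ks (\<psi>, ks))"
      using named_ctx ks wfs by (auto simp: wf_inst_def)
    then have d: "fm_in_ctx \<Sigma> ?\<Gamma> (disj (map (named ks) ?qs))"
      and c: "fm_in_ctx \<Sigma> ?\<Gamma> (conj (map (named ks) [(Or \<phi> \<psi>, ks)]))"
      by (auto simp: fm_in_ctx_def conj_def disj_def named_def)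
    have "prov T ?\<Gamma> (Or (named ks (\<phi>, ks)) (named ks (\<psi>, ks))) (disj (map (named ks) ?qs))"
      by (intro prov.disjE prov_disjI[OF d]) simp_all
    then have "prov T ?\<Gamma> (named ks (Or \<phi> \<psi>, ks)) (disj (map (named ks) ?qs))"
      by (simp add: named_def)
    then have "prov T ?\<Gamma> (conj (map (named ks) [(Or \<phi> \<psi>, ks)])) (disj (map (named ks) ?qs))"
      using prov_conjD[OF c] prov.cut by auto
    from closed[OF _ _ ks _ this] show ?thesis
      using that ks wfs by (auto simp: wf_inst_def)
  qed
  show "Holds (Bot, ks) \<notin> Z" for ks
  proof
    assume H: "Holds (Bot, ks) \<in> Z"
    have ks: "set ks \<subseteq> consts Z" using K H by blast
    have "const_sort ` set ks \<subseteq> sorts \<Sigma>" using ks sort by blast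
    then have "prov T (map const_sort ks) (conj (map (named ks) [(Bot, ks)])) (disj (map (named ks) []))"
      by (auto simp: conj_def disj_def named_def fm_in_ctx_def intro!: prov.conjE1)
    from closed[OF _ _ ks _ this] show False using H by auto
  qed
  show "\<exists>c\<in>consts Z. const_sort c = S \<and> Holds (\<phi>, c # ks) \<in> Z" if "Holds (Ex S \<phi>, ks) \<in> Z" for S \<phi> ks
    using witness[OF that] good unfolding good_def
    by (intro bexI[of _ "Witness S \<phi> ks"]) auto
  show "Holds (fsubst (\<lambda>i. Var (\<rho> i)) \<phi>, ks) \<in> Z \<longleftrightarrow> Holds (\<phi>, ls) \<in> Z"
    if wf: "wf_fm \<Sigma> (map const_sort ls) \<phi>" and ks: "set ks \<subseteq> consts Z"
      and \<rho>: "\<And>i. i < length ls \<Longrightarrow> \<rho> i < length ks \<and> ks ! \<rho> i = ls ! i" for ls \<phi> ks \<rho>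
  proof -
    have ls: "set ls \<subseteq> set ks" using \<rho> by (metis in_set_conv_nth subsetI)
    let ?\<phi> = "fsubst (\<lambda>i. Var (\<rho> i)) \<phi>"
    \<comment> \<open>Over the list \<open>ks\<close>, both instances become literally the same
      formula.\<close>
    have eq: "named ks (?\<phi>, ks) = named ks (\<phi>, ls)"
      unfolding named_def fst_conv snd_conv fsubst_fsubst tsubst.simps
      by (rule fsubst_cong[OF wf]) (use \<rho> in auto)
    have wf': "wf_fm \<Sigma> (map const_sort ks) ?\<phi>"
      by (rule wf_fsubst_Var[OF wf]) (use \<rho> in auto)
    have id: "prov T (map const_sort ks) (named ks (\<phi>, ls)) (named ks (\<phi>, ls))"
      using wf ks ls by (intro prov.ident named_ctx) (auto simp: wf_inst_def)
    show ?thesis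
      using one[of ?\<phi> ks ks ls \<phi>] one[of \<phi> ls ks ks ?\<phi>] id wf wf' ks ls eq by auto
  qed
qed

end

context coherent
begin

text \<open>A sequent that is not derivable starts a good state in which \<open>\<phi>\<close> holds
  and \<open>\<psi>\<close> fails at fresh parameters; the term model of a maximal extension refutes
  it. Countermodels thus always exist over the type of constants, so validity over that one type is
  enough.\<close>

theorem completeness:
  assumes \<phi>: "fm_in_ctx \<Sigma> \<Gamma> \<phi>" and \<psi>: "fm_in_ctx \<Sigma> \<Gamma> \<psi>"
    and valid: "\<And>M :: ('s, 'f, 'r, ('s, 'f, 'r) const) struct. \<And>a.
      model T M \<Longrightarrow> a \<in> tup M \<Gamma> \<Longrightarrow> sat M ((!) a) \<phi> \<Longrightarrow> sat M ((!) a) \<psi>"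
  shows "prov T \<Gamma> \<phi> \<psi>"
proof (rule ccontr)
  assume np: "\<not> prov T \<Gamma> \<phi> \<psi>"
  \<comment> \<open>The index keeps the parameters distinct when a sort occurs repeatedly in the
    context.\<close>
  define ks :: "('s, 'f, 'r) const list" where "ks = map (\<lambda>i. Param i (\<Gamma> ! i)) [0..<length \<Gamma>]"
  have srt: "map const_sort ks = \<Gamma>" unfolding ks_def by (rule nth_equalityI) auto
  have dist: "distinct ks" by (auto simp: ks_def distinct_map inj_on_def)
  define Z0 :: "('s, 'f, 'r) state" where
    "Z0 = Exists ` set ks \<union> {Holds (\<phi>, ks), Fails (\<psi>, ks)}"
  have named: "named ks (\<chi>, ks) = \<chi>" if "fm_in_ctx \<Sigma> \<Gamma> \<chi>" for \<chi>
  proof -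
    have "fsubst (\<lambda>i. Var (index ks (ks ! i))) \<chi> = fsubst Var \<chi>"
      by (rule fsubst_cong[of \<Sigma> \<Gamma>])
        (use that dist srt in \<open>auto simp: fm_in_ctx_def index_distinct\<close>)
    then show ?thesis by (simp add: named_def)
  qed
  have ksort: "const_sort ` set ks \<subseteq> sorts \<Sigma>"
    using \<phi> srt by (metis fm_in_ctx_def set_map)
  \<comment> \<open>Over \<open>ks\<close>, an entailment from copies of \<open>\<phi>\<close> at
    most to copies of \<open>\<psi>\<close> at most would derive the sequent.\<close>
  have "consistent Z0"
    unfolding consistent_def
  proof (intro allI impI notI)
    fix cs as bs
    assume "Exists ` set cs \<subseteq> Z0" "Holds ` set as \<subseteq> Z0" "Fails ` set bs \<subseteq> Z0"
      and e: "entails T cs as bs"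
    then have cs: "set cs \<subseteq> set ks" and as: "set as \<subseteq> {(\<phi>, ks)}" and bs: "set bs \<subseteq> {(\<psi>, ks)}"
      by (auto simp: Z0_def)
    have "entails T ks as bs" by (rule entails_weaken[OF e cs ksort])
    then have p: "prov T \<Gamma> (conj (map (named ks) as)) (disj (map (named ks) bs))"
      by (simp add: entails_def srt)
    have "prov T \<Gamma> \<phi> (conj (map (named ks) as))"
      using as named[OF \<phi>] prov.ident[OF \<phi>] by (intro prov_conj[OF \<phi>]) auto
    moreover have "prov T \<Gamma> (disj (map (named ks) bs)) \<psi>"
      using bs named[OF \<psi>] prov.ident[OF \<psi>] by (intro prov_disjE[OF \<psi>]) auto
    ultimately show False using np p prov.cut by metis
  qed
  then have "good Z0"
    using ksort \<phi> \<psi> srt by (auto simp: good_def Z0_def wf_inst_def fm_in_ctx_def ks_def)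
  let ?A = "{Z. good Z \<and> Z0 \<subseteq> Z}"
  have "\<exists>Z\<in>?A. \<forall>Z'\<in>?A. Z \<subseteq> Z' \<longrightarrow> Z' = Z"
  proof (rule subset_Zorn_nonempty)
    show "?A \<noteq> {}" using \<open>good Z0\<close> by auto
    fix \<C> assume "\<C> \<noteq> {}" "subset.chain ?A \<C>"
    then show "\<Union>\<C> \<in> ?A" using good_Union[of \<C>] by (auto simp: subset_chain_def)
  qed
  then obtain Z where ZA: "Z \<in> ?A" and mx: "\<forall>Z'\<in>?A. Z \<subseteq> Z' \<longrightarrow> Z' = Z" by (elim bexE)
  have Z: "good Z" "Z0 \<subseteq> Z" using ZA by simp_all
  have Zmax: "Z' = Z" if "good Z'" "Z \<subseteq> Z'" for Z'
    using mx Z(2) that by simp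
  interpret maximal T Z by standard (use Z Zmax in simp_all)
  have ks: "set ks \<subseteq> consts Z" using Z(2) by (auto simp: Z0_def)
  \<comment> \<open>Parameters need not represent their own class, so the refuting tuple consists of
    their representatives; \<open>H_rep\<close> says that \<open>H\<close> cannot tell the
    difference.\<close>
  let ?a = "map rep ks"
  have a: "?a \<in> tup term_model \<Gamma>"
  proof -
    have "rep k \<in> consts Z \<and> rep (rep k) = rep k \<and> const_sort (rep k) = const_sort k"
      if "k \<in> set ks" for k
      using eqv_D[OF eqv_rep, of k] rep_rep[of k] ks that by auto
    then show ?thesis using srt by (auto simp: term_model_tup)
  qed
  have a': "map const_sort ?a = \<Gamma>" "set ?a \<subseteq> {c \<in> consts Z. rep c = c}"
    using a by (auto simp: term_model_tup)
  have "sat term_model ((!) ?a) \<phi>"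
    using term_model_sat[of ?a \<phi>] a' \<phi> H_rep[OF ks] Z(2) by (auto simp: fm_in_ctx_def Z0_def)
  then have "sat term_model ((!) ?a) \<psi>"
    by (rule valid[OF term_model_model a])
  then have "Holds (\<psi>, ks) \<in> Z"
    using term_model_sat[of ?a \<psi>] a' \<psi> H_rep[OF ks] by (auto simp: fm_in_ctx_def)
  moreover have "Fails (\<psi>, ks) \<in> Z" using Z(2) by (auto simp: Z0_def)
  moreover have "entails T ks [(\<psi>, ks)] [(\<psi>, ks)]"
    using \<psi> srt named[OF \<psi>] prov.conjE1[of T \<Gamma> \<psi> Top] prov.disjI1[of T \<Gamma> \<psi> Bot]
    by (auto simp: entails_def wf_inst_def fm_in_ctx_def conj_def disj_def intro: prov.cut)
  ultimately show False
    using consistent[of ks "[(\<psi>, ks)]" "[(\<psi>, ks)]"] ks by simp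
qed

end

section \<open>Categories, sieves and equivalences\<close>

lemma hom_comp:
  "is_category C \<Longrightarrow> f \<in> hom C a b \<Longrightarrow> g \<in> hom C b c \<Longrightarrow> Cmp C g f \<in> hom C a c"
  by (auto simp: is_category_def hom_def)

lemma hom_id: "is_category C \<Longrightarrow> a \<in> Ob C \<Longrightarrow> Ident C a \<in> hom C a a"
  by (auto simp: is_category_def)

lemma hom_ob: "is_category C \<Longrightarrow> f \<in> hom C a b \<Longrightarrow> a \<in> Ob C \<and> b \<in> Ob C"
  by (auto simp: is_category_def hom_def)

lemma comp_id1: "is_category C \<Longrightarrow> f \<in> hom C a b \<Longrightarrow> Cmp C f (Ident C a) = f"
  and comp_id2: "is_category C \<Longrightarrow> f \<in> hom C a b \<Longrightarrow> Cmp C (Ident C b) f = f"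
  by (auto simp: is_category_def hom_def)

lemma comp_assoc:
  "is_category C \<Longrightarrow> f \<in> hom C a b \<Longrightarrow> g \<in> hom C b c \<Longrightarrow> h \<in> hom C c d \<Longrightarrow>
   Cmp C h (Cmp C g f) = Cmp C (Cmp C h g) f"
  by (auto simp: is_category_def hom_def)

lemma hom_Ar: "f \<in> hom C a b \<Longrightarrow> f \<in> Ar C \<and> Dom C f = a \<and> Cod C f = b"
  by (simp add: hom_def)

lemma Ar_hom: "f \<in> Ar C \<Longrightarrow> f \<in> hom C (Dom C f) (Cod C f)"
  by (simp add: hom_def)

lemma functor_ob: "is_functor C D F \<Longrightarrow> a \<in> Ob C \<Longrightarrow> fob F a \<in> Ob D"
  by (simp add: is_functor_def)

lemma functor_hom: "is_functor C D F \<Longrightarrow> f \<in> hom C a b \<Longrightarrow> far F f \<in> hom D (fob F a) (fob F b)"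
  by (auto simp: is_functor_def hom_def)

lemma functor_id: "is_functor C D F \<Longrightarrow> a \<in> Ob C \<Longrightarrow> far F (Ident C a) = Ident D (fob F a)"
  by (simp add: is_functor_def)

lemma functor_comp:
  "is_functor C D F \<Longrightarrow> f \<in> hom C a b \<Longrightarrow> g \<in> hom C b c \<Longrightarrow>
   far F (Cmp C g f) = Cmp D (far F g) (far F f)"
  by (auto simp: is_functor_def hom_def)

lemma iso_iff:
  "f \<in> hom C a b \<Longrightarrow> is_iso C f \<longleftrightarrow> (\<exists>g\<in>hom C b a. Cmp C g f = Ident C a \<and> Cmp C f g = Ident C b)"
  by (auto simp: is_iso_def hom_def)

section \<open>Equivalences versus fully faithful, essentially surjective functors\<close>

definition full :: "('o1, 'm1) category \<Rightarrow> ('o2, 'm2) category \<Rightarrow> ('o1, 'm1, 'o2, 'm2) functr \<Rightarrow> bool" where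
  "full C D F \<longleftrightarrow> (\<forall>a\<in>Ob C. \<forall>b\<in>Ob C. \<forall>g\<in>hom D (fob F a) (fob F b). \<exists>f\<in>hom C a b. far F f = g)"

definition faithful :: "('o1, 'm1) category \<Rightarrow> ('o1, 'm1, 'o2, 'm2) functr \<Rightarrow> bool" where
  "faithful C F \<longleftrightarrow> (\<forall>a b. \<forall>f\<in>hom C a b. \<forall>f'\<in>hom C a b. far F f = far F f' \<longrightarrow> f = f')"

definition essentially_surjective ::
  "('o1, 'm1) category \<Rightarrow> ('o2, 'm2) category \<Rightarrow> ('o1, 'm1, 'o2, 'm2) functr \<Rightarrow> bool" where
  "essentially_surjective C D F \<longleftrightarrow> (\<forall>d\<in>Ob D. \<exists>c\<in>Ob C. \<exists>i\<in>hom D (fob F c) d. is_iso D i)"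

text \<open>For each \<open>d\<close> an object \<open>g d\<close> and mutually inverse
  \<open>i d\<close>, \<open>j d\<close> are chosen. The inverse functor sends \<open>h\<close> to
  the preimage of its conjugate by these isomorphisms, and faithfulness transfers all equations from
  \<open>D\<close> to \<open>C\<close>.\<close>

lemma equivalent_categoriesI:
  assumes C: "is_category C" and D: "is_category D" and F: "is_functor C D F"
    and full: "full C D F" and faithful: "faithful C F" and es: "essentially_surjective C D F"
  shows "equivalent_categories C D"
proof -
  have faithfulD: "f = f'" if "f \<in> hom C a b" "f' \<in> hom C a b" "far F f = far F f'" for f f' a b
    using faithful that by (auto simp: faithful_def)
  have "\<forall>d\<in>Ob D. \<exists>c\<in>Ob C. \<exists>i\<in>hom D (fob F c) d. \<exists>j\<in>hom D d (fob F c).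
      Cmp D j i = Ident D (fob F c) \<and> Cmp D i j = Ident D d"
    using es iso_iff unfolding essentially_surjective_def by metis
  then obtain g i j where g: "\<And>d. d \<in> Ob D \<Longrightarrow> g d \<in> Ob C"
    and i: "\<And>d. d \<in> Ob D \<Longrightarrow> i d \<in> hom D (fob F (g d)) d"
    and j: "\<And>d. d \<in> Ob D \<Longrightarrow> j d \<in> hom D d (fob F (g d))"
    and ji: "\<And>d. d \<in> Ob D \<Longrightarrow> Cmp D (j d) (i d) = Ident D (fob F (g d))"
    and ij: "\<And>d. d \<in> Ob D \<Longrightarrow> Cmp D (i d) (j d) = Ident D d"
    by metis
  have "\<exists>f\<in>hom C (g d) (g d'). far F f = Cmp D (j d') (Cmp D h (i d))" if h: "h \<in> hom D d d'" for h d d'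
  proof -
    have ob: "d \<in> Ob D" "d' \<in> Ob D" using hom_ob[OF D h] by auto
    have "Cmp D (j d') (Cmp D h (i d)) \<in> hom D (fob F (g d)) (fob F (g d'))"
      by (rule hom_comp[OF D hom_comp[OF D i[OF ob(1)] h] j[OF ob(2)]])
    then show ?thesis using full g ob by (auto simp: full_def)
  qed
  \<comment> \<open>An arrow determines its domain and codomain, so the preimage can be chosen as a
    function of \<open>h\<close> alone.\<close>
  then have "\<forall>h. \<exists>f. \<forall>d d'. h \<in> hom D d d' \<longrightarrow> f \<in> hom C (g d) (g d') \<and> far F f = Cmp D (j d') (Cmp D h (i d))"
    by (metis hom_Ar)
  then obtain k where k: "\<And>h d d'. h \<in> hom D d d' \<Longrightarrow> k h \<in> hom C (g d) (g d')"
    and Fk: "\<And>h d d'. h \<in> hom D d d' \<Longrightarrow> far F (k h) = Cmp D (j d') (Cmp D h (i d))"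
    by metis
  define G where "G = \<lparr>fob = g, far = k\<rparr>"
  have G: "is_functor D C G"
    unfolding is_functor_def
  proof (intro conjI ballI impI)
    show "fob G d \<in> Ob C" if "d \<in> Ob D" for d using g that by (simp add: G_def)
    show "far G h \<in> hom C (fob G (Dom D h)) (fob G (Cod D h))" if "h \<in> Ar D" for h
      using k[OF Ar_hom[OF that]] by (simp add: G_def)
    show "far G (Ident D d) = Ident C (fob G d)" if d: "d \<in> Ob D" for d
    proof -
      have "far F (k (Ident D d)) = far F (Ident C (g d))"
        using Fk[OF hom_id[OF D d]] d i j ji comp_id2[OF D i[OF d]] functor_id[OF F g[OF d]] by simp
      then show ?thesis
        using faithfulD k[OF hom_id[OF D d]] hom_id[OF C g[OF d]] by (auto simp: G_def)
    qed
    fix h h' assume h: "h \<in> Ar D" "h' \<in> Ar D" and eq: "Cod D h = Dom D h'"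
    let ?d = "Dom D h" let ?e = "Cod D h" let ?c = "Cod D h'"
    have h1: "h \<in> hom D ?d ?e" and h2: "h' \<in> hom D ?e ?c" using h eq by (auto simp: hom_def)
    have ob: "?d \<in> Ob D" "?e \<in> Ob D" "?c \<in> Ob D" using hom_ob[OF D h1] hom_ob[OF D h2] by auto
    have hi: "Cmp D h (i ?d) \<in> hom D (fob F (g ?d)) ?e" by (rule hom_comp[OF D i[OF ob(1)] h1])
    have h'i: "Cmp D h' (i ?e) \<in> hom D (fob F (g ?e)) ?c" by (rule hom_comp[OF D i[OF ob(2)] h2])
    have "far F (Cmp C (k h') (k h)) = Cmp D (Cmp D (j ?c) (Cmp D h' (i ?e))) (Cmp D (j ?e) (Cmp D h (i ?d)))"
      using functor_comp[OF F k[OF h1] k[OF h2]] Fk[OF h1] Fk[OF h2] by simp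
    also have "\<dots> = Cmp D (j ?c) (Cmp D (Cmp D h' (i ?e)) (Cmp D (j ?e) (Cmp D h (i ?d))))"
      by (rule comp_assoc[OF D hom_comp[OF D hi j[OF ob(2)]] h'i j[OF ob(3)], symmetric])
    also have "Cmp D (Cmp D h' (i ?e)) (Cmp D (j ?e) (Cmp D h (i ?d)))
        = Cmp D h' (Cmp D (i ?e) (Cmp D (j ?e) (Cmp D h (i ?d))))"
      by (rule comp_assoc[OF D hom_comp[OF D hi j[OF ob(2)]] i[OF ob(2)] h2, symmetric])
    also have "Cmp D (i ?e) (Cmp D (j ?e) (Cmp D h (i ?d))) = Cmp D h (i ?d)"
      using comp_assoc[OF D hi j[OF ob(2)] i[OF ob(2)]] ij[OF ob(2)] comp_id2[OF D hi] by simp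
    also have "Cmp D h' (Cmp D h (i ?d)) = Cmp D (Cmp D h' h) (i ?d)"
      by (rule comp_assoc[OF D i[OF ob(1)] h1 h2])
    finally have "far F (Cmp C (k h') (k h)) = far F (k (Cmp D h' h))"
      using Fk[OF hom_comp[OF D h1 h2]] by simp
    then show "far G (Cmp D h' h) = Cmp C (far G h') (far G h)"
      using faithfulD[OF k[OF hom_comp[OF D h1 h2]] hom_comp[OF C k[OF h1] k[OF h2]]] by (simp add: G_def)
  qed
  have FG: "naturally_isomorphic D D (comp_functor F G) id_functor"
    unfolding naturally_isomorphic_def
  proof (intro exI[of _ i] conjI ballI)
    show "i d \<in> hom D (fob (comp_functor F G) d) (fob id_functor d)" if "d \<in> Ob D" for d
      using i that by (simp add: G_def comp_functor_def id_functor_def)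
    show "is_iso D (i d)" if "d \<in> Ob D" for d
      using iso_iff[OF i[OF that]] j[OF that] ij[OF that] ji[OF that] by blast
    fix h assume "h \<in> Ar D"
    then have h: "h \<in> hom D (Dom D h) (Cod D h)" by (rule Ar_hom)
    note ob = hom_ob[OF D h]
    have hi: "Cmp D h (i (Dom D h)) \<in> hom D (fob F (g (Dom D h))) (Cod D h)"
      using hom_comp[OF D i h] ob by blast
    show "Cmp D (i (Cod D h)) (far (comp_functor F G) h) = Cmp D (far id_functor h) (i (Dom D h))"
      using comp_assoc[OF D hi j i] ij ob Fk[OF h] comp_id2[OF D hi]
      by (simp add: G_def comp_functor_def id_functor_def)
  qed
  \<comment> \<open>The component of the unit at \<open>a\<close> is the preimage of
    \<open>j\<close> at the image of \<open>a\<close>.\<close>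
  have "\<forall>a\<in>Ob C. \<exists>e\<in>hom C a (g (fob F a)). far F e = j (fob F a)"
    using full g functor_ob[OF F] j by (simp add: full_def)
  then obtain e where e: "\<And>a. a \<in> Ob C \<Longrightarrow> e a \<in> hom C a (g (fob F a))"
    and Fe: "\<And>a. a \<in> Ob C \<Longrightarrow> far F (e a) = j (fob F a)"
    by metis
  have GF: "naturally_isomorphic C C id_functor (comp_functor G F)"
    unfolding naturally_isomorphic_def
  proof (intro exI[of _ e] conjI ballI)
    show "e a \<in> hom C (fob id_functor a) (fob (comp_functor G F) a)" if "a \<in> Ob C" for a
      using e that by (simp add: G_def comp_functor_def id_functor_def)
    show "is_iso C (e a)" if a: "a \<in> Ob C" for a
    proof -
      note Fa = functor_ob[OF F a]
      obtain r where r: "r \<in> hom C (g (fob F a)) a" "far F r = i (fob F a)"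
        using full g[OF Fa] a i[OF Fa] unfolding full_def by blast
      have "far F (Cmp C r (e a)) = far F (Ident C a)"
        using functor_comp[OF F e[OF a] r(1)] r Fe[OF a] ij[OF Fa] functor_id[OF F a] by simp
      then have 1: "Cmp C r (e a) = Ident C a"
        using faithfulD[OF hom_comp[OF C e[OF a] r(1)] hom_id[OF C a]] by simp
      have "far F (Cmp C (e a) r) = far F (Ident C (g (fob F a)))"
        using functor_comp[OF F r(1) e[OF a]] r Fe[OF a] ji[OF Fa] functor_id[OF F g[OF Fa]] by simp
      then have "Cmp C (e a) r = Ident C (g (fob F a))"
        using faithfulD[OF hom_comp[OF C r(1) e[OF a]] hom_id[OF C g[OF Fa]]] by simp
      then show ?thesis using 1 r(1) iso_iff[OF e[OF a]] by blast
    qed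
    fix f assume "f \<in> Ar C"
    then have f: "f \<in> hom C (Dom C f) (Cod C f)" by (rule Ar_hom)
    note ob = hom_ob[OF C f] and Ff = functor_hom[OF F f]
    let ?a = "Dom C f" let ?b = "Cod C f"
    note a = functor_ob[OF F conjunct1[OF ob]] and b = functor_ob[OF F conjunct2[OF ob]]
    have ea: "e ?a \<in> hom C ?a (g (fob F ?a))" and eb: "e ?b \<in> hom C ?b (g (fob F ?b))" using e ob by auto
    have Fi: "Cmp D (far F f) (i (fob F ?a)) \<in> hom D (fob F (g (fob F ?a))) (fob F ?b)"
      by (rule hom_comp[OF D i[OF a] Ff])
    have "far F (Cmp C (k (far F f)) (e ?a)) = Cmp D (Cmp D (j (fob F ?b)) (Cmp D (far F f) (i (fob F ?a)))) (j (fob F ?a))"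
      using functor_comp[OF F ea k[OF Ff]] Fk[OF Ff] Fe ob by simp
    also have "\<dots> = Cmp D (j (fob F ?b)) (Cmp D (Cmp D (far F f) (i (fob F ?a))) (j (fob F ?a)))"
      by (rule comp_assoc[OF D j[OF a] Fi j[OF b], symmetric])
    also have "Cmp D (Cmp D (far F f) (i (fob F ?a))) (j (fob F ?a)) = far F f"
      using comp_assoc[OF D j[OF a] i[OF a] Ff] ij[OF a] comp_id1[OF D Ff] by simp
    also have "Cmp D (j (fob F ?b)) (far F f) = far F (Cmp C (e ?b) f)"
      using functor_comp[OF F f eb] Fe ob by simp
    finally have "Cmp C (k (far F f)) (e ?a) = Cmp C (e ?b) f"
      by (rule faithfulD[OF hom_comp[OF C ea k[OF Ff]] hom_comp[OF C f eb]])
    then show "Cmp C (e ?b) (far id_functor f) = Cmp C (far (comp_functor G F) f) (e ?a)"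
      by (simp add: G_def comp_functor_def id_functor_def)
  qed
  show ?thesis unfolding equivalent_categories_def using C D F G FG GF by blast
qed

lemma iso_cancel_left:
  assumes "is_category C" "is_iso C h" "h \<in> hom C b c" "f \<in> hom C a b" "f' \<in> hom C a b" "Cmp C h f = Cmp C h f'"
  shows "f = f'"
proof -
  obtain k where "k \<in> hom C c b" "Cmp C k h = Ident C b" using assms(2,3) iso_iff by metis
  then show ?thesis
    using comp_assoc[OF assms(1) assms(4,3)] comp_assoc[OF assms(1) assms(5,3)]
      comp_id2[OF assms(1)] assms(4-6) by metis
qed

lemma iso_cancel_right:
  assumes "is_category C" "is_iso C h" "h \<in> hom C a b" "f \<in> hom C b c" "f' \<in> hom C b c" "Cmp C f h = Cmp C f' h"
  shows "f = f'"
proof -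
  obtain k where "k \<in> hom C b a" "Cmp C h k = Ident C b" using assms(2,3) iso_iff by metis
  then show ?thesis
    using comp_assoc[OF assms(1) _ assms(3,4)] comp_assoc[OF assms(1) _ assms(3,5)]
      comp_id1[OF assms(1)] assms(4-6) by metis
qed

lemma is_iso_inverse:
  assumes "f \<in> hom C a b" "g \<in> hom C b a" "Cmp C g f = Ident C a" "Cmp C f g = Ident C b"
  shows "is_iso C f" "is_iso C g"
  using assms iso_iff by metis+

lemma naturally_isomorphic_sym:
  assumes C: "is_category C" and D: "is_category D" and F: "is_functor C D F" and G: "is_functor C D G"
    and "naturally_isomorphic C D F G"
  shows "naturally_isomorphic C D G F"
proof -
  from assms(5) obtain \<eta> where \<eta>: "\<And>a. a \<in> Ob C \<Longrightarrow> \<eta> a \<in> hom D (fob F a) (fob G a) \<and> is_iso D (\<eta> a)"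
    and nat: "\<And>f. f \<in> Ar C \<Longrightarrow> Cmp D (\<eta> (Cod C f)) (far F f) = Cmp D (far G f) (\<eta> (Dom C f))"
    by (auto simp: naturally_isomorphic_def)
  have "\<forall>a\<in>Ob C. \<exists>k\<in>hom D (fob G a) (fob F a). Cmp D k (\<eta> a) = Ident D (fob F a) \<and> Cmp D (\<eta> a) k = Ident D (fob G a)"
    using \<eta> iso_iff by metis
  then obtain \<kappa> where \<kappa>: "\<And>a. a \<in> Ob C \<Longrightarrow> \<kappa> a \<in> hom D (fob G a) (fob F a) \<and>
      Cmp D (\<kappa> a) (\<eta> a) = Ident D (fob F a) \<and> Cmp D (\<eta> a) (\<kappa> a) = Ident D (fob G a)"
    by metis
  show ?thesis
    unfolding naturally_isomorphic_def
  proof (intro exI[of _ \<kappa>] conjI ballI)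
    show "\<kappa> a \<in> hom D (fob G a) (fob F a)" if "a \<in> Ob C" for a using \<kappa> that by blast
    show "is_iso D (\<kappa> a)" if "a \<in> Ob C" for a
      using is_iso_inverse(2)[of "\<eta> a" D] \<kappa>[OF that] \<eta>[OF that] by blast
    fix f assume f: "f \<in> Ar C"
    let ?a = "Dom C f" let ?b = "Cod C f"
    note fh = Ar_hom[OF f] and ob = hom_ob[OF C Ar_hom[OF f]]
    note Ff = functor_hom[OF F fh] and Gf = functor_hom[OF G fh]
    have \<kappa>a: "\<kappa> ?a \<in> hom D (fob G ?a) (fob F ?a)" and \<kappa>b: "\<kappa> ?b \<in> hom D (fob G ?b) (fob F ?b)"
      and \<eta>a: "\<eta> ?a \<in> hom D (fob F ?a) (fob G ?a)" and \<eta>b: "\<eta> ?b \<in> hom D (fob F ?b) (fob G ?b)"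
      using \<kappa> \<eta> ob by auto
    have "Cmp D (Cmp D (\<kappa> ?b) (far G f)) (\<eta> ?a) = Cmp D (\<kappa> ?b) (Cmp D (\<eta> ?b) (far F f))"
      using comp_assoc[OF D \<eta>a Gf \<kappa>b] nat[OF f] by simp
    also have "\<dots> = far F f"
      using comp_assoc[OF D Ff \<eta>b \<kappa>b] \<kappa> ob comp_id2[OF D Ff] by simp
    also have "\<dots> = Cmp D (Cmp D (far F f) (\<kappa> ?a)) (\<eta> ?a)"
      using comp_assoc[OF D \<eta>a \<kappa>a Ff] \<kappa> ob comp_id1[OF D Ff] by simp
    finally show "Cmp D (\<kappa> (Cod C f)) (far G f) = Cmp D (far F f) (\<kappa> (Dom C f))"
      using iso_cancel_right[OF D _ \<eta>a hom_comp[OF D Gf \<kappa>b] hom_comp[OF D \<kappa>a Ff]] \<eta> ob by blast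
  qed
qed

lemma is_functor_id: "is_category C \<Longrightarrow> is_functor C C id_functor"
  by (auto simp: is_functor_def id_functor_def is_category_def hom_def)

lemma is_functor_comp: "is_functor C D F \<Longrightarrow> is_functor D E G \<Longrightarrow> is_functor C E (comp_functor G F)"
  unfolding is_functor_def comp_functor_def by (auto simp: hom_def)

lemma equivalent_categories_sym: "equivalent_categories C D \<Longrightarrow> equivalent_categories D C"
  unfolding equivalent_categories_def
  by (meson is_functor_comp is_functor_id naturally_isomorphic_sym)

lemma equivalent_categories_refl: "is_category C \<Longrightarrow> equivalent_categories C C"
proof (rule equivalent_categoriesI[OF _ _ is_functor_id])
  assume C: "is_category C"
  show "essentially_surjective C C id_functor"
    unfolding essentially_surjective_def id_functor_def
  proof (intro ballI)
    fix d assume d: "d \<in> Ob C"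
    have "is_iso C (Ident C d)"
      using is_iso_inverse(1)[OF hom_id[OF C d] hom_id[OF C d]] comp_id1[OF C hom_id[OF C d]] by simp
    then show "\<exists>c\<in>Ob C. \<exists>i\<in>hom C (fob \<lparr>fob = id, far = id\<rparr> c) d. is_iso C i"
      using d hom_id[OF C d] by auto
  qed
qed (auto simp: full_def faithful_def id_functor_def)

text \<open>Both functors are faithful because the natural isomorphisms can be cancelled. Fullness
  of \<open>F\<close> comes from the faithfulness of \<open>G\<close>: a candidate preimage need
  only have the right image under \<open>G\<close> after \<open>F\<close>.\<close>

lemma equivalent_categoriesD:
  assumes "equivalent_categories C D"
  shows "\<exists>F. is_functor C D F \<and> full C D F \<and> faithful C F \<and> essentially_surjective C D F"
proof -
  \<comment> \<open>Stated for fresh categories because it is used for both functors, the second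
    time with the other natural isomorphism reversed.\<close>
  have key: "faithful C F" if C: "is_category C" and F: "is_functor C D F" and G: "is_functor D C G"
    and ni: "naturally_isomorphic C C id_functor (comp_functor G F)"
    for C :: "('x1, 'y1) category" and D :: "('x2, 'y2) category" and F G
    unfolding faithful_def
  proof (intro allI ballI impI)
    fix a b f f' assume f: "f \<in> hom C a b" "f' \<in> hom C a b" "far F f = far F f'"
    from ni obtain \<eta> where \<eta>: "\<And>a. a \<in> Ob C \<Longrightarrow> \<eta> a \<in> hom C a (fob G (fob F a)) \<and> is_iso C (\<eta> a)"
      and nat: "\<And>f. f \<in> Ar C \<Longrightarrow> Cmp C (\<eta> (Cod C f)) f = Cmp C (far G (far F f)) (\<eta> (Dom C f))"
      by (auto simp: naturally_isomorphic_def id_functor_def comp_functor_def)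
    have "Cmp C (\<eta> b) f = Cmp C (\<eta> b) f'"
      using nat[of f] nat[of f'] f by (simp add: hom_def)
    then show "f = f'"
      using iso_cancel_left[OF C _ _ f(1,2)] \<eta> hom_ob[OF C f(1)] by blast
  qed
  from assms obtain F G where C: "is_category C" and D: "is_category D" and F: "is_functor C D F"
    and G: "is_functor D C G" and GF: "naturally_isomorphic C C id_functor (comp_functor G F)"
    and FG: "naturally_isomorphic D D (comp_functor F G) id_functor"
    by (auto simp: equivalent_categories_def)
  have faF: "faithful C F" by (rule key[OF C F G GF])
  have faG: "faithful D G"
    by (rule key[OF D G F naturally_isomorphic_sym[OF D D is_functor_comp[OF G F] is_functor_id[OF D] FG]])
  have "full C D F"
    unfolding full_def
  proof (intro ballI)
    fix a b g assume a: "a \<in> Ob C" and b: "b \<in> Ob C" and g: "g \<in> hom D (fob F a) (fob F b)"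
    from GF obtain \<eta> where \<eta>: "\<And>a. a \<in> Ob C \<Longrightarrow> \<eta> a \<in> hom C a (fob G (fob F a)) \<and> is_iso C (\<eta> a)"
      and nat: "\<And>f. f \<in> Ar C \<Longrightarrow> Cmp C (\<eta> (Cod C f)) f = Cmp C (far G (far F f)) (\<eta> (Dom C f))"
      by (auto simp: naturally_isomorphic_def id_functor_def comp_functor_def)
    note \<eta>a = conjunct1[OF \<eta>[OF a]] and \<eta>b = conjunct1[OF \<eta>[OF b]] and Gg = functor_hom[OF G g]
    obtain k where k: "k \<in> hom C (fob G (fob F b)) b" "Cmp C k (\<eta> b) = Ident C b"
        "Cmp C (\<eta> b) k = Ident C (fob G (fob F b))"
      using \<eta>[OF b] iso_iff[OF \<eta>b] by blast
    have Gga: "Cmp C (far G g) (\<eta> a) \<in> hom C a (fob G (fob F b))" by (rule hom_comp[OF C \<eta>a Gg])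
    \<comment> \<open>The image of \<open>g\<close> under \<open>G\<close>, conjugated by the unit;
      naturality of the unit makes its image under \<open>G\<close> after \<open>F\<close> equal to
      that of \<open>g\<close> under \<open>G\<close>.\<close>
    let ?f = "Cmp C k (Cmp C (far G g) (\<eta> a))"
    have f: "?f \<in> hom C a b" by (rule hom_comp[OF C Gga k(1)])
    note GFf = functor_hom[OF G functor_hom[OF F f]]
    have "Cmp C (\<eta> b) ?f = Cmp C (far G g) (\<eta> a)"
      using comp_assoc[OF C Gga k(1) \<eta>b] k(3) comp_id2[OF C Gga] by simp
    then have "Cmp C (far G (far F ?f)) (\<eta> a) = Cmp C (far G g) (\<eta> a)"
      using nat[of ?f] hom_Ar[OF f] by simp
    then have "far G (far F ?f) = far G g"
      using iso_cancel_right[OF C _ \<eta>a GFf Gg] \<eta>[OF a] by blast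
    then have "far F ?f = g"
      using faG functor_hom[OF F f] g unfolding faithful_def by blast
    then show "\<exists>f\<in>hom C a b. far F f = g" using f by blast
  qed
  moreover have "essentially_surjective C D F"
    unfolding essentially_surjective_def
  proof (intro ballI)
    fix d assume d: "d \<in> Ob D"
    from FG obtain \<epsilon> where "\<epsilon> d \<in> hom D (fob F (fob G d)) d \<and> is_iso D (\<epsilon> d)"
      using d by (auto simp: naturally_isomorphic_def id_functor_def comp_functor_def)
    then show "\<exists>c\<in>Ob C. \<exists>i\<in>hom D (fob F c) d. is_iso D i" using functor_ob[OF G d] by blast
  qed
  ultimately show ?thesis using F faF by blast
qed

lemma functor_iso:
  assumes "is_category C" "is_functor C D F" "i \<in> hom C a b" "is_iso C i"
  shows "is_iso D (far F i)"
proof -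
  obtain k where k: "k \<in> hom C b a" "Cmp C k i = Ident C a" "Cmp C i k = Ident C b"
    using assms(3,4) iso_iff by metis
  note ob = hom_ob[OF assms(1,3)]
  show ?thesis
    using is_iso_inverse(1)[OF functor_hom[OF assms(2,3)] functor_hom[OF assms(2) k(1)]]
      functor_comp[OF assms(2,3) k(1)] functor_comp[OF assms(2) k(1) assms(3)] k(2,3)
      functor_id[OF assms(2)] ob by simp
qed

lemma iso_comp:
  assumes C: "is_category C" and f: "f \<in> hom C a b" "is_iso C f" and g: "g \<in> hom C b c" "is_iso C g"
  shows "is_iso C (Cmp C g f)"
proof -
  obtain f' where f': "f' \<in> hom C b a" "Cmp C f' f = Ident C a" "Cmp C f f' = Ident C b"
    using f iso_iff by metis
  obtain g' where g': "g' \<in> hom C c b" "Cmp C g' g = Ident C b" "Cmp C g g' = Ident C c"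
    using g iso_iff by metis
  have "Cmp C (Cmp C f' g') (Cmp C g f) = Cmp C f' (Cmp C g' (Cmp C g f))"
    using comp_assoc[OF C hom_comp[OF C f(1) g(1)] g'(1) f'(1)] by simp
  also have "Cmp C g' (Cmp C g f) = f"
    using comp_assoc[OF C f(1) g(1) g'(1)] g'(2) comp_id2[OF C f(1)] by simp
  finally have 1: "Cmp C (Cmp C f' g') (Cmp C g f) = Ident C a" using f'(2) by simp
  have "Cmp C (Cmp C g f) (Cmp C f' g') = Cmp C g (Cmp C f (Cmp C f' g'))"
    using comp_assoc[OF C hom_comp[OF C g'(1) f'(1)] f(1) g(1)] by simp
  also have "Cmp C f (Cmp C f' g') = g'"
    using comp_assoc[OF C g'(1) f'(1) f(1)] f'(3) comp_id2[OF C g'(1)] by simp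
  finally have 2: "Cmp C (Cmp C g f) (Cmp C f' g') = Ident C c" using g'(3) by simp
  show ?thesis
    by (rule is_iso_inverse(1)[OF hom_comp[OF C f(1) g(1)] hom_comp[OF C g'(1) f'(1)] 1 2])
qed

text \<open>The three properties of the functor compose directly, which avoids pasting natural
  isomorphisms.\<close>

lemma equivalent_categories_trans:
  assumes "equivalent_categories C D" "equivalent_categories D E"
  shows "equivalent_categories C E"
proof -
  have cats: "is_category C" "is_category D" "is_category E"
    using assms by (auto simp: equivalent_categories_def)
  from equivalent_categoriesD[OF assms(1)] obtain F where F: "is_functor C D F" "full C D F"
    "faithful C F" "essentially_surjective C D F" by blast
  from equivalent_categoriesD[OF assms(2)] obtain G where G: "is_functor D E G" "full D E G"
    "faithful D G" "essentially_surjective D E G" by blast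
  show ?thesis
  proof (rule equivalent_categoriesI[OF cats(1,3) is_functor_comp[OF F(1) G(1)]])
    show "full C E (comp_functor G F)"
      using F(2) G(2) functor_ob[OF F(1)] unfolding full_def comp_functor_def by (simp, metis)
    show "faithful C (comp_functor G F)"
      using F(3) G(3) functor_hom[OF F(1)] unfolding faithful_def comp_functor_def by (simp, metis)
    show "essentially_surjective C E (comp_functor G F)"
      unfolding essentially_surjective_def
    proof (intro ballI)
      fix e assume "e \<in> Ob E"
      then obtain d i where d: "d \<in> Ob D" "i \<in> hom E (fob G d) e" "is_iso E i"
        using G(4) by (auto simp: essentially_surjective_def)
      then obtain c j where c: "c \<in> Ob C" "j \<in> hom D (fob F c) d" "is_iso D j"
        using F(4) by (auto simp: essentially_surjective_def)
      have "is_iso E (Cmp E i (far G j))"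
        by (rule iso_comp[OF cats(3) functor_hom[OF G(1) c(2)] functor_iso[OF cats(2) G(1) c(2,3)] d(2,3)])
      then show "\<exists>c\<in>Ob C. \<exists>i\<in>hom E (fob (comp_functor G F) c) e. is_iso E i"
        using c(1) hom_comp[OF cats(3) functor_hom[OF G(1) c(2)] d(2)] by (auto simp: comp_functor_def)
    qed
  qed
qed

section \<open>Sieves and their pullbacks\<close>

lemma sieve_comp: "is_sieve C a S \<Longrightarrow> f \<in> S \<Longrightarrow> g \<in> hom C b (Dom C f) \<Longrightarrow> Cmp C f g \<in> S"
  by (auto simp: is_sieve_def hom_def)

definition pull :: "('o, 'm) category \<Rightarrow> 'm \<Rightarrow> 'm set \<Rightarrow> 'm set" where
  "pull C f R = {h \<in> Ar C. Cod C h = Dom C f \<and> Cmp C f h \<in> R}"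

lemma pull_sieve:
  assumes C: "is_category C" and R: "is_sieve C d R" and f: "f \<in> hom C e d"
  shows "is_sieve C e (pull C f R)"
  unfolding is_sieve_def
proof (intro conjI ballI impI)
  show "pull C f R \<subseteq> {h \<in> Ar C. Cod C h = e}" using f by (auto simp: pull_def hom_def)
  fix h k assume h: "h \<in> pull C f R" and k: "k \<in> Ar C" "Cod C k = Dom C h"
  have hh: "h \<in> hom C (Dom C h) e" using h f by (auto simp: pull_def hom_def)
  have kh: "k \<in> hom C (Dom C k) (Dom C h)" using k by (simp add: hom_def)
  have "Dom C (Cmp C f h) = Dom C h" using hom_comp[OF C hh f] by (simp add: hom_def)
  then have "Cmp C (Cmp C f h) k \<in> R" using R h kh by (auto simp: pull_def intro: sieve_comp)
  then show "Cmp C h k \<in> pull C f R"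
    using hom_comp[OF C kh hh] comp_assoc[OF C kh hh f] f by (auto simp: pull_def hom_def)
qed

section \<open>Semantics of the syntactic category\<close>

lemma tup_Nil [simp]: "a \<in> tup M [] \<longleftrightarrow> a = []"
  by (auto simp: tup_def)

lemma tup_Cons: "a \<in> tup M (S # \<Gamma>) \<longleftrightarrow> (\<exists>x\<in>car M S. \<exists>b\<in>tup M \<Gamma>. a = x # b)"
  by (auto simp: tup_def list_all2_Cons2)

lemma tup_append: "a \<in> tup M (\<Gamma> @ \<Delta>) \<longleftrightarrow> (\<exists>b\<in>tup M \<Gamma>. \<exists>c\<in>tup M \<Delta>. a = b @ c)"
  unfolding tup_def by (simp add: list_all2_append2) (metis list_all2_lengthD)

lemma tup_appendI: "b \<in> tup M \<Gamma> \<Longrightarrow> c \<in> tup M \<Delta> \<Longrightarrow> b @ c \<in> tup M (\<Gamma> @ \<Delta>)"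
  by (auto simp: tup_append)

lemma tup_appendE:
  assumes "a \<in> tup M (\<Gamma> @ \<Delta>)"
  obtains b c where "a = b @ c" "b \<in> tup M \<Gamma>" "c \<in> tup M \<Delta>" "length b = length \<Gamma>" "length c = length \<Delta>"
  using assms by (auto simp: tup_append tup_length)

lemma map_nth_upt: "l \<le> length a \<Longrightarrow> map ((!) a) [k..<l] = take (l - k) (drop k a)"
  by (rule nth_equalityI) auto

lemma map_eval_vars [simp]:
  "k + n \<le> length a \<Longrightarrow> map (eval M ((!) a)) (vars k n) = take n (drop k a)"
  by (rule nth_equalityI) auto

lemma sat_inst:
  assumes "wf_fm \<Sigma> \<Gamma> \<phi>" "length ts = length \<Gamma>"
  shows "sat M e (inst \<phi> ts) \<longleftrightarrow> sat M ((!) (map (eval M e) ts)) \<phi>"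
  unfolding inst_def sat_fsubst by (rule sat_cong[OF assms(1)]) (use assms(2) in auto)

lemma Bex_tup_Cons: "(\<exists>b\<in>tup M (S # \<Gamma>). P b) \<longleftrightarrow> (\<exists>b\<in>tup M \<Gamma>. \<exists>x\<in>car M S. P (x # b))"
  unfolding Bex_def tup_Cons by blast

lemma Ball_tup_append: "(\<forall>a\<in>tup M (\<Gamma> @ \<Delta>). P a) \<longleftrightarrow> (\<forall>b\<in>tup M \<Gamma>. \<forall>c\<in>tup M \<Delta>. P (b @ c))"
  unfolding Ball_def tup_append by blast

lemma sat_exs: "sat M ((!) a) (exs \<Delta> \<phi>) \<longleftrightarrow> (\<exists>b\<in>tup M \<Delta>. sat M ((!) (b @ a)) \<phi>)"
  unfolding exs_def
proof (induction \<Delta> arbitrary: \<phi>)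
  case (Cons S \<Delta>)
  have "(\<exists>b\<in>tup M \<Delta>. sat M ((!) (b @ a)) (Ex S \<phi>)) \<longleftrightarrow> (\<exists>b\<in>tup M (S # \<Delta>). sat M ((!) (b @ a)) \<phi>)"
    by (simp add: Bex_tup_Cons nth_Cons_fun)
  then show ?case using Cons by simp
qed simp

lemma sat_conj: "sat M e (conj \<phi>s) \<longleftrightarrow> (\<forall>\<phi>\<in>set \<phi>s. sat M e \<phi>)"
  by (induction \<phi>s) (auto simp: conj_def)

lemma sat_disj: "sat M e (disj \<phi>s) \<longleftrightarrow> (\<exists>\<phi>\<in>set \<phi>s. sat M e \<phi>)"
  by (induction \<phi>s) (auto simp: disj_def)

lemma sat_eqs:
  "length ts = length us \<Longrightarrow> sat M e (eqs ts us) \<longleftrightarrow> map (eval M e) ts = map (eval M e) us"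
  by (induction rule: list_induct2) (auto simp: eqs_def conj_def)

lemma wf_inst_fm: "wf_fm \<Sigma> \<Gamma> \<phi> \<Longrightarrow> list_all2 (wt \<Sigma> \<Delta>) ts \<Gamma> \<Longrightarrow> wf_fm \<Sigma> \<Delta> (inst \<phi> ts)"
  unfolding inst_def by (rule wf_fsubst) (auto simp: list_all2_conv_all_nth)

lemma wf_exs: "wf_fm \<Sigma> \<Gamma> (exs \<Delta> \<phi>) \<longleftrightarrow> set \<Delta> \<subseteq> sorts \<Sigma> \<and> wf_fm \<Sigma> (\<Delta> @ \<Gamma>) \<phi>"
  unfolding exs_def by (induction \<Delta> arbitrary: \<phi>) auto

lemma wf_eqs:
  "length ts = length us \<Longrightarrow>
   wf_fm \<Sigma> \<Gamma> (eqs ts us) \<longleftrightarrow> (\<forall>i<length ts. \<exists>S. wt \<Sigma> \<Gamma> (ts ! i) S \<and> wt \<Sigma> \<Gamma> (us ! i) S)"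
  by (auto simp: eqs_def wf_conj set_zip)

lemma wt_vars:
  "k + n \<le> length \<Delta> \<Longrightarrow> \<Gamma> = take n (drop k \<Delta>) \<Longrightarrow> list_all2 (wt \<Sigma> \<Delta>) (vars k n) \<Gamma>"
  by (auto simp: list_all2_conv_all_nth wt_Var_iff)

section \<open>Models, graphs of arrows and uniform definability\<close>

definition models :: "('s, 'f, 'r) coh_theory \<Rightarrow> ('s, 'f, 'r, ('s, 'f, 'r) const) struct set" where
  "models T = {M. model T M}"

definition ext :: "('s, 'f, 'r, 'm) struct \<Rightarrow> ('s, 'f, 'r) syn_ob \<Rightarrow> 'm list set" where
  "ext M A = {a \<in> tup M (fst A). sat M ((!) a) (snd A)}"

definition graph_fm ::
  "('s, 'f, 'r, 'm) struct \<Rightarrow> ('s, 'f, 'r) syn_ob \<Rightarrow> ('s, 'f, 'r) fm \<Rightarrow> ('s, 'f, 'r) syn_ob \<Rightarrow>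
   ('m list \<times> 'm list) set" where
  "graph_fm M A \<theta> B = {(a, b). a \<in> tup M (fst A) \<and> b \<in> tup M (fst B) \<and> sat M ((!) (a @ b)) \<theta>}"

text \<open>The second component of an arrow is a class of equivalent formulas, all with the same
  graph in a model; the union over the class picks out that graph without choosing a
  representative.\<close>

definition graph :: "('s, 'f, 'r, 'm) struct \<Rightarrow> ('s, 'f, 'r) syn_ar \<Rightarrow> ('m list \<times> 'm list) set" where
  "graph M f = (case f of (A, p, B) \<Rightarrow> \<Union>\<theta>\<in>p. graph_fm M A \<theta> B)"

definition functional_graph :: "'a set \<Rightarrow> 'b set \<Rightarrow> ('a \<times> 'b) set \<Rightarrow> bool" where
  "functional_graph X Y R \<longleftrightarrow> R \<subseteq> X \<times> Y \<and> (\<forall>x\<in>X. \<exists>y. (x, y) \<in> R) \<and>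
     (\<forall>x y y'. (x, y) \<in> R \<longrightarrow> (x, y') \<in> R \<longrightarrow> y = y')"

text \<open>One formula has to work in all structures of the class at once. Building formulas
  through the closure properties below keeps index arithmetic out of the later
  constructions.\<close>

definition definable ::
  "('s, 'f, 'r) signature \<Rightarrow> ('s, 'f, 'r, 'm) struct set \<Rightarrow> 's list \<Rightarrow>
   (('s, 'f, 'r, 'm) struct \<Rightarrow> 'm list \<Rightarrow> bool) \<Rightarrow> bool" where
  "definable \<Sigma> \<M> \<Gamma> X \<longleftrightarrow>
     (\<exists>\<chi>. fm_in_ctx \<Sigma> \<Gamma> \<chi> \<and> (\<forall>M\<in>\<M>. \<forall>a\<in>tup M \<Gamma>. X M a \<longleftrightarrow> sat M ((!) a) \<chi>))"

lemma definableE: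
  assumes "definable \<Sigma> \<M> \<Gamma> X"
  obtains \<chi> where "fm_in_ctx \<Sigma> \<Gamma> \<chi>" "\<forall>M\<in>\<M>. \<forall>a\<in>tup M \<Gamma>. X M a \<longleftrightarrow> sat M ((!) a) \<chi>"
  using assms by (auto simp: definable_def)

lemma definable_fm: "fm_in_ctx \<Sigma> \<Gamma> \<phi> \<Longrightarrow> definable \<Sigma> \<M> \<Gamma> (\<lambda>M a. sat M ((!) a) \<phi>)"
  by (auto simp: definable_def)

lemma definable_cong:
  "definable \<Sigma> \<M> \<Gamma> X \<Longrightarrow> (\<And>M a. M \<in> \<M> \<Longrightarrow> a \<in> tup M \<Gamma> \<Longrightarrow> X M a \<longleftrightarrow> Y M a) \<Longrightarrow> definable \<Sigma> \<M> \<Gamma> Y"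
  by (auto simp: definable_def)

lemma definable_const: "set \<Gamma> \<subseteq> sorts \<Sigma> \<Longrightarrow> definable \<Sigma> \<M> \<Gamma> (\<lambda>M a. P)"
  unfolding definable_def by (rule exI[of _ "if P then Top else Bot"]) (auto simp: fm_in_ctx_def)

lemma definable_conj:
  assumes "definable \<Sigma> \<M> \<Gamma> X" "definable \<Sigma> \<M> \<Gamma> Y"
  shows "definable \<Sigma> \<M> \<Gamma> (\<lambda>M a. X M a \<and> Y M a)"
proof -
  obtain \<chi> where \<chi>: "fm_in_ctx \<Sigma> \<Gamma> \<chi>"
    "\<forall>M\<in>\<M>. \<forall>a\<in>tup M \<Gamma>. X M a \<longleftrightarrow> sat M ((!) a) \<chi>" using assms(1) by (rule definableE)
  obtain \<xi> where \<xi>: "fm_in_ctx \<Sigma> \<Gamma> \<xi>"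
    "\<forall>M\<in>\<M>. \<forall>a\<in>tup M \<Gamma>. Y M a \<longleftrightarrow> sat M ((!) a) \<xi>" using assms(2) by (rule definableE)
  from \<chi> \<xi> show ?thesis
    unfolding definable_def by (intro exI[of _ "And \<chi> \<xi>"]) (auto simp: fm_in_ctx_def)
qed

lemma definable_disj:
  assumes "definable \<Sigma> \<M> \<Gamma> X" "definable \<Sigma> \<M> \<Gamma> Y"
  shows "definable \<Sigma> \<M> \<Gamma> (\<lambda>M a. X M a \<or> Y M a)"
proof -
  obtain \<chi> where \<chi>: "fm_in_ctx \<Sigma> \<Gamma> \<chi>"
    "\<forall>M\<in>\<M>. \<forall>a\<in>tup M \<Gamma>. X M a \<longleftrightarrow> sat M ((!) a) \<chi>" using assms(1) by (rule definableE)
  obtain \<xi> where \<xi>: "fm_in_ctx \<Sigma> \<Gamma> \<xi>"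
    "\<forall>M\<in>\<M>. \<forall>a\<in>tup M \<Gamma>. Y M a \<longleftrightarrow> sat M ((!) a) \<xi>" using assms(2) by (rule definableE)
  from \<chi> \<xi> show ?thesis
    unfolding definable_def by (intro exI[of _ "Or \<chi> \<xi>"]) (auto simp: fm_in_ctx_def)
qed

lemma definable_Bex:
  assumes "set \<Gamma> \<subseteq> sorts \<Sigma>" "\<And>k. k \<in> set ks \<Longrightarrow> definable \<Sigma> \<M> \<Gamma> (X k)"
  shows "definable \<Sigma> \<M> \<Gamma> (\<lambda>M a. \<exists>k\<in>set ks. X k M a)"
  using assms(2)
proof (induction ks)
  case Nil
  show ?case using definable_const[OF assms(1), of _ False] by simp
next
  case (Cons k ks)
  then show ?case using definable_disj[of \<Sigma> \<M> \<Gamma> "X k"] by simp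
qed

text \<open>Inverse image under a renaming of variables: \<open>\<rho>\<close> lists, for every
  variable of the small context, its position in the large one. Permutation, duplication and
  weakening are all instances.\<close>

lemma definable_sub:
  assumes "definable \<Sigma> \<M> \<Gamma> X" "set \<Delta> \<subseteq> sorts \<Sigma>" "length \<rho> = length \<Gamma>"
    "\<And>i. i < length \<Gamma> \<Longrightarrow> \<rho> ! i < length \<Delta> \<and> \<Delta> ! (\<rho> ! i) = \<Gamma> ! i"
  shows "definable \<Sigma> \<M> \<Delta> (\<lambda>M a. X M (map ((!) a) \<rho>))"
proof -
  from assms(1) obtain \<chi> where \<chi>: "fm_in_ctx \<Sigma> \<Gamma> \<chi>"
    "\<forall>M\<in>\<M>. \<forall>a\<in>tup M \<Gamma>. X M a \<longleftrightarrow> sat M ((!) a) \<chi>" by (rule definableE)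
  have "X M (map ((!) a) \<rho>) \<longleftrightarrow> sat M ((!) a) (inst \<chi> (map Var \<rho>))" if "M \<in> \<M>" "a \<in> tup M \<Delta>" for M a
  proof -
    have "map ((!) a) \<rho> \<in> tup M \<Gamma>"
    proof -
      have "a ! (\<rho> ! i) \<in> car M (\<Gamma> ! i)" if "i < length \<Gamma>" for i
        using tup_nth[OF \<open>a \<in> tup M \<Delta>\<close>, of "\<rho> ! i"] assms(4)[OF that] by simp
      then show ?thesis using assms(3) by (simp add: tup_def list_all2_conv_all_nth)
    qed
    then show ?thesis
      using \<chi> that assms(3) by (subst sat_inst[of \<Sigma> \<Gamma>]) (auto simp: fm_in_ctx_def comp_def)
  qed
  moreover have "fm_in_ctx \<Sigma> \<Delta> (inst \<chi> (map Var \<rho>))"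
    using \<chi>(1) assms(2-4) unfolding fm_in_ctx_def
    by (auto intro!: wf_inst_fm[of \<Sigma> \<Gamma>] simp: list_all2_conv_all_nth wt_Var_iff)
  ultimately show ?thesis by (auto simp: definable_def)
qed

lemma definable_ex:
  assumes "definable \<Sigma> \<M> (\<Delta> @ \<Gamma>) X"
  shows "definable \<Sigma> \<M> \<Gamma> (\<lambda>M a. \<exists>b\<in>tup M \<Delta>. X M (b @ a))"
proof -
  from assms obtain \<chi> where \<chi>: "fm_in_ctx \<Sigma> (\<Delta> @ \<Gamma>) \<chi>"
    "\<forall>M\<in>\<M>. \<forall>a\<in>tup M (\<Delta> @ \<Gamma>). X M a \<longleftrightarrow> sat M ((!) a) \<chi>" by (rule definableE)
  then show ?thesis
    unfolding definable_def
    by (intro exI[of _ "exs \<Delta> \<chi>"]) (auto simp: fm_in_ctx_def wf_exs sat_exs tup_appendI)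
qed

lemma definable_eq:
  assumes "set \<Gamma> \<subseteq> sorts \<Sigma>" "length \<rho> = length \<rho>'"
    "\<And>i. i < length \<rho> \<Longrightarrow> \<rho> ! i < length \<Gamma> \<and> \<rho>' ! i < length \<Gamma> \<and> \<Gamma> ! (\<rho> ! i) = \<Gamma> ! (\<rho>' ! i)"
  shows "definable \<Sigma> \<M> \<Gamma> (\<lambda>M a. map ((!) a) \<rho> = map ((!) a) \<rho>')"
  unfolding definable_def
  by (rule exI[of _ "eqs (map Var \<rho>) (map Var \<rho>')"])
    (use assms in \<open>auto simp: fm_in_ctx_def wf_eqs wt_Var_iff sat_eqs comp_def\<close>)

lemma definable_block:
  assumes "definable \<Sigma> \<M> \<Gamma> X" "set \<Delta> \<subseteq> sorts \<Sigma>" "k + length \<Gamma> \<le> length \<Delta>"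
    "take (length \<Gamma>) (drop k \<Delta>) = \<Gamma>"
  shows "definable \<Sigma> \<M> \<Delta> (\<lambda>M a. X M (take (length \<Gamma>) (drop k a)))"
proof (rule definable_cong[OF definable_sub[OF assms(1,2), of "[k..<k + length \<Gamma>]"]])
  show "[k..<k + length \<Gamma>] ! i < length \<Delta> \<and> \<Delta> ! ([k..<k + length \<Gamma>] ! i) = \<Gamma> ! i"
    if "i < length \<Gamma>" for i
    using assms(3) arg_cong[OF assms(4), of "\<lambda>xs. xs ! i"] that by simp
qed (use assms(3) in \<open>auto simp: map_nth_upt tup_length\<close>)

section \<open>The syntactic category seen through graphs in models\<close>

lemma Ob_syn_cat: "A \<in> Ob (syn_cat T) \<longleftrightarrow> fm_in_ctx (sig T) (fst A) (snd A)"
  by (auto simp: syn_cat_def)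

lemma hom_syn_cat:
  "f \<in> hom (syn_cat T) A B \<longleftrightarrow>
   A \<in> Ob (syn_cat T) \<and> B \<in> Ob (syn_cat T) \<and> (\<exists>\<theta>. functional_fm T A \<theta> B \<and> f = syn_arrow T A \<theta> B)"
  by (cases A; cases B) (auto simp: hom_def syn_cat_def syn_arrow_def)

lemma Ident_syn_cat: "Ident (syn_cat T) A = syn_arrow T A
   (And (inst (snd A) (vars 0 (length (fst A))))
     (eqs (vars 0 (length (fst A))) (vars (length (fst A)) (length (fst A))))) A"
  by (cases A) (simp add: syn_cat_def Let_def)

lemma Cmp_syn_cat: "Cmp (syn_cat T) g f =
   (fst f, \<Union>\<theta>\<in>fst (snd f). \<Union>\<chi>\<in>fst (snd g).
      fst (snd (syn_arrow T (fst f) (comp_fm (fst (fst f)) (fst (fst g)) (fst (snd (snd g))) \<theta> \<chi>) (snd (snd g)))),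
    snd (snd g))"
  by (cases f; cases g) (simp add: syn_cat_def)

context coherent
begin

abbreviation "C \<equiv> syn_cat T"

text \<open>Soundness together with completeness. Fixing the element type in \<open>models\<close>
  makes this an equivalence with a quantifier over a set; it is the bridge by which sequents are
  henceforth read semantically.\<close>

lemma prov_iff: "prov T \<Gamma> \<phi> \<psi> \<longleftrightarrow> fm_in_ctx \<Sigma> \<Gamma> \<phi> \<and> fm_in_ctx \<Sigma> \<Gamma> \<psi> \<and>
   (\<forall>M\<in>models T. \<forall>a\<in>tup M \<Gamma>. sat M ((!) a) \<phi> \<longrightarrow> sat M ((!) a) \<psi>)"
  using completeness[of \<Gamma> \<phi> \<psi>] prov_fm_in_ctx[OF coherent, of \<Gamma> \<phi> \<psi>] soundness[OF coherent]
  by (auto simp: models_def)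

text \<open>The three sequents of \<open>functional_fm\<close> say in each model that the graph lies
  between the two extensions, is total, and is single-valued.\<close>

lemma functional_fm_iff:
  assumes "A \<in> Ob C" "B \<in> Ob C"
  shows "functional_fm T A \<theta> B \<longleftrightarrow> fm_in_ctx \<Sigma> (fst A @ fst B) \<theta> \<and>
    (\<forall>M\<in>models T. functional_graph (ext M A) (ext M B) (graph_fm M A \<theta> B))"
proof -
  obtain \<Gamma> \<phi> \<Delta> \<psi> where AB: "A = (\<Gamma>, \<phi>)" "B = (\<Delta>, \<psi>)" by (metis surj_pair)
  let ?n = "length \<Gamma>" and ?m = "length \<Delta>"
  have wf: "set \<Gamma> \<subseteq> sorts \<Sigma>" "set \<Delta> \<subseteq> sorts \<Sigma>" "wf_fm \<Sigma> \<Gamma> \<phi>" "wf_fm \<Sigma> \<Delta> \<psi>"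
    using assms AB by (auto simp: Ob_syn_cat fm_in_ctx_def)
  show ?thesis
  proof (cases "wf_fm \<Sigma> (\<Gamma> @ \<Delta>) \<theta>")
    case True
    have 1: "prov T (\<Gamma> @ \<Delta>) \<theta> (And (inst \<phi> (vars 0 ?n)) (inst \<psi> (vars ?n ?m))) \<longleftrightarrow>
      (\<forall>M\<in>models T. \<forall>a b. (a, b) \<in> graph_fm M A \<theta> B \<longrightarrow> a \<in> ext M A \<and> b \<in> ext M B)"
      unfolding prov_iff
      by (auto simp: fm_in_ctx_def wf True AB graph_fm_def ext_def Ball_tup_append tup_length
          sat_inst[OF wf(3)] sat_inst[OF wf(4)] intro!: wf_inst_fm[OF wf(3)] wf_inst_fm[OF wf(4)] wt_vars)
    have 2: "prov T \<Gamma> \<phi> (exs \<Delta> (inst \<theta> (vars ?m ?n @ vars 0 ?m))) \<longleftrightarrow>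
      (\<forall>M\<in>models T. \<forall>a\<in>ext M A. \<exists>b. (a, b) \<in> graph_fm M A \<theta> B)"
      unfolding prov_iff
      by (auto simp: fm_in_ctx_def wf True AB graph_fm_def ext_def tup_length wf_exs sat_exs
          sat_inst[OF True] intro!: wf_inst_fm[OF True] list_all2_appendI wt_vars)
    have 3: "prov T (\<Gamma> @ \<Delta> @ \<Delta>)
         (And (inst \<theta> (vars 0 ?n @ vars ?n ?m)) (inst \<theta> (vars 0 ?n @ vars (?n + ?m) ?m)))
         (eqs (vars ?n ?m) (vars (?n + ?m) ?m)) \<longleftrightarrow>
      (\<forall>M\<in>models T. \<forall>a b b'. (a, b) \<in> graph_fm M A \<theta> B \<longrightarrow> (a, b') \<in> graph_fm M A \<theta> B \<longrightarrow> b = b')"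
      unfolding prov_iff
      by (auto simp: fm_in_ctx_def wf True AB graph_fm_def ext_def Ball_tup_append tup_length wf_eqs sat_eqs
          wt_Var_iff nth_append sat_inst[OF True] intro!: wf_inst_fm[OF True] list_all2_appendI wt_vars;
        blast)
    show ?thesis
      using True 1 2 3 by (auto simp: AB functional_fm_def Let_def functional_graph_def fm_in_ctx_def wf)
  qed (auto simp: AB functional_fm_def fm_in_ctx_def Let_def)
qed

lemma functional_fm_ctx: "functional_fm T A \<theta> B \<Longrightarrow> fm_in_ctx \<Sigma> (fst A @ fst B) \<theta>"
  by (auto simp: functional_fm_def Let_def split: prod.splits)

lemma graph_syn_arrow:
  assumes "fm_in_ctx \<Sigma> (fst A @ fst B) \<theta>" "M \<in> models T"
  shows "graph M (syn_arrow T A \<theta> B) = graph_fm M A \<theta> B"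
proof -
  have eq: "graph_fm M A \<theta>' B = graph_fm M A \<theta> B"
    if "prov T (fst A @ fst B) \<theta> \<theta>'" "prov T (fst A @ fst B) \<theta>' \<theta>" for \<theta>'
    using that assms(2) unfolding prov_iff by (auto simp: graph_fm_def tup_appendI)
  show ?thesis
    unfolding graph_def syn_arrow_def prod.case
  proof (rule UN_constant_eq)
    show "\<theta> \<in> {\<theta>'. prov T (fst A @ fst B) \<theta> \<theta>' \<and> prov T (fst A @ fst B) \<theta>' \<theta>}"
      using prov.ident[OF assms(1)] by simp
  qed (use eq in blast)
qed

lemma syn_arrow_eqI:
  assumes "fm_in_ctx \<Sigma> (fst A @ fst B) \<theta>" "fm_in_ctx \<Sigma> (fst A @ fst B) \<theta>'"
    "\<And>M. M \<in> models T \<Longrightarrow> graph_fm M A \<theta> B = graph_fm M A \<theta>' B"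
  shows "syn_arrow T A \<theta> B = syn_arrow T A \<theta>' B"
proof -
  have "sat M ((!) a) \<theta> \<longleftrightarrow> sat M ((!) a) \<theta>'" if M: "M \<in> models T" and a: "a \<in> tup M (fst A @ fst B)" for M a
    using assms(3)[OF M] a by (auto simp: graph_fm_def tup_append set_eq_iff)
  then have "prov T (fst A @ fst B) \<theta> \<theta>'" "prov T (fst A @ fst B) \<theta>' \<theta>"
    using assms by (auto simp: prov_iff)
  then show ?thesis by (auto simp: syn_arrow_def intro: prov.cut)
qed

lemma homE:
  assumes "f \<in> hom C A B"
  obtains \<theta> where "functional_fm T A \<theta> B" "f = syn_arrow T A \<theta> B" "A \<in> Ob C" "B \<in> Ob C"
    "\<forall>M\<in>models T. graph M f = graph_fm M A \<theta> B"
  using assms graph_syn_arrow functional_fm_ctx by (fastforce simp: hom_syn_cat)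

text \<open>Formulas with the same graph in all models are provably equivalent, so they have the
  same class.\<close>

lemma arrow_eqI:
  assumes "f \<in> hom C A B" "g \<in> hom C A B" "\<And>M. M \<in> models T \<Longrightarrow> graph M f = graph M g"
  shows "f = g"
  using assms by (auto elim!: homE intro!: syn_arrow_eqI functional_fm_ctx)

lemma graph_functional:
  assumes "f \<in> hom C A B" "M \<in> models T"
  shows "functional_graph (ext M A) (ext M B) (graph M f)"
  using assms by (auto elim!: homE simp: functional_fm_iff)

text \<open>The way to construct arrows: a family of functions, one in each model, comes from an
  arrow once it is uniformly definable. \<open>X\<close> is the same relation as \<open>R\<close>,
  read on concatenated tuples.\<close>

lemma arrow_ex:
  assumes A: "A \<in> Ob C" and B: "B \<in> Ob C" and X: "definable \<Sigma> (models T) (fst A @ fst B) X"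
    and R: "\<And>M. M \<in> models T \<Longrightarrow> functional_graph (ext M A) (ext M B) (R M)"
    and XR: "\<And>M a b. M \<in> models T \<Longrightarrow> a \<in> tup M (fst A) \<Longrightarrow> b \<in> tup M (fst B) \<Longrightarrow>
      X M (a @ b) \<longleftrightarrow> (a, b) \<in> R M"
  shows "\<exists>f\<in>hom C A B. \<forall>M\<in>models T. graph M f = R M"
proof -
  from X obtain \<chi> where \<chi>: "fm_in_ctx \<Sigma> (fst A @ fst B) \<chi>"
    "\<forall>M\<in>models T. \<forall>a\<in>tup M (fst A @ fst B). X M a \<longleftrightarrow> sat M ((!) a) \<chi>" by (rule definableE)
  have eq: "graph_fm M A \<chi> B = R M" if M: "M \<in> models T" for M
  proof -
    have "(a, b) \<in> graph_fm M A \<chi> B \<longleftrightarrow> (a, b) \<in> R M" if "a \<in> tup M (fst A)" "b \<in> tup M (fst B)" for a b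
      using that \<chi>(2) M XR[OF M that] by (simp add: graph_fm_def tup_appendI)
    then show ?thesis
      using R[OF M] by (auto simp: functional_graph_def graph_fm_def ext_def)
  qed
  then have "functional_fm T A \<chi> B"
    using A B R \<chi>(1) by (simp add: functional_fm_iff)
  then show ?thesis
    using A B \<chi>(1) eq by (intro bexI[of _ "syn_arrow T A \<chi> B"]) (auto simp: graph_syn_arrow hom_syn_cat)
qed

lemma graph_definable:
  assumes "f \<in> hom C A B"
  shows "definable \<Sigma> (models T) (fst A @ fst B) (\<lambda>M x. (take (length (fst A)) x, drop (length (fst A)) x) \<in> graph M f)"
proof -
  from assms obtain \<theta> where \<theta>: "functional_fm T A \<theta> B" "\<forall>M\<in>models T. graph M f = graph_fm M A \<theta> B"
    by (rule homE)
  show ?thesis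
    by (rule definable_cong[OF definable_fm[OF functional_fm_ctx[OF \<theta>(1)]]])
      (auto simp: \<theta>(2) graph_fm_def elim: tup_appendE)
qed

lemma functional_graph_comp:
  "functional_graph X Y R \<Longrightarrow> functional_graph Y Z S \<Longrightarrow> functional_graph X Z (R O S)"
  unfolding functional_graph_def by (auto simp: subset_iff) blast+

lemma ext_graph: "f \<in> hom C A B \<Longrightarrow> M \<in> models T \<Longrightarrow> (a, b) \<in> graph M f \<Longrightarrow> a \<in> ext M A \<and> b \<in> ext M B"
  using graph_functional[of f A B M] by (auto simp: functional_graph_def)

lemma Ident_hom:
  assumes A: "A \<in> Ob C"
  shows "Ident C A \<in> hom C A A" and "M \<in> models T \<Longrightarrow> graph M (Ident C A) = Id_on (ext M A)"
proof -
  let ?\<Gamma> = "fst A" let ?n = "length ?\<Gamma>"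
  let ?\<theta> = "And (inst (snd A) (vars 0 ?n)) (eqs (vars 0 ?n) (vars ?n ?n))"
  have wf: "wf_fm \<Sigma> ?\<Gamma> (snd A)" "set ?\<Gamma> \<subseteq> sorts \<Sigma>" using A by (auto simp: Ob_syn_cat fm_in_ctx_def)
  have f: "fm_in_ctx \<Sigma> (?\<Gamma> @ ?\<Gamma>) ?\<theta>"
    using wf by (auto simp: fm_in_ctx_def wf_eqs wt_Var_iff nth_append intro!: wf_inst_fm[OF wf(1)] wt_vars)
  have g: "graph_fm M A ?\<theta> A = Id_on (ext M A)" for M :: "('s, 'f, 'r, ('s, 'f, 'r) const) struct"
    by (auto simp: graph_fm_def ext_def sat_inst[OF wf(1)] sat_eqs tup_length Id_on_iff)
  then have "functional_fm T A ?\<theta> A"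
    using f by (auto simp: functional_fm_iff A functional_graph_def)
  then show "Ident C A \<in> hom C A A"
    using A by (auto simp: hom_syn_cat Ident_syn_cat)
  show "M \<in> models T \<Longrightarrow> graph M (Ident C A) = Id_on (ext M A)"
    using f g by (simp add: Ident_syn_cat graph_syn_arrow)
qed

lemma graph_comp_fm:
  assumes "fm_in_ctx \<Sigma> (\<Gamma> @ \<Delta>) \<theta>" "fm_in_ctx \<Sigma> (\<Delta> @ E) \<chi>"
  shows "fm_in_ctx \<Sigma> (\<Gamma> @ E) (comp_fm \<Gamma> \<Delta> E \<theta> \<chi>)"
    and "graph_fm M (\<Gamma>, \<phi>) (comp_fm \<Gamma> \<Delta> E \<theta> \<chi>) (E, \<xi>) = graph_fm M (\<Gamma>, \<phi>) \<theta> (\<Delta>, \<psi>) O graph_fm M (\<Delta>, \<psi>) \<chi> (E, \<xi>)"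
proof -
  have wf: "wf_fm \<Sigma> (\<Gamma> @ \<Delta>) \<theta>" "wf_fm \<Sigma> (\<Delta> @ E) \<chi>" using assms by (auto simp: fm_in_ctx_def)
  show "fm_in_ctx \<Sigma> (\<Gamma> @ E) (comp_fm \<Gamma> \<Delta> E \<theta> \<chi>)"
    using assms
    by (auto simp: fm_in_ctx_def comp_fm_def Let_def wf_exs
        intro!: wf_inst_fm[OF wf(1)] wf_inst_fm[OF wf(2)] list_all2_appendI wt_vars)
  show "graph_fm M (\<Gamma>, \<phi>) (comp_fm \<Gamma> \<Delta> E \<theta> \<chi>) (E, \<xi>) = graph_fm M (\<Gamma>, \<phi>) \<theta> (\<Delta>, \<psi>) O graph_fm M (\<Delta>, \<psi>) \<chi> (E, \<xi>)"
    by (auto simp: graph_fm_def comp_fm_def Let_def sat_exs sat_inst[OF wf(1)] sat_inst[OF wf(2)] tup_length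
        relcomp_unfold)
qed

text \<open>Representatives of the same class have the same graph, hence so do their composites; the
  union in the definition of composition therefore has only one term.\<close>

lemma Cmp_syn_arrow:
  assumes f: "f \<in> hom C A B" and g: "g \<in> hom C B D"
    and \<theta>: "f = syn_arrow T A \<theta> B" "fm_in_ctx \<Sigma> (fst A @ fst B) \<theta>"
    and \<chi>: "g = syn_arrow T B \<chi> D" "fm_in_ctx \<Sigma> (fst B @ fst D) \<chi>"
  shows "Cmp C g f = syn_arrow T A (comp_fm (fst A) (fst B) (fst D) \<theta> \<chi>) D"
proof -
  obtain \<Gamma> \<phi> \<Delta> \<psi> E \<xi> where o: "A = (\<Gamma>, \<phi>)" "B = (\<Delta>, \<psi>)" "D = (E, \<xi>)" by (metis surj_pair)
  have eq: "syn_arrow T A (comp_fm \<Gamma> \<Delta> E \<theta>' \<chi>') D = syn_arrow T A (comp_fm \<Gamma> \<Delta> E \<theta> \<chi>) D"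
    if \<theta>': "\<theta>' \<in> fst (snd f)" and \<chi>': "\<chi>' \<in> fst (snd g)" for \<theta>' \<chi>'
  proof -
    have p: "prov T (\<Gamma> @ \<Delta>) \<theta> \<theta>'" "prov T (\<Gamma> @ \<Delta>) \<theta>' \<theta>" "prov T (\<Delta> @ E) \<chi> \<chi>'" "prov T (\<Delta> @ E) \<chi>' \<chi>"
      using \<theta>' \<chi>' by (auto simp: \<theta> \<chi> o syn_arrow_def)
    then have c: "fm_in_ctx \<Sigma> (\<Gamma> @ \<Delta>) \<theta>'" "fm_in_ctx \<Sigma> (\<Delta> @ E) \<chi>'"
      by (auto simp: prov_iff)
    have "graph_fm M A \<theta>' B = graph_fm M A \<theta> B" "graph_fm M B \<chi>' D = graph_fm M B \<chi> D" if "M \<in> models T" for M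
      using p that by (auto simp: graph_fm_def prov_iff tup_appendI o)
    then show ?thesis
      using \<theta>(2) \<chi>(2) c unfolding o
      by (intro syn_arrow_eqI) (simp_all add: graph_comp_fm(1) graph_comp_fm(2)[where \<psi> = \<psi>])
  qed
  have "\<theta> \<in> fst (snd f)" "\<chi> \<in> fst (snd g)"
    using \<theta> \<chi> prov.ident by (auto simp: syn_arrow_def)
  then have "(\<Union>\<theta>'\<in>fst (snd f). \<Union>\<chi>'\<in>fst (snd g). fst (snd (syn_arrow T A (comp_fm \<Gamma> \<Delta> E \<theta>' \<chi>') D))) =
      fst (snd (syn_arrow T A (comp_fm \<Gamma> \<Delta> E \<theta> \<chi>) D))"
    by (intro UN_constant_eq[of \<theta>] UN_constant_eq[of \<chi>] ballI
        arg_cong[of _ _ "\<lambda>x. fst (snd x)"] eq)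
  then show ?thesis
    unfolding Cmp_syn_cat by (simp add: \<theta> \<chi> o syn_arrow_def)
qed

lemma Cmp_hom:
  assumes f: "f \<in> hom C A B" and g: "g \<in> hom C B D"
  shows "Cmp C g f \<in> hom C A D" and "M \<in> models T \<Longrightarrow> graph M (Cmp C g f) = graph M f O graph M g"
proof -
  obtain \<Gamma> \<phi> \<Delta> \<psi> E \<xi> where o: "A = (\<Gamma>, \<phi>)" "B = (\<Delta>, \<psi>)" "D = (E, \<xi>)" by (metis surj_pair)
  from f obtain \<theta> where \<theta>: "functional_fm T A \<theta> B" "f = syn_arrow T A \<theta> B" "A \<in> Ob C"
    "\<forall>M\<in>models T. graph M f = graph_fm M A \<theta> B" by (rule homE)
  from g obtain \<chi> where \<chi>: "functional_fm T B \<chi> D" "g = syn_arrow T B \<chi> D" "D \<in> Ob C"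
    "\<forall>M\<in>models T. graph M g = graph_fm M B \<chi> D" by (rule homE)
  note c = functional_fm_ctx[OF \<theta>(1)] functional_fm_ctx[OF \<chi>(1)]
  let ?\<omega> = "comp_fm (fst A) (fst B) (fst D) \<theta> \<chi>"
  have w: "fm_in_ctx \<Sigma> (fst A @ fst D) ?\<omega>" using graph_comp_fm(1)[OF c] by simp
  have gr: "graph_fm M A ?\<omega> D = graph M f O graph M g" if "M \<in> models T" for M
    using graph_comp_fm(2)[OF c, of M \<phi> \<xi> \<psi>] bspec[OF \<theta>(4) that] bspec[OF \<chi>(4) that] by (simp add: o)
  have "functional_fm T A ?\<omega> D"
    using w gr graph_functional[OF f] graph_functional[OF g] functional_graph_comp
    by (fastforce simp: functional_fm_iff \<theta> \<chi>)
  moreover have eq: "Cmp C g f = syn_arrow T A ?\<omega> D"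
    by (rule Cmp_syn_arrow[OF f g \<theta>(2) c(1) \<chi>(2) c(2)])
  ultimately show "Cmp C g f \<in> hom C A D" using \<theta> \<chi> by (auto simp: hom_syn_cat)
  show "M \<in> models T \<Longrightarrow> graph M (Cmp C g f) = graph M f O graph M g"
    using gr w by (simp add: eq graph_syn_arrow)
qed

lemma hom_Ob: "f \<in> hom C A B \<Longrightarrow> A \<in> Ob C \<and> B \<in> Ob C"
  by (simp add: hom_syn_cat)

text \<open>The laws hold for relational composition of graphs in every model, and graphs determine
  arrows.\<close>

lemma syn_cat_category: "is_category C"
proof -
  have ar: "f \<in> hom C (Dom C f) (Cod C f)" if "f \<in> Ar C" for f
    using that by (simp add: hom_def)
  have unit: "Cmp C f (Ident C A) = f \<and> Cmp C (Ident C B) f = f" if f: "f \<in> hom C A B" for f A B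
  proof -
    note AB = hom_Ob[OF f]
    have I: "Ident C A \<in> hom C A A" "Ident C B \<in> hom C B B" using AB Ident_hom(1) by blast+
    have "graph M (Cmp C f (Ident C A)) = graph M f" if M: "M \<in> models T" for M
      using Cmp_hom(2)[OF I(1) f M] Ident_hom(2)[OF conjunct1[OF AB] M] ext_graph[OF f M]
      by (auto simp: relcomp_unfold Id_on_iff)
    moreover have "graph M (Cmp C (Ident C B) f) = graph M f" if M: "M \<in> models T" for M
      using Cmp_hom(2)[OF f I(2) M] Ident_hom(2)[OF conjunct2[OF AB] M] ext_graph[OF f M]
      by (auto simp: relcomp_unfold Id_on_iff)
    ultimately show ?thesis
      using arrow_eqI[OF Cmp_hom(1)[OF I(1) f] f] arrow_eqI[OF Cmp_hom(1)[OF f I(2)] f] by blast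
  qed
  have assoc: "Cmp C h (Cmp C g f) = Cmp C (Cmp C h g) f"
    if f: "f \<in> hom C A B" and g: "g \<in> hom C B D" and h: "h \<in> hom C D E" for f g h A B D E
    by (rule arrow_eqI[OF Cmp_hom(1)[OF Cmp_hom(1)[OF f g] h] Cmp_hom(1)[OF f Cmp_hom(1)[OF g h]]])
      (simp add: Cmp_hom(2)[OF Cmp_hom(1)[OF f g] h] Cmp_hom(2)[OF f Cmp_hom(1)[OF g h]]
        Cmp_hom(2)[OF f g] Cmp_hom(2)[OF g h] O_assoc)
  show ?thesis
    unfolding is_category_def
    using ar hom_Ob Ident_hom(1) Cmp_hom(1) unit assoc by (intro conjI ballI impI) (metis)+
qed

section \<open>Finite covering families and the coherent topology\<close>

definition covers :: "('s, 'f, 'r) syn_ob \<Rightarrow> ('s, 'f, 'r) syn_ar set \<Rightarrow> bool" where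
  "covers B G \<longleftrightarrow> finite G \<and> G \<subseteq> {g \<in> Ar C. Cod C g = B} \<and>
     (\<forall>M\<in>models T. \<forall>b\<in>ext M B. \<exists>g\<in>G. \<exists>a. (a, b) \<in> graph M g)"

lemma coversD: "covers B G \<Longrightarrow> M \<in> models T \<Longrightarrow> b \<in> ext M B \<Longrightarrow> \<exists>g\<in>G. \<exists>a. (a, b) \<in> graph M g"
  unfolding covers_def by blast

lemma covers_finite: "covers B G \<Longrightarrow> finite G"
  unfolding covers_def by blast

text \<open>In a model the disjunction of existential formulas says that an element of the extension
  of \<open>B\<close> lies in the image of some member of the family; completeness does the
  rest.\<close>

lemma covers_iff_prov:
  assumes B: "B \<in> Ob C" and fam: "\<forall>(A, \<theta>)\<in>set fam. A \<in> Ob C \<and> functional_fm T A \<theta> B"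
  shows "covers B ((\<lambda>(A, \<theta>). syn_arrow T A \<theta> B) ` set fam) \<longleftrightarrow>
    prov T (fst B) (snd B) (disj (map (\<lambda>(A, \<theta>). exs (fst A) \<theta>) fam))"
proof -
  have Bwf: "fm_in_ctx \<Sigma> (fst B) (snd B)" using B by (simp add: Ob_syn_cat)
  have ctx: "\<forall>(A, \<theta>)\<in>set fam. fm_in_ctx \<Sigma> (fst A @ fst B) \<theta>"
    using fam functional_fm_ctx by fast
  have hom: "syn_arrow T A \<theta> B \<in> hom C A B" if "(A, \<theta>) \<in> set fam" for A \<theta>
    using fam that B unfolding hom_syn_cat by blast
  have gr: "graph M (syn_arrow T A \<theta> B) = graph_fm M A \<theta> B" if "(A, \<theta>) \<in> set fam" "M \<in> models T" for A \<theta> M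
    using graph_syn_arrow[OF _ that(2)] ctx that(1) by blast
  have "fm_in_ctx \<Sigma> (fst B) (disj (map (\<lambda>(A, \<theta>). exs (fst A) \<theta>) fam))"
    using ctx Bwf by (fastforce simp: fm_in_ctx_def wf_disj wf_exs)
  then have "prov T (fst B) (snd B) (disj (map (\<lambda>(A, \<theta>). exs (fst A) \<theta>) fam)) \<longleftrightarrow>
      (\<forall>M\<in>models T. \<forall>b\<in>ext M B. \<exists>(A, \<theta>)\<in>set fam. \<exists>a. (a, b) \<in> graph_fm M A \<theta> B)"
    unfolding prov_iff using Bwf
    by (auto simp: sat_disj sat_exs ext_def graph_fm_def split_def) blast+
  also have "\<dots> \<longleftrightarrow> (\<forall>M\<in>models T. \<forall>b\<in>ext M B. \<exists>(A, \<theta>)\<in>set fam. \<exists>a. (a, b) \<in> graph M (syn_arrow T A \<theta> B))"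
    using gr by (intro ball_cong refl bex_cong) (auto split: prod.splits)
  also have "\<dots> \<longleftrightarrow> covers B ((\<lambda>(A, \<theta>). syn_arrow T A \<theta> B) ` set fam)"
    using hom unfolding covers_def by (simp add: split_def hom_def image_subset_iff)
  finally show ?thesis by blast
qed

lemma syn_arrow_hom: "syn_arrow T A \<theta> B \<in> Ar C \<Longrightarrow> syn_arrow T A \<theta> B \<in> hom C A B"
  by (simp add: hom_def syn_cat_def syn_arrow_def)

lemma coversE:
  assumes "covers B G"
  obtains fam where "(\<lambda>(A, \<theta>). syn_arrow T A \<theta> B) ` set fam = G"
    "\<forall>(A, \<theta>)\<in>set fam. A \<in> Ob C \<and> functional_fm T A \<theta> B"
proof -
  have "\<exists>A \<theta>. g = syn_arrow T A \<theta> B \<and> A \<in> Ob C \<and> functional_fm T A \<theta> B" if "g \<in> G" for g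
  proof -
    have "g \<in> hom C (Dom C g) B" using assms that by (auto simp: covers_def hom_def)
    then show ?thesis by (blast elim: homE)
  qed
  then obtain a t where at: "\<And>g. g \<in> G \<Longrightarrow> g = syn_arrow T (a g) (t g) B \<and> a g \<in> Ob C \<and> functional_fm T (a g) (t g) B"
    by metis
  obtain gs where gs: "set gs = G" using finite_list[OF covers_finite[OF assms]] by blast
  show thesis
  proof (rule that[of "map (\<lambda>g. (a g, t g)) gs"])
    show "(\<lambda>(A, \<theta>). syn_arrow T A \<theta> B) ` set (map (\<lambda>g. (a g, t g)) gs) = G"
      using at gs by (force simp: image_image)
    show "\<forall>(A, \<theta>)\<in>set (map (\<lambda>g. (a g, t g)) gs). A \<in> Ob C \<and> functional_fm T A \<theta> B"
      using at gs by simp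
  qed
qed

lemma coherent_topology_iff:
  assumes B: "B \<in> Ob C"
  shows "S \<in> coherent_topology T B \<longleftrightarrow> is_sieve C B S \<and> (\<exists>G\<subseteq>S. covers B G)"
proof (intro iffI conjI)
  assume S: "S \<in> coherent_topology T B"
  then show s: "is_sieve C B S" by (simp add: coherent_topology_def)
  from S obtain fam where fam: "\<forall>(A, \<theta>)\<in>set fam. functional_fm T A \<theta> B \<and> syn_arrow T A \<theta> B \<in> S"
    "prov T (fst B) (snd B) (disj (map (\<lambda>(A, \<theta>). exs (fst A) \<theta>) fam))"
    by (auto simp: coherent_topology_def)
  have "\<forall>(A, \<theta>)\<in>set fam. A \<in> Ob C \<and> functional_fm T A \<theta> B"
  proof safe
    fix A \<theta> assume "(A, \<theta>) \<in> set fam"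
    then have "functional_fm T A \<theta> B" "syn_arrow T A \<theta> B \<in> S" using fam(1) by blast+
    moreover from this have "syn_arrow T A \<theta> B \<in> Ar C" using s unfolding is_sieve_def by blast
    ultimately show "A \<in> Ob C" "functional_fm T A \<theta> B" using hom_Ob[OF syn_arrow_hom] by blast+
  qed
  then have "covers B ((\<lambda>(A, \<theta>). syn_arrow T A \<theta> B) ` set fam)"
    using fam(2) covers_iff_prov[OF B] by blast
  moreover have "(\<lambda>(A, \<theta>). syn_arrow T A \<theta> B) ` set fam \<subseteq> S" using fam(1) by auto
  ultimately show "\<exists>G\<subseteq>S. covers B G" by blast
next
  assume "is_sieve C B S \<and> (\<exists>G\<subseteq>S. covers B G)"
  then obtain G where s: "is_sieve C B S" and G: "G \<subseteq> S" "covers B G" by blast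
  obtain fam where fam: "(\<lambda>(A, \<theta>). syn_arrow T A \<theta> B) ` set fam = G"
    "\<forall>(A, \<theta>)\<in>set fam. A \<in> Ob C \<and> functional_fm T A \<theta> B"
    using G(2) by (rule coversE)
  have "prov T (fst B) (snd B) (disj (map (\<lambda>(A, \<theta>). exs (fst A) \<theta>) fam))"
    using covers_iff_prov[OF B fam(2)] G(2) unfolding fam(1) by blast
  moreover have "\<forall>(A, \<theta>)\<in>set fam. functional_fm T A \<theta> B \<and> syn_arrow T A \<theta> B \<in> S"
    using fam G(1) by blast
  ultimately show "S \<in> coherent_topology T B"
    using s unfolding coherent_topology_def by blast
qed

text \<open>The fibre product is given by the formula that \<open>f\<close> and \<open>g\<close>
  have a common value. The conclusion records what stability of covers relies on: a commuting square
  whose projection to \<open>A\<close> reaches every element with image hit by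
  \<open>g\<close>.\<close>

lemma syn_pullback:
  assumes f: "f \<in> hom C A B" and g: "g \<in> hom C E B"
  obtains P p q where "p \<in> hom C P A" "q \<in> hom C P E" "Cmp C f p = Cmp C g q"
    "\<And>M a e b. M \<in> models T \<Longrightarrow> (a, b) \<in> graph M f \<Longrightarrow> (e, b) \<in> graph M g \<Longrightarrow> \<exists>x. (x, a) \<in> graph M p"
proof -
  note ob = hom_Ob[OF f] hom_Ob[OF g]
  let ?\<Gamma> = "fst A" and ?\<Delta> = "fst B" and ?E = "fst E"
  let ?n = "length ?\<Gamma>" and ?m = "length ?\<Delta>" and ?k = "length ?E"
  have srt: "set ?\<Gamma> \<subseteq> sorts \<Sigma>" "set ?\<Delta> \<subseteq> sorts \<Sigma>" "set ?E \<subseteq> sorts \<Sigma>"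
    using ob by (auto simp: Ob_syn_cat fm_in_ctx_def)
  define X where "X M x \<longleftrightarrow> (\<exists>b. (take ?n x, b) \<in> graph M f \<and> (drop ?n x, b) \<in> graph M g)"
    for M :: "('s, 'f, 'r, ('s, 'f, 'r) const) struct" and x
  \<comment> \<open>The common value is put in front of the context, where
    \<open>definable_ex\<close> quantifies it away.\<close>
  have blk: "definable \<Sigma> (models T) (?\<Delta> @ ?\<Gamma> @ ?E)
      (\<lambda>M x. (map ((!) x) [?m..<?m + ?n], map ((!) x) [0..<?m]) \<in> graph M f \<and>
        (map ((!) x) [?m + ?n..<?m + ?n + ?k], map ((!) x) [0..<?m]) \<in> graph M g)"
  proof (rule definable_conj)
    show "definable \<Sigma> (models T) (?\<Delta> @ ?\<Gamma> @ ?E)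
        (\<lambda>M x. (map ((!) x) [?m..<?m + ?n], map ((!) x) [0..<?m]) \<in> graph M f)"
    proof -
      have "definable \<Sigma> (models T) (?\<Delta> @ ?\<Gamma> @ ?E)
        (\<lambda>M x. (take ?n (map ((!) x) ([?m..<?m + ?n] @ [0..<?m])),
          drop ?n (map ((!) x) ([?m..<?m + ?n] @ [0..<?m]))) \<in> graph M f)"
        by (rule definable_sub[OF graph_definable[OF f]]) (use srt in \<open>auto simp: nth_append\<close>)
      then show ?thesis by simp
    qed
    show "definable \<Sigma> (models T) (?\<Delta> @ ?\<Gamma> @ ?E)
        (\<lambda>M x. (map ((!) x) [?m + ?n..<?m + ?n + ?k], map ((!) x) [0..<?m]) \<in> graph M g)"
    proof -
      have "definable \<Sigma> (models T) (?\<Delta> @ ?\<Gamma> @ ?E)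
        (\<lambda>M x. (take ?k (map ((!) x) ([?m + ?n..<?m + ?n + ?k] @ [0..<?m])),
          drop ?k (map ((!) x) ([?m + ?n..<?m + ?n + ?k] @ [0..<?m]))) \<in> graph M g)"
        by (rule definable_sub[OF graph_definable[OF g]]) (use srt in \<open>auto simp: nth_append\<close>)
      then show ?thesis by simp
    qed
  qed
  have tups: "(a, b) \<in> graph M h \<Longrightarrow> a \<in> tup M (fst A') \<and> b \<in> tup M (fst B')"
    if "h \<in> hom C A' B'" "M \<in> models T" for M a b h A' B'
    using ext_graph[OF that] by (auto simp: ext_def)
  have "definable \<Sigma> (models T) (?\<Gamma> @ ?E) X"
    by (rule definable_cong[OF definable_ex[OF blk]])
      (auto simp: X_def map_nth_upt tup_length elim!: tup_appendE dest: tups[OF f] tups[OF g])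
  then obtain \<chi> where \<chi>: "fm_in_ctx \<Sigma> (?\<Gamma> @ ?E) \<chi>"
    "\<forall>M\<in>models T. \<forall>x\<in>tup M (?\<Gamma> @ ?E). X M x \<longleftrightarrow> sat M ((!) x) \<chi>" by (auto elim: definableE)
  let ?P = "(?\<Gamma> @ ?E, \<chi>)"
  have P: "?P \<in> Ob C" using \<chi> by (simp add: Ob_syn_cat)
  have extP: "\<exists>b. (take ?n x, b) \<in> graph M f \<and> (drop ?n x, b) \<in> graph M g"
    if "M \<in> models T" "x \<in> ext M ?P" for M x
    using \<chi>(2) that by (auto simp: ext_def X_def)
  have Pext: "a @ e \<in> ext M ?P \<and> take ?n (a @ e) = a"
    if "M \<in> models T" "(a, b) \<in> graph M f" "(e, b) \<in> graph M g" for M a e b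
  proof -
    have *: "a \<in> tup M ?\<Gamma>" "e \<in> tup M ?E" using tups[OF f that(1,2)] tups[OF g that(1,3)] by auto
    then have "X M (a @ e)" unfolding X_def using that(2,3) by (auto simp: tup_length)
    then show ?thesis using \<chi>(2) * that(1) by (auto simp: ext_def tup_appendI tup_length)
  qed
  have parts: "take ?n x \<in> ext M A \<and> drop ?n x \<in> ext M E" if "M \<in> models T" "x \<in> ext M ?P" for M x
    using extP[OF that] ext_graph[OF f that(1)] ext_graph[OF g that(1)] by blast
  have dp: "definable \<Sigma> (models T) (fst ?P @ ?\<Gamma>) (\<lambda>M x. sat M ((!) (take (?n + ?k) x)) \<chi> \<and>
     map ((!) x) [0..<?n] = map ((!) x) [?n + ?k..<?n + ?k + ?n])"
    unfolding fst_conv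
    using definable_block[OF definable_fm[OF \<chi>(1)], of "(?\<Gamma> @ ?E) @ ?\<Gamma>" 0 "models T"] srt
    by (intro definable_conj definable_eq) (auto simp: nth_append)
  have dq: "definable \<Sigma> (models T) (fst ?P @ ?E) (\<lambda>M x. sat M ((!) (take (?n + ?k) x)) \<chi> \<and>
     map ((!) x) [?n..<?n + ?k] = map ((!) x) [?n + ?k..<?n + ?k + ?k])"
    unfolding fst_conv
    using definable_block[OF definable_fm[OF \<chi>(1)], of "(?\<Gamma> @ ?E) @ ?E" 0 "models T"] srt
    by (intro definable_conj definable_eq) (auto simp: nth_append)
  let ?p = "\<lambda>M. {(x, a). x \<in> ext M ?P \<and> a = take ?n x}"
  let ?q = "\<lambda>M. {(x, e). x \<in> ext M ?P \<and> e = drop ?n x}"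
  have fp: "functional_graph (ext M ?P) (ext M A) (?p M)"
    and fq: "functional_graph (ext M ?P) (ext M E) (?q M)"
    if M: "M \<in> models T" for M
    using parts[OF M] by (auto simp: functional_graph_def)
  have "\<exists>p'\<in>hom C ?P A. \<forall>M\<in>models T. graph M p' = ?p M"
    by (rule arrow_ex[OF P conjunct1[OF ob(1)] dp fp]) (auto simp: map_nth_upt tup_length ext_def)
  then obtain p' where p': "p' \<in> hom C ?P A" "\<And>M. M \<in> models T \<Longrightarrow> graph M p' = ?p M" by blast
  have "\<exists>q'\<in>hom C ?P E. \<forall>M\<in>models T. graph M q' = ?q M"
    by (rule arrow_ex[OF P conjunct1[OF ob(2)] dq fq]) (auto simp: map_nth_upt tup_length ext_def)
  then obtain q' where q': "q' \<in> hom C ?P E" "\<And>M. M \<in> models T \<Longrightarrow> graph M q' = ?q M" by blast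
  have "graph M (Cmp C f p') = graph M (Cmp C g q')" if M: "M \<in> models T" for M
  proof -
    have uniq: "(a, b) \<in> graph M h \<Longrightarrow> (a, b') \<in> graph M h \<Longrightarrow> b = b'" if "h \<in> hom C A' B'" for a b b' h A' B'
      using graph_functional[OF that M] by (auto simp: functional_graph_def)
    have "(x, b) \<in> graph M (Cmp C f p') \<longleftrightarrow> x \<in> ext M ?P \<and> (take ?n x, b) \<in> graph M f" for x b
      using Cmp_hom(2)[OF p'(1) f M] p'(2)[OF M] by auto
    moreover have "(x, b) \<in> graph M (Cmp C g q') \<longleftrightarrow> x \<in> ext M ?P \<and> (drop ?n x, b) \<in> graph M g" for x b
      using Cmp_hom(2)[OF q'(1) g M] q'(2)[OF M] by auto
    ultimately show ?thesis
      using extP[OF M] uniq[OF f] uniq[OF g] by (intro set_eqI) (metis surj_pair)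
  qed
  then have "Cmp C f p' = Cmp C g q'"
    by (rule arrow_eqI[OF Cmp_hom(1)[OF p'(1) f] Cmp_hom(1)[OF q'(1) g]])
  moreover have "\<exists>x. (x, a) \<in> graph M p'" if "M \<in> models T" "(a, b) \<in> graph M f" "(e, b) \<in> graph M g" for M a e b
  proof -
    have "(a @ e, a) \<in> graph M p'" using Pext[OF that] p'(2)[OF that(1)] by simp
    then show ?thesis ..
  qed
  ultimately show thesis using that p'(1) q'(1) by blast
qed

text \<open>Each arrow of a finite cover is pulled back along \<open>f\<close>; the projections lie
  in the pulled-back sieve and still cover, because the image of any element of \<open>A\<close> is
  hit by some arrow of the cover.\<close>

lemma coherent_topology_pull:
  assumes R: "R \<in> coherent_topology T B" and f: "f \<in> hom C A B"
  shows "pull C f R \<in> coherent_topology T A"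
proof -
  note ob = hom_Ob[OF f]
  from R ob obtain G where s: "is_sieve C B R" and G: "G \<subseteq> R" "covers B G"
    by (auto simp: coherent_topology_iff)
  have "\<exists>p\<in>pull C f R. \<forall>M\<in>models T. \<forall>a b e. (a, b) \<in> graph M f \<longrightarrow> (e, b) \<in> graph M g \<longrightarrow> (\<exists>x. (x, a) \<in> graph M p)"
    if g: "g \<in> G" for g
  proof -
    have gh: "g \<in> hom C (Dom C g) B" using g G(2) by (auto simp: covers_def hom_def)
    obtain P p q where p: "p \<in> hom C P A" "q \<in> hom C P (Dom C g)" "Cmp C f p = Cmp C g q"
      "\<And>M a e b. M \<in> models T \<Longrightarrow> (a, b) \<in> graph M f \<Longrightarrow> (e, b) \<in> graph M g \<Longrightarrow> \<exists>x. (x, a) \<in> graph M p"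
      by (rule syn_pullback[OF f gh]) blast
    have "Cmp C g q \<in> R" using s g G(1) p(2) by (auto simp: is_sieve_def hom_def)
    then have "p \<in> pull C f R" using p f by (auto simp: pull_def hom_def)
    then show ?thesis using p(4) by blast
  qed
  then obtain P where P: "\<And>g. g \<in> G \<Longrightarrow> P g \<in> pull C f R"
    "\<And>g M a b e. g \<in> G \<Longrightarrow> M \<in> models T \<Longrightarrow> (a, b) \<in> graph M f \<Longrightarrow> (e, b) \<in> graph M g \<Longrightarrow> \<exists>x. (x, a) \<in> graph M (P g)"
    by metis
  have "covers A (P ` G)"
    unfolding covers_def
  proof (intro conjI ballI)
    show "finite (P ` G)" using G(2) by (simp add: covers_def)
    show "P ` G \<subseteq> {g \<in> Ar C. Cod C g = A}" using P(1) f by (auto simp: pull_def hom_def)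
    fix M a assume M: "M \<in> models T" and a: "a \<in> ext M A"
    obtain b where ab: "(a, b) \<in> graph M f"
      using graph_functional[OF f M] a by (auto simp: functional_graph_def)
    then have "b \<in> ext M B" using ext_graph[OF f M] by blast
    then obtain g e where "g \<in> G" "(e, b) \<in> graph M g" using coversD[OF G(2) M] by blast
    then show "\<exists>g\<in>P ` G. \<exists>x. (x, a) \<in> graph M g" using P(2) M ab by blast
  qed
  moreover have "P ` G \<subseteq> pull C f R" using P(1) by auto
  ultimately show ?thesis
    using pull_sieve[OF syn_cat_category s f] ob by (auto simp: coherent_topology_iff)
qed

text \<open>Composites of a finite cover with finite covers of its domains form a finite cover
  contained in \<open>Z\<close>.\<close>

lemma coherent_topology_trans:
  assumes R: "R \<in> coherent_topology T B" and B: "B \<in> Ob C" and Z: "is_sieve C B Z"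
    and loc: "\<And>r. r \<in> R \<Longrightarrow> pull C r Z \<in> coherent_topology T (Dom C r)"
  shows "Z \<in> coherent_topology T B"
proof -
  from R B obtain G where s: "is_sieve C B R" and G: "G \<subseteq> R" "covers B G"
    by (auto simp: coherent_topology_iff)
  have hom: "g \<in> hom C (Dom C g) B" if "g \<in> G" for g
    using G(2) that by (auto simp: covers_def hom_def)
  have "\<exists>H\<subseteq>pull C g Z. covers (Dom C g) H" if g: "g \<in> G" for g
    using loc[of g] G(1) g hom_Ob[OF hom[OF g]] by (auto simp: coherent_topology_iff)
  then obtain H where H: "\<And>g. g \<in> G \<Longrightarrow> H g \<subseteq> pull C g Z" "\<And>g. g \<in> G \<Longrightarrow> covers (Dom C g) (H g)"
    by metis
  let ?K = "\<Union>g\<in>G. Cmp C g ` H g"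
  have KZ: "?K \<subseteq> Z" using H(1) unfolding pull_def by blast
  moreover have "covers B ?K"
    unfolding covers_def
  proof (intro conjI ballI)
    show "finite ?K" using G(2) H(2) by (auto simp: covers_def)
    show "?K \<subseteq> {g \<in> Ar C. Cod C g = B}" using KZ Z by (auto simp: is_sieve_def)
    fix M b assume M: "M \<in> models T" and "b \<in> ext M B"
    then obtain g a where g: "g \<in> G" "(a, b) \<in> graph M g" using coversD[OF G(2)] by blast
    have "a \<in> ext M (Dom C g)" using ext_graph[OF hom[OF g(1)] M g(2)] by blast
    then obtain h x where h: "h \<in> H g" "(x, a) \<in> graph M h" using coversD[OF H(2)[OF g(1)] M] by blast
    have "h \<in> hom C (Dom C h) (Dom C g)" using H(2)[OF g(1)] h(1) by (auto simp: covers_def hom_def)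
    from Cmp_hom(2)[OF this hom[OF g(1)] M] have "(x, b) \<in> graph M (Cmp C g h)"
      using g h by blast
    then show "\<exists>k\<in>?K. \<exists>x. (x, b) \<in> graph M k" using g h by blast
  qed
  ultimately show ?thesis using Z B by (auto simp: coherent_topology_iff)
qed

end

section \<open>The comparison lemma\<close>

lemma presheaf_restr:
  assumes "is_presheaf U C P" "f \<in> hom C a b" "x \<in> sects P b"
  shows "restr P f x \<in> sects P a"
proof -
  have "restr P f \<in> sects P (Cod C f) \<rightarrow>\<^sub>E sects P (Dom C f)"
    using assms(1,2) unfolding is_presheaf_def by (auto simp: hom_def)
  then show ?thesis using assms(2,3) by (auto simp: hom_def)
qed

lemma presheaf_id: "is_presheaf U C P \<Longrightarrow> a \<in> Ob C \<Longrightarrow> x \<in> sects P a \<Longrightarrow> restr P (Ident C a) x = x"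
  by (simp add: is_presheaf_def)

lemma presheaf_comp:
  "is_presheaf U C P \<Longrightarrow> f \<in> hom C a b \<Longrightarrow> g \<in> hom C b c \<Longrightarrow> x \<in> sects P c \<Longrightarrow>
   restr P (Cmp C g f) x = restr P f (restr P g x)"
  by (auto simp: is_presheaf_def hom_def)

lemma sheaf_presheaf: "is_sheaf U C J P \<Longrightarrow> is_presheaf U C P"
  by (simp add: is_sheaf_def)

lemma sieve_hom: "is_sieve C a S \<Longrightarrow> f \<in> S \<Longrightarrow> f \<in> hom C (Dom C f) a"
  by (auto simp: is_sieve_def hom_def)

text \<open>Both sections are amalgamations of the matching family of restrictions of
  \<open>x\<close>, and an amalgamation is unique.\<close>

lemma sheaf_separated:
  assumes P: "is_sheaf U C J P" and a: "a \<in> Ob C" and S: "S \<in> J a" "is_sieve C a S"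
    and xy: "x \<in> sects P a" "y \<in> sects P a" and eq: "\<And>f. f \<in> S \<Longrightarrow> restr P f x = restr P f y"
  shows "x = y"
proof -
  have "matching_family C P S (\<lambda>f. restr P f x)"
    unfolding matching_family_def
    using presheaf_restr[OF sheaf_presheaf[OF P] sieve_hom[OF S(2)] xy(1)]
      presheaf_comp[OF sheaf_presheaf[OF P] _ sieve_hom[OF S(2)] xy(1)]
    by (simp add: hom_def)
  then have "\<exists>!z. z \<in> sects P a \<and> (\<forall>f\<in>S. restr P f z = restr P f x)"
    using P a S(1) unfolding is_sheaf_def by blast
  then show ?thesis using xy eq by metis
qed

lemma nat_trans_mem: "is_nat_trans C P Q \<alpha> \<Longrightarrow> a \<in> Ob C \<Longrightarrow> x \<in> sects P a \<Longrightarrow> \<alpha> a x \<in> sects Q a"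
  unfolding is_nat_trans_def by (meson PiE_mem)

lemma nat_trans_nat:
  "is_nat_trans C P Q \<alpha> \<Longrightarrow> f \<in> hom C a b \<Longrightarrow> x \<in> sects P b \<Longrightarrow> \<alpha> a (restr P f x) = restr Q f (\<alpha> b x)"
  by (auto simp: is_nat_trans_def hom_def)

lemma nat_trans_eqI:
  assumes "is_nat_trans C P Q \<alpha>" "is_nat_trans C P Q \<beta>"
    "\<And>a x. a \<in> Ob C \<Longrightarrow> x \<in> sects P a \<Longrightarrow> \<alpha> a x = \<beta> a x"
  shows "\<alpha> = \<beta>"
proof (rule PiE_ext)
  show "\<alpha> \<in> (\<Pi>\<^sub>E a\<in>Ob C. sects P a \<rightarrow>\<^sub>E sects Q a)" "\<beta> \<in> (\<Pi>\<^sub>E a\<in>Ob C. sects P a \<rightarrow>\<^sub>E sects Q a)"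
    using assms(1,2) by (simp_all add: is_nat_trans_def)
  then show "\<alpha> a = \<beta> a" if "a \<in> Ob C" for a
    using that assms(3) by (intro PiE_ext[of "\<alpha> a" "sects P a" "\<lambda>_. sects Q a"]) auto
qed

lemma nat_transI:
  assumes "\<And>a x. a \<in> Ob C \<Longrightarrow> x \<in> sects P a \<Longrightarrow> t a x \<in> sects Q a"
    "\<And>f a b x. f \<in> hom C a b \<Longrightarrow> a \<in> Ob C \<Longrightarrow> b \<in> Ob C \<Longrightarrow> x \<in> sects P b \<Longrightarrow> restr P f x \<in> sects P a \<Longrightarrow>
      t a (restr P f x) = restr Q f (t b x)"
    "is_category C" "is_presheaf U C P"
  shows "is_nat_trans C P Q (\<lambda>a\<in>Ob C. \<lambda>x\<in>sects P a. t a x)"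
  unfolding is_nat_trans_def
proof (intro conjI ballI)
  fix f x assume f: "f \<in> Ar C" and x: "x \<in> sects P (Cod C f)"
  then show "(\<lambda>a\<in>Ob C. \<lambda>x\<in>sects P a. t a x) (Dom C f) (restr P f x) =
      restr Q f ((\<lambda>a\<in>Ob C. \<lambda>x\<in>sects P a. t a x) (Cod C f) x)"
    using assms(2)[OF Ar_hom[OF f]] hom_ob[OF assms(3) Ar_hom[OF f]] presheaf_restr[OF assms(4) Ar_hom[OF f] x]
    by simp
qed (use assms(1) in auto)

section \<open>The category of sheaves\<close>

lemma Sh_Ob: "P \<in> Ob (Sh U C J) \<longleftrightarrow> is_sheaf U C J P"
  by (simp add: Sh_def)

lemma Sh_hom: "h \<in> hom (Sh U C J) P Q \<longleftrightarrow>
   (\<exists>\<alpha>. h = (P, \<alpha>, Q) \<and> is_sheaf U C J P \<and> is_sheaf U C J Q \<and> is_nat_trans C P Q \<alpha>)"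
  by (auto simp: Sh_def hom_def)

lemma Sh_Ident: "Ident (Sh U C J) P = (P, \<lambda>a\<in>Ob C. \<lambda>x\<in>sects P a. x, P)"
  by (simp add: Sh_def)

lemma Sh_Cmp: "Cmp (Sh U C J) (Q, \<beta>, R) (P, \<alpha>, Q') =
    (P, \<lambda>a\<in>Ob C. \<lambda>x\<in>sects P a. \<beta> a (\<alpha> a x), R)"
  by (simp add: Sh_def compose_def)

lemma nat_trans_comp:
  assumes "is_category C" "is_presheaf U C P" "is_nat_trans C P Q \<alpha>" "is_nat_trans C Q R \<beta>"
  shows "is_nat_trans C P R (\<lambda>a\<in>Ob C. \<lambda>x\<in>sects P a. \<beta> a (\<alpha> a x))"
  by (intro nat_transI[OF _ _ assms(1,2)])
    (simp_all add: nat_trans_mem[OF assms(3)] nat_trans_mem[OF assms(4)] nat_trans_nat[OF assms(3)]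
      nat_trans_nat[OF assms(4)])

lemma nat_trans_ident:
  "is_category C \<Longrightarrow> is_presheaf U C P \<Longrightarrow> is_nat_trans C P P (\<lambda>a\<in>Ob C. \<lambda>x\<in>sects P a. x)"
  by (rule nat_transI) auto

lemma Sh_category:
  assumes C: "is_category C"
  shows "is_category (Sh U C J)" (is "is_category ?S")
proof -
  have comp: "Cmp ?S h g \<in> hom ?S P R" if "g \<in> hom ?S P Q" "h \<in> hom ?S Q R" for g h P Q R
    using that nat_trans_comp[OF C] sheaf_presheaf by (fastforce simp: Sh_hom Sh_Cmp)
  have ident: "Ident ?S P \<in> hom ?S P P" if "P \<in> Ob ?S" for P
    using that nat_trans_ident[OF C] sheaf_presheaf by (fastforce simp: Sh_hom Sh_Ob Sh_Ident)
  have unit: "Cmp ?S g (Ident ?S P) = g \<and> Cmp ?S (Ident ?S Q) g = g" if "g \<in> hom ?S P Q" for g P Q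
  proof -
    from that obtain \<alpha> where g: "g = (P, \<alpha>, Q)" and a: "is_nat_trans C P Q \<alpha>" and
      sh: "is_sheaf U C J P" "is_sheaf U C J Q"
      by (auto simp: Sh_hom)
    have i: "is_nat_trans C P P (\<lambda>a\<in>Ob C. \<lambda>x\<in>sects P a. x)" "is_nat_trans C Q Q (\<lambda>a\<in>Ob C. \<lambda>x\<in>sects Q a. x)"
      using nat_trans_ident[OF C] sh sheaf_presheaf by blast+
    show ?thesis
      unfolding g Sh_Ident Sh_Cmp
      using nat_trans_comp[OF C sheaf_presheaf[OF sh(1)] i(1) a]
        nat_trans_comp[OF C sheaf_presheaf[OF sh(1)] a i(2)] a nat_trans_mem[OF a]
      by (auto intro!: nat_trans_eqI[of C P Q])
  qed
  have assoc: "Cmp ?S k (Cmp ?S h g) = Cmp ?S (Cmp ?S k h) g"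
    if "g \<in> hom ?S P Q" "h \<in> hom ?S Q R" "k \<in> hom ?S R V" for g h k P Q R V
  proof -
    from that obtain \<alpha> \<beta> \<gamma> where e: "g = (P, \<alpha>, Q)" "h = (Q, \<beta>, R)" "k = (R, \<gamma>, V)" and
      a: "is_nat_trans C P Q \<alpha>"
      by (auto simp: Sh_hom)
    show ?thesis
      unfolding e Sh_Cmp using nat_trans_mem[OF a] by (auto simp: fun_eq_iff restrict_def)
  qed
  show ?thesis
    unfolding is_category_def
  proof (intro conjI ballI impI)
    fix g assume "g \<in> Ar ?S"
    then show "Dom ?S g \<in> Ob ?S" "Cod ?S g \<in> Ob ?S" by (auto simp: Sh_def)
  qed (use comp ident unit assoc Ar_hom in \<open>metis\<close>)+
qed

text \<open>The pointwise inverses of a bijective natural transformation are automatically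
  natural.\<close>

lemma Sh_isoI:
  assumes C: "is_category C" and P: "is_sheaf U C J P" and Q: "is_sheaf U C J Q"
    and \<alpha>: "is_nat_trans C P Q \<alpha>" and bij: "\<And>a. a \<in> Ob C \<Longrightarrow> bij_betw (\<alpha> a) (sects P a) (sects Q a)"
  shows "is_iso (Sh U C J) (P, \<alpha>, Q)"
proof -
  let ?i = "\<lambda>a. inv_into (sects P a) (\<alpha> a)"
  have i1: "?i a y \<in> sects P a" "\<alpha> a (?i a y) = y" if "a \<in> Ob C" "y \<in> sects Q a" for a y
    using bij[OF that(1)] that(2) by (auto simp: bij_betw_def inv_into_into f_inv_into_f)
  have i2: "?i a (\<alpha> a x) = x" if "a \<in> Ob C" "x \<in> sects P a" for a x
    using bij[OF that(1)] that(2) by (auto simp: bij_betw_def)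
  have n: "is_nat_trans C Q P (\<lambda>a\<in>Ob C. \<lambda>y\<in>sects Q a. ?i a y)"
  proof (rule nat_transI[OF _ _ C sheaf_presheaf[OF Q]])
    fix f a b y assume f: "f \<in> hom C a b" and ab: "a \<in> Ob C" "b \<in> Ob C" and y: "y \<in> sects Q b"
      "restr Q f y \<in> sects Q a"
    have "?i a (\<alpha> a (restr P f (?i b y))) = restr P f (?i b y)"
      using i2[OF ab(1)] presheaf_restr[OF sheaf_presheaf[OF P] f] i1[OF ab(2) y(1)] by blast
    then show "?i a (restr Q f y) = restr P f (?i b y)"
      using nat_trans_nat[OF \<alpha> f] i1[OF ab(2) y(1)] by simp
  qed (use i1 in blast)
  show ?thesis
  proof (rule is_iso_inverse(1))
    show "(P, \<alpha>, Q) \<in> hom (Sh U C J) P Q" using P Q \<alpha> by (auto simp: Sh_hom)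
    show "(Q, \<lambda>a\<in>Ob C. \<lambda>y\<in>sects Q a. ?i a y, P) \<in> hom (Sh U C J) Q P" using P Q n by (auto simp: Sh_hom)
  qed (use i1 i2 nat_trans_mem[OF \<alpha>] in \<open>auto simp: Sh_Cmp Sh_Ident fun_eq_iff restrict_def\<close>)
qed

text \<open>The binary product condition, iterated along a finite index set. The empty product needs
  a one-element member of \<open>U\<close>, which is a subset of some nonempty member.\<close>

lemma small_PiE:
  assumes U: "small_sets U" and "finite I" "\<And>i. i \<in> I \<Longrightarrow> B i \<in> U"
  shows "\<exists>V\<in>U. V \<approx> (\<Pi>\<^sub>E i\<in>I. B i)"
  using assms(2,3)
proof (induction I)
  case empty
  obtain A a where "A \<in> U" "a \<in> A" using U by (auto simp: small_sets_def)
  then have "{a} \<in> U" using U by (auto simp: small_sets_def)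
  moreover have "{a} \<approx> (\<Pi>\<^sub>E i\<in>{}. B i)" by (simp add: singleton_eqpoll)
  ultimately show ?case by blast
next
  case (insert i I)
  then obtain V where V: "V \<in> U" "V \<approx> (\<Pi>\<^sub>E i\<in>I. B i)" by auto
  have "B i \<in> U" using insert by auto
  then obtain W where W: "W \<in> U" "W \<approx> B i \<times> V" 
  proof -
    have "\<exists>W\<in>U. W \<approx> B i \<times> V" using U \<open>B i \<in> U\<close> V(1) by (simp add: small_sets_def)
    then show ?thesis using that by blast
  qed
  have "(\<Pi>\<^sub>E j\<in>insert i I. B j) \<approx> B i \<times> (\<Pi>\<^sub>E j\<in>I. B j)"
  proof -
    have "bij_betw (\<lambda>(y, g). g(i := y)) (B i \<times> (\<Pi>\<^sub>E j\<in>I. B j)) (\<Pi>\<^sub>E j\<in>insert i I. B j)"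
      unfolding bij_betw_def PiE_insert_eq using inj_combinator[OF insert(2), of B] by auto
    then show ?thesis unfolding eqpoll_def using bij_betw_inv by blast
  qed
  moreover have "W \<approx> B i \<times> (\<Pi>\<^sub>E j\<in>I. B j)"
    by (rule eqpoll_trans[OF W(2) times_eqpoll_cong[OF eqpoll_refl V(2)]])
  ultimately show ?case using W(1) eqpoll_sym eqpoll_trans by blast
qed

text \<open>The image under the embedding, transported into a member of \<open>U\<close>, is a
  subset of that member and hence itself in \<open>U\<close>.\<close>

lemma small_embed:
  assumes U: "small_sets U" and V: "V \<in> U" "V \<approx> Y" and f: "inj_on f X" "f ` X \<subseteq> Y"
  shows "\<exists>W\<in>U. \<exists>g. bij_betw g X W"
proof -
  obtain h where h: "bij_betw h Y V" using V(2) eqpoll_sym unfolding eqpoll_def by blast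
  have "inj_on (h \<circ> f) X"
    using f h by (intro comp_inj_on) (auto simp: bij_betw_def intro: inj_on_subset)
  moreover have "(h \<circ> f) ` X \<subseteq> V" using f(2) h by (auto simp: bij_betw_def)
  then have "(h \<circ> f) ` X \<in> U" using U V(1) unfolding small_sets_def by blast
  ultimately show ?thesis
    by (intro bexI[of _ "(h \<circ> f) ` X"] exI[of _ "h \<circ> f"]) (simp_all add: bij_betw_def)
qed

section \<open>Generated sieves and dense functors between sites\<close>

definition gen :: "('o, 'm) category \<Rightarrow> 'm set \<Rightarrow> 'm set" where
  "gen C X = {Cmp C g k | g k. g \<in> X \<and> k \<in> Ar C \<and> Cod C k = Dom C g}"

lemma genI: "g \<in> X \<Longrightarrow> g \<in> hom C b d \<Longrightarrow> k \<in> hom C a b \<Longrightarrow> Cmp C g k \<in> gen C X"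
  by (auto simp: gen_def hom_def)

lemma genE:
  assumes "h \<in> gen C X"
  obtains g k where "g \<in> X" "k \<in> hom C (Dom C k) (Dom C g)" "h = Cmp C g k"
  using assms by (auto simp: gen_def hom_def)

lemma gen_sieve:
  assumes C: "is_category C" and X: "\<And>g. g \<in> X \<Longrightarrow> g \<in> hom C (Dom C g) d"
  shows "is_sieve C d (gen C X)"
  unfolding is_sieve_def
proof (intro conjI ballI impI subsetI)
  fix h assume "h \<in> gen C X"
  then obtain g k where gk: "g \<in> X" "k \<in> hom C (Dom C k) (Dom C g)" "h = Cmp C g k" by (rule genE)
  note h = hom_comp[OF C gk(2) X[OF gk(1)]]
  show "h \<in> {f \<in> Ar C. Cod C f = d}" using h gk(3) by (simp add: hom_def)
  fix m assume "m \<in> Ar C" "Cod C m = Dom C h"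
  then have m: "m \<in> hom C (Dom C m) (Dom C k)" using h gk(3) by (auto simp: hom_def)
  show "Cmp C h m \<in> gen C X"
    using genI[OF gk(1) X[OF gk(1)] hom_comp[OF C m gk(2)]] comp_assoc[OF C m gk(2) X[OF gk(1)]] gk(3) by simp
qed

lemma gen_least: "is_sieve C d S \<Longrightarrow> X \<subseteq> S \<Longrightarrow> gen C X \<subseteq> S"
  by (auto simp: gen_def is_sieve_def)

lemma gen_self: "is_category C \<Longrightarrow> g \<in> X \<Longrightarrow> g \<in> hom C a d \<Longrightarrow> g \<in> gen C X"
  using genI[of g X C a d "Ident C a"] hom_id hom_ob comp_id1 by metis

text \<open>The objects of the comma category of \<open>F\<close> over \<open>d\<close>.\<close>

definition over :: "('o1, 'm1) category \<Rightarrow> ('o2, 'm2) category \<Rightarrow> ('o1, 'm1, 'o2, 'm2) functr \<Rightarrow> 'o2 \<Rightarrow> ('o1 \<times> 'm2) set" where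
  "over C D F d = {(c, g). c \<in> Ob C \<and> g \<in> hom D (fob F c) d}"

text \<open>The setting of the comparison lemma: \<open>J\<close> is the topology induced from
  \<open>K\<close> along a fully faithful functor whose image is dense. Density is required with
  finite families, which later bounds the size of the Kan extension.\<close>

locale dense_functor =
  fixes C :: "('o1, 'm1) category" and D :: "('o2, 'm2) category" and F :: "('o1, 'm1, 'o2, 'm2) functr"
    and J :: "'o1 \<Rightarrow> 'm1 set set" and K :: "'o2 \<Rightarrow> 'm2 set set"
  assumes C: "is_category C" and D: "is_category D" and F: "is_functor C D F"
    and full: "full C D F" and faithful: "faithful C F"
    and J_sieve: "a \<in> Ob C \<Longrightarrow> S \<in> J a \<Longrightarrow> is_sieve C a S"
    and K_sieve: "d \<in> Ob D \<Longrightarrow> R \<in> K d \<Longrightarrow> is_sieve D d R"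
    and K_up: "d \<in> Ob D \<Longrightarrow> R \<in> K d \<Longrightarrow> R \<subseteq> Z \<Longrightarrow> is_sieve D d Z \<Longrightarrow> Z \<in> K d"
    and K_pull: "R \<in> K d \<Longrightarrow> f \<in> hom D e d \<Longrightarrow> pull D f R \<in> K e"
    and K_trans: "d \<in> Ob D \<Longrightarrow> R \<in> K d \<Longrightarrow> is_sieve D d Z \<Longrightarrow>
      (\<And>r. r \<in> R \<Longrightarrow> pull D r Z \<in> K (Dom D r)) \<Longrightarrow> Z \<in> K d"
    and J_iff: "a \<in> Ob C \<Longrightarrow> is_sieve C a S \<Longrightarrow> S \<in> J a \<longleftrightarrow> gen D (far F ` S) \<in> K (fob F a)"
    and dense: "d \<in> Ob D \<Longrightarrow> \<exists>G. finite G \<and> G \<subseteq> over C D F d \<and> gen D (snd ` G) \<in> K d"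
begin

abbreviation "Fo \<equiv> fob F"
abbreviation "Fa \<equiv> far F"

lemma preimage: "a \<in> Ob C \<Longrightarrow> b \<in> Ob C \<Longrightarrow> g \<in> hom D (Fo a) (Fo b) \<Longrightarrow> \<exists>f\<in>hom C a b. Fa f = g"
  using full by (simp add: full_def)

lemma faithfulD: "f \<in> hom C a b \<Longrightarrow> f' \<in> hom C a b \<Longrightarrow> Fa f = Fa f' \<Longrightarrow> f = f'"
  using faithful by (auto simp: faithful_def)

lemma overD: "(c, g) \<in> over C D F d \<Longrightarrow> c \<in> Ob C \<and> g \<in> hom D (Fo c) d"
  by (simp add: over_def)

lemma over_comp: "(c, g) \<in> over C D F d \<Longrightarrow> u \<in> hom C c' c \<Longrightarrow> (c', Cmp D g (Fa u)) \<in> over C D F d"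
  using hom_ob[OF C] hom_comp[OF D functor_hom[OF F]] by (auto simp: over_def)

lemma gen_over_sieve: "G \<subseteq> over C D F d \<Longrightarrow> is_sieve D d (gen D (snd ` G))"
  by (rule gen_sieve[OF D]) (auto simp: over_def hom_def)

lemma gen_over_all: "d \<in> Ob D \<Longrightarrow> gen D (snd ` over C D F d) \<in> K d"
proof -
  assume d: "d \<in> Ob D"
  then obtain G where "G \<subseteq> over C D F d" "gen D (snd ` G) \<in> K d" using dense by blast
  moreover from this have "gen D (snd ` G) \<subseteq> gen D (snd ` over C D F d)" unfolding gen_def by blast
  ultimately show ?thesis
    using K_up[OF d _ _ gen_over_sieve[OF order_refl]] by blast
qed

lemma separated_gen:
  assumes Q: "is_sheaf U D K Q" and d: "d \<in> Ob D" and X: "\<And>g. g \<in> X \<Longrightarrow> g \<in> hom D (Dom D g) d"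
    and cov: "gen D X \<in> K d" and xy: "x \<in> sects Q d" "y \<in> sects Q d"
    and eq: "\<And>g. g \<in> X \<Longrightarrow> restr Q g x = restr Q g y"
  shows "x = y"
proof (rule sheaf_separated[where J = K, OF Q d cov K_sieve[OF d cov] xy])
  fix f assume "f \<in> gen D X"
  then obtain g k where gk: "g \<in> X" "k \<in> hom D (Dom D k) (Dom D g)" "f = Cmp D g k" by (rule genE)
  show "restr Q f x = restr Q f y"
    using presheaf_comp[OF sheaf_presheaf[OF Q] gk(2) X[OF gk(1)]] xy eq[OF gk(1)] gk(3) by simp
qed

lemma separated_over:
  assumes Q: "is_sheaf U D K Q" and d: "d \<in> Ob D" and G: "G \<subseteq> over C D F d" "gen D (snd ` G) \<in> K d"
    and xy: "x \<in> sects Q d" "y \<in> sects Q d"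
    and eq: "\<And>c g. (c, g) \<in> G \<Longrightarrow> restr Q g x = restr Q g y"
  shows "x = y"
  by (rule separated_gen[OF Q d _ G(2) xy]) (use G(1) eq in \<open>auto simp: over_def hom_def\<close>)

text \<open>A matching family whose compatibility is only tested against arrows coming from
  \<open>C\<close>. It extends to the generated sieve by restriction; two factorisations of one
  arrow give equal sections because, after restriction to a cover by objects in the image, fullness
  turns the comparison into one along arrows of \<open>C\<close>.\<close>

lemma amalgamate:
  assumes Q: "is_sheaf U D K Q" and d: "d \<in> Ob D"
    and G: "G \<subseteq> over C D F d" "gen D (snd ` G) \<in> K d"
    and closed: "\<And>c g c' u. (c, g) \<in> G \<Longrightarrow> u \<in> hom C c' c \<Longrightarrow> (c', Cmp D g (Fa u)) \<in> G"
    and x: "\<And>c g. (c, g) \<in> G \<Longrightarrow> x (c, g) \<in> sects Q (Fo c)"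
    and compat: "\<And>c g c' u. (c, g) \<in> G \<Longrightarrow> u \<in> hom C c' c \<Longrightarrow>
      restr Q (Fa u) (x (c, g)) = x (c', Cmp D g (Fa u))"
  shows "\<exists>y\<in>sects Q d. \<forall>(c, g)\<in>G. restr Q g y = x (c, g)"
proof -
  note pQ = sheaf_presheaf[OF Q]
  have Gh: "g \<in> hom D (Fo c) d" "c \<in> Ob C" if "(c, g) \<in> G" for c g
    using G(1) that by (auto simp: over_def)
  have wd: "restr Q k (x (c, g)) = restr Q k' (x (c', g'))"
    if g: "(c, g) \<in> G" "(c', g') \<in> G" and k: "k \<in> hom D e (Fo c)" "k' \<in> hom D e (Fo c')"
      and eq: "Cmp D g k = Cmp D g' k'" for c g c' g' k k' e
  proof -
    have e: "e \<in> Ob D" using hom_ob[OF D k(1)] by blast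
    then obtain H where H: "H \<subseteq> over C D F e" "gen D (snd ` H) \<in> K e" using dense by blast
    \<comment> \<open>By fullness the composite of \<open>k\<close> and \<open>w\<close> comes from
      \<open>C\<close>, so the restricted section is the value of \<open>x\<close> at the total
      composite and depends on nothing else.\<close>
    have step: "restr Q w (restr Q k (x (c, g))) = x (b, Cmp D (Cmp D g k) w)"
      if bw: "(b, w) \<in> H" and cg: "(c, g) \<in> G" and k: "k \<in> hom D e (Fo c)" for b w c g k
    proof -
      have w: "w \<in> hom D (Fo b) e" "b \<in> Ob C" using H(1) bw by (auto simp: over_def)
      note g = Gh[OF cg]
      obtain u where u: "u \<in> hom C b c" "Fa u = Cmp D k w"
        using preimage[OF w(2) g(2) hom_comp[OF D w(1) k]] by blast
      have "restr Q w (restr Q k (x (c, g))) = restr Q (Fa u) (x (c, g))"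
        using presheaf_comp[OF pQ w(1) k x[OF cg]] u by simp
      also have "\<dots> = x (b, Cmp D g (Cmp D k w))" using compat[OF cg u(1)] u(2) by simp
      finally show ?thesis using comp_assoc[OF D w(1) k g(1)] by simp
    qed
    show ?thesis
      by (rule separated_over[OF Q e H presheaf_restr[OF pQ k(1) x[OF g(1)]] presheaf_restr[OF pQ k(2) x[OF g(2)]]])
        (use step g k eq in metis)
  qed
  let ?S = "gen D (snd ` G)"
  \<comment> \<open>A member of the sieve may factor through \<open>G\<close> in several ways; by
    \<open>wd\<close> all factorisations give the same value.\<close>
  define z where "z h = (SOME v. \<exists>c g k. (c, g) \<in> G \<and> k \<in> hom D (Dom D h) (Fo c) \<and> h = Cmp D g k \<and>
     v = restr Q k (x (c, g)))" for h
  have z: "z (Cmp D g k) = restr Q k (x (c, g))" if "(c, g) \<in> G" "k \<in> hom D e (Fo c)" for c g k e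
  proof -
    have "Dom D (Cmp D g k) = e" using hom_comp[OF D that(2) Gh(1)[OF that(1)]] by (simp add: hom_def)
    then show ?thesis
      unfolding z_def
    proof (intro some_equality, goal_cases)
      case 1
      then show ?case using that by blast
    next
      case (2 v)
      then obtain c' g' k' where "(c', g') \<in> G" "k' \<in> hom D e (Fo c')" "Cmp D g k = Cmp D g' k'"
        "v = restr Q k' (x (c', g'))" by blast
      then show ?case using wd[OF that(1) _ that(2)] by metis
    qed
  qed
  have SE: "\<exists>c g k e. (c, g) \<in> G \<and> k \<in> hom D e (Fo c) \<and> h = Cmp D g k \<and> e = Dom D h" if h: "h \<in> ?S" for h
  proof -
    obtain g k where gk: "g \<in> snd ` G" "k \<in> hom D (Dom D k) (Dom D g)" "h = Cmp D g k"
      using h by (rule genE)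
    then obtain c where c: "(c, g) \<in> G" by force
    have k: "k \<in> hom D (Dom D k) (Fo c)" using gk(2) hom_Ar[OF Gh(1)[OF c]] by simp
    show ?thesis using c k gk(3) hom_Ar[OF hom_comp[OF D k Gh(1)[OF c]]] by metis
  qed
  have "matching_family D Q ?S z"
    unfolding matching_family_def
  proof (intro conjI ballI impI)
    fix h assume "h \<in> ?S"
    then obtain c g k where h: "(c, g) \<in> G" "k \<in> hom D (Dom D h) (Fo c)" "h = Cmp D g k" using SE by blast
    show "z h \<in> sects Q (Dom D h)"
      using presheaf_restr[OF pQ h(2) x[OF h(1)]] z[OF h(1,2)] h(3) by simp
    fix m assume "m \<in> Ar D" "Cod D m = Dom D h"
    then have m: "m \<in> hom D (Dom D m) (Dom D h)" by (simp add: hom_def)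
    have "z (Cmp D h m) = restr Q (Cmp D k m) (x (c, g))"
      using z[OF h(1) hom_comp[OF D m h(2)]] comp_assoc[OF D m h(2) Gh(1)[OF h(1)]] h(3) by simp
    then show "restr Q m (z h) = z (Cmp D h m)"
      using presheaf_comp[OF pQ m h(2) x[OF h(1)]] z[OF h(1,2)] h(3) by simp
  qed
  then obtain y where y: "y \<in> sects Q d" "\<And>f. f \<in> ?S \<Longrightarrow> restr Q f y = z f"
    using Q d G(2) unfolding is_sheaf_def by blast
  have "restr Q g y = x (c, g)" if "(c, g) \<in> G" for c g
  proof -
    note g = Gh[OF that]
    have "g \<in> snd ` G" by (rule image_eqI[of g snd "(c, g)"]) (use that in simp_all)
    then have "g \<in> ?S" by (rule gen_self[OF D _ g(1)])
    then have "restr Q g y = z (Cmp D g (Ident D (Fo c)))" using y(2) comp_id1[OF D g(1)] by simp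
    also have "\<dots> = restr Q (Ident D (Fo c)) (x (c, g))"
      using z[OF that hom_id[OF D functor_ob[OF F g(2)]]] .
    finally show ?thesis using presheaf_id[OF pQ functor_ob[OF F g(2)] x[OF that]] by simp
  qed
  then show ?thesis using y(1) by blast
qed

section \<open>Restriction of sheaves along the functor\<close>

definition res :: "('o2, 'm2, 'u) presheaf \<Rightarrow> ('o1, 'm1, 'u) presheaf" where
  "res Q = \<lparr>sects = (\<lambda>c\<in>Ob C. sects Q (Fo c)), restr = (\<lambda>f\<in>Ar C. restr Q (Fa f))\<rparr>"

lemma sects_res: "c \<in> Ob C \<Longrightarrow> sects (res Q) c = sects Q (Fo c)"
  by (simp add: res_def)

lemma restr_res: "f \<in> hom C a b \<Longrightarrow> restr (res Q) f = restr Q (Fa f)"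
  by (simp add: res_def hom_def)

lemma res_presheaf:
  assumes Q: "is_presheaf U D Q"
  shows "is_presheaf U C (res Q)"
  unfolding is_presheaf_def
proof (intro conjI ballI allI impI)
  show "sects (res Q) \<in> (\<Pi>\<^sub>E a\<in>Ob C. U)"
    using Q functor_ob[OF F] unfolding is_presheaf_def res_def by (auto simp: PiE_iff)
  show "restr (res Q) \<in> (\<Pi>\<^sub>E f\<in>Ar C. sects (res Q) (Cod C f) \<rightarrow>\<^sub>E sects (res Q) (Dom C f))"
  proof (rule PiE_I)
    fix f assume f: "f \<in> Ar C"
    have "restr Q (Fa f) \<in> sects Q (Cod D (Fa f)) \<rightarrow>\<^sub>E sects Q (Dom D (Fa f))"
      using Q hom_Ar[OF functor_hom[OF F Ar_hom[OF f]]] unfolding is_presheaf_def by blast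
    then show "restr (res Q) f \<in> sects (res Q) (Cod C f) \<rightarrow>\<^sub>E sects (res Q) (Dom C f)"
      using hom_Ar[OF functor_hom[OF F Ar_hom[OF f]]] hom_ob[OF C Ar_hom[OF f]] f by (simp add: res_def)
  qed (simp add: res_def)
next
  fix a x assume "a \<in> Ob C" "x \<in> sects (res Q) a"
  then show "restr (res Q) (Ident C a) x = x"
    by (simp add: sects_res restr_res[OF hom_id[OF C]] functor_id[OF F] presheaf_id[OF Q functor_ob[OF F]])
next
  fix f g x assume f: "f \<in> Ar C" and g: "g \<in> Ar C" and eq: "Cod C f = Dom C g" and x: "x \<in> sects (res Q) (Cod C g)"
  have fh: "f \<in> hom C (Dom C f) (Dom C g)" and gh: "g \<in> hom C (Dom C g) (Cod C g)" using f g eq by (auto simp: hom_def)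
  show "restr (res Q) (Cmp C g f) x = restr (res Q) f (restr (res Q) g x)"
    using x hom_ob[OF C gh]
    by (simp add: sects_res restr_res[OF hom_comp[OF C fh gh]] restr_res[OF fh] restr_res[OF gh]
        functor_comp[OF F fh gh] presheaf_comp[OF Q functor_hom[OF F fh] functor_hom[OF F gh]])
qed

text \<open>The images of the arrows of a \<open>J\<close>-cover generate a \<open>K\<close>-cover,
  so a matching family over the former can be amalgamated in \<open>Q\<close> over the
  latter.\<close>

lemma res_sheaf:
  assumes Q: "is_sheaf U D K Q"
  shows "is_sheaf U C J (res Q)"
  unfolding is_sheaf_def
proof (intro conjI ballI allI impI)
  note pQ = sheaf_presheaf[OF Q]
  show "is_presheaf U C (res Q)" by (rule res_presheaf[OF pQ])
  fix a S x assume a: "a \<in> Ob C" and S: "S \<in> J a" and x: "matching_family C (res Q) S x"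
  note sv = J_sieve[OF a S]
  note Sh = sieve_hom[OF sv]
  have Fo: "Fo a \<in> Ob D" by (rule functor_ob[OF F a])
  let ?G = "{(Dom C s, Fa s) | s. s \<in> S}"
  have G: "?G \<subseteq> over C D F (Fo a)"
    using functor_hom[OF F Sh] hom_ob[OF C Sh] by (auto simp: over_def)
  have sndG: "snd ` ?G = Fa ` S" by force
  then have cov: "gen D (snd ` ?G) \<in> K (Fo a)" using J_iff[OF a sv] S by simp
  \<comment> \<open>All arrows of the sieve end at \<open>a\<close>, so by faithfulness an arrow is
    determined by its domain and its image; the family can thus be indexed by such pairs.\<close>
  define y where "y = (\<lambda>(c, g). x (THE s. s \<in> S \<and> Dom C s = c \<and> Fa s = g))"
  have y: "y (Dom C s, Fa s) = x s" if s: "s \<in> S" for s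
  proof -
    have "(THE s'. s' \<in> S \<and> Dom C s' = Dom C s \<and> Fa s' = Fa s) = s"
      by (rule the_equality) (use s Sh faithfulD in metis)+
    then show ?thesis by (simp add: y_def)
  qed
  have xs: "x s \<in> sects Q (Fo (Dom C s))" if "s \<in> S" for s
    using x that hom_ob[OF C Sh[OF that]] by (auto simp: matching_family_def sects_res)
  have xc: "restr Q (Fa u) (x s) = x (Cmp C s u)" if "s \<in> S" "u \<in> hom C c' (Dom C s)" for s u c'
  proof -
    have "restr (res Q) u (x s) = x (Cmp C s u)" using x that by (simp add: matching_family_def hom_def)
    then show ?thesis by (simp add: restr_res[OF that(2)])
  qed
  have sc: "Cmp C s u \<in> S \<and> Dom C (Cmp C s u) = c' \<and> Fa (Cmp C s u) = Cmp D (Fa s) (Fa u)"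
    if "s \<in> S" "u \<in> hom C c' (Dom C s)" for s u c'
    using sieve_comp[OF sv that] functor_comp[OF F that(2) Sh[OF that(1)]]
      hom_Ar[OF hom_comp[OF C that(2) Sh[OF that(1)]]] by simp
  have "\<exists>v\<in>sects Q (Fo a). \<forall>(c, g)\<in>?G. restr Q g v = y (c, g)"
  proof (rule amalgamate[OF Q Fo G cov])
    show "(c', Cmp D g (Fa u)) \<in> ?G" if "(c, g) \<in> ?G" "u \<in> hom C c' c" for c g c' u
    proof -
      from that obtain s where "s \<in> S" "c = Dom C s" "g = Fa s" by blast
      then show ?thesis using sc[of s u c'] that(2) by force
    qed
    show "y (c, g) \<in> sects Q (Fo c)" if "(c, g) \<in> ?G" for c g
      using that y xs by auto
    show "restr Q (Fa u) (y (c, g)) = y (c', Cmp D g (Fa u))" if "(c, g) \<in> ?G" "u \<in> hom C c' c" for c g c' u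
    proof -
      from that obtain s where s: "s \<in> S" "c = Dom C s" "g = Fa s" by blast
      show ?thesis using y[OF s(1)] xc[of s u c'] sc[of s u c'] y[of "Cmp C s u"] s that(2) by simp
    qed
  qed
  then obtain v where v: "v \<in> sects Q (Fo a)" "\<And>s. s \<in> S \<Longrightarrow> restr Q (Fa s) v = x s"
    using y by fastforce
  show "\<exists>!v. v \<in> sects (res Q) a \<and> (\<forall>f\<in>S. restr (res Q) f v = x f)"
  proof (rule ex1I[of _ v])
    show "v \<in> sects (res Q) a \<and> (\<forall>f\<in>S. restr (res Q) f v = x f)"
      using v a by (simp add: sects_res restr_res[OF Sh])
    fix w assume w: "w \<in> sects (res Q) a \<and> (\<forall>f\<in>S. restr (res Q) f w = x f)"
    show "w = v"
      by (rule separated_over[OF Q Fo G cov _ v(1)]) (use w v(2) a in \<open>auto simp: sects_res restr_res[OF Sh]\<close>)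
  qed
qed

definition res_functor ::
  "(('o2, 'm2, 'u) presheaf, ('o2, 'm2, 'u) presheaf \<times> ('o2 \<Rightarrow> 'u \<Rightarrow> 'u) \<times> ('o2, 'm2, 'u) presheaf,
    ('o1, 'm1, 'u) presheaf, ('o1, 'm1, 'u) presheaf \<times> ('o1 \<Rightarrow> 'u \<Rightarrow> 'u) \<times> ('o1, 'm1, 'u) presheaf) functr" where
  "res_functor = \<lparr>fob = res, far = (\<lambda>(Q, \<alpha>, R). (res Q, \<lambda>c\<in>Ob C. \<alpha> (Fo c), res R))\<rparr>"

lemma res_nat_trans:
  assumes "is_nat_trans D Q R \<alpha>"
  shows "is_nat_trans C (res Q) (res R) (\<lambda>c\<in>Ob C. \<alpha> (Fo c))"
  unfolding is_nat_trans_def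
proof (intro conjI ballI)
  show "(\<lambda>c\<in>Ob C. \<alpha> (Fo c)) \<in> (\<Pi>\<^sub>E a\<in>Ob C. sects (res Q) a \<rightarrow>\<^sub>E sects (res R) a)"
  proof (rule PiE_I)
    fix c assume c: "c \<in> Ob C"
    have "\<alpha> (Fo c) \<in> sects Q (Fo c) \<rightarrow>\<^sub>E sects R (Fo c)"
      using assms functor_ob[OF F c] unfolding is_nat_trans_def by (auto dest: PiE_mem)
    then show "(\<lambda>c\<in>Ob C. \<alpha> (Fo c)) c \<in> sects (res Q) c \<rightarrow>\<^sub>E sects (res R) c"
      using c by (simp add: sects_res)
  qed simp
  fix f x assume f: "f \<in> Ar C" and x: "x \<in> sects (res Q) (Cod C f)"
  note fh = Ar_hom[OF f] and ob = hom_ob[OF C Ar_hom[OF f]]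
  show "(\<lambda>c\<in>Ob C. \<alpha> (Fo c)) (Dom C f) (restr (res Q) f x) = restr (res R) f ((\<lambda>c\<in>Ob C. \<alpha> (Fo c)) (Cod C f) x)"
    using nat_trans_nat[OF assms functor_hom[OF F fh]] x ob by (simp add: sects_res restr_res[OF fh])
qed

lemma res_is_functor: "is_functor (Sh U D K) (Sh U C J) res_functor"
  unfolding is_functor_def
proof (intro conjI ballI impI)
  show "fob res_functor Q \<in> Ob (Sh U C J)" if "Q \<in> Ob (Sh U D K)" for Q
    using that res_sheaf by (simp add: Sh_Ob res_functor_def)
  show "far res_functor f \<in> hom (Sh U C J) (fob res_functor (Dom (Sh U D K) f)) (fob res_functor (Cod (Sh U D K) f))"
    if "f \<in> Ar (Sh U D K)" for f
  proof -
    from Ar_hom[OF that] obtain Q \<alpha> R where "f = (Q, \<alpha>, R)" "is_sheaf U D K Q" "is_sheaf U D K R"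
      "is_nat_trans D Q R \<alpha>" by (auto simp: Sh_hom)
    then show ?thesis
      using res_sheaf res_nat_trans by (auto simp: res_functor_def Sh_hom Sh_def[of U D K])
  qed
  show "far res_functor (Ident (Sh U D K) Q) = Ident (Sh U C J) (fob res_functor Q)" if "Q \<in> Ob (Sh U D K)" for Q
    using functor_ob[OF F] by (auto simp: res_functor_def Sh_Ident fun_eq_iff restrict_def sects_res)
  fix f g assume "f \<in> Ar (Sh U D K)" "g \<in> Ar (Sh U D K)" "Cod (Sh U D K) f = Dom (Sh U D K) g"
  then obtain Q \<alpha> R \<beta> V where fg: "f = (Q, \<alpha>, R)" "g = (R, \<beta>, V)"
    using Ar_hom[of f "Sh U D K"] Ar_hom[of g "Sh U D K"] unfolding Sh_hom by metis
  show "far res_functor (Cmp (Sh U D K) g f) = Cmp (Sh U C J) (far res_functor g) (far res_functor f)"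
    using functor_ob[OF F] by (auto simp: fg res_functor_def Sh_Cmp fun_eq_iff restrict_def sects_res)
qed

lemma nat_trans_determined:
  assumes R: "is_sheaf U D K R" and d: "d \<in> Ob D" and y: "y \<in> sects R d" "y' \<in> sects R d"
    and "\<And>c g. (c, g) \<in> over C D F d \<Longrightarrow> restr R g y = restr R g y'"
  shows "y = y'"
  by (rule separated_over[OF R d order_refl gen_over_all[OF d] y]) (rule assms(5))

lemma res_faithful: "faithful (Sh U D K) res_functor"
  unfolding faithful_def
proof (intro allI ballI impI)
  fix Q R f f' assume f: "f \<in> hom (Sh U D K) Q R" "f' \<in> hom (Sh U D K) Q R" and eq: "far res_functor f = far res_functor f'"
  from f obtain \<alpha> \<alpha>' where a: "f = (Q, \<alpha>, R)" "f' = (Q, \<alpha>', R)" and sh: "is_sheaf U D K Q" "is_sheaf U D K R"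
    and n: "is_nat_trans D Q R \<alpha>" "is_nat_trans D Q R \<alpha>'"
    by (auto simp: Sh_hom)
  have e: "\<alpha> (Fo c) = \<alpha>' (Fo c)" if "c \<in> Ob C" for c
    using eq that by (simp add: a res_functor_def) (metis restrict_apply')
  have "\<alpha> d x = \<alpha>' d x" if d: "d \<in> Ob D" and x: "x \<in> sects Q d" for d x
  proof (rule nat_trans_determined[OF sh(2) d nat_trans_mem[OF n(1) d x] nat_trans_mem[OF n(2) d x]])
    fix c g assume "(c, g) \<in> over C D F d"
    then have g: "g \<in> hom D (Fo c) d" "c \<in> Ob C" by (auto simp: over_def)
    show "restr R g (\<alpha> d x) = restr R g (\<alpha>' d x)"
      using nat_trans_nat[OF n(1) g(1) x] nat_trans_nat[OF n(2) g(1) x] e[OF g(2)] by simp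
  qed
  then show "f = f'" using nat_trans_eqI[OF n] a by simp
qed

text \<open>The component at \<open>d\<close> is glued from the values that \<open>\<gamma>\<close>
  prescribes at all objects over \<open>d\<close>. Naturality is tested at these objects, and
  agreement with \<open>\<gamma>\<close> is restriction along an identity.\<close>

lemma res_full: "full (Sh U D K) (Sh U C J) res_functor"
  unfolding full_def
proof (intro ballI)
  fix Q R h assume "Q \<in> Ob (Sh U D K)" "R \<in> Ob (Sh U D K)"
    and "h \<in> hom (Sh U C J) (fob res_functor Q) (fob res_functor R)"
  then have Q: "is_sheaf U D K Q" and R: "is_sheaf U D K R"
    and "\<exists>\<gamma>. h = (res Q, \<gamma>, res R) \<and> is_nat_trans C (res Q) (res R) \<gamma>"
    by (auto simp: Sh_Ob Sh_hom res_functor_def)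
  then obtain \<gamma> where h: "h = (res Q, \<gamma>, res R)" and \<gamma>: "is_nat_trans C (res Q) (res R) \<gamma>" by blast
  note pQ = sheaf_presheaf[OF Q] and pR = sheaf_presheaf[OF R]
  have \<gamma>m: "\<gamma> c x \<in> sects R (Fo c)" if "c \<in> Ob C" "x \<in> sects Q (Fo c)" for c x
    using nat_trans_mem[OF \<gamma> that(1)] that by (simp add: sects_res)
  have \<gamma>n: "\<gamma> c' (restr Q (Fa u) x) = restr R (Fa u) (\<gamma> c x)" if "u \<in> hom C c' c" "x \<in> sects Q (Fo c)" for c c' u x
    using nat_trans_nat[OF \<gamma> that(1)] that(2) hom_ob[OF C that(1)] by (simp add: sects_res restr_res[OF that(1)])
  have ex: "\<exists>z\<in>sects R d. \<forall>(c, g)\<in>over C D F d. restr R g z = \<gamma> c (restr Q g y)"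
    if d: "d \<in> Ob D" and y: "y \<in> sects Q d" for d y
  proof -
    have "\<exists>z\<in>sects R d. \<forall>(c, g)\<in>over C D F d. restr R g z = (\<lambda>(c, g). \<gamma> c (restr Q g y)) (c, g)"
    proof (rule amalgamate[OF R d order_refl gen_over_all[OF d] over_comp])
      fix c g assume cg: "(c, g) \<in> over C D F d"
      then have g: "g \<in> hom D (Fo c) d" "c \<in> Ob C" by (auto simp: over_def)
      show "(\<lambda>(c, g). \<gamma> c (restr Q g y)) (c, g) \<in> sects R (Fo c)"
        using \<gamma>m[OF g(2) presheaf_restr[OF pQ g(1) y]] by simp
      fix c' u assume u: "u \<in> hom C c' c"
      show "restr R (Fa u) ((\<lambda>(c, g). \<gamma> c (restr Q g y)) (c, g)) = (\<lambda>(c, g). \<gamma> c (restr Q g y)) (c', Cmp D g (Fa u))"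
        using \<gamma>n[OF u presheaf_restr[OF pQ g(1) y]] presheaf_comp[OF pQ functor_hom[OF F u] g(1) y] by simp
    qed
    then show ?thesis by simp
  qed
  let ?ok = "\<lambda>d y z. z \<in> sects R d \<and> (\<forall>(c, g)\<in>over C D F d. restr R g z = \<gamma> c (restr Q g y))"
  define t where "t d y = (SOME z. ?ok d y z)" for d y
  have ok: "?ok d y (t d y)" if "d \<in> Ob D" "y \<in> sects Q d" for d y
    unfolding t_def by (rule someI_ex) (use ex[OF that] in blast)
  then have t: "t d y \<in> sects R d" if "d \<in> Ob D" "y \<in> sects Q d" for d y using that by blast
  have tr: "restr R g (t d y) = \<gamma> c (restr Q g y)"
    if "d \<in> Ob D" "y \<in> sects Q d" "(c, g) \<in> over C D F d" for d y c g
    using ok[OF that(1,2)] that(3) by blast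
  let ?\<alpha> = "\<lambda>d\<in>Ob D. \<lambda>y\<in>sects Q d. t d y"
  have \<alpha>: "is_nat_trans D Q R ?\<alpha>"
  proof (rule nat_transI[OF t _ D pQ])
    fix f a b x assume f: "f \<in> hom D a b" and ab: "a \<in> Ob D" "b \<in> Ob D" and x: "x \<in> sects Q b" "restr Q f x \<in> sects Q a"
    show "t a (restr Q f x) = restr R f (t b x)"
    proof (rule nat_trans_determined[OF R ab(1) t[OF ab(1) x(2)] presheaf_restr[OF pR f t[OF ab(2) x(1)]]])
      fix c g assume cg: "(c, g) \<in> over C D F a"
      then have g: "g \<in> hom D (Fo c) a" "c \<in> Ob C" by (auto simp: over_def)
      have "(c, Cmp D f g) \<in> over C D F b" using g hom_comp[OF D g(1) f] by (simp add: over_def)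
      from tr[OF ab(2) x(1) this] show "restr R g (t a (restr Q f x)) = restr R g (restr R f (t b x))"
        using tr[OF ab(1) x(2) cg] presheaf_comp[OF pQ g(1) f x(1)] presheaf_comp[OF pR g(1) f t[OF ab(2) x(1)]] by simp
    qed
  qed
  have "far res_functor (Q, ?\<alpha>, R) = h"
  proof -
    have "(\<lambda>c\<in>Ob C. ?\<alpha> (Fo c)) = \<gamma>"
    proof (rule nat_trans_eqI[OF res_nat_trans[OF \<alpha>] \<gamma>])
      fix c x assume c: "c \<in> Ob C" and "x \<in> sects (res Q) c"
      then have x: "x \<in> sects Q (Fo c)" by (simp add: sects_res)
      note Fc = functor_ob[OF F c]
      have "(c, Ident D (Fo c)) \<in> over C D F (Fo c)" using c hom_id[OF D Fc] by (simp add: over_def)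
      from tr[OF Fc x this] show "(\<lambda>c\<in>Ob C. ?\<alpha> (Fo c)) c x = \<gamma> c x"
        using c x Fc presheaf_id[OF pR Fc t[OF Fc x]] presheaf_id[OF pQ Fc x] by simp
    qed
    then show ?thesis by (simp add: res_functor_def h)
  qed
  then show "\<exists>f\<in>hom (Sh U D K) Q R. far res_functor f = h"
    using Q R \<alpha> by (intro bexI[of _ "(Q, ?\<alpha>, R)"]) (auto simp: Sh_hom)
qed

section \<open>The right Kan extension of a sheaf\<close>

text \<open>The functor reflects covers. Each arrow \<open>r\<close> of \<open>R\<close> has a
  domain covered by objects in the image; composites of these covering arrows with \<open>r\<close>
  come from \<open>C\<close> by fullness and belong to the preimage, so \<open>K_trans\<close>
  applies.\<close>

lemma preimage_cover:
  assumes a: "a \<in> Ob C" and R: "R \<in> K (Fo a)"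
  shows "{u \<in> Ar C. Cod C u = a \<and> Fa u \<in> R} \<in> J a" and "is_sieve C a {u \<in> Ar C. Cod C u = a \<and> Fa u \<in> R}"
proof -
  let ?S = "{u \<in> Ar C. Cod C u = a \<and> Fa u \<in> R}"
  note Fo = functor_ob[OF F a]
  note Rs = K_sieve[OF Fo R]
  show S: "is_sieve C a ?S"
    unfolding is_sieve_def
  proof (intro conjI ballI impI)
    fix u g assume u: "u \<in> ?S" and g: "g \<in> Ar C" "Cod C g = Dom C u"
    have uh: "u \<in> hom C (Dom C u) a" and gh: "g \<in> hom C (Dom C g) (Dom C u)" using u g by (auto simp: hom_def)
    have "Cmp D (Fa u) (Fa g) \<in> R"
      using sieve_comp[OF Rs, of "Fa u" "Fa g"] u functor_hom[OF F gh] hom_Ar[OF functor_hom[OF F uh]] by simp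
    then show "Cmp C u g \<in> ?S"
      using functor_comp[OF F gh uh] hom_comp[OF C gh uh] by (simp add: hom_def)
  qed auto
  have ZS: "is_sieve D (Fo a) (gen D (Fa ` ?S))"
    by (rule gen_sieve[OF D]) (use functor_hom[OF F Ar_hom] hom_Ar in \<open>fastforce\<close>)
  have "gen D (Fa ` ?S) \<in> K (Fo a)"
  proof (rule K_trans[OF Fo R ZS])
    fix r assume r: "r \<in> R"
    note rh = sieve_hom[OF Rs r]
    have e: "Dom D r \<in> Ob D" using hom_ob[OF D rh] by blast
    show "pull D r (gen D (Fa ` ?S)) \<in> K (Dom D r)"
    proof (rule K_up[OF e gen_over_all[OF e] gen_least[OF pull_sieve[OF D ZS rh]] pull_sieve[OF D ZS rh]])
      show "snd ` over C D F (Dom D r) \<subseteq> pull D r (gen D (Fa ` ?S))"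
      proof (clarsimp simp: over_def)
        fix c g assume c: "c \<in> Ob C" and g: "g \<in> hom D (Fo c) (Dom D r)"
        note rg = hom_comp[OF D g rh]
        obtain u where u: "u \<in> hom C c a" "Fa u = Cmp D r g" using preimage[OF c a rg] by blast
        have "u \<in> ?S" using u sieve_comp[OF Rs r g] by (simp add: hom_def)
        then have "Cmp D r g \<in> gen D (Fa ` ?S)" using gen_self[OF D _ rg] u(2) by (metis (no_types, lifting) imageI)
        then show "g \<in> pull D r (gen D (Fa ` ?S))" using g by (simp add: pull_def hom_def)
      qed
    qed
  qed
  then show "?S \<in> J a" using J_iff[OF a S] by blast
qed

text \<open>The value at \<open>d\<close> of the right Kan extension of \<open>P\<close> along the functor. Its elements are determined by
  their values at a finite cover, which makes it small.\<close>

definition compatible :: "('o1, 'm1, 'u) presheaf \<Rightarrow> 'o2 \<Rightarrow> ('o1 \<times> 'm2 \<Rightarrow> 'u) set" where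
  "compatible P d = {x. x \<in> (\<Pi>\<^sub>E (c, g)\<in>over C D F d. sects P c) \<and>
     (\<forall>c g c' u. (c, g) \<in> over C D F d \<longrightarrow> u \<in> hom C c' c \<longrightarrow>
       restr P u (x (c, g)) = x (c', Cmp D g (Fa u)))}"

lemma compatible_mem: "x \<in> compatible P d \<Longrightarrow> (c, g) \<in> over C D F d \<Longrightarrow> x (c, g) \<in> sects P c"
  unfolding compatible_def by fastforce

lemma compatible_restr:
  "x \<in> compatible P d \<Longrightarrow> (c, g) \<in> over C D F d \<Longrightarrow> u \<in> hom C c' c \<Longrightarrow>
   restr P u (x (c, g)) = x (c', Cmp D g (Fa u))"
  unfolding compatible_def by blast

lemma compatible_eqI:
  assumes "x \<in> compatible P d" "y \<in> compatible P d" "\<And>c g. (c, g) \<in> over C D F d \<Longrightarrow> x (c, g) = y (c, g)"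
  shows "x = y"
  by (rule PiE_ext[where k = "over C D F d" and s = "\<lambda>(c, g). sects P c"])
    (use assms in \<open>auto simp: compatible_def\<close>)

lemma compatibleI:
  assumes "\<And>c g. (c, g) \<in> over C D F d \<Longrightarrow> x (c, g) \<in> sects P c"
    "\<And>c g c' u. (c, g) \<in> over C D F d \<Longrightarrow> u \<in> hom C c' c \<Longrightarrow> restr P u (x (c, g)) = x (c', Cmp D g (Fa u))"
  shows "restrict x (over C D F d) \<in> compatible P d"
  using assms over_comp by (auto simp: compatible_def)

lemma compatible_small:
  assumes U: "small_sets U" and P: "is_sheaf U C J P" and d: "d \<in> Ob D"
  shows "\<exists>V\<in>U. \<exists>\<beta>. bij_betw \<beta> (compatible P d) V"
proof -
  obtain G where G: "finite G" "G \<subseteq> over C D F d" "gen D (snd ` G) \<in> K d" using dense[OF d] by blast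
  have PU: "(case i of (c, g) \<Rightarrow> sects P c) \<in> U" if "i \<in> G" for i
    using sheaf_presheaf[OF P] G(2) that unfolding is_presheaf_def by (auto simp: over_def)
  obtain V where V: "V \<in> U" "V \<approx> (\<Pi>\<^sub>E i\<in>G. case i of (c, g) \<Rightarrow> sects P c)"
    using small_PiE[OF U G(1), of "\<lambda>i. case i of (c, g) \<Rightarrow> sects P c"] PU by blast
  show ?thesis
  proof (rule small_embed[OF U V])
    show "(\<lambda>x. restrict x G) ` compatible P d \<subseteq> (\<Pi>\<^sub>E i\<in>G. case i of (c, g) \<Rightarrow> sects P c)"
      using compatible_mem G(2) by fastforce
    \<comment> \<open>To compare two families at \<open>(c, g)\<close>, pull the finite cover back
      along \<open>g\<close> and then to \<open>C\<close>. On the resulting cover of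
      \<open>c\<close>, each composite factors through a member of \<open>G\<close> by an arrow from
      \<open>C\<close>, so compatibility expresses the restricted value through a value on
      \<open>G\<close>.\<close>
    show "inj_on (\<lambda>x. restrict x G) (compatible P d)"
    proof (rule inj_onI)
      fix x y assume x: "x \<in> compatible P d" and y: "y \<in> compatible P d" and eq: "restrict x G = restrict y G"
      have eqG: "x i = y i" if "i \<in> G" for i using eq that by (metis restrict_apply')
      show "x = y"
      proof (rule compatible_eqI[OF x y])
        fix c g assume cg: "(c, g) \<in> over C D F d"
        then have g: "g \<in> hom D (Fo c) d" and c: "c \<in> Ob C" by (auto simp: over_def)
        note S = preimage_cover[OF c K_pull[OF G(3) g]]
        show "x (c, g) = y (c, g)"
        proof (rule sheaf_separated[where J = J, OF P c S compatible_mem[OF x cg] compatible_mem[OF y cg]])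
          fix u assume "u \<in> {u \<in> Ar C. Cod C u = c \<and> Fa u \<in> pull D g (gen D (snd ` G))}"
          then have u: "u \<in> hom C (Dom C u) c" and "Cmp D g (Fa u) \<in> gen D (snd ` G)"
            by (auto simp: pull_def hom_def)
          then obtain b w k where bw: "(b, w) \<in> G" and k: "k \<in> hom D (Dom D k) (Dom D w)" "Cmp D g (Fa u) = Cmp D w k"
            by (auto elim!: genE)
          have bo: "(b, w) \<in> over C D F d" using bw G(2) by blast
          then have w: "w \<in> hom D (Fo b) d" and b: "b \<in> Ob C" by (auto simp: over_def)
          have "Dom D (Cmp D g (Fa u)) = Fo (Dom C u)"
            using hom_comp[OF D functor_hom[OF F u] g] by (simp add: hom_def)
          moreover have k': "k \<in> hom D (Dom D k) (Fo b)" using k(1) w by (simp add: hom_def)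
          then have "Dom D (Cmp D w k) = Dom D k"
            using hom_comp[OF D k' w] by (simp add: hom_def)
          ultimately have "k \<in> hom D (Fo (Dom C u)) (Fo b)" using k' k(2) by simp
          then obtain v where v: "v \<in> hom C (Dom C u) b" "Fa v = k"
            using preimage hom_ob[OF C u] b by blast
          show "restr P u (x (c, g)) = restr P u (y (c, g))"
            using compatible_restr[OF x cg u] compatible_restr[OF y cg u] compatible_restr[OF x bo v(1)]
              compatible_restr[OF y bo v(1)] v(2) k(2) eqG[OF bw] by simp
        qed
      qed
    qed
  qed
qed

lemma over_postcomp: "h \<in> hom D e d \<Longrightarrow> (c, g) \<in> over C D F e \<Longrightarrow> (c, Cmp D h g) \<in> over C D F d"
  using hom_comp[OF D] by (auto simp: over_def)

text \<open>The restriction map of the Kan extension: composition of the index arrow with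
  \<open>h\<close>.\<close>

definition shift :: "'m2 \<Rightarrow> ('o1 \<times> 'm2 \<Rightarrow> 'u) \<Rightarrow> 'o1 \<times> 'm2 \<Rightarrow> 'u" where
  "shift h x = (\<lambda>(c, g)\<in>over C D F (Dom D h). x (c, Cmp D h g))"

lemma shift_apply: "h \<in> hom D e d \<Longrightarrow> (c, g) \<in> over C D F e \<Longrightarrow> shift h x (c, g) = x (c, Cmp D h g)"
  by (simp add: shift_def hom_def)

lemma shift_compatible:
  assumes x: "x \<in> compatible P d" and h: "h \<in> hom D e d"
  shows "shift h x \<in> compatible P e"
proof -
  have "restrict (\<lambda>(c, g). x (c, Cmp D h g)) (over C D F e) \<in> compatible P e"
  proof (rule compatibleI)
    fix c g assume cg: "(c, g) \<in> over C D F e"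
    show "(case (c, g) of (c, g) \<Rightarrow> x (c, Cmp D h g)) \<in> sects P c"
      using compatible_mem[OF x over_postcomp[OF h cg]] by simp
    fix c' u assume u: "u \<in> hom C c' c"
    show "restr P u (case (c, g) of (c, g) \<Rightarrow> x (c, Cmp D h g)) =
        (case (c', Cmp D g (Fa u)) of (c, g) \<Rightarrow> x (c, Cmp D h g))"
      using compatible_restr[OF x over_postcomp[OF h cg] u] comp_assoc[OF D functor_hom[OF F u] conjunct2[OF overD[OF cg]] h]
      by simp
  qed
  then show ?thesis using h by (simp add: shift_def hom_def)
qed

text \<open>The sheaf condition for the Kan extension, proved for the families themselves before
  they are transported into \<open>U\<close>. The value at \<open>(c, g)\<close> is glued in
  \<open>P\<close> over the sieve of arrows into \<open>c\<close> whose image, composed with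
  \<open>g\<close>, lies in \<open>R\<close>.\<close>

lemma compatible_amalgamate:
  assumes P: "is_sheaf U C J P" and d: "d \<in> Ob D" and R: "R \<in> K d"
    and X: "\<And>f. f \<in> R \<Longrightarrow> X f \<in> compatible P (Dom D f)"
    and Xc: "\<And>f g e. f \<in> R \<Longrightarrow> g \<in> hom D e (Dom D f) \<Longrightarrow> X (Cmp D f g) = shift g (X f)"
  shows "\<exists>!y. y \<in> compatible P d \<and> (\<forall>f\<in>R. shift f y = X f)"
proof -
  note pP = sheaf_presheaf[OF P] and Rs = K_sieve[OF d R]
  let ?S = "\<lambda>c g. {u \<in> Ar C. Cod C u = c \<and> Fa u \<in> pull D g R}"
  have S: "?S c g \<in> J c" "is_sieve C c (?S c g)" if "(c, g) \<in> over C D F d" for c g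
    using preimage_cover[OF _ K_pull[OF R]] overD[OF that] by blast+
  have SD: "u \<in> hom C (Dom C u) c \<and> Cmp D g (Fa u) \<in> R \<and> Dom D (Cmp D g (Fa u)) = Fo (Dom C u)"
    if "u \<in> ?S c g" "(c, g) \<in> over C D F d" for u c g
  proof -
    have u: "u \<in> hom C (Dom C u) c" using that by (simp add: hom_def)
    show ?thesis
      using u that hom_comp[OF D functor_hom[OF F u] conjunct2[OF overD[OF that(2)]]] by (simp add: pull_def hom_def)
  qed
  have SI: "u \<in> ?S c g" if "u \<in> hom C c' c" "(c, g) \<in> over C D F d" "Cmp D g (Fa u) \<in> R" for u c c' g
    using that overD[OF that(2)] hom_Ar[OF functor_hom[OF F that(1)]] by (auto simp: pull_def hom_def)
  \<comment> \<open>The value forced on the amalgamation along \<open>u\<close>: the composite lies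
    in \<open>R\<close>, and the family prescribed there is evaluated at the identity.\<close>
  let ?p = "\<lambda>g u. X (Cmp D g (Fa u)) (Dom C u, Ident D (Fo (Dom C u)))"
  have idover: "(c, Ident D (Fo c)) \<in> over C D F (Fo c)" if "c \<in> Ob C" for c
    using that hom_id[OF D functor_ob[OF F that]] by (simp add: over_def)
  have pm: "?p g u \<in> sects P (Dom C u)" if "u \<in> ?S c g" "(c, g) \<in> over C D F d" for u c g
  proof -
    have "Dom C u \<in> Ob C" using hom_ob[OF C] SD[OF that] by blast
    then show ?thesis
      using compatible_mem[OF X[of "Cmp D g (Fa u)"], of "Dom C u"] idover[of "Dom C u"] SD[OF that] by simp
  qed
  \<comment> \<open>Compatibility of \<open>X\<close> with \<open>shift\<close>: evaluating at the
    identity after composing with \<open>h\<close> is the same as evaluating at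
    \<open>h\<close>.\<close>
  have Xid: "X (Cmp D f h) (c, Ident D (Fo c)) = X f (c, h)" if f: "f \<in> R" and ch: "(c, h) \<in> over C D F (Dom D f)" for f c h
  proof -
    have h: "h \<in> hom D (Fo c) (Dom D f)" "c \<in> Ob C" using overD[OF ch] by auto
    show ?thesis
      unfolding Xc[OF f h(1)] using shift_apply[OF h(1) idover[OF h(2)], of "X f"] comp_id1[OF D h(1)] by simp
  qed
  have match: "matching_family C P (?S c g) (?p g)" if cg: "(c, g) \<in> over C D F d" for c g
    unfolding matching_family_def
  proof (intro conjI ballI impI)
    fix u assume u: "u \<in> ?S c g"
    show "?p g u \<in> sects P (Dom C u)" by (rule pm[OF u cg])
    note uD = SD[OF u cg]
    have uo: "Dom C u \<in> Ob C" using hom_ob[OF C] uD by blast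
    let ?f = "Cmp D g (Fa u)"
    fix v assume "v \<in> Ar C" "Cod C v = Dom C u"
    then have v: "v \<in> hom C (Dom C v) (Dom C u)" by (simp add: hom_def)
    have "restr P v (?p g u) = X ?f (Dom C v, Cmp D (Ident D (Fo (Dom C u))) (Fa v))"
      using compatible_restr[OF X[of ?f] _ v, of "Ident D (Fo (Dom C u))"] uD idover[OF uo] by simp
    also have "\<dots> = X ?f (Dom C v, Fa v)" using comp_id2[OF D functor_hom[OF F v]] by simp
    also have "\<dots> = X (Cmp D ?f (Fa v)) (Dom C v, Ident D (Fo (Dom C v)))"
      using Xid[of ?f "Dom C v" "Fa v"] uD functor_hom[OF F v] hom_ob[OF C v] by (simp add: over_def)
    also have "Cmp D ?f (Fa v) = Cmp D g (Fa (Cmp C u v))"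
      using comp_assoc[OF D functor_hom[OF F v] functor_hom[OF F conjunct1[OF uD]] conjunct2[OF overD[OF cg]]]
        functor_comp[OF F v conjunct1[OF uD]] by simp
    finally show "restr P v (?p g u) = ?p g (Cmp C u v)"
      using hom_comp[OF C v conjunct1[OF uD]] by (simp add: hom_def)
  qed
  have "\<forall>i\<in>over C D F d. \<exists>y. y \<in> sects P (fst i) \<and> (\<forall>u\<in>?S (fst i) (snd i). restr P u y = ?p (snd i) u)"
  proof
    fix i assume i: "i \<in> over C D F d"
    then have cg: "(fst i, snd i) \<in> over C D F d" by simp
    show "\<exists>y. y \<in> sects P (fst i) \<and> (\<forall>u\<in>?S (fst i) (snd i). restr P u y = ?p (snd i) u)"
      using P overD[OF cg] S[OF cg] match[OF cg] unfolding is_sheaf_def by blast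
  qed
  from bchoice[OF this] obtain y where y0: "\<forall>i\<in>over C D F d. y i \<in> sects P (fst i) \<and>
      (\<forall>u\<in>?S (fst i) (snd i). restr P u (y i) = ?p (snd i) u)" ..
  have y: "y (c, g) \<in> sects P c" if "(c, g) \<in> over C D F d" for c g
    using bspec[OF y0 that] by simp
  have yr: "restr P u (y (c, g)) = ?p g u" if "(c, g) \<in> over C D F d" "u \<in> ?S c g" for c g u
    using bspec[OF y0 that(1)] that(2) by simp
  have sep: "a = b" if cg: "(c, g) \<in> over C D F d" and ab: "a \<in> sects P c" "b \<in> sects P c"
    and eq: "\<And>u. u \<in> ?S c g \<Longrightarrow> restr P u a = restr P u b" for c g a b
    by (rule sheaf_separated[where J = J, OF P conjunct1[OF overD[OF cg]] S[OF cg] ab eq])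
  let ?y = "restrict y (over C D F d)"
  have yc: "?y \<in> compatible P d"
  proof (rule compatibleI[OF y])
    fix c g c' w assume cg: "(c, g) \<in> over C D F d" and w: "w \<in> hom C c' c"
    note cg' = over_comp[OF cg w]
    show "restr P w (y (c, g)) = y (c', Cmp D g (Fa w))"
    proof (rule sep[OF cg' presheaf_restr[OF pP w y[OF cg]] y[OF cg']])
      fix u assume u: "u \<in> ?S c' (Cmp D g (Fa w))"
      note uD = SD[OF u cg']
      have a: "Cmp D (Cmp D g (Fa w)) (Fa u) = Cmp D g (Fa (Cmp C w u))"
        using comp_assoc[OF D functor_hom[OF F conjunct1[OF uD]] functor_hom[OF F w] conjunct2[OF overD[OF cg]]]
          functor_comp[OF F conjunct1[OF uD] w] by simp
      note wu = hom_comp[OF C conjunct1[OF uD] w]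
      have "restr P u (restr P w (y (c, g))) = restr P (Cmp C w u) (y (c, g))"
        using presheaf_comp[OF pP conjunct1[OF uD] w y[OF cg]] by simp
      also have "\<dots> = ?p g (Cmp C w u)"
        using yr[OF cg SI[OF wu cg]] uD a by simp
      also have "\<dots> = ?p (Cmp D g (Fa w)) u" using a hom_Ar[OF wu] by simp
      also have "\<dots> = restr P u (y (c', Cmp D g (Fa w)))" using yr[OF cg' u] by simp
      finally show "restr P u (restr P w (y (c, g))) = restr P u (y (c', Cmp D g (Fa w)))" .
    qed
  qed
  have yX: "shift f ?y = X f" if f: "f \<in> R" for f
  proof -
    note fh = sieve_hom[OF Rs f]
    show ?thesis
    proof (rule compatible_eqI[OF shift_compatible[OF yc fh] X[OF f]])
      fix c g assume cg: "(c, g) \<in> over C D F (Dom D f)"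
      note g = conjunct2[OF overD[OF cg]]
      note cfg = over_postcomp[OF fh cg]
      have "y (c, Cmp D f g) = X f (c, g)"
      proof (rule sep[OF cfg y[OF cfg] compatible_mem[OF X[OF f] cg]])
        fix u assume u: "u \<in> ?S c (Cmp D f g)"
        note uD = SD[OF u cfg]
        note gu = over_comp[OF cg conjunct1[OF uD]]
        have "restr P u (y (c, Cmp D f g)) = X (Cmp D f (Cmp D g (Fa u))) (Dom C u, Ident D (Fo (Dom C u)))"
          using yr[OF cfg u] comp_assoc[OF D functor_hom[OF F conjunct1[OF uD]] g fh] by simp
        also have "\<dots> = X f (Dom C u, Cmp D g (Fa u))" by (rule Xid[OF f gu])
        finally show "restr P u (y (c, Cmp D f g)) = restr P u (X f (c, g))"
          using compatible_restr[OF X[OF f] cg conjunct1[OF uD]] by simp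
      qed
      then show "shift f ?y (c, g) = X f (c, g)" using shift_apply[OF fh cg, of ?y] cfg by simp
    qed
  qed
  show ?thesis
  proof (rule ex1I[of _ ?y])
    show "?y \<in> compatible P d \<and> (\<forall>f\<in>R. shift f ?y = X f)" using yc yX by blast
    fix z assume z: "z \<in> compatible P d \<and> (\<forall>f\<in>R. shift f z = X f)"
    show "z = ?y"
    proof (rule compatible_eqI[OF conjunct1[OF z] yc])
      fix c g assume cg: "(c, g) \<in> over C D F d"
      show "z (c, g) = ?y (c, g)"
      proof (rule sep[OF cg compatible_mem[OF conjunct1[OF z] cg] compatible_mem[OF yc cg]])
        fix u assume u: "u \<in> ?S c g"
        note uD = SD[OF u cg]
        let ?f = "Cmp D g (Fa u)"
        have uo: "Dom C u \<in> Ob C" using hom_ob[OF C] uD by blast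
        have fh: "?f \<in> hom D (Fo (Dom C u)) d" using sieve_hom[OF Rs] uD by metis
        have val: "restr P u (v (c, g)) = X ?f (Dom C u, Ident D (Fo (Dom C u)))"
          if v: "v \<in> compatible P d" "\<forall>f\<in>R. shift f v = X f" for v
        proof -
          have "X ?f (Dom C u, Ident D (Fo (Dom C u))) = shift ?f v (Dom C u, Ident D (Fo (Dom C u)))"
            using v(2) uD by simp
          also have "\<dots> = v (Dom C u, Cmp D ?f (Ident D (Fo (Dom C u))))"
            by (rule shift_apply[OF fh idover[OF uo]])
          also have "\<dots> = restr P u (v (c, g))"
            using comp_id1[OF D fh] compatible_restr[OF v(1) cg conjunct1[OF uD]] by simp
          finally show ?thesis by simp
        qed
        show "restr P u (z (c, g)) = restr P u (?y (c, g))"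
          using val[of z] val[of ?y] z yc yX by simp
      qed
    qed
  qed
qed

section \<open>Essential surjectivity and the comparison lemma\<close>

text \<open>The preimage of \<open>P\<close> is its Kan extension, transported pointwise along
  bijections onto members of \<open>U\<close>. At the image of \<open>c\<close>, evaluation at the
  identity is bijective, because by full faithfulness a compatible family there consists of the
  restrictions of a single section.\<close>

lemma res_essentially_surjective:
  fixes U :: "'u set set"
  assumes U: "small_sets U"
  shows "essentially_surjective (Sh U D K) (Sh U C J) res_functor"
  unfolding essentially_surjective_def
proof (intro ballI)
  fix P :: "('o1, 'm1, 'u) presheaf" assume "P \<in> Ob (Sh U C J)"
  then have P: "is_sheaf U C J P" by (simp add: Sh_Ob)
  note pP = sheaf_presheaf[OF P]
  \<comment> \<open>\<open>\<beta>\<close> encodes compatible families as elements of a small set,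
    and \<open>\<iota>\<close> below decodes them.\<close>
  obtain V \<beta> where V: "\<And>d. d \<in> Ob D \<Longrightarrow> V d \<in> U" and \<beta>: "\<And>d. d \<in> Ob D \<Longrightarrow> bij_betw (\<beta> d) (compatible P d) (V d)"
    using compatible_small[OF U P] by metis
  define \<iota> where "\<iota> d = inv_into (compatible P d) (\<beta> d)" for d
  have \<iota>: "\<iota> d y \<in> compatible P d" "\<beta> d (\<iota> d y) = y" if "d \<in> Ob D" "y \<in> V d" for d y
    using \<beta>[OF that(1)] that(2) by (auto simp: \<iota>_def bij_betw_def inv_into_into f_inv_into_f)
  have \<beta>m: "\<beta> d x \<in> V d" "\<iota> d (\<beta> d x) = x" if "d \<in> Ob D" "x \<in> compatible P d" for d x
    using \<beta>[OF that(1)] that(2) by (auto simp: \<iota>_def bij_betw_def)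
  define Q :: "('o2, 'm2, 'u) presheaf" where
    "Q = \<lparr>sects = (\<lambda>d\<in>Ob D. V d),
       restr = (\<lambda>h\<in>Ar D. \<lambda>y\<in>V (Cod D h). \<beta> (Dom D h) (shift h (\<iota> (Cod D h) y)))\<rparr>"
  have Qs: "sects Q d = V d" if "d \<in> Ob D" for d using that by (simp add: Q_def)
  have Qr: "restr Q h y = \<beta> e (shift h (\<iota> d y))" if "h \<in> hom D e d" "y \<in> V d" for h e d y
    using that by (simp add: Q_def hom_def)
  have Q\<iota>: "\<iota> e (restr Q h y) = shift h (\<iota> d y)" "restr Q h y \<in> V e" if h: "h \<in> hom D e d" and y: "y \<in> V d" for h e d y
    using Qr[OF h y] \<beta>m shift_compatible[OF \<iota>(1) h] hom_ob[OF D h] y by auto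
  have \<iota>_inj: "y = y'" if "d \<in> Ob D" "y \<in> V d" "y' \<in> V d" "\<iota> d y = \<iota> d y'" for d y y'
    using \<iota>(2) that by metis
  have pQ: "is_presheaf U D Q"
    unfolding is_presheaf_def
  proof (intro conjI ballI allI impI)
    show "sects Q \<in> (\<Pi>\<^sub>E a\<in>Ob D. U)" using V by (auto simp: Q_def)
    show "restr Q \<in> (\<Pi>\<^sub>E f\<in>Ar D. sects Q (Cod D f) \<rightarrow>\<^sub>E sects Q (Dom D f))"
    proof (rule PiE_I)
      fix h assume h: "h \<in> Ar D"
      note hh = Ar_hom[OF h]
      show "restr Q h \<in> sects Q (Cod D h) \<rightarrow>\<^sub>E sects Q (Dom D h)"
        using Q\<iota>(2)[OF hh] hom_ob[OF D hh] h by (intro PiE_I) (auto simp: Qs, auto simp: Q_def)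
    qed (simp add: Q_def)
  next
    fix d y assume d: "d \<in> Ob D" and "y \<in> sects Q d"
    then have y: "y \<in> V d" by (simp add: Qs)
    note i = hom_id[OF D d]
    have "shift (Ident D d) (\<iota> d y) = \<iota> d y"
    proof (rule compatible_eqI[OF shift_compatible[OF \<iota>(1)[OF d y] i] \<iota>(1)[OF d y]])
      fix c g assume cg: "(c, g) \<in> over C D F d"
      show "shift (Ident D d) (\<iota> d y) (c, g) = \<iota> d y (c, g)"
        using shift_apply[OF i cg, of "\<iota> d y"] comp_id2[OF D conjunct2[OF overD[OF cg]]] by simp
    qed
    then show "restr Q (Ident D d) y = y" using Qr[OF i y] \<iota>(2)[OF d y] by simp
  next
    fix f g y assume "f \<in> Ar D" "g \<in> Ar D" "Cod D f = Dom D g" and y': "y \<in> sects Q (Cod D g)"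
    then have f: "f \<in> hom D (Dom D f) (Dom D g)" and g: "g \<in> hom D (Dom D g) (Cod D g)" by (auto simp: hom_def)
    note ob = hom_ob[OF D f] hom_ob[OF D g] and gf = hom_comp[OF D f g]
    have y: "y \<in> V (Cod D g)" using y' ob by (simp add: Qs)
    let ?x = "\<iota> (Cod D g) y"
    have x: "?x \<in> compatible P (Cod D g)" using \<iota>(1) ob y by blast
    have "shift (Cmp D g f) ?x = shift f (shift g ?x)"
    proof (rule compatible_eqI[OF shift_compatible[OF x gf] shift_compatible[OF shift_compatible[OF x g] f]])
      fix c h assume ch: "(c, h) \<in> over C D F (Dom D f)"
      show "shift (Cmp D g f) ?x (c, h) = shift f (shift g ?x) (c, h)"
        using shift_apply[OF gf ch, of ?x] shift_apply[OF f ch, of "shift g ?x"]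
          shift_apply[OF g over_postcomp[OF f ch], of ?x] comp_assoc[OF D conjunct2[OF overD[OF ch]] f g] by simp
    qed
    then show "restr Q (Cmp D g f) y = restr Q f (restr Q g y)"
      using Qr[OF gf y] Qr[OF f Q\<iota>(2)[OF g y]] Q\<iota>(1)[OF g y] by simp
  qed
  have Q: "is_sheaf U D K Q"
    unfolding is_sheaf_def
  proof (intro conjI pQ ballI allI impI)
    fix d R m assume d: "d \<in> Ob D" and R: "R \<in> K d" and m: "matching_family D Q R m"
    note Rs = K_sieve[OF d R]
    let ?X = "\<lambda>f. \<iota> (Dom D f) (m f)"
    have mV: "m f \<in> V (Dom D f)" if "f \<in> R" for f
      using m that hom_ob[OF D sieve_hom[OF Rs that]] by (auto simp: matching_family_def Qs)
    have "\<exists>!y. y \<in> compatible P d \<and> (\<forall>f\<in>R. shift f y = ?X f)"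
    proof (rule compatible_amalgamate[OF P d R])
      show "?X f \<in> compatible P (Dom D f)" if "f \<in> R" for f
        using \<iota>(1)[OF _ mV[OF that]] hom_ob[OF D sieve_hom[OF Rs that]] by blast
      fix f g e assume f: "f \<in> R" and g: "g \<in> hom D e (Dom D f)"
      have "Dom D (Cmp D f g) = e" using hom_comp[OF D g sieve_hom[OF Rs f]] by (simp add: hom_def)
      moreover have "m (Cmp D f g) = restr Q g (m f)" using m f g by (auto simp: matching_family_def hom_def)
      ultimately show "?X (Cmp D f g) = shift g (?X f)" using Q\<iota>(1)[OF g mV[OF f]] by simp
    qed
    then obtain x where x: "x \<in> compatible P d" "\<And>f. f \<in> R \<Longrightarrow> shift f x = ?X f"
      and xu: "\<And>x'. x' \<in> compatible P d \<Longrightarrow> (\<forall>f\<in>R. shift f x' = ?X f) \<Longrightarrow> x' = x" by auto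
    show "\<exists>!y. y \<in> sects Q d \<and> (\<forall>f\<in>R. restr Q f y = m f)"
    proof (rule ex1I[of _ "\<beta> d x"])
      show "\<beta> d x \<in> sects Q d \<and> (\<forall>f\<in>R. restr Q f (\<beta> d x) = m f)"
      proof (intro conjI ballI)
        show "\<beta> d x \<in> sects Q d" using \<beta>m(1)[OF d x(1)] d by (simp add: Qs)
        fix f assume f: "f \<in> R"
        note fh = sieve_hom[OF Rs f]
        have fo: "Dom D f \<in> Ob D" using hom_ob[OF D fh] by blast
        show "restr Q f (\<beta> d x) = m f"
          using Qr[OF fh \<beta>m(1)[OF d x(1)]] \<beta>m(2)[OF d x(1)] x(2)[OF f] \<iota>(2)[OF fo mV[OF f]] by simp
      qed
      fix y assume y: "y \<in> sects Q d \<and> (\<forall>f\<in>R. restr Q f y = m f)"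
      then have yV: "y \<in> V d" using d by (simp add: Qs)
      have "\<iota> d y = x"
        by (rule xu[OF \<iota>(1)[OF d yV]]) (use y Q\<iota>(1)[OF sieve_hom[OF Rs] yV] in \<open>auto\<close>)
      then show "y = \<beta> d x" using \<iota>(2)[OF d yV] by simp
    qed
  qed
  \<comment> \<open>The counit of the Kan extension: a family is evaluated at the identity.\<close>
  let ?t = "\<lambda>c y. \<iota> (Fo c) y (c, Ident D (Fo c))"
  have idover: "(c, Ident D (Fo c)) \<in> over C D F (Fo c)" if "c \<in> Ob C" for c
    using that hom_id[OF D functor_ob[OF F that]] by (simp add: over_def)
  have rs: "sects (res Q) c = V (Fo c)" if "c \<in> Ob C" for c
    using that functor_ob[OF F that] by (simp add: sects_res Qs)
  have n: "is_nat_trans C (res Q) P (\<lambda>c\<in>Ob C. \<lambda>y\<in>sects (res Q) c. ?t c y)"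
  proof (rule nat_transI[OF _ _ C res_presheaf[OF pQ]])
    fix c y assume "c \<in> Ob C" "y \<in> sects (res Q) c"
    then show "?t c y \<in> sects P c"
      using compatible_mem[OF \<iota>(1) idover] functor_ob[OF F] rs by simp
  next
    fix f a b y assume f: "f \<in> hom C a b" and ab: "a \<in> Ob C" "b \<in> Ob C" and y': "y \<in> sects (res Q) b"
    note Ff = functor_hom[OF F f]
    have y: "y \<in> V (Fo b)" using y' ab rs by simp
    have "?t a (restr (res Q) f y) = shift (Fa f) (\<iota> (Fo b) y) (a, Ident D (Fo a))"
      using Q\<iota>(1)[OF Ff y] by (simp add: restr_res[OF f])
    also have "\<dots> = \<iota> (Fo b) y (a, Fa f)"
      using shift_apply[OF Ff idover[OF ab(1)]] comp_id1[OF D Ff] by simp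
    also have "\<dots> = restr P f (?t b y)"
      using compatible_restr[OF \<iota>(1)[OF functor_ob[OF F ab(2)] y] idover[OF ab(2)] f] comp_id2[OF D Ff] by simp
    finally show "?t a (restr (res Q) f y) = restr P f (?t b y)" .
  qed
  have bij: "bij_betw ((\<lambda>c\<in>Ob C. \<lambda>y\<in>sects (res Q) c. ?t c y) c) (sects (res Q) c) (sects P c)" if c: "c \<in> Ob C" for c
  proof -
    note Fc = functor_ob[OF F c]
    have det: "\<iota> (Fo c) y (c', g) = restr P u (?t c y)"
      if "y \<in> V (Fo c)" "u \<in> hom C c' c" "Fa u = g" for y c' u g
      using compatible_restr[OF \<iota>(1)[OF Fc that(1)] idover[OF c] that(2)] comp_id2[OF D functor_hom[OF F that(2)]] that(3)
      by simp
    have "inj_on (?t c) (V (Fo c))"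
    proof (rule inj_onI)
      fix y y' assume y: "y \<in> V (Fo c)" "y' \<in> V (Fo c)" and eq: "?t c y = ?t c y'"
      have "\<iota> (Fo c) y = \<iota> (Fo c) y'"
      proof (rule compatible_eqI[OF \<iota>(1)[OF Fc y(1)] \<iota>(1)[OF Fc y(2)]])
        fix c' g assume "(c', g) \<in> over C D F (Fo c)"
        then obtain u where "u \<in> hom C c' c" "Fa u = g" using preimage c overD by blast
        then show "\<iota> (Fo c) y (c', g) = \<iota> (Fo c) y' (c', g)" using det y eq by simp
      qed
      then show "y = y'" by (rule \<iota>_inj[OF Fc y])
    qed
    moreover have "?t c ` V (Fo c) = sects P c"
    proof
      show "?t c ` V (Fo c) \<subseteq> sects P c" using compatible_mem[OF \<iota>(1)[OF Fc] idover[OF c]] by blast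
      show "sects P c \<subseteq> ?t c ` V (Fo c)"
      proof
        fix p assume p: "p \<in> sects P c"
        \<comment> \<open>The family of all restrictions of \<open>p\<close>; faithfulness makes the
          arrow \<open>u\<close> with a given image unique.\<close>
        define r where "r = (\<lambda>(c', g). restr P (SOME u. u \<in> hom C c' c \<and> Fa u = g) p)"
        have r: "r (c', Fa u) = restr P u p" if "u \<in> hom C c' c" for c' u
        proof -
          have "(SOME u'. u' \<in> hom C c' c \<and> Fa u' = Fa u) = u"
            by (rule some_equality) (use that faithfulD in blast)+
          then show ?thesis by (simp add: r_def)
        qed
        have "restrict r (over C D F (Fo c)) \<in> compatible P (Fo c)"
        proof (rule compatibleI)
          fix c' g assume cg: "(c', g) \<in> over C D F (Fo c)"
          obtain u where u: "u \<in> hom C c' c" "Fa u = g" using preimage[OF _ c] overD[OF cg] by blast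
          show "r (c', g) \<in> sects P c'" using r[OF u(1)] presheaf_restr[OF pP u(1) p] u(2) by simp
          fix c'' v assume v: "v \<in> hom C c'' c'"
          show "restr P v (r (c', g)) = r (c'', Cmp D g (Fa v))"
            using r[OF u(1)] r[OF hom_comp[OF C v u(1)]] functor_comp[OF F v u(1)] presheaf_comp[OF pP v u(1) p] u(2) by simp
        qed
        note rc = \<beta>m[OF Fc this]
        have "?t c (\<beta> (Fo c) (restrict r (over C D F (Fo c)))) = r (c, Fa (Ident C c))"
          using rc(2) idover[OF c] functor_id[OF F c] by simp
        also have "\<dots> = p" using r[OF hom_id[OF C c]] presheaf_id[OF pP c p] by simp
        finally show "p \<in> ?t c ` V (Fo c)" using rc(1) by (metis (no_types, lifting) imageI)
      qed
    qed
    ultimately show ?thesis using c rs[OF c] by (simp add: bij_betw_def inj_on_def image_def)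
  qed
  let ?i = "(res Q, \<lambda>c\<in>Ob C. \<lambda>y\<in>sects (res Q) c. ?t c y, P)"
  have "is_iso (Sh U C J) ?i" by (rule Sh_isoI[OF C res_sheaf[OF Q] P n bij])
  moreover have "?i \<in> hom (Sh U C J) (fob res_functor Q) P"
    using res_sheaf[OF Q] P n by (auto simp: Sh_hom res_functor_def)
  ultimately show "\<exists>Q\<in>Ob (Sh U D K). \<exists>i\<in>hom (Sh U C J) (fob res_functor Q) P. is_iso (Sh U C J) i"
    using Q by (auto simp: Sh_Ob)
qed

theorem comparison_lemma:
  fixes U :: "'u set set"
  assumes "small_sets U"
  shows "equivalent_categories (Sh U D K) (Sh U C J)"
  by (rule equivalent_categoriesI[OF Sh_category[OF D] Sh_category[OF C] res_is_functor res_full res_faithful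
        res_essentially_surjective[OF assms]])

end

section \<open>Translations of theories\<close>

lemma map_tm_tsubst: "map_tm hf (tsubst \<sigma> t) = tsubst (\<lambda>i. map_tm hf (\<sigma> i)) (map_tm hf t)"
  by (induction t) auto

lemma map_tm_lift: "map_tm hf (lift \<sigma> i) = lift (\<lambda>i. map_tm hf (\<sigma> i)) i"
  by (auto simp: lift_def map_tm_tsubst split: nat.split)

lemma map_fm_fsubst:
  "map_fm hs hf hr (fsubst \<sigma> \<phi>) = fsubst (\<lambda>i. map_tm hf (\<sigma> i)) (map_fm hs hf hr \<phi>)"
  by (induction \<phi> arbitrary: \<sigma>) (auto simp: map_tm_tsubst map_tm_lift)

lemma map_tm_vars: "map (map_tm hf) (vars k n) = vars k n"
  by (rule nth_equalityI) auto

lemma map_fm_conj: "map_fm hs hf hr (conj \<phi>s) = conj (map (map_fm hs hf hr) \<phi>s)"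
  by (induction \<phi>s) (auto simp: conj_def)

lemma map_fm_disj: "map_fm hs hf hr (disj \<phi>s) = disj (map (map_fm hs hf hr) \<phi>s)"
  by (induction \<phi>s) (auto simp: disj_def)

lemma map_fm_eqs:
  "map_fm hs hf hr (eqs ts us) = eqs (map (map_tm hf) ts) (map (map_tm hf) us)"
  by (auto simp: eqs_def map_fm_conj zip_map_map intro!: arg_cong[of _ _ conj])

lemma map_fm_exs: "map_fm hs hf hr (exs \<Delta> \<phi>) = exs (map hs \<Delta>) (map_fm hs hf hr \<phi>)"
  unfolding exs_def by (induction \<Delta> arbitrary: \<phi>) auto

lemma syn_arrow_eq_iff:
  assumes "fm_in_ctx (sig T) (fst A @ fst B) \<theta>'"
  shows "syn_arrow T A \<theta> B = syn_arrow T A \<theta>' B \<longleftrightarrow>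
    prov T (fst A @ fst B) \<theta> \<theta>' \<and> prov T (fst A @ fst B) \<theta>' \<theta>"
proof
  assume "syn_arrow T A \<theta> B = syn_arrow T A \<theta>' B"
  then have "{\<chi>. prov T (fst A @ fst B) \<theta> \<chi> \<and> prov T (fst A @ fst B) \<chi> \<theta>} =
      {\<chi>. prov T (fst A @ fst B) \<theta>' \<chi> \<and> prov T (fst A @ fst B) \<chi> \<theta>'}"
    by (simp add: syn_arrow_def)
  moreover have "\<theta>' \<in> {\<chi>. prov T (fst A @ fst B) \<theta>' \<chi> \<and> prov T (fst A @ fst B) \<chi> \<theta>'}"
    using prov.ident[OF assms] by simp
  ultimately show "prov T (fst A @ fst B) \<theta> \<theta>' \<and> prov T (fst A @ fst B) \<theta>' \<theta>" by blast
next
  assume "prov T (fst A @ fst B) \<theta> \<theta>' \<and> prov T (fst A @ fst B) \<theta>' \<theta>"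
  then show "syn_arrow T A \<theta> B = syn_arrow T A \<theta>' B"
    by (auto simp: syn_arrow_def intro: prov.cut)
qed

context coherent
begin

lemma coherent_topology_up:
  assumes "B \<in> Ob C" "R \<in> coherent_topology T B" "R \<subseteq> Z" "is_sieve C B Z"
  shows "Z \<in> coherent_topology T B"
  using assms by (auto simp: coherent_topology_iff)

end

text \<open>The symbol types of the theories may differ and the maps are arbitrary, so that renamed
  copies, logically equivalent theories and Morita extensions are all instances.\<close>

locale translation = T1: coherent T1 + T2: coherent T2
  for T1 :: "('s1, 'f1, 'r1) coh_theory" and T2 :: "('s2, 'f2, 'r2) coh_theory" +
  fixes hs :: "'s1 \<Rightarrow> 's2" and hf :: "'f1 \<Rightarrow> 'f2" and hr :: "'r1 \<Rightarrow> 'r2"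
  assumes trans_ctx: "fm_in_ctx (sig T1) \<Gamma> \<phi> \<Longrightarrow> fm_in_ctx (sig T2) (map hs \<Gamma>) (map_fm hs hf hr \<phi>)"
    and conservative: "fm_in_ctx (sig T1) \<Gamma> \<phi> \<Longrightarrow> fm_in_ctx (sig T1) \<Gamma> \<psi> \<Longrightarrow>
      prov T2 (map hs \<Gamma>) (map_fm hs hf hr \<phi>) (map_fm hs hf hr \<psi>) \<longleftrightarrow> prov T1 \<Gamma> \<phi> \<psi>"
    and surjective: "set \<Gamma> \<subseteq> sorts (sig T1) \<Longrightarrow> fm_in_ctx (sig T2) (map hs \<Gamma>) \<theta> \<Longrightarrow>
      \<exists>\<chi>. fm_in_ctx (sig T1) \<Gamma> \<chi> \<and> prov T2 (map hs \<Gamma>) (map_fm hs hf hr \<chi>) \<theta> \<and>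
        prov T2 (map hs \<Gamma>) \<theta> (map_fm hs hf hr \<chi>)"
    and covered: "B \<in> Ob (syn_cat T2) \<Longrightarrow>
      \<exists>G. finite G \<and> (\<forall>(A, g)\<in>G. A \<in> Ob (syn_cat T1) \<and>
          g \<in> hom (syn_cat T2) (map hs (fst A), map_fm hs hf hr (snd A)) B) \<and>
        T2.covers B (snd ` G)"
begin

abbreviation "h \<equiv> map_fm hs hf hr"

section \<open>The functor of syntactic categories induced by a translation\<close>

definition tr :: "('s1, 'f1, 'r1) syn_ob \<Rightarrow> ('s2, 'f2, 'r2) syn_ob" where
  "tr A = (map hs (fst A), h (snd A))"

lemma fst_tr: "fst (tr A) = map hs (fst A)" and snd_tr: "snd (tr A) = h (snd A)"
  by (simp_all add: tr_def)

text \<open>The translations of the members of a class need not form a whole class of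
  \<open>T2\<close>, so one representative is translated and its class is taken there.
  \<open>far_syn_arrow\<close> shows that the choice is immaterial.\<close>

definition tr_functor :: "(('s1, 'f1, 'r1) syn_ob, ('s1, 'f1, 'r1) syn_ar, ('s2, 'f2, 'r2) syn_ob, ('s2, 'f2, 'r2) syn_ar) functr"
  where "tr_functor = \<lparr>fob = tr, far = (\<lambda>(A, p, B). syn_arrow T2 (tr A) (h (SOME \<theta>. \<theta> \<in> p)) (tr B))\<rparr>"

abbreviation "C1 \<equiv> syn_cat T1"
abbreviation "C2 \<equiv> syn_cat T2"

lemma tr_Ob: "A \<in> Ob C1 \<Longrightarrow> tr A \<in> Ob C2"
  using trans_ctx by (auto simp: Ob_syn_cat tr_def)

text \<open>The well-formedness assumption confines attention to indices inside \<open>ts\<close>;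
  beyond the list the two substitutions may differ.\<close>

lemma h_inst:
  assumes "fm_in_ctx (sig T1) \<Gamma> \<phi>" "length ts = length \<Gamma>"
  shows "h (inst \<phi> ts) = inst (h \<phi>) (map (map_tm hf) ts)"
  unfolding inst_def map_fm_fsubst
  by (rule fsubst_cong[of "sig T2" "map hs \<Gamma>"]) (use assms trans_ctx in \<open>auto simp: fm_in_ctx_def\<close>)

text \<open>Each defining sequent over \<open>T2\<close> is the translation of the corresponding
  sequent over \<open>T1\<close>, so conservativity gives both directions.\<close>

lemma functional_tr_iff:
  assumes A: "A \<in> Ob C1" and B: "B \<in> Ob C1" and \<theta>: "fm_in_ctx (sig T1) (fst A @ fst B) \<theta>"
  shows "functional_fm T2 (tr A) (h \<theta>) (tr B) \<longleftrightarrow> functional_fm T1 A \<theta> B"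
proof -
  obtain \<Gamma> \<phi> \<Delta> \<psi> where AB: "A = (\<Gamma>, \<phi>)" "B = (\<Delta>, \<psi>)" by (metis surj_pair)
  let ?n = "length \<Gamma>" and ?m = "length \<Delta>"
  have wf: "set \<Gamma> \<subseteq> sorts (sig T1)" "set \<Delta> \<subseteq> sorts (sig T1)" "wf_fm (sig T1) \<Gamma> \<phi>" "wf_fm (sig T1) \<Delta> \<psi>"
    "wf_fm (sig T1) (\<Gamma> @ \<Delta>) \<theta>"
    using A B \<theta> AB by (auto simp: Ob_syn_cat fm_in_ctx_def)
  have f: "fm_in_ctx (sig T1) \<Gamma> \<phi>" "fm_in_ctx (sig T1) \<Delta> \<psi>" "fm_in_ctx (sig T1) (\<Gamma> @ \<Delta>) \<theta>"
    using wf by (auto simp: fm_in_ctx_def)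
  let ?r1 = "And (inst \<phi> (vars 0 ?n)) (inst \<psi> (vars ?n ?m))"
  let ?r2 = "exs \<Delta> (inst \<theta> (vars ?m ?n @ vars 0 ?m))"
  let ?l3 = "And (inst \<theta> (vars 0 ?n @ vars ?n ?m)) (inst \<theta> (vars 0 ?n @ vars (?n + ?m) ?m))"
  let ?r3 = "eqs (vars ?n ?m) (vars (?n + ?m) ?m) :: ('s1, 'f1, 'r1) fm"
  have w: "fm_in_ctx (sig T1) (\<Gamma> @ \<Delta>) ?r1" "fm_in_ctx (sig T1) \<Gamma> ?r2"
    "fm_in_ctx (sig T1) (\<Gamma> @ \<Delta> @ \<Delta>) ?l3" "fm_in_ctx (sig T1) (\<Gamma> @ \<Delta> @ \<Delta>) ?r3"
    using wf
    by (auto simp: fm_in_ctx_def wf_exs wf_eqs wt_Var_iff nth_append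
        intro!: wf_inst_fm[OF wf(3)] wf_inst_fm[OF wf(4)] wf_inst_fm[OF wf(5)] list_all2_appendI wt_vars)
  have e: "h ?r1 = And (inst (h \<phi>) (vars 0 ?n)) (inst (h \<psi>) (vars ?n ?m))"
    "h ?r2 = exs (map hs \<Delta>) (inst (h \<theta>) (vars ?m ?n @ vars 0 ?m))"
    "h ?l3 = And (inst (h \<theta>) (vars 0 ?n @ vars ?n ?m)) (inst (h \<theta>) (vars 0 ?n @ vars (?n + ?m) ?m))"
    "h ?r3 = eqs (vars ?n ?m) (vars (?n + ?m) ?m)"
    by (simp_all add: h_inst[OF f(1)] h_inst[OF f(2)] h_inst[OF f(3)] map_fm_exs map_fm_eqs map_tm_vars)
  show ?thesis
    using conservative[OF f(3) w(1)] conservative[OF f(1) w(2)] conservative[OF w(3,4)] trans_ctx[OF f(3)] f(3)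
    unfolding functional_fm_def AB tr_def e by (simp add: Let_def)
qed

lemma syn_arrow_tr_cong:
  assumes "fm_in_ctx (sig T1) (fst A @ fst B) \<theta>" "fm_in_ctx (sig T1) (fst A @ fst B) \<theta>'"
  shows "syn_arrow T2 (tr A) (h \<theta>) (tr B) = syn_arrow T2 (tr A) (h \<theta>') (tr B) \<longleftrightarrow>
    syn_arrow T1 A \<theta> B = syn_arrow T1 A \<theta>' B"
proof -
  show ?thesis
    using syn_arrow_eq_iff[OF assms(2)] syn_arrow_eq_iff[of T2 "tr A" "tr B" "h \<theta>'" "h \<theta>"] trans_ctx[OF assms(2)]
      conservative[OF assms] conservative[OF assms(2,1)] by (simp add: tr_def)
qed

lemma far_syn_arrow:
  assumes "fm_in_ctx (sig T1) (fst A @ fst B) \<theta>"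
  shows "far tr_functor (syn_arrow T1 A \<theta> B) = syn_arrow T2 (tr A) (h \<theta>) (tr B)"
proof -
  let ?p = "{\<theta>'. prov T1 (fst A @ fst B) \<theta> \<theta>' \<and> prov T1 (fst A @ fst B) \<theta>' \<theta>}"
  let ?\<theta> = "SOME \<theta>'. \<theta>' \<in> ?p"
  have "\<theta> \<in> ?p" using prov.ident[OF assms] by simp
  then have p: "?\<theta> \<in> ?p" by (rule someI)
  then have ctx: "fm_in_ctx (sig T1) (fst A @ fst B) ?\<theta>"
    using prov_fm_in_ctx[OF T1.coherent] by blast
  have "syn_arrow T1 A ?\<theta> B = syn_arrow T1 A \<theta> B"
    using p by (auto simp: syn_arrow_def intro: prov.cut)
  then have "syn_arrow T2 (tr A) (h ?\<theta>) (tr B) = syn_arrow T2 (tr A) (h \<theta>) (tr B)"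
    using syn_arrow_tr_cong[OF ctx assms] by blast
  then show ?thesis by (simp add: tr_functor_def syn_arrow_def)
qed

lemma far_hom:
  assumes "f \<in> hom C1 A B"
  obtains \<theta> where "f = syn_arrow T1 A \<theta> B" "far tr_functor f = syn_arrow T2 (tr A) (h \<theta>) (tr B)"
    "fm_in_ctx (sig T1) (fst A @ fst B) \<theta>" "functional_fm T1 A \<theta> B" "functional_fm T2 (tr A) (h \<theta>) (tr B)"
    "far tr_functor f \<in> hom C2 (tr A) (tr B)"
proof -
  from assms obtain \<theta> where \<theta>: "functional_fm T1 A \<theta> B" "f = syn_arrow T1 A \<theta> B" "A \<in> Ob C1" "B \<in> Ob C1"
    by (rule T1.homE)
  have c: "fm_in_ctx (sig T1) (fst A @ fst B) \<theta>" using T1.functional_fm_ctx \<theta>(1) by blast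
  have "functional_fm T2 (tr A) (h \<theta>) (tr B)" using functional_tr_iff[OF \<theta>(3,4) c] \<theta>(1) by blast
  then show thesis
    using that[OF \<theta>(2) _ c \<theta>(1)] far_syn_arrow[OF c] \<theta> tr_Ob by (auto simp: hom_syn_cat)
qed

lemma tr_is_functor: "is_functor C1 C2 tr_functor"
  unfolding is_functor_def
proof (intro conjI ballI impI)
  show "fob tr_functor A \<in> Ob C2" if "A \<in> Ob C1" for A
    using tr_Ob that by (simp add: tr_functor_def)
  show "far tr_functor f \<in> hom C2 (fob tr_functor (Dom C1 f)) (fob tr_functor (Cod C1 f))" if "f \<in> Ar C1" for f
  proof -
    have f: "f \<in> hom C1 (Dom C1 f) (Cod C1 f)" by (rule Ar_hom[OF that])
    have "fob tr_functor = tr" by (simp add: tr_functor_def)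
    then show ?thesis by (auto intro: far_hom[OF f])
  qed
  show "far tr_functor (Ident C1 A) = Ident C2 (fob tr_functor A)" if A: "A \<in> Ob C1" for A
  proof -
    let ?n = "length (fst A)"
    have f: "fm_in_ctx (sig T1) (fst A) (snd A)" using A by (simp add: Ob_syn_cat)
    let ?\<theta> = "And (inst (snd A) (vars 0 ?n)) (eqs (vars 0 ?n) (vars ?n ?n))"
    have "fm_in_ctx (sig T1) (fst A @ fst A) ?\<theta>"
      using f by (auto simp: fm_in_ctx_def wf_eqs wt_Var_iff nth_append intro!: wf_inst_fm[of _ "fst A"] wt_vars)
    from far_syn_arrow[OF this] show ?thesis
      by (simp add: Ident_syn_cat tr_functor_def fst_tr snd_tr h_inst[OF f] map_fm_eqs map_tm_vars)
  qed
  fix f g assume "f \<in> Ar C1" "g \<in> Ar C1" "Cod C1 f = Dom C1 g"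
  then obtain A B E where f: "f \<in> hom C1 A B" and g: "g \<in> hom C1 B E" by (auto simp: hom_def)
  from f obtain \<theta> where \<theta>: "f = syn_arrow T1 A \<theta> B" "far tr_functor f = syn_arrow T2 (tr A) (h \<theta>) (tr B)"
    "fm_in_ctx (sig T1) (fst A @ fst B) \<theta>" "functional_fm T2 (tr A) (h \<theta>) (tr B)"
    "far tr_functor f \<in> hom C2 (tr A) (tr B)" by (rule far_hom)
  from g obtain \<chi> where \<chi>: "g = syn_arrow T1 B \<chi> E" "far tr_functor g = syn_arrow T2 (tr B) (h \<chi>) (tr E)"
    "fm_in_ctx (sig T1) (fst B @ fst E) \<chi>" "functional_fm T2 (tr B) (h \<chi>) (tr E)"
    "far tr_functor g \<in> hom C2 (tr B) (tr E)" by (rule far_hom)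
  let ?\<omega> = "comp_fm (fst A) (fst B) (fst E) \<theta> \<chi>"
  have eq: "h ?\<omega> = comp_fm (fst (tr A)) (fst (tr B)) (fst (tr E)) (h \<theta>) (h \<chi>)"
    by (simp add: comp_fm_def Let_def map_fm_exs h_inst[OF \<theta>(3)] h_inst[OF \<chi>(3)] map_tm_vars fst_tr)
  have "far tr_functor (Cmp C1 g f) = syn_arrow T2 (tr A) (h ?\<omega>) (tr E)"
    using T1.Cmp_syn_arrow[OF f g \<theta>(1,3) \<chi>(1,3)] far_syn_arrow[OF T1.graph_comp_fm(1)[OF \<theta>(3) \<chi>(3)]] by simp
  also have "\<dots> = Cmp C2 (far tr_functor g) (far tr_functor f)"
    using T2.Cmp_syn_arrow[OF \<theta>(5) \<chi>(5) \<theta>(2) T2.functional_fm_ctx[OF \<theta>(4)] \<chi>(2) T2.functional_fm_ctx[OF \<chi>(4)]]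
    by (simp add: eq)
  finally show "far tr_functor (Cmp C1 g f) = Cmp C2 (far tr_functor g) (far tr_functor f)" .
qed

text \<open>By surjectivity on translated contexts, the formula of an arrow may be replaced by a
  provably equivalent translated one without changing its class; conservativity makes the
  untranslated formula functional.\<close>

lemma tr_full: "full C1 C2 tr_functor"
  unfolding full_def
proof (intro ballI)
  fix A B g assume A: "A \<in> Ob C1" and B: "B \<in> Ob C1" and "g \<in> hom C2 (fob tr_functor A) (fob tr_functor B)"
  then have g: "g \<in> hom C2 (tr A) (tr B)" by (simp add: tr_functor_def)
  then obtain \<theta> where \<theta>: "functional_fm T2 (tr A) \<theta> (tr B)" "g = syn_arrow T2 (tr A) \<theta> (tr B)"
    by (rule T2.homE)
  note c = T2.functional_fm_ctx[OF \<theta>(1)]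
  have "set (fst A @ fst B) \<subseteq> sorts (sig T1)" using A B by (auto simp: Ob_syn_cat fm_in_ctx_def)
  from surjective[OF this, of \<theta>] c obtain \<chi> where \<chi>: "fm_in_ctx (sig T1) (fst A @ fst B) \<chi>"
    "prov T2 (fst (tr A) @ fst (tr B)) (h \<chi>) \<theta>" "prov T2 (fst (tr A) @ fst (tr B)) \<theta> (h \<chi>)"
    by (auto simp: fst_tr)
  have hc: "fm_in_ctx (sig T2) (fst (tr A) @ fst (tr B)) (h \<chi>)" using \<chi>(2) by (simp add: T2.prov_iff)
  have gr: "graph_fm M (tr A) (h \<chi>) (tr B) = graph_fm M (tr A) \<theta> (tr B)" if "M \<in> models T2" for M
    using \<chi>(2,3) that unfolding T2.prov_iff by (auto simp: graph_fm_def tup_appendI)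
  have "functional_fm T2 (tr A) (h \<chi>) (tr B)"
    using \<theta>(1) hc gr tr_Ob A B by (simp add: T2.functional_fm_iff)
  then have "functional_fm T1 A \<chi> B" using functional_tr_iff[OF A B \<chi>(1)] by blast
  then have "syn_arrow T1 A \<chi> B \<in> hom C1 A B" using A B by (auto simp: hom_syn_cat)
  moreover have "far tr_functor (syn_arrow T1 A \<chi> B) = g"
    using far_syn_arrow[OF \<chi>(1)] T2.syn_arrow_eqI[OF hc c gr] \<theta>(2) by simp
  ultimately show "\<exists>f\<in>hom C1 A B. far tr_functor f = g" by blast
qed

lemma tr_faithful: "faithful C1 tr_functor"
  unfolding faithful_def
proof (intro allI ballI impI)
  fix A B f f' assume f: "f \<in> hom C1 A B" and f': "f' \<in> hom C1 A B" and eq: "far tr_functor f = far tr_functor f'"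
  from f obtain \<theta> where \<theta>: "f = syn_arrow T1 A \<theta> B" "far tr_functor f = syn_arrow T2 (tr A) (h \<theta>) (tr B)"
    "fm_in_ctx (sig T1) (fst A @ fst B) \<theta>" by (rule far_hom)
  from f' obtain \<theta>' where \<theta>': "f' = syn_arrow T1 A \<theta>' B" "far tr_functor f' = syn_arrow T2 (tr A) (h \<theta>') (tr B)"
    "fm_in_ctx (sig T1) (fst A @ fst B) \<theta>'" by (rule far_hom)
  show "f = f'" using syn_arrow_tr_cong[OF \<theta>(3) \<theta>'(3)] eq \<theta> \<theta>' by simp
qed

text \<open>A finite family covers when a single sequent is derivable, and the sequent for the image
  family is the translation of the sequent for \<open>G\<close>.\<close>

lemma covers_tr_iff:
  assumes B: "B \<in> Ob C1" and G: "finite G" "G \<subseteq> {g \<in> Ar C1. Cod C1 g = B}"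
  shows "T2.covers (tr B) (far tr_functor ` G) \<longleftrightarrow> T1.covers B G"
proof -
  have "\<exists>A \<theta>. g = syn_arrow T1 A \<theta> B \<and> A \<in> Ob C1 \<and> functional_fm T1 A \<theta> B" if "g \<in> G" for g
  proof -
    have "g \<in> hom C1 (Dom C1 g) B" using G(2) that by (auto simp: hom_def)
    then show ?thesis by (blast elim: T1.homE)
  qed
  then obtain a t where at: "\<And>g. g \<in> G \<Longrightarrow> g = syn_arrow T1 (a g) (t g) B \<and> a g \<in> Ob C1 \<and> functional_fm T1 (a g) (t g) B"
    by metis
  obtain gs where gs: "set gs = G" using finite_list[OF G(1)] by blast
  let ?fam = "map (\<lambda>g. (a g, t g)) gs"
  let ?fam2 = "map (\<lambda>g. (tr (a g), h (t g))) gs"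
  have c: "fm_in_ctx (sig T1) (fst (a g) @ fst B) (t g)" if "g \<in> G" for g
    using at[OF that] T1.functional_fm_ctx by blast
  have fam: "\<forall>(A, \<theta>)\<in>set ?fam. A \<in> Ob C1 \<and> functional_fm T1 A \<theta> B" using at gs by simp
  have fam2: "\<forall>(A, \<theta>)\<in>set ?fam2. A \<in> Ob C2 \<and> functional_fm T2 A \<theta> (tr B)"
    using at gs tr_Ob functional_tr_iff[OF _ B c] by simp
  have im: "(\<lambda>(A, \<theta>). syn_arrow T1 A \<theta> B) ` set ?fam = G"
    using at gs by (force simp: image_image)
  have "far tr_functor g = syn_arrow T2 (tr (a g)) (h (t g)) (tr B)" if "g \<in> G" for g
    using far_syn_arrow[OF c[OF that]] at[OF that] by metis
  then have im2: "(\<lambda>(A, \<theta>). syn_arrow T2 A \<theta> (tr B)) ` set ?fam2 = far tr_functor ` G"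
    using gs by (auto simp: image_image)
  let ?\<delta> = "disj (map (\<lambda>(A, \<theta>). exs (fst A) \<theta>) ?fam)"
  have d: "h ?\<delta> = disj (map (\<lambda>(A, \<theta>). exs (fst A) \<theta>) ?fam2)"
    by (simp add: map_fm_disj map_fm_exs fst_tr comp_def)
  have "fm_in_ctx (sig T1) (fst B) (snd B)" "fm_in_ctx (sig T1) (fst B) ?\<delta>"
    using B c gs by (auto simp: Ob_syn_cat fm_in_ctx_def wf_disj wf_exs)
  from conservative[OF this] show ?thesis
    using T1.covers_iff_prov[OF B fam] T2.covers_iff_prov[OF tr_Ob[OF B] fam2]
    unfolding im im2 d by (simp add: fst_tr snd_tr)
qed

lemma covering_tr_iff:
  assumes A: "A \<in> Ob C1" and S: "is_sieve C1 A S"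
  shows "S \<in> coherent_topology T1 A \<longleftrightarrow> gen C2 (far tr_functor ` S) \<in> coherent_topology T2 (tr A)"
proof -
  have Fh: "far tr_functor s \<in> hom C2 (tr (Dom C1 s)) (tr A)" if "s \<in> S" for s
    using sieve_hom[OF S that] by (auto elim: far_hom)
  have gs: "is_sieve C2 (tr A) (gen C2 (far tr_functor ` S))"
    by (rule gen_sieve[OF T2.syn_cat_category]) (use Fh hom_Ar in \<open>fastforce\<close>)
  have sub: "far tr_functor ` S \<subseteq> gen C2 (far tr_functor ` S)"
    using gen_self[OF T2.syn_cat_category _ Fh] by blast
  show ?thesis
  proof
    assume "S \<in> coherent_topology T1 A"
    then obtain G where G: "G \<subseteq> S" "T1.covers A G" using T1.coherent_topology_iff[OF A] by blast
    have "T2.covers (tr A) (far tr_functor ` G)"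
      using covers_tr_iff[OF A T1.covers_finite[OF G(2)]] G unfolding T1.covers_def by blast
    then show "gen C2 (far tr_functor ` S) \<in> coherent_topology T2 (tr A)"
      unfolding T2.coherent_topology_iff[OF tr_Ob[OF A]]
      using gs image_mono[OF G(1), of "far tr_functor"] sub by (intro conjI exI[of _ "far tr_functor ` G"]) auto
  next
    assume "gen C2 (far tr_functor ` S) \<in> coherent_topology T2 (tr A)"
    then obtain G where G: "G \<subseteq> gen C2 (far tr_functor ` S)" "T2.covers (tr A) G"
      using T2.coherent_topology_iff[OF tr_Ob[OF A]] by blast
    \<comment> \<open>Each arrow of the cover factors through the image of some \<open>s\<close> in
      \<open>S\<close>. The images of these finitely many \<open>s\<close> cover as well, since
      their graphs reach at least the same elements.\<close>
    have "\<exists>s\<in>S. \<exists>k. k \<in> hom C2 (Dom C2 k) (tr (Dom C1 s)) \<and> g = Cmp C2 (far tr_functor s) k" if "g \<in> G" for g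
    proof -
      have "g \<in> gen C2 (far tr_functor ` S)" using that G(1) by blast
      then obtain s k where s: "s \<in> S" "k \<in> hom C2 (Dom C2 k) (Dom C2 (far tr_functor s))" "g = Cmp C2 (far tr_functor s) k"
        by (blast elim: genE)
      then show ?thesis using hom_Ar[OF Fh[OF s(1)]] by metis
    qed
    then obtain s k where s: "\<And>g. g \<in> G \<Longrightarrow> s g \<in> S"
      and k: "\<And>g. g \<in> G \<Longrightarrow> k g \<in> hom C2 (Dom C2 (k g)) (tr (Dom C1 (s g))) \<and> g = Cmp C2 (far tr_functor (s g)) (k g)"
      by metis
    have fin: "finite (s ` G)" using T2.covers_finite[OF G(2)] by simp
    have "T2.covers (tr A) (far tr_functor ` s ` G)"
      unfolding T2.covers_def
    proof (intro conjI ballI)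
      show "far tr_functor ` s ` G \<subseteq> {g \<in> Ar C2. Cod C2 g = tr A}"
        using Fh[OF s] by (auto simp: hom_def)
      fix M b assume M: "M \<in> models T2" and b: "b \<in> ext M (tr A)"
      obtain g x where g: "g \<in> G" "(x, b) \<in> graph M g" using T2.coversD[OF G(2) M b] by blast
      have "graph M g = graph M (k g) O graph M (far tr_functor (s g))"
        using T2.Cmp_hom(2)[OF conjunct1[OF k[OF g(1)]] Fh[OF s[OF g(1)]] M] k[OF g(1)] by metis
      then show "\<exists>g\<in>far tr_functor ` s ` G. \<exists>a. (a, b) \<in> graph M g" using g by blast
    qed (use fin in simp)
    then have "T1.covers A (s ` G)"
      using covers_tr_iff[OF A fin] s S unfolding is_sieve_def by blast
    then show "S \<in> coherent_topology T1 A"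
      using T1.coherent_topology_iff[OF A] S s by blast
  qed
qed

sublocale dense_functor C1 C2 tr_functor "coherent_topology T1" "coherent_topology T2"
proof
  show "is_category C1" "is_category C2" by (rule T1.syn_cat_category T2.syn_cat_category)+
  show "is_functor C1 C2 tr_functor" by (rule tr_is_functor)
  show "full C1 C2 tr_functor" by (rule tr_full)
  show "faithful C1 tr_functor" by (rule tr_faithful)
  show "is_sieve C1 A S" if "A \<in> Ob C1" "S \<in> coherent_topology T1 A" for A S
    using that by (simp add: coherent_topology_def)
  show "is_sieve C2 B R" if "B \<in> Ob C2" "R \<in> coherent_topology T2 B" for B R
    using that by (simp add: coherent_topology_def)
  show "Z \<in> coherent_topology T2 B"
    if "B \<in> Ob C2" "R \<in> coherent_topology T2 B" "R \<subseteq> Z" "is_sieve C2 B Z" for B R Z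
    by (rule T2.coherent_topology_up[OF that])
  show "pull C2 f R \<in> coherent_topology T2 E" if "R \<in> coherent_topology T2 B" "f \<in> hom C2 E B" for R B f E
    by (rule T2.coherent_topology_pull[OF that])
  show "Z \<in> coherent_topology T2 B"
    if "B \<in> Ob C2" "R \<in> coherent_topology T2 B" "is_sieve C2 B Z"
      "\<And>r. r \<in> R \<Longrightarrow> pull C2 r Z \<in> coherent_topology T2 (Dom C2 r)" for B R Z
    using T2.coherent_topology_trans that by blast
  show "S \<in> coherent_topology T1 A \<longleftrightarrow> gen C2 (far tr_functor ` S) \<in> coherent_topology T2 (fob tr_functor A)"
    if "A \<in> Ob C1" "is_sieve C1 A S" for A S
    using covering_tr_iff[OF that] by (simp add: tr_functor_def)
  show "\<exists>G. finite G \<and> G \<subseteq> over C1 C2 tr_functor B \<and> gen C2 (snd ` G) \<in> coherent_topology T2 B" if B: "B \<in> Ob C2" for B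
  proof -
    from covered[OF B] obtain G where G: "finite G" "\<forall>(A, g)\<in>G. A \<in> Ob C1 \<and> g \<in> hom C2 (tr A) B" "T2.covers B (snd ` G)"
      unfolding tr_def by blast
    have o: "G \<subseteq> over C1 C2 tr_functor B" using G(2) by (auto simp: over_def tr_functor_def)
    have gh: "g \<in> hom C2 (Dom C2 g) B" if "g \<in> snd ` G" for g
      using G(2) that hom_Ar by fastforce
    have "snd ` G \<subseteq> gen C2 (snd ` G)" using gen_self[OF T2.syn_cat_category _ gh] by blast
    then have "gen C2 (snd ` G) \<in> coherent_topology T2 B"
      using T2.coherent_topology_iff[OF B] gen_sieve[OF T2.syn_cat_category gh] G(3) by blast
    then show ?thesis using G(1) o by blast
  qed
qed

theorem equivalent_toposes:
  fixes U :: "'u set set"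
  assumes "small_sets U"
  shows "equivalent_categories (classifying_topos U T2) (classifying_topos U T1)"
  unfolding classifying_topos_def by (rule comparison_lemma[OF assms])

end

section \<open>Definability along charts\<close>

text \<open>A relation between two tuples remains definable when its arguments are read off two
  blocks of a larger context, starting at \<open>k\<close> and \<open>l\<close>.\<close>

lemma definable_blocks:
  assumes X: "definable \<Sigma> \<M> (\<Gamma> @ \<Delta>) (\<lambda>M z. Y M (take (length \<Gamma>) z) (drop (length \<Gamma>) z))"
    and E: "set E \<subseteq> sorts \<Sigma>" and k: "k + length \<Gamma> \<le> length E" "take (length \<Gamma>) (drop k E) = \<Gamma>"
    and l: "l + length \<Delta> \<le> length E" "take (length \<Delta>) (drop l E) = \<Delta>"
  shows "definable \<Sigma> \<M> E (\<lambda>M z. Y M (take (length \<Gamma>) (drop k z)) (take (length \<Delta>) (drop l z)))"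
proof (rule definable_cong[OF definable_sub[OF X E, of "[k..<k + length \<Gamma>] @ [l..<l + length \<Delta>]"]])
  fix i assume i: "i < length (\<Gamma> @ \<Delta>)"
  show "([k..<k + length \<Gamma>] @ [l..<l + length \<Delta>]) ! i < length E \<and>
      E ! (([k..<k + length \<Gamma>] @ [l..<l + length \<Delta>]) ! i) = (\<Gamma> @ \<Delta>) ! i"
  proof (cases "i < length \<Gamma>")
    case True
    then have "E ! (k + i) = \<Gamma> ! i" using arg_cong[OF k(2), of "\<lambda>xs. xs ! i"] k(1) by simp
    then show ?thesis using True k(1) by (simp add: nth_append)
  next
    case False
    then have "E ! (l + (i - length \<Gamma>)) = \<Delta> ! (i - length \<Gamma>)"
      using arg_cong[OF l(2), of "\<lambda>xs. xs ! (i - length \<Gamma>)"] l(1) i by simp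
    then show ?thesis using False l(1) i by (simp add: nth_append)
  qed
qed (use k(1) l(1) in \<open>auto simp: map_nth_upt tup_length\<close>)

type_synonym ('s, 'f, 'r) chart = "'s list \<times> ('s, 'f, 'r) fm"

text \<open>A chart for a sort \<open>S\<close> is a partial map \<open>\<Delta> \<rightharpoonup> S\<close> given by a formula in context \<open>\<Delta> @ [S]\<close>; \<open>dec\<close> is its
  graph, and \<open>decs\<close> is the graph of a product of charts.\<close>

definition dec :: "('s, 'f, 'r, 'm) struct \<Rightarrow> ('s, 'f, 'r) chart \<Rightarrow> 'm list \<Rightarrow> 'm \<Rightarrow> bool" where
  "dec M k x y \<longleftrightarrow> sat M ((!) (x @ [y])) (snd k)"

fun decs :: "('s, 'f, 'r, 'm) struct \<Rightarrow> ('s, 'f, 'r) chart list \<Rightarrow> 'm list \<Rightarrow> 'm list \<Rightarrow> bool" where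
  "decs M [] x ys \<longleftrightarrow> x = [] \<and> ys = []"
| "decs M (k # ks) x ys \<longleftrightarrow> (\<exists>y ys'. ys = y # ys' \<and> dec M k (take (length (fst k)) x) y \<and>
     decs M ks (drop (length (fst k)) x) ys')"

definition cx :: "('s, 'f, 'r) chart list \<Rightarrow> 's list" where
  "cx ks = concat (map fst ks)"

lemma cx_simps [simp]: "cx [] = []" "cx (k # ks) = fst k @ cx ks"
  by (simp_all add: cx_def)

definition old_chart :: "'s \<Rightarrow> ('s, 'f, 'r) chart" where
  "old_chart S = ([S], Eq (Var 0) (Var 1))"

lemma fst_old_chart [simp]: "fst (old_chart S) = [S]"
  by (simp add: old_chart_def)

lemma dec_old_chart: "dec M (old_chart S) [x] y \<longleftrightarrow> x = y"
  by (simp add: dec_def old_chart_def)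

lemma chs_old_iff:
  "(\<And>S. S \<in> set \<Gamma> \<Longrightarrow> charts S = [old_chart S]) \<Longrightarrow>
   list_all2 (\<lambda>k S. k \<in> set (charts S)) ks \<Gamma> \<longleftrightarrow> ks = map old_chart \<Gamma>"
  by (induction \<Gamma> arbitrary: ks) (simp_all add: list_all2_Cons2 del: split_paired_Ex)

lemma cx_old: "cx (map old_chart \<Gamma>) = \<Gamma>"
  by (induction \<Gamma>) auto

lemma decs_old: "length x = length \<Gamma> \<Longrightarrow> decs M (map old_chart \<Gamma>) x ys \<longleftrightarrow> x = ys"
  by (induction \<Gamma> arbitrary: x ys) (auto simp: length_Suc_conv dec_old_chart)

text \<open>What is needed to pull a formula of \<open>T2\<close> back to codes: in charts,
  equality, the graphs of function symbols and the relation symbols must be definable by formulas of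
  \<open>T1\<close>, evaluated in models of \<open>T2\<close>. Charts are jointly surjective partial
  functions, and an old sort has only the identity chart.\<close>

locale charted = T1: coherent T1 + T2: coherent T2 for T1 T2 :: "('s, 'f, 'r) coh_theory" +
  fixes charts :: "'s \<Rightarrow> ('s, 'f, 'r) chart list"
  assumes sub: "subsignature (sig T1) (sig T2)"
    and ch_ctx: "S \<in> sorts (sig T2) \<Longrightarrow> k \<in> set (charts S) \<Longrightarrow>
      set (fst k) \<subseteq> sorts (sig T1) \<and> fm_in_ctx (sig T2) (fst k @ [S]) (snd k)"
    and ch_fun: "M \<in> models T2 \<Longrightarrow> S \<in> sorts (sig T2) \<Longrightarrow> k \<in> set (charts S) \<Longrightarrow> x \<in> tup M (fst k) \<Longrightarrow>
      y \<in> car M S \<Longrightarrow> y' \<in> car M S \<Longrightarrow> dec M k x y \<Longrightarrow> dec M k x y' \<Longrightarrow> y = y'"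
    and ch_surj: "M \<in> models T2 \<Longrightarrow> S \<in> sorts (sig T2) \<Longrightarrow> y \<in> car M S \<Longrightarrow>
      \<exists>k\<in>set (charts S). \<exists>x\<in>tup M (fst k). dec M k x y"
    and ch_eq: "S \<in> sorts (sig T2) \<Longrightarrow> k \<in> set (charts S) \<Longrightarrow> k' \<in> set (charts S) \<Longrightarrow>
      definable (sig T1) (models T2) (fst k @ fst k')
        (\<lambda>M z. \<exists>y\<in>car M S. dec M k (take (length (fst k)) z) y \<and> dec M k' (drop (length (fst k)) z) y)"
    and ch_fint: "f \<in> funs (sig T2) \<Longrightarrow> list_all2 (\<lambda>k S. k \<in> set (charts S)) ks (fdom (sig T2) f) \<Longrightarrow>
      k \<in> set (charts (fcod (sig T2) f)) \<Longrightarrow> definable (sig T1) (models T2) (fst k @ cx ks)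
        (\<lambda>M z. \<exists>ys\<in>tup M (fdom (sig T2) f). decs M ks (drop (length (fst k)) z) ys \<and>
           dec M k (take (length (fst k)) z) (fint M f ys))"
    and ch_rint: "R \<in> rels (sig T2) \<Longrightarrow> list_all2 (\<lambda>k S. k \<in> set (charts S)) ks (rdom (sig T2) R) \<Longrightarrow>
      definable (sig T1) (models T2) (cx ks) (\<lambda>M x. \<exists>ys\<in>tup M (rdom (sig T2) R). decs M ks x ys \<and> rint M R ys)"
    and ch_old: "S \<in> sorts (sig T1) \<Longrightarrow> charts S = [old_chart S]"
begin

section \<open>Decoding tuples along products of charts\<close>

abbreviation "\<Sigma>1 \<equiv> sig T1"
abbreviation "\<Sigma>2 \<equiv> sig T2"
abbreviation "\<M> \<equiv> models T2"

abbreviation chs :: "('s, 'f, 'r) chart list \<Rightarrow> 's list \<Rightarrow> bool" where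
  "chs \<equiv> list_all2 (\<lambda>k S. k \<in> set (charts S))"

lemma cx_sorts: "chs ks \<Gamma> \<Longrightarrow> set \<Gamma> \<subseteq> sorts \<Sigma>2 \<Longrightarrow> set (cx ks) \<subseteq> sorts \<Sigma>1"
  by (induction rule: list_all2_induct) (use ch_ctx in fastforce)+

lemma decs_surj:
  assumes M: "M \<in> \<M>"
  shows "ys \<in> tup M \<Gamma> \<Longrightarrow> set \<Gamma> \<subseteq> sorts \<Sigma>2 \<Longrightarrow> \<exists>ks. chs ks \<Gamma> \<and> (\<exists>x\<in>tup M (cx ks). decs M ks x ys)"
proof (induction \<Gamma> arbitrary: ys)
  case (Cons S \<Gamma>)
  then obtain y ys' where ys: "ys = y # ys'" "y \<in> car M S" "ys' \<in> tup M \<Gamma>" by (auto simp: tup_Cons)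
  obtain ks x where ks: "chs ks \<Gamma>" "x \<in> tup M (cx ks)" "decs M ks x ys'" using Cons.IH[OF ys(3)] Cons.prems(2) by auto
  obtain k x' where k: "k \<in> set (charts S)" "x' \<in> tup M (fst k)" "dec M k x' y"
    using ch_surj[OF M _ ys(2)] Cons.prems(2) by auto
  have "x' @ x \<in> tup M (cx (k # ks))" using k ks by (simp add: tup_appendI)
  moreover have "decs M (k # ks) (x' @ x) ys"
    using k ks by (simp add: ys(1) tup_length[OF k(2)])
  moreover have "chs (k # ks) (S # \<Gamma>)" using k(1) ks(1) by simp
  ultimately show ?case by blast
qed simp

lemma decs_fun:
  assumes M: "M \<in> \<M>"
  shows "chs ks \<Gamma> \<Longrightarrow> set \<Gamma> \<subseteq> sorts \<Sigma>2 \<Longrightarrow> x \<in> tup M (cx ks) \<Longrightarrow> ys \<in> tup M \<Gamma> \<Longrightarrow> ys' \<in> tup M \<Gamma> \<Longrightarrow>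
    decs M ks x ys \<Longrightarrow> decs M ks x ys' \<Longrightarrow> ys = ys'"
proof (induction arbitrary: x ys ys' rule: list_all2_induct)
  case (Cons k ks S \<Gamma>)
  from Cons.prems(2) obtain x1 x2 where x: "x = x1 @ x2" "x1 \<in> tup M (fst k)" "x2 \<in> tup M (cx ks)"
    "length x1 = length (fst k)" by (auto elim: tup_appendE)
  from Cons.prems(3,4) obtain y us y' us' where y: "ys = y # us" "y \<in> car M S" "us \<in> tup M \<Gamma>"
    "ys' = y' # us'" "y' \<in> car M S" "us' \<in> tup M \<Gamma>" by (auto simp: tup_Cons)
  have d: "dec M k x1 y" "decs M ks x2 us" "dec M k x1 y'" "decs M ks x2 us'"
    using Cons.prems(5,6) x(4) by (simp_all add: x(1) y(1,4))
  have "us = us'" using Cons.IH[OF _ x(3) y(3,6) d(2,4)] Cons.prems(1) by simp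
  moreover have "y = y'" using ch_fun[OF M _ Cons.hyps(1) x(2) y(2,5) d(1,3)] Cons.prems(1) by simp
  ultimately show ?case by (simp add: y)
qed simp

text \<open>Decoding is single-valued, so the existential quantifier over decoded tuples commutes
  with conjunction.\<close>

lemma decs_ex_iff:
  assumes "M \<in> \<M>" "chs ks \<Gamma>" "set \<Gamma> \<subseteq> sorts \<Sigma>2" "x \<in> tup M (cx ks)"
  shows "(\<exists>ys\<in>tup M \<Gamma>. decs M ks x ys \<and> P ys \<and> Q ys) \<longleftrightarrow>
    (\<exists>ys\<in>tup M \<Gamma>. decs M ks x ys \<and> P ys) \<and> (\<exists>ys\<in>tup M \<Gamma>. decs M ks x ys \<and> Q ys)"
  using decs_fun[OF assms] by blast

text \<open>A property of decoded tuples, pulled back to codes; a code that decodes to nothing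
  counts as false.\<close>

definition dfb :: "('s, 'f, 'r) chart list \<Rightarrow> 's list \<Rightarrow>
    (('s, 'f, 'r, ('s, 'f, 'r) const) struct \<Rightarrow> ('s, 'f, 'r) const list \<Rightarrow> bool) \<Rightarrow> bool" where
  "dfb ks \<Gamma> P \<longleftrightarrow> definable \<Sigma>1 \<M> (cx ks) (\<lambda>M x. \<exists>ys\<in>tup M \<Gamma>. decs M ks x ys \<and> P M ys)"

text \<open>This says that the domain of a product of charts is definable. For a single chart it is
  \<open>ch_eq\<close> on the diagonal: a code is in the domain when it names the same element as
  itself.\<close>

lemma dfb_True: "chs ks \<Gamma> \<Longrightarrow> set \<Gamma> \<subseteq> sorts \<Sigma>2 \<Longrightarrow> dfb ks \<Gamma> (\<lambda>M ys. True)"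
  unfolding dfb_def
proof (induction rule: list_all2_induct)
  case Nil
  show ?case by (rule definable_cong[OF definable_const[of _ _ _ True]]) auto
next
  case (Cons k ks S \<Gamma>)
  then have S: "S \<in> sorts \<Sigma>2" and \<Gamma>: "set \<Gamma> \<subseteq> sorts \<Sigma>2" by auto
  let ?n = "length (fst k)"
  have E: "set (cx (k # ks)) \<subseteq> sorts \<Sigma>1"
    using cx_sorts[of "k # ks" "S # \<Gamma>"] Cons by auto
  have 1: "definable \<Sigma>1 \<M> (cx (k # ks)) (\<lambda>M z. \<exists>y\<in>car M S. dec M k (take ?n (drop 0 z)) y \<and> dec M k (take ?n (drop 0 z)) y)"
    by (rule definable_blocks[OF ch_eq[OF S Cons.hyps(1) Cons.hyps(1)] E]) auto
  have 2: "definable \<Sigma>1 \<M> (cx (k # ks)) (\<lambda>M z. \<exists>ys\<in>tup M \<Gamma>. decs M ks (take (length (cx ks)) (drop ?n z)) ys \<and> True)"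
    by (rule definable_block[OF Cons.IH[OF \<Gamma>] E]) auto
  show ?case
    by (rule definable_cong[OF definable_conj[OF 1 2]])
      (auto elim!: tup_appendE simp: Bex_tup_Cons)
qed

lemma dfb_conj:
  assumes "chs ks \<Gamma>" "set \<Gamma> \<subseteq> sorts \<Sigma>2" "dfb ks \<Gamma> P" "dfb ks \<Gamma> Q"
  shows "dfb ks \<Gamma> (\<lambda>M ys. P M ys \<and> Q M ys)"
  unfolding dfb_def
  by (rule definable_cong[OF definable_conj[OF assms(3,4)[unfolded dfb_def]]])
    (use decs_ex_iff[OF _ assms(1,2)] in blast)

lemma dfb_disj:
  assumes "dfb ks \<Gamma> P" "dfb ks \<Gamma> Q"
  shows "dfb ks \<Gamma> (\<lambda>M ys. P M ys \<or> Q M ys)"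
  unfolding dfb_def
  by (rule definable_cong[OF definable_disj[OF assms[unfolded dfb_def]]]) blast

lemma dfb_False: "chs ks \<Gamma> \<Longrightarrow> set \<Gamma> \<subseteq> sorts \<Sigma>2 \<Longrightarrow> dfb ks \<Gamma> (\<lambda>M ys. False)"
  unfolding dfb_def by (rule definable_cong[OF definable_const[of _ _ _ False]]) (use cx_sorts in auto)

text \<open>\<open>dft ls ks \<Gamma> P\<close>: the relation \<open>decode z \<in> P (decode x)\<close> between the variables \<open>z\<close> of \<open>ls\<close> and
  the variables \<open>x\<close> of \<open>ks\<close> is definable.\<close>

definition dft :: "('s, 'f, 'r) chart list \<Rightarrow> ('s, 'f, 'r) chart list \<Rightarrow> 's list \<Rightarrow>
    (('s, 'f, 'r, ('s, 'f, 'r) const) struct \<Rightarrow> ('s, 'f, 'r) const list \<Rightarrow> ('s, 'f, 'r) const list) \<Rightarrow> bool" where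
  "dft ls ks \<Gamma> P \<longleftrightarrow> definable \<Sigma>1 \<M> (cx ls @ cx ks)
     (\<lambda>M z. \<exists>ys\<in>tup M \<Gamma>. decs M ks (drop (length (cx ls)) z) ys \<and> decs M ls (take (length (cx ls)) z) (P M ys))"

lemma decs_one: "length x = length (fst k) \<Longrightarrow> decs M [k] x [y] \<longleftrightarrow> dec M k x y"
  by auto

lemma cx_nth: "i < length ks \<Longrightarrow> take (length (fst (ks ! i))) (drop (length (cx (take i ks))) (cx ks)) = fst (ks ! i) \<and>
    length (cx (take i ks)) + length (fst (ks ! i)) \<le> length (cx ks)"
proof (induction ks arbitrary: i)
  case (Cons k ks)
  then show ?case by (cases i) auto
qed simp

lemma decs_nth: "decs M ks x ys \<Longrightarrow> i < length ks \<Longrightarrow>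
    dec M (ks ! i) (take (length (fst (ks ! i))) (drop (length (cx (take i ks))) x)) (ys ! i)"
proof (induction ks arbitrary: i x ys)
  case (Cons k ks)
  show ?case
  proof (cases i)
    case 0
    then show ?thesis using Cons.prems by auto
  next
    case (Suc j)
    then show ?thesis
      using Cons.prems Cons.IH[of "drop (length (fst k)) x" "tl ys" j] by (auto simp: add.commute)
  qed
qed simp

lemma tup_block: "x \<in> tup M \<Gamma> \<Longrightarrow> k + n \<le> length \<Gamma> \<Longrightarrow> take n (drop k x) \<in> tup M (take n (drop k \<Gamma>))"
  unfolding tup_def by auto

text \<open>The code for \<open>k\<close> and the \<open>i\<close>-th block of the code for
  \<open>ks\<close> must name the same element, which \<open>ch_eq\<close> makes definable; in
  addition the whole code for \<open>ks\<close> must decode.\<close>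

lemma dft_var:
  assumes ks: "chs ks \<Gamma>" and \<Gamma>: "set \<Gamma> \<subseteq> sorts \<Sigma>2" and i: "i < length \<Gamma>" and k: "k \<in> set (charts (\<Gamma> ! i))"
  shows "dft [k] ks \<Gamma> (\<lambda>M ys. [ys ! i])"
proof -
  let ?n = "length (fst k)" and ?S = "\<Gamma> ! i"
  let ?l = "ks ! i" let ?m = "length (fst ?l)" and ?o = "length (cx (take i ks))"
  have len: "length ks = length \<Gamma>" using ks by (rule list_all2_lengthD)
  have l: "?l \<in> set (charts ?S)" using ks i by (simp add: list_all2_conv_all_nth)
  have S: "?S \<in> sorts \<Sigma>2" using \<Gamma> i by auto
  have E: "set (fst k @ cx ks) \<subseteq> sorts \<Sigma>1" using cx_sorts[OF ks \<Gamma>] ch_ctx[OF S k] by auto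
  note cn = cx_nth[of i ks] 
  have 1: "definable \<Sigma>1 \<M> (fst k @ cx ks) (\<lambda>M z. \<exists>ys\<in>tup M \<Gamma>. decs M ks (take (length (cx ks)) (drop ?n z)) ys \<and> True)"
    by (rule definable_block[OF dfb_True[OF ks \<Gamma>, unfolded dfb_def] E]) auto
  have 2: "definable \<Sigma>1 \<M> (fst k @ cx ks) (\<lambda>M z. \<exists>y\<in>car M ?S. dec M k (take ?n (drop 0 z)) y \<and> dec M ?l (take ?m (drop (?n + ?o) z)) y)"
    by (rule definable_blocks[OF ch_eq[OF S k l] E]) (use cn i len in auto)
  have "dft [k] ks \<Gamma> (\<lambda>M ys. [ys ! i]) \<longleftrightarrow> definable \<Sigma>1 \<M> (fst k @ cx ks)
     (\<lambda>M z. \<exists>ys\<in>tup M \<Gamma>. decs M ks (drop ?n z) ys \<and> decs M [k] (take ?n z) [ys ! i])"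
    by (simp add: dft_def)
  also have "\<dots>"
  proof (rule definable_cong[OF definable_conj[OF 1 2]])
    fix M z assume M: "M \<in> \<M>" and "z \<in> tup M (fst k @ cx ks)"
    then obtain x' x where z: "z = x' @ x" "x' \<in> tup M (fst k)" "x \<in> tup M (cx ks)" "length x' = ?n"
      "length x = length (cx ks)" by (auto elim: tup_appendE)
    have blk: "take ?m (drop ?o x) \<in> tup M (fst ?l)"
      using tup_block[OF z(3), of ?o ?m] cn i len by simp
    have "dec M k x' y \<longleftrightarrow> dec M k x' (ys ! i)"
      if "ys \<in> tup M \<Gamma>" "decs M ks x ys" "y \<in> car M ?S" "dec M ?l (take ?m (drop ?o x)) y" for ys y
    proof -
      have "dec M ?l (take ?m (drop ?o x)) (ys ! i)" using decs_nth[OF that(2)] i len by simp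
      then have "y = ys ! i" using ch_fun[OF M S l blk that(3) tup_nth[OF that(1) i] that(4)] by blast
      then show ?thesis by simp
    qed
    moreover have "dec M ?l (take ?m (drop ?o x)) (ys ! i)" if "decs M ks x ys" for ys
      using decs_nth[OF that] i len by simp
    ultimately show "((\<exists>ys\<in>tup M \<Gamma>. decs M ks (take (length (cx ks)) (drop ?n z)) ys \<and> True) \<and>
        (\<exists>y\<in>car M ?S. dec M k (take ?n (drop 0 z)) y \<and> dec M ?l (take ?m (drop (?n + ?o) z)) y)) \<longleftrightarrow>
      (\<exists>ys\<in>tup M \<Gamma>. decs M ks (drop ?n z) ys \<and> decs M [k] (take ?n z) [ys ! i])"
      using z(4,5) tup_nth[OF _ i] unfolding z(1)
      by (simp add: decs_one del: decs.simps) blast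
  qed
  finally show ?thesis .
qed

lemma dft_list:
  assumes ks: "chs ks \<Gamma>" and \<Gamma>: "set \<Gamma> \<subseteq> sorts \<Sigma>2"
  shows "list_all2 (\<lambda>t S. \<forall>k\<in>set (charts S). dft [k] ks \<Gamma> (\<lambda>M ys. [P t M ys])) ts Ss \<Longrightarrow> set Ss \<subseteq> sorts \<Sigma>2 \<Longrightarrow> chs ls Ss \<Longrightarrow>
    dft ls ks \<Gamma> (\<lambda>M ys. map (\<lambda>t. P t M ys) ts)"
proof (induction arbitrary: ls rule: list_all2_induct)
  case Nil
  then show ?case using dfb_True[OF ks \<Gamma>] by (simp add: dft_def dfb_def)
next
  case (Cons t ts S Ss)
  then obtain l ls' where ls: "ls = l # ls'" "l \<in> set (charts S)" "chs ls' Ss" by (auto simp: list_all2_Cons2)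
  have E: "set (cx ls @ cx ks) \<subseteq> sorts \<Sigma>1" using cx_sorts[OF ks \<Gamma>] cx_sorts[OF Cons.prems(2,1)] by simp
  let ?a = "length (fst l)" and ?b = "length (cx ls')" and ?c = "length (cx ks)"
  have "definable \<Sigma>1 \<M> (cx [l] @ cx ks)
      (\<lambda>M z. \<exists>ys\<in>tup M \<Gamma>. decs M ks (drop (length (cx [l])) z) ys \<and> decs M [l] (take (length (cx [l])) z) [P t M ys])"
    using Cons.hyps(1) ls(2) unfolding dft_def by blast
  from definable_blocks[OF this E, of 0 "?a + ?b"]
  have 1: "definable \<Sigma>1 \<M> (cx ls @ cx ks)
      (\<lambda>M z. \<exists>ys\<in>tup M \<Gamma>. decs M ks (take ?c (drop (?a + ?b) z)) ys \<and> decs M [l] (take ?a z) [P t M ys])"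
    by (simp add: ls)
  have "definable \<Sigma>1 \<M> (cx ls' @ cx ks)
      (\<lambda>M z. \<exists>ys\<in>tup M \<Gamma>. decs M ks (drop (length (cx ls')) z) ys \<and>
        decs M ls' (take (length (cx ls')) z) (map (\<lambda>t. P t M ys) ts))"
    using Cons.IH[OF _ ls(3)] Cons.prems(1) unfolding dft_def by simp
  from definable_blocks[OF this E, of ?a "?a + ?b"]
  have 2: "definable \<Sigma>1 \<M> (cx ls @ cx ks)
      (\<lambda>M z. \<exists>ys\<in>tup M \<Gamma>. decs M ks (take ?c (drop (?a + ?b) z)) ys \<and>
        decs M ls' (take ?b (drop ?a z)) (map (\<lambda>t. P t M ys) ts))"
    by (simp add: ls)
  show ?case
    unfolding dft_def
  proof (rule definable_cong[OF definable_conj[OF 1 2]])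
    fix M z assume M: "M \<in> \<M>" and "z \<in> tup M (cx ls @ cx ks)"
    then obtain u v x where z: "z = (u @ v) @ x" "u \<in> tup M (fst l)" "v \<in> tup M (cx ls')" "x \<in> tup M (cx ks)"
      "length u = ?a" "length v = ?b" "length x = ?c" by (auto simp: ls(1) elim!: tup_appendE)
    show "((\<exists>ys\<in>tup M \<Gamma>. decs M ks (take ?c (drop (?a + ?b) z)) ys \<and> decs M [l] (take ?a z) [P t M ys]) \<and>
      (\<exists>ys\<in>tup M \<Gamma>. decs M ks (take ?c (drop (?a + ?b) z)) ys \<and>
        decs M ls' (take ?b (drop ?a z)) (map (\<lambda>t. P t M ys) ts))) \<longleftrightarrow>
      (\<exists>ys\<in>tup M \<Gamma>. decs M ks (drop (length (cx ls)) z) ys \<and>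
        decs M ls (take (length (cx ls)) z) (map (\<lambda>t. P t M ys) (t # ts)))"
      using z(5-7) decs_ex_iff[OF M ks \<Gamma> z(4), of "\<lambda>ys. dec M l u (P t M ys)" "\<lambda>ys. decs M ls' v (map (\<lambda>t. P t M ys) ts)"]
      unfolding z(1) ls(1) by simp
  qed
qed

lemma chs_product: "set (product_lists (map charts Ss)) = {ls. chs ls Ss}"
  by (simp add: product_lists_set list_all2_map2)

text \<open>Composition of a definable \<open>Q\<close> with a definable map \<open>P\<close> of
  decoded tuples. The intermediate tuple is replaced by a code for it, quantified over finitely many
  chart lists: joint surjectivity provides a code and single-valuedness makes the choice irrelevant.
  \<open>E\<close> holds further parameters of \<open>Q\<close>.\<close>

lemma dft_pull:
  assumes ks: "chs ks \<Gamma>" and \<Gamma>: "set \<Gamma> \<subseteq> sorts \<Sigma>2" and Ss: "set Ss \<subseteq> sorts \<Sigma>2"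
    and P: "\<And>ls. chs ls Ss \<Longrightarrow> dft ls ks \<Gamma> P"
    and Pm: "\<And>M ys. M \<in> \<M> \<Longrightarrow> ys \<in> tup M \<Gamma> \<Longrightarrow> P M ys \<in> tup M Ss"
    and E: "set E \<subseteq> sorts \<Sigma>1"
    and Q: "\<And>ls. chs ls Ss \<Longrightarrow> definable \<Sigma>1 \<M> (E @ cx ls)
      (\<lambda>M z. \<exists>us\<in>tup M Ss. decs M ls (drop (length E) z) us \<and> Q M (take (length E) z) us)"
  shows "definable \<Sigma>1 \<M> (E @ cx ks)
    (\<lambda>M z. \<exists>ys\<in>tup M \<Gamma>. decs M ks (drop (length E) z) ys \<and> Q M (take (length E) z) (P M ys))"
proof -
  let ?n = "length E" and ?c = "length (cx ks)"
  have EK: "set (E @ cx ks) \<subseteq> sorts \<Sigma>1" using E cx_sorts[OF ks \<Gamma>] by simp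
  let ?L = "product_lists (map charts Ss)"
  let ?A = "\<lambda>ls M z. (\<exists>ys\<in>tup M \<Gamma>. decs M ks (drop ?n z) ys \<and> False) \<or> (\<exists>w\<in>tup M (cx ls).
    (\<exists>ys\<in>tup M \<Gamma>. decs M ks (drop ?n z) ys \<and> decs M ls w (P M ys)) \<and>
    (\<exists>us\<in>tup M Ss. decs M ls w us \<and> Q M (take ?n z) us))"
  have "definable \<Sigma>1 \<M> (E @ cx ks) (\<lambda>M z. \<exists>ls\<in>set ?L. ?A ls M z)"
  proof (rule definable_Bex[OF EK])
    fix ls assume "ls \<in> set ?L"
    then have ls: "chs ls Ss" by (simp add: chs_product)
    let ?d = "length (cx ls)"
    have EL: "set (cx ls @ E @ cx ks) \<subseteq> sorts \<Sigma>1" using EK cx_sorts[OF ls Ss] by simp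
    have 1: "definable \<Sigma>1 \<M> (cx ls @ E @ cx ks) (\<lambda>M z.
        \<exists>ys\<in>tup M \<Gamma>. decs M ks (take ?c (drop (?d + ?n) z)) ys \<and> decs M ls (take ?d (drop 0 z)) (P M ys))"
      by (rule definable_blocks[OF P[OF ls, unfolded dft_def] EL]) auto
    have 2: "definable \<Sigma>1 \<M> (cx ls @ E @ cx ks) (\<lambda>M z.
        \<exists>us\<in>tup M Ss. decs M ls (take ?d (drop 0 z)) us \<and> Q M (take ?n (drop ?d z)) us)"
      by (rule definable_blocks[OF Q[OF ls] EL]) auto
    show "definable \<Sigma>1 \<M> (E @ cx ks) (?A ls)"
      by (rule definable_cong[OF definable_ex[OF definable_conj[OF 1 2]]])
        (auto elim!: tup_appendE simp: tup_length)
  qed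
  then show ?thesis
  proof (rule definable_cong)
    fix M z assume M: "M \<in> \<M>" and "z \<in> tup M (E @ cx ks)"
    show "(\<exists>ls\<in>set ?L. ?A ls M z) \<longleftrightarrow> (\<exists>ys\<in>tup M \<Gamma>. decs M ks (drop ?n z) ys \<and> Q M (take ?n z) (P M ys))"
    proof
      assume "\<exists>ls\<in>set ?L. ?A ls M z"
      then obtain ls w ys us where ls: "chs ls Ss" and w: "w \<in> tup M (cx ls)" and
        y: "ys \<in> tup M \<Gamma>" "decs M ks (drop ?n z) ys" "decs M ls w (P M ys)" and
        u: "us \<in> tup M Ss" "decs M ls w us" "Q M (take ?n z) us"
        unfolding chs_product by blast
      have "us = P M ys" by (rule decs_fun[OF M ls Ss w u(1) Pm[OF M y(1)] u(2) y(3)])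
      then show "\<exists>ys\<in>tup M \<Gamma>. decs M ks (drop ?n z) ys \<and> Q M (take ?n z) (P M ys)" using y u by blast
    next
      assume "\<exists>ys\<in>tup M \<Gamma>. decs M ks (drop ?n z) ys \<and> Q M (take ?n z) (P M ys)"
      then obtain ys where y: "ys \<in> tup M \<Gamma>" "decs M ks (drop ?n z) ys" "Q M (take ?n z) (P M ys)" by blast
      obtain ls w where "chs ls Ss" "w \<in> tup M (cx ls)" "decs M ls w (P M ys)"
        using decs_surj[OF M Pm[OF M y(1)] Ss] by blast
      then show "\<exists>ls\<in>set ?L. ?A ls M z" unfolding chs_product using y Pm[OF M y(1)] by blast
    qed
  qed
qed

section \<open>Pulling terms and formulas back along charts\<close>

lemma models_struct: "M \<in> \<M> \<Longrightarrow> is_struct \<Sigma>2 M"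
  by (simp add: models_def model_def)

lemma eval_car: "M \<in> \<M> \<Longrightarrow> ys \<in> tup M \<Gamma> \<Longrightarrow> wt \<Sigma>2 \<Gamma> t S \<Longrightarrow> eval M ((!) ys) t \<in> car M S"
  using eval_in_car[OF models_struct] tup_nth by metis

lemma eval_tup: "M \<in> \<M> \<Longrightarrow> ys \<in> tup M \<Gamma> \<Longrightarrow> list_all2 (wt \<Sigma>2 \<Gamma>) ts Ss \<Longrightarrow> map (eval M ((!) ys)) ts \<in> tup M Ss"
  by (auto simp: tup_def[of M Ss] list_all2_conv_all_nth intro: eval_car)

lemma dft_term:
  assumes ks: "chs ks \<Gamma>" and \<Gamma>: "set \<Gamma> \<subseteq> sorts \<Sigma>2"
  shows "wt \<Sigma>2 \<Gamma> t S \<Longrightarrow> \<forall>k\<in>set (charts S). dft [k] ks \<Gamma> (\<lambda>M ys. [eval M ((!) ys) t])"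
proof (induction rule: wt.induct)
  case (Var i)
  then show ?case using dft_var[OF ks \<Gamma>] by simp
next
  case (Fn f ts)
  let ?Ss = "fdom \<Sigma>2 f"
  have Ss: "set ?Ss \<subseteq> sorts \<Sigma>2" and cod: "fcod \<Sigma>2 f \<in> sorts \<Sigma>2"
    using T2.wf_sig Fn(1) by (auto simp: wf_signature_def)
  have wts: "list_all2 (wt \<Sigma>2 \<Gamma>) ts ?Ss" using Fn(2) by (auto intro: list_all2_mono)
  have ihs: "list_all2 (\<lambda>t S. \<forall>k\<in>set (charts S). dft [k] ks \<Gamma> (\<lambda>M ys. [eval M ((!) ys) t])) ts ?Ss"
    using Fn(2) by (auto intro: list_all2_mono)
  show ?case
  proof
    fix k assume k: "k \<in> set (charts (fcod \<Sigma>2 f))"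
    have "definable \<Sigma>1 \<M> (fst k @ cx ks) (\<lambda>M z. \<exists>ys\<in>tup M \<Gamma>. decs M ks (drop (length (fst k)) z) ys \<and>
        dec M k (take (length (fst k)) z) (fint M f (map (eval M ((!) ys)) ts)))"
      by (rule dft_pull[OF ks \<Gamma> Ss dft_list[OF ks \<Gamma> ihs Ss] eval_tup[OF _ _ wts] _ ch_fint[OF Fn(1) _ k]])
        (use ch_ctx[OF cod k] in auto)
    then show "dft [k] ks \<Gamma> (\<lambda>M ys. [eval M ((!) ys) (Fn f ts)])"
      unfolding dft_def cx_simps append_Nil2 by (rule definable_cong) (auto elim!: tup_appendE)
  qed
qed

text \<open>A quantifier over a sort becomes a finite disjunction, over the charts of the sort, of
  quantifiers over codes. An equation between terms becomes the existence of a common code for the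
  two values.\<close>

lemma dfb_fm:
  "wf_fm \<Sigma>2 \<Gamma> \<phi> \<Longrightarrow> chs ks \<Gamma> \<Longrightarrow> set \<Gamma> \<subseteq> sorts \<Sigma>2 \<Longrightarrow> dfb ks \<Gamma> (\<lambda>M ys. sat M ((!) ys) \<phi>)"
proof (induction \<phi> arbitrary: \<Gamma> ks)
  case (Eq t u)
  then obtain S where t: "wt \<Sigma>2 \<Gamma> t S" and u: "wt \<Sigma>2 \<Gamma> u S" by auto
  have S: "S \<in> sorts \<Sigma>2" by (rule wt_sort[OF T2.wf_sig Eq(3) t])
  have E: "set (cx ks) \<subseteq> sorts \<Sigma>1" by (rule cx_sorts[OF Eq(2,3)])
  let ?A = "\<lambda>k M x. \<exists>w\<in>tup M (fst k). (\<exists>ys\<in>tup M \<Gamma>. decs M ks x ys \<and> dec M k w (eval M ((!) ys) t)) \<and>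
    (\<exists>ys\<in>tup M \<Gamma>. decs M ks x ys \<and> dec M k w (eval M ((!) ys) u))"
  have "definable \<Sigma>1 \<M> (cx ks) (\<lambda>M x. \<exists>k\<in>set (charts S). ?A k M x)"
  proof (rule definable_Bex[OF E])
    fix k assume k: "k \<in> set (charts S)"
    have d: "definable \<Sigma>1 \<M> (fst k @ cx ks) (\<lambda>M z. \<exists>ys\<in>tup M \<Gamma>. decs M ks (drop (length (fst k)) z) ys \<and>
        decs M [k] (take (length (fst k)) z) [eval M ((!) ys) t])" if "wt \<Sigma>2 \<Gamma> t S" for t
      using dft_term[OF Eq(2,3) that] k by (simp add: dft_def)
    show "definable \<Sigma>1 \<M> (cx ks) (?A k)"
      by (rule definable_cong[OF definable_ex[OF definable_conj[OF d[OF t] d[OF u]]]])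
        (simp add: tup_length cong: bex_cong)
  qed
  then show ?case
    unfolding dfb_def
  proof (rule definable_cong)
    fix M x assume M: "M \<in> \<M>" and x: "x \<in> tup M (cx ks)"
    show "(\<exists>k\<in>set (charts S). ?A k M x) \<longleftrightarrow> (\<exists>ys\<in>tup M \<Gamma>. decs M ks x ys \<and> sat M ((!) ys) (Eq t u))"
    proof
      assume "\<exists>k\<in>set (charts S). ?A k M x"
      then obtain k w ys where k: "k \<in> set (charts S)" "w \<in> tup M (fst k)" and ys: "ys \<in> tup M \<Gamma>" "decs M ks x ys"
        and d: "dec M k w (eval M ((!) ys) t)" "dec M k w (eval M ((!) ys) u)"
        using decs_fun[OF M Eq(2,3) x] by blast
      have "eval M ((!) ys) t = eval M ((!) ys) u"
        by (rule ch_fun[OF M S k eval_car[OF M ys(1) t] eval_car[OF M ys(1) u] d])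
      then show "\<exists>ys\<in>tup M \<Gamma>. decs M ks x ys \<and> sat M ((!) ys) (Eq t u)" using ys by auto
    next
      assume "\<exists>ys\<in>tup M \<Gamma>. decs M ks x ys \<and> sat M ((!) ys) (Eq t u)"
      then obtain ys where ys: "ys \<in> tup M \<Gamma>" "decs M ks x ys" "eval M ((!) ys) t = eval M ((!) ys) u" by auto
      then show "\<exists>k\<in>set (charts S). ?A k M x"
        using ch_surj[OF M S eval_car[OF M ys(1) t]] by metis
    qed
  qed
next
  case (Rel R ts)
  then have R: "R \<in> rels \<Sigma>2" and ts: "list_all2 (wt \<Sigma>2 \<Gamma>) ts (rdom \<Sigma>2 R)" by auto
  have Ss: "set (rdom \<Sigma>2 R) \<subseteq> sorts \<Sigma>2" using T2.wf_sig R by (auto simp: wf_signature_def)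
  have ihs: "list_all2 (\<lambda>t S. \<forall>k\<in>set (charts S). dft [k] ks \<Gamma> (\<lambda>M ys. [eval M ((!) ys) t])) ts (rdom \<Sigma>2 R)"
    using ts dft_term[OF Rel(2,3)] by (auto intro: list_all2_mono)
  have "definable \<Sigma>1 \<M> ([] @ cx ks) (\<lambda>M z. \<exists>ys\<in>tup M \<Gamma>. decs M ks (drop (length ([] :: 's list)) z) ys \<and>
      rint M R (map (eval M ((!) ys)) ts))"
    by (rule dft_pull[OF Rel(2,3) Ss dft_list[OF Rel(2,3) ihs Ss] eval_tup[OF _ _ ts], where Q = "\<lambda>M z us. rint M R us"])
      (use ch_rint[OF R] in auto)
  then show ?case by (simp add: dfb_def)
next
  case (Ex S \<phi>)
  then have S: "S \<in> sorts \<Sigma>2" and wf: "wf_fm \<Sigma>2 (S # \<Gamma>) \<phi>" by auto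
  have E: "set (cx ks) \<subseteq> sorts \<Sigma>1" by (rule cx_sorts[OF Ex(3,4)])
  let ?A = "\<lambda>k M x. \<exists>w\<in>tup M (fst k). \<exists>ys\<in>tup M (S # \<Gamma>). decs M (k # ks) (w @ x) ys \<and> sat M ((!) ys) \<phi>"
  have "definable \<Sigma>1 \<M> (cx ks) (\<lambda>M x. \<exists>k\<in>set (charts S). ?A k M x)"
  proof (rule definable_Bex[OF E])
    fix k assume k: "k \<in> set (charts S)"
    have "dfb (k # ks) (S # \<Gamma>) (\<lambda>M ys. sat M ((!) ys) \<phi>)"
      using Ex(3,4) S k by (intro Ex.IH[OF wf]) auto
    then show "definable \<Sigma>1 \<M> (cx ks) (?A k)"
      unfolding dfb_def cx_simps by (rule definable_ex)
  qed
  then show ?case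
    unfolding dfb_def
  proof (rule definable_cong)
    fix M x assume M: "M \<in> \<M>" and x: "x \<in> tup M (cx ks)"
    have "?A k M x \<longleftrightarrow> (\<exists>w\<in>tup M (fst k). \<exists>ys\<in>tup M \<Gamma>. \<exists>y\<in>car M S. dec M k w y \<and> decs M ks x ys \<and> sat M (case_nat y ((!) ys)) \<phi>)"
      if "k \<in> set (charts S)" for k
      by (simp add: Bex_tup_Cons tup_length nth_Cons_fun cong: bex_cong)
    note A = this
    show "(\<exists>k\<in>set (charts S). ?A k M x) \<longleftrightarrow> (\<exists>ys\<in>tup M \<Gamma>. decs M ks x ys \<and> sat M ((!) ys) (Ex S \<phi>))"
    proof
      assume "\<exists>k\<in>set (charts S). ?A k M x"
      then obtain k where k: "k \<in> set (charts S)" "?A k M x" by blast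
      from k(2) show "\<exists>ys\<in>tup M \<Gamma>. decs M ks x ys \<and> sat M ((!) ys) (Ex S \<phi>)"
        unfolding A[OF k(1)] sat.simps by blast
    next
      assume "\<exists>ys\<in>tup M \<Gamma>. decs M ks x ys \<and> sat M ((!) ys) (Ex S \<phi>)"
      then obtain ys y where ys: "ys \<in> tup M \<Gamma>" "decs M ks x ys" and y: "y \<in> car M S" "sat M (case_nat y ((!) ys)) \<phi>"
        by auto
      from ch_surj[OF M S y(1)] obtain k w where k: "k \<in> set (charts S)" "w \<in> tup M (fst k)" "dec M k w y" by blast
      then have "?A k M x" unfolding A[OF k(1)] using ys y by blast
      then show "\<exists>k\<in>set (charts S). ?A k M x" using k(1) by blast
    qed
  qed
next
  case Top
  then show ?case using dfb_True by simp
next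
  case Bot
  then show ?case using dfb_False by simp
next
  case (And \<phi> \<psi>)
  then show ?case using dfb_conj by simp
next
  case (Or \<phi> \<psi>)
  then show ?case using dfb_disj by simp
qed

section \<open>Old contexts, and covers by old objects\<close>

lemma chs_old: "set \<Gamma> \<subseteq> sorts \<Sigma>1 \<Longrightarrow> chs ks \<Gamma> \<longleftrightarrow> ks = map old_chart \<Gamma>"
  using ch_old by (intro chs_old_iff) auto

lemma old_sorts: "set \<Gamma> \<subseteq> sorts \<Sigma>1 \<Longrightarrow> set \<Gamma> \<subseteq> sorts \<Sigma>2"
  using sub by (auto simp: subsignature_def)

text \<open>Over old sorts all charts are identities, so the pulled-back formula defines the very
  same set of tuples as \<open>\<theta>\<close>.\<close>

lemma old_definable:
  assumes \<Gamma>: "set \<Gamma> \<subseteq> sorts \<Sigma>1" and \<theta>: "fm_in_ctx \<Sigma>2 \<Gamma> \<theta>"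
  shows "\<exists>\<chi>. fm_in_ctx \<Sigma>1 \<Gamma> \<chi> \<and> prov T2 \<Gamma> \<chi> \<theta> \<and> prov T2 \<Gamma> \<theta> \<chi>"
proof -
  have "dfb (map old_chart \<Gamma>) \<Gamma> (\<lambda>M ys. sat M ((!) ys) \<theta>)"
    using \<theta> chs_old[OF \<Gamma>] old_sorts[OF \<Gamma>] by (intro dfb_fm) (auto simp: fm_in_ctx_def)
  then have "definable \<Sigma>1 \<M> \<Gamma> (\<lambda>M x. sat M ((!) x) \<theta>)"
    unfolding dfb_def cx_old by (elim definable_cong) (auto simp: decs_old[OF tup_length])
  then obtain \<chi> where \<chi>: "fm_in_ctx \<Sigma>1 \<Gamma> \<chi>" "\<forall>M\<in>\<M>. \<forall>x\<in>tup M \<Gamma>. sat M ((!) x) \<theta> \<longleftrightarrow> sat M ((!) x) \<chi>"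
    by (rule definableE)
  then show ?thesis
    using \<theta> fm_in_ctx_mono[OF \<chi>(1) sub] by (intro exI[of _ \<chi>]) (simp add: T2.prov_iff)
qed

text \<open>Decoding is also a relation definable in the language of \<open>T2\<close>, so it can
  serve as an arrow of the larger syntactic category.\<close>

lemma decs_definable:
  "chs ks \<Gamma> \<Longrightarrow> set \<Gamma> \<subseteq> sorts \<Sigma>2 \<Longrightarrow>
   definable \<Sigma>2 \<M> (cx ks @ \<Gamma>) (\<lambda>M z. decs M ks (take (length (cx ks)) z) (drop (length (cx ks)) z))"
proof (induction rule: list_all2_induct)
  case Nil
  show ?case by (rule definable_cong[OF definable_const[of _ _ _ True]]) auto
next
  case (Cons k ks S \<Gamma>)
  then have S: "S \<in> sorts \<Sigma>2" and \<Gamma>: "set \<Gamma> \<subseteq> sorts \<Sigma>2" by auto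
  let ?a = "length (fst k)" and ?b = "length (cx ks)"
  have E: "set (cx (k # ks) @ S # \<Gamma>) \<subseteq> sorts \<Sigma>2"
    using cx_sorts[of "k # ks" "S # \<Gamma>"] old_sorts Cons by auto
  have "definable \<Sigma>2 \<M> (fst k @ [S]) (\<lambda>M z. sat M ((!) (take ?a z @ drop ?a z)) (snd k))"
    using definable_fm[OF conjunct2[OF ch_ctx[OF S Cons.hyps(1)]]] by simp
  from definable_blocks[OF this E, of 0 "?a + ?b"]
  have 1: "definable \<Sigma>2 \<M> (cx (k # ks) @ S # \<Gamma>) (\<lambda>M z. sat M ((!) (take ?a z @ take 1 (drop (?a + ?b) z))) (snd k))"
    by simp
  have 2: "definable \<Sigma>2 \<M> (cx (k # ks) @ S # \<Gamma>)
      (\<lambda>M z. decs M ks (take ?b (drop ?a z)) (take (length \<Gamma>) (drop (?a + ?b + 1) z)))"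
    by (rule definable_blocks[OF Cons.IH[OF \<Gamma>] E]) auto
  show ?case
    by (rule definable_cong[OF definable_conj[OF 1 2]])
      (auto elim!: tup_appendE simp: tup_Cons dec_def tup_length)
qed

text \<open>For every choice of charts for the context, the codes whose decoding satisfies the
  formula form an object of the smaller category, and decoding maps it to \<open>B\<close>. These
  arrows jointly cover, as charts are jointly surjective.\<close>

lemma old_covers:
  assumes B: "B \<in> Ob (syn_cat T2)"
  shows "\<exists>G. finite G \<and> (\<forall>(A, g)\<in>G. A \<in> Ob (syn_cat T1) \<and> g \<in> hom (syn_cat T2) A B) \<and> T2.covers B (snd ` G)"
proof -
  let ?\<Gamma> = "fst B" and ?\<phi> = "snd B"
  have \<Gamma>: "set ?\<Gamma> \<subseteq> sorts \<Sigma>2" and \<phi>: "wf_fm \<Sigma>2 ?\<Gamma> ?\<phi>" using B by (auto simp: Ob_syn_cat fm_in_ctx_def)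
  let ?R = "\<lambda>ks M. {(x, ys). x \<in> tup M (cx ks) \<and> ys \<in> tup M ?\<Gamma> \<and> decs M ks x ys \<and> sat M ((!) ys) ?\<phi>}"
  have ex: "\<exists>A g. A \<in> Ob (syn_cat T1) \<and> g \<in> hom (syn_cat T2) A B \<and> (\<forall>M\<in>\<M>. graph M g = ?R ks M)" if ks: "chs ks ?\<Gamma>" for ks
  proof -
    from dfb_fm[OF \<phi> ks \<Gamma>] obtain \<chi> where \<chi>: "fm_in_ctx \<Sigma>1 (cx ks) \<chi>"
      "\<forall>M\<in>\<M>. \<forall>x\<in>tup M (cx ks). (\<exists>ys\<in>tup M ?\<Gamma>. decs M ks x ys \<and> sat M ((!) ys) ?\<phi>) \<longleftrightarrow> sat M ((!) x) \<chi>"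
      unfolding dfb_def by (rule definableE)
    let ?A = "(cx ks, \<chi>)"
    have A1: "?A \<in> Ob (syn_cat T1)" and A2: "?A \<in> Ob (syn_cat T2)"
      using \<chi>(1) fm_in_ctx_mono[OF _ sub] by (auto simp: Ob_syn_cat)
    have E: "set (cx ks @ ?\<Gamma>) \<subseteq> sorts \<Sigma>2" using cx_sorts[OF ks \<Gamma>] old_sorts \<Gamma> by auto
    have d1: "definable \<Sigma>2 \<M> (cx ks @ ?\<Gamma>) (\<lambda>M z. sat M ((!) (take (length ?\<Gamma>) (drop (length (cx ks)) z))) ?\<phi>)"
      by (rule definable_block[OF definable_fm E]) (use \<phi> \<Gamma> in \<open>auto simp: fm_in_ctx_def\<close>)
    have d: "definable \<Sigma>2 \<M> (fst ?A @ fst B) (\<lambda>M z. decs M ks (take (length (cx ks)) z) (drop (length (cx ks)) z) \<and>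
        sat M ((!) (take (length ?\<Gamma>) (drop (length (cx ks)) z))) ?\<phi>)"
      using definable_conj[OF decs_definable[OF ks \<Gamma>] d1] by simp
    have "functional_graph (ext M ?A) (ext M B) (?R ks M)" if M: "M \<in> \<M>" for M
      unfolding functional_graph_def
    proof (intro conjI)
      show "?R ks M \<subseteq> ext M ?A \<times> ext M B" using \<chi>(2) M by (auto simp: ext_def)
      show "\<forall>x\<in>ext M ?A. \<exists>ys. (x, ys) \<in> ?R ks M" using \<chi>(2) M by (auto simp: ext_def)
      show "\<forall>x y y'. (x, y) \<in> ?R ks M \<longrightarrow> (x, y') \<in> ?R ks M \<longrightarrow> y = y'"
        using decs_fun[OF M ks \<Gamma>] by blast
    qed
    from T2.arrow_ex[OF A2 B d this] obtain g where "g \<in> hom (syn_cat T2) ?A B" "\<forall>M\<in>\<M>. graph M g = ?R ks M"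
      by (auto simp: tup_length)
    then show ?thesis using A1 by blast
  qed
  have "\<forall>ks\<in>{ks. chs ks ?\<Gamma>}. \<exists>p. fst p \<in> Ob (syn_cat T1) \<and> snd p \<in> hom (syn_cat T2) (fst p) B \<and>
      (\<forall>M\<in>\<M>. graph M (snd p) = ?R ks M)"
  proof
    fix ks assume "ks \<in> {ks. chs ks ?\<Gamma>}"
    then have "chs ks ?\<Gamma>" by simp
    from ex[OF this] obtain A g where "A \<in> Ob (syn_cat T1)" "g \<in> hom (syn_cat T2) A B"
      "\<forall>M\<in>\<M>. graph M g = ?R ks M" by blast
    then show "\<exists>p. fst p \<in> Ob (syn_cat T1) \<and> snd p \<in> hom (syn_cat T2) (fst p) B \<and> (\<forall>M\<in>\<M>. graph M (snd p) = ?R ks M)"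
      by (intro exI[of _ "(A, g)"]) simp
  qed
  from bchoice[OF this] obtain p where p: "\<forall>ks\<in>{ks. chs ks ?\<Gamma>}. fst (p ks) \<in> Ob (syn_cat T1) \<and>
      snd (p ks) \<in> hom (syn_cat T2) (fst (p ks)) B \<and> (\<forall>M\<in>\<M>. graph M (snd (p ks)) = ?R ks M)" ..
  let ?G = "p ` {ks. chs ks ?\<Gamma>}"
  have fin: "finite {ks. chs ks ?\<Gamma>}" unfolding chs_product[symmetric] by (rule finite_set)
  have "T2.covers B (snd ` ?G)"
    unfolding T2.covers_def
  proof (intro conjI ballI)
    show "snd ` ?G \<subseteq> {g \<in> Ar (syn_cat T2). Cod (syn_cat T2) g = B}"
      using p by (auto simp: hom_def)
    fix M b assume M: "M \<in> \<M>" and "b \<in> ext M B"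
    then have b: "b \<in> tup M ?\<Gamma>" "sat M ((!) b) ?\<phi>" by (auto simp: ext_def)
    from decs_surj[OF M b(1) \<Gamma>] obtain ks x where k: "chs ks ?\<Gamma>" "x \<in> tup M (cx ks)" "decs M ks x b" by blast
    then have "(x, b) \<in> graph M (snd (p ks))" using p M b by simp
    moreover have "snd (p ks) \<in> snd ` ?G" using k(1) by blast
    ultimately show "\<exists>g\<in>snd ` ?G. \<exists>a. (a, b) \<in> graph M g" by blast
  qed (use fin in simp)
  moreover have "\<forall>(A, g)\<in>?G. A \<in> Ob (syn_cat T1) \<and> g \<in> hom (syn_cat T2) A B"
    using p by auto
  ultimately show ?thesis using fin by (intro exI[of _ ?G]) simp
qed

end

section \<open>Morita extensions\<close>

lemma Ball_tup_Cons: "(\<forall>a\<in>tup M (S # \<Gamma>). P a) \<longleftrightarrow> (\<forall>x\<in>car M S. \<forall>b\<in>tup M \<Gamma>. P (x # b))"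
  unfolding Ball_def tup_Cons by blast

lemma Ball_tup_Nil: "(\<forall>a\<in>tup M []. P a) \<longleftrightarrow> P []"
  by auto

lemma Bex_tup_Nil: "(\<exists>a\<in>tup M []. P a) \<longleftrightarrow> P []"
  by auto

section \<open>Semantic form of the defining axioms\<close>

definition holds :: "('s, 'f, 'r, 'm) struct \<Rightarrow> ('s, 'f, 'r) sequent \<Rightarrow> bool" where
  "holds M s \<longleftrightarrow> (case s of (\<Gamma>, \<phi>, \<psi>) \<Rightarrow> \<forall>a\<in>tup M \<Gamma>. sat M ((!) a) \<phi> \<longrightarrow> sat M ((!) a) \<psi>)"

lemma model_iff: "model T M \<longleftrightarrow> is_struct (sig T) M \<and> (\<forall>s\<in>axs T. holds M s)"
  by (auto simp: model_def holds_def)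

fun block_sat :: "('s, 'f, 'r) signature \<Rightarrow> ('s, 'f, 'r, 'm) struct \<Rightarrow> ('s, 'f, 'r) block \<Rightarrow> bool" where
  "block_sat \<Sigma> M (DefFun f \<phi>) \<longleftrightarrow>
     (\<forall>a\<in>tup M (fdom \<Sigma> f). \<forall>y\<in>car M (fcod \<Sigma> f). fint M f a = y \<longleftrightarrow> sat M ((!) (a @ [y])) \<phi>)"
| "block_sat \<Sigma> M (DefRel R \<phi>) \<longleftrightarrow> (\<forall>a\<in>tup M (rdom \<Sigma> R). rint M R a \<longleftrightarrow> sat M ((!) a) \<phi>)"
| "block_sat \<Sigma> M (DefProd P Ss ps) \<longleftrightarrow>
     (\<forall>a\<in>tup M Ss. \<exists>p\<in>car M P. \<forall>i<length Ss. fint M (ps ! i) [p] = a ! i) \<and>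
     (\<forall>p\<in>car M P. \<forall>q\<in>car M P. (\<forall>i<length Ss. fint M (ps ! i) [p] = fint M (ps ! i) [q]) \<longrightarrow> p = q)"
| "block_sat \<Sigma> M (DefCoprod P Ss rs) \<longleftrightarrow>
     (\<forall>p\<in>car M P. \<exists>i<length Ss. \<exists>x\<in>car M (Ss ! i). fint M (rs ! i) [x] = p) \<and>
     (\<forall>i<length Ss. \<forall>j<length Ss. \<forall>x\<in>car M (Ss ! i). \<forall>y\<in>car M (Ss ! j).
        fint M (rs ! i) [x] = fint M (rs ! j) [y] \<longrightarrow> i = j \<and> x = y)"
| "block_sat \<Sigma> M (DefSub S S' \<phi> i) \<longleftrightarrow>
     (\<forall>x\<in>car M S'. sat M ((!) [x]) \<phi> \<longleftrightarrow> (\<exists>y\<in>car M S. fint M i [y] = x)) \<and>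
     (\<forall>x\<in>car M S. \<forall>y\<in>car M S. fint M i [x] = fint M i [y] \<longrightarrow> x = y)"
| "block_sat \<Sigma> M (DefQuot S S' \<phi> e) \<longleftrightarrow>
     (\<forall>x\<in>car M S'. \<forall>y\<in>car M S'. fint M e [x] = fint M e [y] \<longleftrightarrow> sat M ((!) [x, y]) \<phi>) \<and>
     (\<forall>s\<in>car M S. \<exists>x\<in>car M S'. fint M e [x] = s)"

lemma struct_fint1:
  "is_struct \<Sigma> M \<Longrightarrow> f \<in> funs \<Sigma> \<Longrightarrow> fdom \<Sigma> f = [S] \<Longrightarrow> fcod \<Sigma> f = S' \<Longrightarrow> x \<in> car M S \<Longrightarrow> fint M f [x] \<in> car M S'"
  by (auto simp: is_struct_def tup_Cons)

text \<open>The product and coproduct axioms compare two values through a common one ranging over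
  carriers, whereas \<open>block_sat\<close> equates them directly. Hence the typing of the new
  function symbols: the common value must belong to the carrier.\<close>

lemma block_sat_iff:
  assumes valid: "valid_block T \<Sigma> d" and M: "is_struct \<Sigma> M" and new: "new_funs d \<subseteq> funs \<Sigma>"
  shows "block_sat \<Sigma> M d \<longleftrightarrow> (\<forall>s\<in>block_axioms \<Sigma> d. holds M s)"
proof (cases d)
  case (DefFun f \<phi>)
  show ?thesis
    unfolding DefFun
    by (auto simp: Let_def holds_def Ball_tup_append Ball_tup_Cons Ball_tup_Nil tup_length nth_append)
next
  case (DefRel R \<phi>)
  show ?thesis
    unfolding DefRel by (auto simp: Let_def holds_def tup_length)
next
  case (DefProd P Ss ps)
  let ?n = "length Ss"
  have ps: "fint M (ps ! i) [p] \<in> car M (Ss ! i)" if "i < ?n" "p \<in> car M P" for i p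
    using struct_fint1[OF M _ _ _ that(2), of "ps ! i"] valid new that(1) by (auto simp: DefProd subset_iff)
  have 2: "(\<forall>p\<in>car M P. \<forall>q\<in>car M P. (\<forall>i<?n. fint M (ps ! i) [p] = fint M (ps ! i) [q]) \<longrightarrow> p = q) \<longleftrightarrow>
    (\<forall>a\<in>tup M Ss. \<forall>p\<in>car M P. \<forall>q\<in>car M P.
      (\<forall>i<?n. fint M (ps ! i) [p] = a ! i) \<and> (\<forall>i<?n. fint M (ps ! i) [q] = a ! i) \<longrightarrow> p = q)" (is "?l \<longleftrightarrow> ?r")
  proof
    assume r: ?r
    show ?l
    proof (intro ballI impI)
      fix p q assume pq: "p \<in> car M P" "q \<in> car M P" "\<forall>i<?n. fint M (ps ! i) [p] = fint M (ps ! i) [q]"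
      \<comment> \<open>The tuple of projections of \<open>p\<close> instantiates the common
        coordinates in the uniqueness axiom.\<close>
      have t: "map (\<lambda>i. fint M (ps ! i) [p]) [0..<?n] \<in> tup M Ss"
        using ps pq(1) by (auto simp: tup_def list_all2_conv_all_nth)
      show "p = q" using bspec[OF r t] pq by simp
    qed
  qed auto
  have [simp]: "(\<forall>i\<in>{0..<?n}. Q i) \<longleftrightarrow> (\<forall>i<?n. Q i)" for Q by auto
  show ?thesis
    unfolding DefProd block_sat.simps 2
    by (auto simp: Let_def holds_def Ball_tup_append Ball_tup_Cons Ball_tup_Nil tup_length nth_append sat_conj)
next
  case (DefCoprod P Ss rs)
  let ?n = "length Ss"
  have rs: "fint M (rs ! i) [x] \<in> car M P" if "i < ?n" "x \<in> car M (Ss ! i)" for i x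
    using struct_fint1[OF M _ _ _ that(2), of "rs ! i"] valid new that(1) by (auto simp: DefCoprod subset_iff)
  have ax: "(\<forall>s\<in>block_axioms \<Sigma> d. holds M s) \<longleftrightarrow>
      (\<forall>p\<in>car M P. \<exists>i<?n. \<exists>x\<in>car M (Ss ! i). fint M (rs ! i) [x] = p) \<and>
      (\<forall>i<?n. \<forall>x\<in>car M (Ss ! i). \<forall>y\<in>car M (Ss ! i). \<forall>p\<in>car M P.
         fint M (rs ! i) [x] = p \<and> fint M (rs ! i) [y] = p \<longrightarrow> x = y) \<and>
      (\<forall>i<?n. \<forall>j<?n. i \<noteq> j \<longrightarrow> (\<forall>x\<in>car M (Ss ! i). \<forall>y\<in>car M (Ss ! j). \<forall>p\<in>car M P.
         \<not> (fint M (rs ! i) [x] = p \<and> fint M (rs ! j) [y] = p)))"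
  proof -
    have 1: "(\<forall>s\<in>{([P], Top, disj (map (\<lambda>i. Ex (Ss ! i) (Eq (Fn (rs ! i) [Var 0]) (Var 1))) [0..<?n]))}. holds M s) \<longleftrightarrow>
        (\<forall>p\<in>car M P. \<exists>i<?n. \<exists>x\<in>car M (Ss ! i). fint M (rs ! i) [x] = p)"
      by (simp add: holds_def Ball_tup_Cons Ball_tup_Nil sat_disj Bex_def)
    have 2: "(\<forall>s\<in>{F i | i. i < ?n}. Q s) \<longleftrightarrow> (\<forall>i<?n. Q (F i))" for F :: "nat \<Rightarrow> 'k" and Q by blast
    have 3: "(\<forall>s\<in>{F i j | i j. i < ?n \<and> j < ?n \<and> i \<noteq> j}. Q s) \<longleftrightarrow> (\<forall>i<?n. \<forall>j<?n. i \<noteq> j \<longrightarrow> Q (F i j))"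
      for F :: "nat \<Rightarrow> nat \<Rightarrow> 'k" and Q by blast
    show ?thesis
      unfolding DefCoprod block_axioms.simps Let_def ball_Un 1 2 3
      by (simp add: holds_def Ball_tup_Cons Ball_tup_Nil numeral_2_eq_2 imp_conjL)
  qed
  show ?thesis
    unfolding ax unfolding DefCoprod block_sat.simps using rs by (intro iffI conjI allI impI ballI) metis+
next
  case (DefSub S S' \<phi> i)
  show ?thesis
    unfolding DefSub
    by (auto simp: Let_def holds_def Ball_tup_Cons Ball_tup_Nil)
next
  case (DefQuot S S' \<phi> e)
  show ?thesis
    unfolding DefQuot
    by (auto simp: Let_def holds_def Ball_tup_Cons Ball_tup_Nil)
qed

text \<open>The charts for the kinds of new sorts. \<open>graph_chart\<close> is a coproduct
  injection or a quotient map; \<open>sub_chart\<close> is the inverse of an inclusion, thus truly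
  partial; \<open>prod_chart\<close> is the inverse of the tuple of projections.\<close>

definition graph_chart :: "'s \<Rightarrow> 'f \<Rightarrow> ('s, 'f, 'r) chart" where
  "graph_chart S f = ([S], Eq (Fn f [Var 0]) (Var 1))"

definition sub_chart :: "'s \<Rightarrow> 'f \<Rightarrow> ('s, 'f, 'r) chart" where
  "sub_chart S f = ([S], Eq (Fn f [Var 1]) (Var 0))"

definition prod_chart :: "'s list \<Rightarrow> 'f list \<Rightarrow> ('s, 'f, 'r) chart" where
  "prod_chart Ss ps = (Ss, conj (map (\<lambda>i. Eq (Fn (ps ! i) [Var (length Ss)]) (Var i)) [0..<length Ss]))"

lemma fst_chart [simp]: "fst (graph_chart S f) = [S]" "fst (sub_chart S f) = [S]" "fst (prod_chart Ss ps) = Ss"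
  by (simp_all add: graph_chart_def sub_chart_def prod_chart_def)

lemma dec_graph_chart: "dec M (graph_chart S f) [x] y \<longleftrightarrow> fint M f [x] = y"
  by (simp add: dec_def graph_chart_def)

lemma dec_sub_chart: "dec M (sub_chart S f) [x] y \<longleftrightarrow> fint M f [y] = x"
  by (simp add: dec_def sub_chart_def)

lemma dec_prod_chart:
  "length x = length Ss \<Longrightarrow> dec M (prod_chart Ss ps) x y \<longleftrightarrow> (\<forall>i<length Ss. fint M (ps ! i) [y] = x ! i)"
  by (auto simp: dec_def prod_chart_def sat_conj nth_append)

text \<open>Carrier of the expansion of a model of \<open>T1\<close>: an element of an old sort is represented by the
  singleton of a one-element list, an element of a product by the singleton of the tuple, and an
  equivalence class by the set of one-element lists of its members. The number is the index of a
  summand of a coproduct, and \<open>0\<close> otherwise.\<close>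

definition emb :: "'a \<Rightarrow> nat \<times> 'a list set" where
  "emb x = (0, {[x]})"

definition unemb :: "nat \<times> 'a list set \<Rightarrow> 'a" where
  "unemb b = hd (the_elem (snd b))"

lemma unemb [simp]: "unemb (emb x) = x" "unemb (n, {[x]}) = x"
  by (simp_all add: unemb_def emb_def)

lemma emb_inj [simp]: "emb x = emb y \<longleftrightarrow> x = y"
  by (simp add: emb_def)

lemma map_unemb [simp]: "map unemb (map emb a) = a"
  by (simp add: comp_def)

locale morita = T1: coherent T1 + T2: coherent T2 for T1 T2 :: "('s, 'f, 'r) coh_theory" +
  fixes \<D> :: "('s, 'f, 'r) block set"
  assumes sub: "subsignature (sig T1) (sig T2)"
    and valid: "d \<in> \<D> \<Longrightarrow> valid_block T1 (sig T2) d"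
    and new_sorts: "d \<in> \<D> \<Longrightarrow> new_sorts d \<subseteq> sorts (sig T2) - sorts (sig T1)"
    and new_funs: "d \<in> \<D> \<Longrightarrow> new_funs d \<subseteq> funs (sig T2) - funs (sig T1)"
    and new_rels: "d \<in> \<D> \<Longrightarrow> new_rels d \<subseteq> rels (sig T2) - rels (sig T1)"
    and uniq_sort: "S \<in> sorts (sig T2) - sorts (sig T1) \<Longrightarrow> \<exists>!d. d \<in> \<D> \<and> S \<in> new_sorts d"
    and uniq_fun: "f \<in> funs (sig T2) - funs (sig T1) \<Longrightarrow> \<exists>!d. d \<in> \<D> \<and> f \<in> new_funs d"
    and uniq_rel: "R \<in> rels (sig T2) - rels (sig T1) \<Longrightarrow> \<exists>!d. d \<in> \<D> \<and> R \<in> new_rels d"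
    and axs_T2: "axs T2 = axs T1 \<union> (\<Union>d\<in>\<D>. block_axioms (sig T2) d)"
begin

abbreviation "\<Sigma>1 \<equiv> sig T1"
abbreviation "\<Sigma>2 \<equiv> sig T2"

lemma sorts_mono: "S \<in> sorts \<Sigma>1 \<Longrightarrow> S \<in> sorts \<Sigma>2"
  using sub by (auto simp: subsignature_def)

lemma fun_old: "f \<in> funs \<Sigma>1 \<Longrightarrow> f \<in> funs \<Sigma>2 \<and> fdom \<Sigma>2 f = fdom \<Sigma>1 f \<and> fcod \<Sigma>2 f = fcod \<Sigma>1 f \<and>
    set (fdom \<Sigma>1 f) \<subseteq> sorts \<Sigma>1 \<and> fcod \<Sigma>1 f \<in> sorts \<Sigma>1"
  using sub T1.wf_sig by (auto simp: subsignature_def wf_signature_def)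

lemma rel_old: "R \<in> rels \<Sigma>1 \<Longrightarrow> R \<in> rels \<Sigma>2 \<and> rdom \<Sigma>2 R = rdom \<Sigma>1 R \<and> set (rdom \<Sigma>1 R) \<subseteq> sorts \<Sigma>1"
  using sub T1.wf_sig by (auto simp: subsignature_def wf_signature_def)

text \<open>The structure itself is unchanged: old symbols keep their arities and the axioms of
  \<open>T1\<close> are among those of \<open>T2\<close>.\<close>

lemma reduct: "model T2 M \<Longrightarrow> model T1 M"
  using axs_T2 by (auto simp: model_iff is_struct_def dest!: fun_old)

lemma block_sat: "model T2 M \<Longrightarrow> d \<in> \<D> \<Longrightarrow> block_sat \<Sigma>2 M d"
  using block_sat_iff[OF valid, of d M] new_funs[of d] axs_T2 by (auto simp: model_iff)

lemma block_sat_models: "M \<in> models T2 \<Longrightarrow> d \<in> \<D> \<Longrightarrow> block_sat \<Sigma>2 M d"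
  by (rule block_sat) (simp add: models_def)

lemma inhabited_sort: "inhabited T1 S \<Longrightarrow> S \<in> sorts \<Sigma>1"
  by (simp add: inhabited_def)

lemma prod_D:
  assumes "DefProd P Ss ps \<in> \<D>"
  shows "set Ss \<subseteq> sorts \<Sigma>1" "P \<in> sorts \<Sigma>2" "P \<notin> sorts \<Sigma>1" "length ps = length Ss" "distinct ps"
    and "i < length Ss \<Longrightarrow> fdom \<Sigma>2 (ps ! i) = [P] \<and> fcod \<Sigma>2 (ps ! i) = Ss ! i \<and> ps ! i \<in> funs \<Sigma>2 \<and> ps ! i \<notin> funs \<Sigma>1"
  using valid[OF assms] new_sorts[OF assms] new_funs[OF assms] inhabited_sort by (auto simp: subset_iff)

lemma coprod_D:
  assumes "DefCoprod P Ss rs \<in> \<D>"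
  shows "set Ss \<subseteq> sorts \<Sigma>1" "P \<in> sorts \<Sigma>2" "P \<notin> sorts \<Sigma>1" "length rs = length Ss" "distinct rs"
    and "i < length Ss \<Longrightarrow> fdom \<Sigma>2 (rs ! i) = [Ss ! i] \<and> fcod \<Sigma>2 (rs ! i) = P \<and> rs ! i \<in> funs \<Sigma>2 \<and> rs ! i \<notin> funs \<Sigma>1"
  using valid[OF assms] new_sorts[OF assms] new_funs[OF assms] inhabited_sort by (auto simp: subset_iff)

lemma sub_D:
  assumes "DefSub S S' \<phi> i \<in> \<D>"
  shows "S' \<in> sorts \<Sigma>1" "S \<in> sorts \<Sigma>2" "S \<notin> sorts \<Sigma>1" "fm_in_ctx \<Sigma>1 [S'] \<phi>"
    "fdom \<Sigma>2 i = [S]" "fcod \<Sigma>2 i = S'" "i \<in> funs \<Sigma>2" "i \<notin> funs \<Sigma>1"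
  using valid[OF assms] new_sorts[OF assms] new_funs[OF assms] inhabited_sort by auto

lemma quot_D:
  assumes "DefQuot S S' \<phi> e \<in> \<D>"
  shows "S' \<in> sorts \<Sigma>1" "S \<in> sorts \<Sigma>2" "S \<notin> sorts \<Sigma>1" "fm_in_ctx \<Sigma>1 [S', S'] \<phi>"
    "fdom \<Sigma>2 e = [S']" "fcod \<Sigma>2 e = S" "e \<in> funs \<Sigma>2" "e \<notin> funs \<Sigma>1" "provable_equivalence T1 S' \<phi>"
  using valid[OF assms] new_sorts[OF assms] new_funs[OF assms] inhabited_sort by auto

lemma fun_D:
  assumes "DefFun f \<phi> \<in> \<D>"
  shows "fm_in_ctx \<Sigma>1 (fdom \<Sigma>2 f @ [fcod \<Sigma>2 f]) \<phi>" "provably_functional T1 (fdom \<Sigma>2 f) (fcod \<Sigma>2 f) \<phi>"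
    "set (fdom \<Sigma>2 f) \<subseteq> sorts \<Sigma>1" "fcod \<Sigma>2 f \<in> sorts \<Sigma>1" "f \<in> funs \<Sigma>2" "f \<notin> funs \<Sigma>1"
  using valid[OF assms] new_funs[OF assms] by (auto simp: fm_in_ctx_def)

lemma rel_D:
  assumes "DefRel R \<phi> \<in> \<D>"
  shows "fm_in_ctx \<Sigma>1 (rdom \<Sigma>2 R) \<phi>" "set (rdom \<Sigma>2 R) \<subseteq> sorts \<Sigma>1" "R \<in> rels \<Sigma>2" "R \<notin> rels \<Sigma>1"
  using valid[OF assms] new_rels[OF assms] by (auto simp: fm_in_ctx_def)

section \<open>The charts of a Morita extension\<close>

definition sort_block :: "'s \<Rightarrow> ('s, 'f, 'r) block" where
  "sort_block S = (THE d. d \<in> \<D> \<and> S \<in> new_sorts d)"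

definition fun_block :: "'f \<Rightarrow> ('s, 'f, 'r) block" where
  "fun_block f = (THE d. d \<in> \<D> \<and> f \<in> new_funs d)"

definition rel_block :: "'r \<Rightarrow> ('s, 'f, 'r) block" where
  "rel_block R = (THE d. d \<in> \<D> \<and> R \<in> new_rels d)"

lemma sort_block: "d \<in> \<D> \<Longrightarrow> S \<in> new_sorts d \<Longrightarrow> sort_block S = d"
  unfolding sort_block_def using uniq_sort[of S] new_sorts[of d] by (intro the1_equality) auto

lemma fun_block: "d \<in> \<D> \<Longrightarrow> f \<in> new_funs d \<Longrightarrow> fun_block f = d"
  unfolding fun_block_def using uniq_fun[of f] new_funs[of d] by (intro the1_equality) auto

lemma rel_block: "d \<in> \<D> \<Longrightarrow> R \<in> new_rels d \<Longrightarrow> rel_block R = d"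
  unfolding rel_block_def using uniq_rel[of R] new_rels[of d] by (intro the1_equality) auto

text \<open>The empty list is never the value at a sort of \<open>T2\<close>: blocks for functions
  and relations introduce no sort.\<close>

definition charts :: "'s \<Rightarrow> ('s, 'f, 'r) chart list" where
  "charts S = (if S \<in> sorts \<Sigma>1 then [old_chart S] else case sort_block S of
     DefProd P Ss ps \<Rightarrow> [prod_chart Ss ps]
   | DefCoprod P Ss rs \<Rightarrow> map (\<lambda>i. graph_chart (Ss ! i) (rs ! i)) [0..<length Ss]
   | DefSub S0 S' \<phi> i \<Rightarrow> [sub_chart S' i]
   | DefQuot S0 S' \<phi> e \<Rightarrow> [graph_chart S' e]
   | _ \<Rightarrow> [])"

lemma charts_old: "S \<in> sorts \<Sigma>1 \<Longrightarrow> charts S = [old_chart S]"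
  by (simp add: charts_def)

lemma charts_prod: "DefProd P Ss ps \<in> \<D> \<Longrightarrow> charts P = [prod_chart Ss ps]"
  using prod_D(3) sort_block by (fastforce simp: charts_def)

lemma charts_coprod: "DefCoprod P Ss rs \<in> \<D> \<Longrightarrow> charts P = map (\<lambda>i. graph_chart (Ss ! i) (rs ! i)) [0..<length Ss]"
  using coprod_D(3) sort_block by (fastforce simp: charts_def)

lemma charts_sub: "DefSub S S' \<phi> i \<in> \<D> \<Longrightarrow> charts S = [sub_chart S' i]"
  using sub_D(3) sort_block by (fastforce simp: charts_def)

lemma charts_quot: "DefQuot S S' \<phi> e \<in> \<D> \<Longrightarrow> charts S = [graph_chart S' e]"
  using quot_D(3) sort_block by (fastforce simp: charts_def)

lemma sort_cases [consumes 1, case_names old prod coprod sub quot]: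
  assumes "S \<in> sorts \<Sigma>2"
  obtains "S \<in> sorts \<Sigma>1" | Ss ps where "DefProd S Ss ps \<in> \<D>" | Ss rs where "DefCoprod S Ss rs \<in> \<D>"
  | S' \<phi> i where "DefSub S S' \<phi> i \<in> \<D>" | S' \<phi> e where "DefQuot S S' \<phi> e \<in> \<D>"
proof (cases "S \<in> sorts \<Sigma>1")
  case False
  then obtain d where "d \<in> \<D>" "S \<in> new_sorts d" using uniq_sort[of S] assms by auto
  then show thesis by (cases d) (auto intro: that)
qed (rule that(1))

lemma fn_cases [consumes 1, case_names old dfn proj inj sub quot]:
  assumes "f \<in> funs \<Sigma>2"
  obtains "f \<in> funs \<Sigma>1" | \<phi> where "DefFun f \<phi> \<in> \<D>"
  | P Ss ps i where "DefProd P Ss ps \<in> \<D>" "i < length Ss" "f = ps ! i"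
  | P Ss rs i where "DefCoprod P Ss rs \<in> \<D>" "i < length Ss" "f = rs ! i"
  | S S' \<phi> where "DefSub S S' \<phi> f \<in> \<D>" | S S' \<phi> where "DefQuot S S' \<phi> f \<in> \<D>"
proof (cases "f \<in> funs \<Sigma>1")
  case False
  then obtain d where d: "d \<in> \<D>" "f \<in> new_funs d" using uniq_fun[of f] assms by auto
  show thesis
  proof (cases d)
    case (DefProd P Ss ps)
    then show ?thesis using d that(3) prod_D(4) by (auto simp: in_set_conv_nth)
  next
    case (DefCoprod P Ss rs)
    then show ?thesis using d that(4) coprod_D(4) by (auto simp: in_set_conv_nth)
  qed (use d that in auto)
qed (rule that(1))

lemma rel_cases [consumes 1, case_names old dfn]:
  assumes "R \<in> rels \<Sigma>2"
  obtains "R \<in> rels \<Sigma>1" | \<phi> where "DefRel R \<phi> \<in> \<D>"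
proof (cases "R \<in> rels \<Sigma>1")
  case False
  then obtain d where "d \<in> \<D>" "R \<in> new_rels d" using uniq_rel[of R] assms by auto
  then show thesis by (cases d) (auto intro: that)
qed (rule that(1))

lemma fint_car: "M \<in> models T2 \<Longrightarrow> f \<in> funs \<Sigma>2 \<Longrightarrow> fdom \<Sigma>2 f = [S] \<Longrightarrow> fcod \<Sigma>2 f = S' \<Longrightarrow> x \<in> car M S \<Longrightarrow>
    fint M f [x] \<in> car M S'"
  by (rule struct_fint1[of \<Sigma>2]) (simp_all add: models_def model_def)

lemma definable_var_eq:
  "i < length \<Gamma> \<Longrightarrow> j < length \<Gamma> \<Longrightarrow> \<Gamma> ! i = \<Gamma> ! j \<Longrightarrow> set \<Gamma> \<subseteq> sorts \<Sigma> \<Longrightarrow> definable \<Sigma> \<M> \<Gamma> (\<lambda>M a. a ! i = a ! j)"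
  using definable_fm[of \<Sigma> \<Gamma> "Eq (Var i) (Var j)" \<M>] by (simp add: fm_in_ctx_def wt_Var_iff)

lemma charts_ctx:
  assumes "S \<in> sorts \<Sigma>2" "k \<in> set (charts S)"
  shows "set (fst k) \<subseteq> sorts \<Sigma>1 \<and> fm_in_ctx \<Sigma>2 (fst k @ [S]) (snd k)"
  using assms(1)
proof (cases rule: sort_cases)
  case old
  then show ?thesis using assms by (auto simp: charts_old fm_in_ctx_def old_chart_def wt_Var_iff)
next
  case (prod Ss ps)
  note p = prod_D[OF prod]
  show ?thesis
    using assms p sorts_mono
    by (auto simp: charts_prod[OF prod] fm_in_ctx_def prod_chart_def wf_conj wt_Var_iff wt_Fn_iff nth_append)
next
  case (coprod Ss rs)
  note p = coprod_D[OF coprod]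
  show ?thesis
    using assms p sorts_mono
    by (auto simp: charts_coprod[OF coprod] fm_in_ctx_def graph_chart_def wt_Var_iff wt_Fn_iff subset_iff)
next
  case (sub S' \<phi> i)
  show ?thesis
    using assms sub_D[OF sub] sorts_mono
    by (auto simp: charts_sub[OF sub] fm_in_ctx_def sub_chart_def wt_Var_iff wt_Fn_iff)
next
  case (quot S' \<phi> e)
  show ?thesis
    using assms quot_D[OF quot] sorts_mono
    by (auto simp: charts_quot[OF quot] fm_in_ctx_def graph_chart_def wt_Var_iff wt_Fn_iff)
qed

lemma charts_fun:
  assumes M: "M \<in> models T2" and S: "S \<in> sorts \<Sigma>2" and k: "k \<in> set (charts S)" and x: "x \<in> tup M (fst k)"
    and y: "y \<in> car M S" "y' \<in> car M S" and d: "dec M k x y" "dec M k x y'"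
  shows "y = y'"
  using S
proof (cases rule: sort_cases)
  case old
  then show ?thesis using k x d by (auto simp: charts_old tup_Cons dec_old_chart)
next
  case (prod Ss ps)
  then show ?thesis
    using k x d y block_sat_models[OF M prod] by (auto simp: charts_prod dec_prod_chart tup_length)
next
  case (coprod Ss rs)
  then show ?thesis using k x d by (auto simp: charts_coprod tup_Cons dec_graph_chart)
next
  case (sub S' \<phi> i)
  then show ?thesis
    using k x d y block_sat_models[OF M sub] by (auto simp: charts_sub tup_Cons dec_sub_chart)
next
  case (quot S' \<phi> e)
  then show ?thesis using k x d by (auto simp: charts_quot tup_Cons dec_graph_chart)
qed

lemma charts_surj:
  assumes M: "M \<in> models T2" and S: "S \<in> sorts \<Sigma>2" and y: "y \<in> car M S"
  shows "\<exists>k\<in>set (charts S). \<exists>x\<in>tup M (fst k). dec M k x y"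
  using S
proof (cases rule: sort_cases)
  case old
  then show ?thesis using y by (simp add: charts_old Bex_tup_Cons dec_old_chart)
next
  case (prod Ss ps)
  note p = prod_D[OF prod]
  let ?x = "map (\<lambda>i. fint M (ps ! i) [y]) [0..<length Ss]"
  have "?x \<in> tup M Ss"
    using p(6) fint_car[OF M _ _ _ y] by (auto simp: tup_def list_all2_conv_all_nth)
  then show ?thesis
    by (auto simp: charts_prod[OF prod] dec_prod_chart tup_length intro!: bexI[of _ ?x])
next
  case (coprod Ss rs)
  then show ?thesis
    using block_sat_models[OF M coprod] y by (fastforce simp: charts_coprod Bex_tup_Cons dec_graph_chart)
next
  case (sub S' \<phi> i)
  note p = sub_D[OF sub]
  then show ?thesis
    using fint_car[OF M p(7,5,6) y] by (simp add: charts_sub[OF sub] Bex_tup_Cons dec_sub_chart)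
next
  case (quot S' \<phi> e)
  then show ?thesis
    using block_sat_models[OF M quot] y by (simp add: charts_quot Bex_tup_Cons dec_graph_chart)
qed

text \<open>Two codes name the same element of a product when they are equal, of a coproduct when
  they are equal and in the same summand, of a subsort when they are equal and satisfy
  \<open>\<phi>\<close>, of a quotient when they are related by \<open>\<phi>\<close>. All of these
  are formulas over old sorts.\<close>

lemma charts_eq:
  assumes S: "S \<in> sorts \<Sigma>2" and k: "k \<in> set (charts S)" "k' \<in> set (charts S)"
  shows "definable \<Sigma>1 (models T2) (fst k @ fst k')
    (\<lambda>M z. \<exists>y\<in>car M S. dec M k (take (length (fst k)) z) y \<and> dec M k' (drop (length (fst k)) z) y)"
  using S
proof (cases rule: sort_cases)
  case old
  then have kk: "k = old_chart S" "k' = old_chart S" using k by (auto simp: charts_old)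
  have "definable \<Sigma>1 (models T2) [S, S] (\<lambda>M z. z ! 0 = z ! 1)" by (rule definable_var_eq) (use old in auto)
  then have "definable \<Sigma>1 (models T2) (fst k @ fst k') (\<lambda>M z. z ! 0 = z ! 1)" by (simp add: kk old_chart_def)
  then show ?thesis by (rule definable_cong) (auto simp: kk old_chart_def tup_Cons dec_def)
next
  case (prod Ss ps)
  then have kk: "k = prod_chart Ss ps" "k' = prod_chart Ss ps" using k by (auto simp: charts_prod)
  note p = prod_D[OF prod]
  let ?n = "length Ss"
  have "definable \<Sigma>1 (models T2) (Ss @ Ss) (\<lambda>M z. map ((!) z) [0..<?n] = map ((!) z) [?n..<?n + ?n])"
    by (rule definable_eq) (use p in \<open>auto simp: nth_append\<close>)
  then show ?thesis
    unfolding kk fst_chart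
  proof (rule definable_cong)
    fix M z assume M: "M \<in> models T2" and "z \<in> tup M (Ss @ Ss)"
    then obtain a b where z: "z = a @ b" "a \<in> tup M Ss" "b \<in> tup M Ss" "length a = ?n" "length b = ?n"
      by (auto elim: tup_appendE)
    obtain q where q: "q \<in> car M S" "\<forall>i<?n. fint M (ps ! i) [q] = a ! i"
      using block_sat_models[OF M prod] z(2) by auto
    have "(\<exists>y\<in>car M S. dec M (prod_chart Ss ps) a y \<and> dec M (prod_chart Ss ps) b y) \<longleftrightarrow> a = b"
    proof
      assume "\<exists>y\<in>car M S. dec M (prod_chart Ss ps) a y \<and> dec M (prod_chart Ss ps) b y"
      then show "a = b" using z(4,5) by (intro nth_equalityI) (auto simp: dec_prod_chart)
    qed (use q z(4) in \<open>auto simp: dec_prod_chart\<close>)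
    then show "map ((!) z) [0..<?n] = map ((!) z) [?n..<?n + ?n] \<longleftrightarrow>
      (\<exists>y\<in>car M S. dec M (prod_chart Ss ps) (take ?n z) y \<and> dec M (prod_chart Ss ps) (drop ?n z) y)"
      using z(4,5) by (simp add: z(1) map_nth_upt)
  qed
next
  case (coprod Ss rs)
  then obtain i j where i: "i < length Ss" "j < length Ss" and kk: "k = graph_chart (Ss ! i) (rs ! i)" "k' = graph_chart (Ss ! j) (rs ! j)"
    using k by (auto simp: charts_coprod)
  note p = coprod_D[OF coprod]
  have srt: "set [Ss ! i, Ss ! j] \<subseteq> sorts \<Sigma>1" using p(1) i by auto
  have key: "(\<exists>y\<in>car M S. fint M (rs ! i) [a] = y \<and> fint M (rs ! j) [b] = y) \<longleftrightarrow> i = j \<and> a = b"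
    if "M \<in> models T2" "a \<in> car M (Ss ! i)" "b \<in> car M (Ss ! j)" for M a b
    using block_sat_models[OF that(1) coprod] that(2,3) i fint_car[OF that(1) _ _ _ that(2)] p(6)[OF i(1)]
    by (auto; blast)
  have "definable \<Sigma>1 (models T2) [Ss ! i, Ss ! j] (\<lambda>M z. i = j \<and> z ! 0 = z ! 1)"
  proof (cases "i = j")
    case True
    then show ?thesis using definable_var_eq[of 0 "[Ss ! i, Ss ! j]" 1 \<Sigma>1 "models T2"] srt by simp
  next
    case False
    then show ?thesis using definable_const[OF srt, of _ False] by simp
  qed
  then show ?thesis
    unfolding kk fst_chart append.simps
  proof (rule definable_cong)
    fix M z assume M: "M \<in> models T2" and "z \<in> tup M [Ss ! i, Ss ! j]"
    then obtain a b where z: "z = [a, b]" "a \<in> car M (Ss ! i)" "b \<in> car M (Ss ! j)" by (auto simp: tup_Cons)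
    show "(i = j \<and> z ! 0 = z ! 1) \<longleftrightarrow>
        (\<exists>y\<in>car M S. dec M (graph_chart (Ss ! i) (rs ! i)) (take (length [Ss ! i]) z) y \<and>
          dec M (graph_chart (Ss ! j) (rs ! j)) (drop (length [Ss ! i]) z) y)"
      using key[OF M z(2,3)] by (simp add: z(1) dec_graph_chart)
  qed
next
  case (sub S' \<phi> i)
  then have kk: "k = sub_chart S' i" "k' = sub_chart S' i" using k by (auto simp: charts_sub)
  note p = sub_D[OF sub]
  \<comment> \<open>Equality alone is not enough: a code that violates \<open>\<phi>\<close> names
    no element of the subsort.\<close>
  have "definable \<Sigma>1 (models T2) [S', S'] (\<lambda>M z. sat M ((!) (take (length [S']) (drop 0 z))) \<phi> \<and> z ! 0 = z ! 1)"
    by (rule definable_conj[OF definable_block[OF definable_fm[OF p(4)]] definable_var_eq]) (use p in auto)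
  then show ?thesis
    unfolding kk fst_chart append.simps
  proof (rule definable_cong)
    fix M z assume M: "M \<in> models T2" and "z \<in> tup M [S', S']"
    then obtain a b where z: "z = [a, b]" "a \<in> car M S'" "b \<in> car M S'" by (auto simp: tup_Cons)
    have "sat M ((!) [a]) \<phi> \<longleftrightarrow> (\<exists>y\<in>car M S. fint M i [y] = a)" using block_sat_models[OF M sub] z(2) by simp
    then show "sat M ((!) (take (length [S']) (drop 0 z))) \<phi> \<and> z ! 0 = z ! 1 \<longleftrightarrow>
        (\<exists>y\<in>car M S. dec M (sub_chart S' i) (take (length [S']) z) y \<and> dec M (sub_chart S' i) (drop (length [S']) z) y)"
      by (auto simp: z(1) dec_sub_chart)
  qed
next
  case (quot S' \<phi> e)
  then have kk: "k = graph_chart S' e" "k' = graph_chart S' e" using k by (auto simp: charts_quot)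
  note p = quot_D[OF quot]
  show ?thesis
    unfolding kk fst_chart append.simps
  proof (rule definable_cong[OF definable_fm[OF p(4)]])
    fix M z assume M: "M \<in> models T2" and "z \<in> tup M [S', S']"
    then obtain a b where z: "z = [a, b]" "a \<in> car M S'" "b \<in> car M S'" by (auto simp: tup_Cons)
    have "sat M ((!) [a, b]) \<phi> \<longleftrightarrow> fint M e [a] = fint M e [b]" using block_sat_models[OF M quot] z(2,3) by simp
    then show "sat M ((!) z) \<phi> \<longleftrightarrow> (\<exists>y\<in>car M S. dec M (graph_chart S' e) (take (length [S']) z) y \<and>
        dec M (graph_chart S' e) (drop (length [S']) z) y)"
      using fint_car[OF M p(7,5,6) z(2)] by (auto simp: z(1) dec_graph_chart)
  qed
qed

abbreviation chs :: "('s, 'f, 'r) chart list \<Rightarrow> 's list \<Rightarrow> bool" where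
  "chs \<equiv> list_all2 (\<lambda>k S. k \<in> set (charts S))"

lemma chs_old: "set \<Gamma> \<subseteq> sorts \<Sigma>1 \<Longrightarrow> chs ks \<Gamma> \<longleftrightarrow> ks = map old_chart \<Gamma>"
  using charts_old by (intro chs_old_iff) auto

text \<open>On codes, a projection is equality with a coordinate, an injection is equality within
  its own summand and false in the others, an inclusion is equality together with
  \<open>\<phi>\<close>, and a quotient map is \<open>\<phi>\<close> itself. Explicitly defined
  functions use their defining formula.\<close>

lemma charts_fint:
  assumes f: "f \<in> funs \<Sigma>2" and ks: "chs ks (fdom \<Sigma>2 f)" and k: "k \<in> set (charts (fcod \<Sigma>2 f))"
  shows "definable \<Sigma>1 (models T2) (fst k @ cx ks)
        (\<lambda>M z. \<exists>ys\<in>tup M (fdom \<Sigma>2 f). decs M ks (drop (length (fst k)) z) ys \<and>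
           dec M k (take (length (fst k)) z) (fint M f ys))"
  using f
proof (cases rule: fn_cases)
  case old
  note o = fun_old[OF old]
  have kk: "ks = map old_chart (fdom \<Sigma>1 f)" "k = old_chart (fcod \<Sigma>1 f)" using o ks k by (auto simp: chs_old charts_old)
  let ?n = "length (fdom \<Sigma>1 f)"
  have wtv: "list_all2 (wt \<Sigma>1 (fcod \<Sigma>1 f # fdom \<Sigma>1 f)) (vars 1 ?n) (fdom \<Sigma>1 f)" by (rule wt_vars) auto
  have "fm_in_ctx \<Sigma>1 (fcod \<Sigma>1 f # fdom \<Sigma>1 f) (Eq (Fn f (vars 1 ?n)) (Var 0))"
    using o old wtv by (auto simp: fm_in_ctx_def wt_Fn_iff wt_Var_iff)
  from definable_fm[OF this] show ?thesis
    unfolding kk cx_old fst_old_chart append.simps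
    by (rule definable_cong) (use o in \<open>auto simp: tup_Cons dec_old_chart decs_old tup_length\<close>)
next
  case (dfn \<phi>)
  note p = fun_D[OF dfn]
  have kk: "ks = map old_chart (fdom \<Sigma>2 f)" "k = old_chart (fcod \<Sigma>2 f)" using p ks k by (auto simp: chs_old charts_old)
  let ?n = "length (fdom \<Sigma>2 f)"
  \<comment> \<open>The defining formula has the value as its last variable, the chart has it first;
    the list of positions rotates it.\<close>
  have "definable \<Sigma>1 (models T2) (fcod \<Sigma>2 f # fdom \<Sigma>2 f) (\<lambda>M z. sat M ((!) (map ((!) z) ([1..<1 + ?n] @ [0]))) \<phi>)"
    by (rule definable_sub[OF definable_fm[OF p(1)]]) (use p in \<open>auto simp: nth_append nth_Cons' simp del: upt_Suc\<close>)
  then show ?thesis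
    unfolding kk cx_old fst_old_chart append.simps
  proof (rule definable_cong)
    fix M z assume M: "M \<in> models T2" and "z \<in> tup M (fcod \<Sigma>2 f # fdom \<Sigma>2 f)"
    then obtain x b where z: "z = x # b" "x \<in> car M (fcod \<Sigma>2 f)" "b \<in> tup M (fdom \<Sigma>2 f)" by (auto simp: tup_Cons)
    have b: "length b = ?n" by (rule tup_length[OF z(3)])
    then have "map ((!) z) ([1..<1 + ?n] @ [0]) = b @ [x]"
      by (intro nth_equalityI) (auto simp: z(1) nth_append nth_Cons' simp del: upt_Suc)
    moreover have "fint M f b = x \<longleftrightarrow> sat M ((!) (b @ [x])) \<phi>" using block_sat_models[OF M dfn] z by simp
    ultimately show "sat M ((!) (map ((!) z) ([1..<1 + ?n] @ [0]))) \<phi> \<longleftrightarrow>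
        (\<exists>ys\<in>tup M (fdom \<Sigma>2 f). decs M (map old_chart (fdom \<Sigma>2 f)) (drop (length [fcod \<Sigma>2 f]) z) ys \<and>
          dec M (old_chart (fcod \<Sigma>2 f)) (take (length [fcod \<Sigma>2 f]) z) (fint M f ys))"
      using z b by (auto simp: dec_old_chart decs_old)
  qed
next
  case (proj P Ss ps i)
  note p = prod_D[OF proj(1)] and pi = prod_D(6)[OF proj(1,2)]
  have kk: "ks = [prod_chart Ss ps]" "k = old_chart (Ss ! i)"
    using pi ks k p(1) proj(2,3) by (auto simp: list_all2_Cons2 charts_prod[OF proj(1)] charts_old subset_iff)
  have "definable \<Sigma>1 (models T2) (Ss ! i # Ss) (\<lambda>M z. z ! 0 = z ! (Suc i))"
    by (rule definable_var_eq) (use p(1) proj(2) in auto)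
  then show ?thesis
    unfolding kk cx_simps fst_chart fst_old_chart append.simps append_Nil2
  proof (rule definable_cong)
    fix M z assume M: "M \<in> models T2" and "z \<in> tup M (Ss ! i # Ss)"
    then obtain a x where z: "z = a # x" "x \<in> tup M Ss" by (auto simp: tup_Cons)
    obtain q where q: "q \<in> car M P" "\<forall>i<length Ss. fint M (ps ! i) [q] = x ! i"
      using block_sat_models[OF M proj(1)] z(2) by auto
    show "z ! 0 = z ! Suc i \<longleftrightarrow> (\<exists>ys\<in>tup M (fdom \<Sigma>2 f). decs M [prod_chart Ss ps] (drop (length [Ss ! i]) z) ys \<and>
        dec M (old_chart (Ss ! i)) (take (length [Ss ! i]) z) (fint M f ys))"
      using pi proj(2,3) z q by (auto simp: Bex_tup_Cons Bex_tup_Nil dec_old_chart dec_prod_chart tup_length intro!: bexI[of _ q])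
  qed
next
  case (inj P Ss rs i)
  note p = coprod_D[OF inj(1)] and pi = coprod_D(6)[OF inj(1,2)]
  obtain j where j: "j < length Ss" and kk: "ks = [old_chart (Ss ! i)]" "k = graph_chart (Ss ! j) (rs ! j)"
    using pi ks k p(1) inj(2,3) by (auto simp: list_all2_Cons2 charts_coprod[OF inj(1)] charts_old subset_iff)
  have srt: "set [Ss ! j, Ss ! i] \<subseteq> sorts \<Sigma>1" using p(1) inj(2) j by auto
  have key: "fint M (rs ! j) [a] = fint M (rs ! i) [b] \<longleftrightarrow> j = i \<and> a = b"
    if "M \<in> models T2" "a \<in> car M (Ss ! j)" "b \<in> car M (Ss ! i)" for M a b
    using block_sat_models[OF that(1) inj(1)] that(2,3) inj(2) j by (auto; blast)
  have "definable \<Sigma>1 (models T2) [Ss ! j, Ss ! i] (\<lambda>M z. j = i \<and> z ! 0 = z ! 1)"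
  proof (cases "j = i")
    case True
    then show ?thesis using definable_var_eq[of 0 "[Ss ! j, Ss ! i]" 1 \<Sigma>1 "models T2"] srt by simp
  next
    case False
    then show ?thesis using definable_const[OF srt, of _ False] by simp
  qed
  then show ?thesis
    unfolding kk cx_simps fst_chart fst_old_chart append.simps append_Nil2
    by (rule definable_cong) (use key pi inj(3) in \<open>auto simp: tup_Cons Bex_tup_Cons dec_graph_chart dec_old_chart\<close>)
next
  case (sub S S' \<phi>)
  note p = sub_D[OF sub]
  have kk: "ks = [sub_chart S' f]" "k = old_chart S'"
    using p ks k by (auto simp: list_all2_Cons2 charts_sub[OF sub] charts_old)
  have "definable \<Sigma>1 (models T2) [S', S'] (\<lambda>M z. sat M ((!) (take (length [S']) (drop 0 z))) \<phi> \<and> z ! 0 = z ! 1)"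
    by (rule definable_conj[OF definable_block[OF definable_fm[OF p(4)]] definable_var_eq]) (use p in auto)
  then show ?thesis
    unfolding kk cx_simps fst_chart fst_old_chart append.simps append_Nil2
    by (rule definable_cong)
      (use block_sat_models[OF _ sub] p in \<open>auto simp: tup_Cons Bex_tup_Cons Bex_tup_Nil dec_sub_chart dec_old_chart\<close>)
next
  case (quot S S' \<phi>)
  note p = quot_D[OF quot]
  have kk: "ks = [old_chart S']" "k = graph_chart S' f"
    using p ks k by (auto simp: list_all2_Cons2 charts_quot[OF quot] charts_old)
  show ?thesis
    unfolding kk cx_simps fst_chart fst_old_chart append.simps append_Nil2
    by (rule definable_cong[OF definable_fm[OF p(4)]])
      (use block_sat_models[OF _ quot] p in \<open>auto simp: tup_Cons Bex_tup_Cons dec_graph_chart dec_old_chart\<close>)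
qed

lemma charts_rint:
  assumes R: "R \<in> rels \<Sigma>2" and ks: "chs ks (rdom \<Sigma>2 R)"
  shows "definable \<Sigma>1 (models T2) (cx ks) (\<lambda>M x. \<exists>ys\<in>tup M (rdom \<Sigma>2 R). decs M ks x ys \<and> rint M R ys)"
  using R
proof (cases rule: rel_cases)
  case old
  note o = rel_old[OF old]
  have kk: "ks = map old_chart (rdom \<Sigma>1 R)" using o ks by (auto simp: chs_old)
  have "list_all2 (wt \<Sigma>1 (rdom \<Sigma>1 R)) (vars 0 (length (rdom \<Sigma>1 R))) (rdom \<Sigma>1 R)" by (rule wt_vars) auto
  then have "fm_in_ctx \<Sigma>1 (rdom \<Sigma>1 R) (Rel R (vars 0 (length (rdom \<Sigma>1 R))))"
    using o old by (simp add: fm_in_ctx_def)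
  from definable_fm[OF this] show ?thesis
    unfolding kk cx_old by (rule definable_cong) (use o in \<open>auto simp: decs_old tup_length\<close>)
next
  case (dfn \<phi>)
  note p = rel_D[OF dfn]
  have kk: "ks = map old_chart (rdom \<Sigma>2 R)" using p ks by (auto simp: chs_old)
  show ?thesis
    unfolding kk cx_old
    by (rule definable_cong[OF definable_fm[OF p(1)]])
      (use block_sat_models[OF _ dfn] in \<open>auto simp: decs_old tup_length\<close>)
qed

lemma charted: "charted T1 T2 charts"
  by (intro charted.intro charted_axioms.intro T1.coherent_axioms T2.coherent_axioms sub charts_ctx charts_fun charts_surj
      charts_eq charts_fint charts_rint charts_old)

section \<open>The expansion of a model of the smaller theory\<close>

definition expand :: "('s, 'f, 'r, 'a) struct \<Rightarrow> ('s, 'f, 'r, nat \<times> 'a list set) struct" where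
  "expand M = \<lparr>
     car = (\<lambda>S. if S \<in> sorts \<Sigma>1 then emb ` car M S else case sort_block S of
         DefProd P Ss ps \<Rightarrow> (\<lambda>a. (0, {a})) ` tup M Ss
       | DefCoprod P Ss rs \<Rightarrow> {(i, {[x]}) | i x. i < length Ss \<and> x \<in> car M (Ss ! i)}
       | DefSub S0 S' \<phi> i \<Rightarrow> emb ` {x \<in> car M S'. sat M ((!) [x]) \<phi>}
       | DefQuot S0 S' \<phi> e \<Rightarrow> (\<lambda>x. (0, {[y] | y. y \<in> car M S' \<and> sat M ((!) [x, y]) \<phi>})) ` car M S'
       | _ \<Rightarrow> {}),
     fint = (\<lambda>f bs. if f \<in> funs \<Sigma>1 then emb (fint M f (map unemb bs)) else case fun_block f of
         DefFun f' \<phi> \<Rightarrow> emb (THE y. y \<in> car M (fcod \<Sigma>2 f) \<and> sat M ((!) (map unemb bs @ [y])) \<phi>)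
       | DefProd P Ss ps \<Rightarrow> emb (the_elem (snd (hd bs)) ! index ps f)
       | DefCoprod P Ss rs \<Rightarrow> (index rs f, {[unemb (hd bs)]})
       | DefQuot S0 S' \<phi> e \<Rightarrow> (0, {[y] | y. y \<in> car M S' \<and> sat M ((!) [unemb (hd bs), y]) \<phi>})
       | _ \<Rightarrow> hd bs),
     rint = (\<lambda>R bs. if R \<in> rels \<Sigma>1 then rint M R (map unemb bs) else case rel_block R of
         DefRel R' \<phi> \<Rightarrow> sat M ((!) (map unemb bs)) \<phi>
       | _ \<Rightarrow> False)\<rparr>"

context
  fixes M :: "('s, 'f, 'r, 'a) struct"
  assumes M: "model T1 M"
begin

abbreviation "E \<equiv> expand M"

lemma car_old: "S \<in> sorts \<Sigma>1 \<Longrightarrow> car E S = emb ` car M S"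
  by (simp add: expand_def)

lemma car_prod: "DefProd P Ss ps \<in> \<D> \<Longrightarrow> car E P = (\<lambda>a. (0, {a})) ` tup M Ss"
  using prod_D(3)[of P Ss ps] sort_block[of "DefProd P Ss ps" P] by (simp add: expand_def)

lemma car_coprod: "DefCoprod P Ss rs \<in> \<D> \<Longrightarrow> car E P = {(i, {[x]}) | i x. i < length Ss \<and> x \<in> car M (Ss ! i)}"
  using coprod_D(3)[of P Ss rs] sort_block[of "DefCoprod P Ss rs" P] by (simp add: expand_def)

lemma car_sub: "DefSub S S' \<phi> i \<in> \<D> \<Longrightarrow> car E S = emb ` {x \<in> car M S'. sat M ((!) [x]) \<phi>}"
  using sub_D(3)[of S S' \<phi> i] sort_block[of "DefSub S S' \<phi> i" S] by (simp add: expand_def)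

abbreviation "cls S' \<phi> x \<equiv> (0 :: nat, {[y] | y. y \<in> car M S' \<and> sat M ((!) [x, y]) \<phi>})"

lemma car_quot: "DefQuot S S' \<phi> e \<in> \<D> \<Longrightarrow> car E S = cls S' \<phi> ` car M S'"
  using quot_D(3)[of S S' \<phi> e] sort_block[of "DefQuot S S' \<phi> e" S] by (simp add: expand_def)

lemma tup_old: "set \<Gamma> \<subseteq> sorts \<Sigma>1 \<Longrightarrow> tup E \<Gamma> = map emb ` tup M \<Gamma>"
proof (induction \<Gamma>)
  case (Cons S \<Gamma>)
  have IH: "tup E \<Gamma> = map emb ` tup M \<Gamma>" and S: "car E S = emb ` car M S" using Cons by (simp_all add: car_old)
  show ?case
  proof (intro set_eqI iffI)
    fix b assume "b \<in> tup E (S # \<Gamma>)"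
    then obtain x a where "b = map emb (x # a)" "x \<in> car M S" "a \<in> tup M \<Gamma>" by (auto simp: tup_Cons IH S)
    then show "b \<in> map emb ` tup M (S # \<Gamma>)" by (intro image_eqI[of _ _ "x # a"]) (auto simp: tup_Cons)
  next
    fix b assume "b \<in> map emb ` tup M (S # \<Gamma>)"
    then obtain x a where "b = emb x # map emb a" "x \<in> car M S" "a \<in> tup M \<Gamma>" by (auto simp: tup_Cons)
    then show "b \<in> tup E (S # \<Gamma>)" unfolding tup_Cons IH S by blast
  qed
qed (auto simp: set_eq_iff)

lemma fint_old: "f \<in> funs \<Sigma>1 \<Longrightarrow> fint E f bs = emb (fint M f (map unemb bs))"
  by (simp add: expand_def)

lemma fint_def: "DefFun f \<phi> \<in> \<D> \<Longrightarrow>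
    fint E f bs = emb (THE y. y \<in> car M (fcod \<Sigma>2 f) \<and> sat M ((!) (map unemb bs @ [y])) \<phi>)"
  using fun_D(6)[of f \<phi>] fun_block[of "DefFun f \<phi>" f] by (simp add: expand_def)

lemma fint_proj: "DefProd P Ss ps \<in> \<D> \<Longrightarrow> i < length Ss \<Longrightarrow> fint E (ps ! i) [(n, {a})] = emb (a ! i)"
  using prod_D(4-6)[of P Ss ps] fun_block[of "DefProd P Ss ps" "ps ! i"]
  by (simp add: expand_def index_distinct)

lemma fint_inj: "DefCoprod P Ss rs \<in> \<D> \<Longrightarrow> i < length Ss \<Longrightarrow> fint E (rs ! i) [b] = (i, {[unemb b]})"
  using coprod_D(4-6)[of P Ss rs] fun_block[of "DefCoprod P Ss rs" "rs ! i"]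
  by (simp add: expand_def index_distinct)

text \<open>The inclusion is the identity and falls under the default case of \<open>expand\<close>,
  since elements of the subsort and of its ambient sort are embedded in the same way.\<close>

lemma fint_sub: "DefSub S S' \<phi> i \<in> \<D> \<Longrightarrow> fint E i [b] = b"
  using sub_D(8)[of S S' \<phi> i] fun_block[of "DefSub S S' \<phi> i" i] by (simp add: expand_def)

lemma fint_quot: "DefQuot S S' \<phi> e \<in> \<D> \<Longrightarrow> fint E e [b] = cls S' \<phi> (unemb b)"
  using quot_D(8)[of S S' \<phi> e] fun_block[of "DefQuot S S' \<phi> e" e] by (simp add: expand_def)

lemma rint_old: "R \<in> rels \<Sigma>1 \<Longrightarrow> rint E R bs = rint M R (map unemb bs)"
  by (simp add: expand_def)

lemma rint_def: "DefRel R \<phi> \<in> \<D> \<Longrightarrow> rint E R bs \<longleftrightarrow> sat M ((!) (map unemb bs)) \<phi>"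
  using rel_D(4)[of R \<phi>] rel_block[of "DefRel R \<phi>" R] by (simp add: expand_def)

lemma eval_expand: "wt \<Sigma>1 \<Gamma> t S \<Longrightarrow> eval E (\<lambda>i. emb (e i)) t = emb (eval M e t)"
proof (induction rule: wt.induct)
  case (Fn f ts)
  then have "map (eval E (\<lambda>i. emb (e i))) ts = map emb (map (eval M e) ts)"
    by (auto simp: list_all2_conv_all_nth in_set_conv_nth)
  then show ?case using Fn(1) by (simp add: fint_old comp_def del: map_map map_eq_conv)
qed simp

text \<open>The carrier of an old sort consists exactly of the embedded elements, so quantifiers
  range over the same elements before and after the expansion.\<close>

lemma sat_expand_env: "wf_fm \<Sigma>1 \<Gamma> \<phi> \<Longrightarrow> sat E (\<lambda>i. emb (e i)) \<phi> \<longleftrightarrow> sat M e \<phi>"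
proof (induction \<phi> arbitrary: \<Gamma> e)
  case (Eq t u)
  then obtain S where "wt \<Sigma>1 \<Gamma> t S" "wt \<Sigma>1 \<Gamma> u S" by auto
  then show ?case using eval_expand by simp
next
  case (Rel R ts)
  have "eval E (\<lambda>i. emb (e i)) (ts ! i) = emb (eval M e (ts ! i))" if "i < length ts" for i
    using eval_expand[of \<Gamma> "ts ! i" "rdom \<Sigma>1 R ! i" e] Rel that by (auto simp: list_all2_conv_all_nth)
  then have "map (eval E (\<lambda>i. emb (e i))) ts = map emb (map (eval M e) ts)" by (auto simp: in_set_conv_nth)
  then show ?case using Rel by (simp add: rint_old comp_def del: map_map map_eq_conv)
next
  case (Ex S \<phi>)
  have "case_nat (emb x) (\<lambda>i. emb (e i)) = (\<lambda>i. emb (case_nat x e i))" for x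
    by (auto simp: fun_eq_iff split: nat.split)
  then have "sat E (case_nat (emb x) (\<lambda>i. emb (e i))) \<phi> \<longleftrightarrow> sat M (case_nat x e) \<phi>" for x
    using Ex.IH[of "S # \<Gamma>" "case_nat x e"] Ex.prems by simp
  then show ?case using Ex.prems by (simp add: car_old)
qed auto

lemma sat_expand:
  assumes "wf_fm \<Sigma>1 \<Gamma> \<phi>" "length a = length \<Gamma>"
  shows "sat E ((!) (map emb a)) \<phi> \<longleftrightarrow> sat M ((!) a) \<phi>"
  using sat_cong[OF assms(1), of "(!) (map emb a)" "\<lambda>i. emb (a ! i)" E] sat_expand_env[OF assms(1)] assms(2) by simp

lemma functional_sem:
  assumes d: "DefFun f \<phi> \<in> \<D>" and a: "a \<in> tup M (fdom \<Sigma>2 f)"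
  shows "\<exists>!y. y \<in> car M (fcod \<Sigma>2 f) \<and> sat M ((!) (a @ [y])) \<phi>"
proof -
  note p = fun_D[OF d]
  let ?Ss = "fdom \<Sigma>2 f" let ?S = "fcod \<Sigma>2 f" let ?n = "length ?Ss"
  have wf: "wf_fm \<Sigma>1 (?Ss @ [?S]) \<phi>" using p(1) by (simp add: fm_in_ctx_def)
  have pr: "prov T1 ?Ss Top (Ex ?S (inst \<phi> (vars 1 ?n @ [Var 0])))"
    "prov T1 (?Ss @ [?S, ?S]) (And (inst \<phi> (vars 0 ?n @ [Var ?n])) (inst \<phi> (vars 0 ?n @ [Var (?n + 1)])))
         (Eq (Var ?n) (Var (?n + 1)))"
    using p(2) by (auto simp: provably_functional_def Let_def)
  have la: "length a = ?n" by (rule tup_length[OF a])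
  have "sat M ((!) a) (Ex ?S (inst \<phi> (vars 1 ?n @ [Var 0])))"
    using soundness[OF T1.coherent M pr(1) a] by simp
  then obtain y where y: "y \<in> car M ?S" "sat M ((!) (a @ [y])) \<phi>"
    by (auto simp: nth_Cons_fun[symmetric] sat_inst[OF wf] la)
  have "y = y'" if "y' \<in> car M ?S" "sat M ((!) (a @ [y'])) \<phi>" for y'
  proof -
    have "a @ [y, y'] \<in> tup M (?Ss @ [?S, ?S])" using a y that by (intro tup_appendI) (simp_all add: tup_Cons)
    from soundness[OF T1.coherent M pr(2) this] show ?thesis
      using y(2) that(2) by (simp add: sat_inst[OF wf] la nth_append)
  qed
  then show ?thesis using y by blast
qed

lemma equivalence_sem:
  assumes d: "DefQuot S S' \<phi> e \<in> \<D>"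
  shows "x \<in> car M S' \<Longrightarrow> sat M ((!) [x, x]) \<phi>"
    and "x \<in> car M S' \<Longrightarrow> y \<in> car M S' \<Longrightarrow> sat M ((!) [x, y]) \<phi> \<Longrightarrow> sat M ((!) [y, x]) \<phi>"
    and "x \<in> car M S' \<Longrightarrow> y \<in> car M S' \<Longrightarrow> z \<in> car M S' \<Longrightarrow> sat M ((!) [x, y]) \<phi> \<Longrightarrow> sat M ((!) [y, z]) \<phi> \<Longrightarrow>
      sat M ((!) [x, z]) \<phi>"
proof -
  note p = quot_D[OF d]
  have wf: "wf_fm \<Sigma>1 [S', S'] \<phi>" using p(4) by (simp add: fm_in_ctx_def)
  have pr: "prov T1 [S'] Top (inst \<phi> [Var 0, Var 0])" "prov T1 [S', S'] \<phi> (inst \<phi> [Var 1, Var 0])"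
    "prov T1 [S', S', S'] (And (inst \<phi> [Var 0, Var 1]) (inst \<phi> [Var 1, Var 2])) (inst \<phi> [Var 0, Var 2])"
    using p(9) by (auto simp: provable_equivalence_def)
  show "sat M ((!) [x, x]) \<phi>" if "x \<in> car M S'"
    using soundness[OF T1.coherent M pr(1), of "[x]"] that by (simp add: tup_Cons sat_inst[OF wf])
  show "sat M ((!) [y, x]) \<phi>" if "x \<in> car M S'" "y \<in> car M S'" "sat M ((!) [x, y]) \<phi>"
    using soundness[OF T1.coherent M pr(2), of "[x, y]"] that by (simp add: tup_Cons sat_inst[OF wf])
  show "sat M ((!) [x, z]) \<phi>" if "x \<in> car M S'" "y \<in> car M S'" "z \<in> car M S'" "sat M ((!) [x, y]) \<phi>" "sat M ((!) [y, z]) \<phi>"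
    using soundness[OF T1.coherent M pr(3), of "[x, y, z]"] that by (simp add: tup_Cons sat_inst[OF wf] numeral_2_eq_2)
qed

lemma expand_struct: "is_struct \<Sigma>2 E"
  unfolding is_struct_def
proof (intro ballI)
  fix f xs assume f: "f \<in> funs \<Sigma>2" and xs: "xs \<in> tup E (fdom \<Sigma>2 f)"
  from f show "fint E f xs \<in> car E (fcod \<Sigma>2 f)"
  proof (cases rule: fn_cases)
    case old
    note o = fun_old[OF old]
    from xs obtain a where "xs = map emb a" "a \<in> tup M (fdom \<Sigma>1 f)" using o tup_old by auto
    moreover have "fint M f a \<in> car M (fcod \<Sigma>1 f)"
      using calculation(2) M old by (simp add: model_def is_struct_def)
    ultimately show ?thesis using o by (simp add: fint_old[OF old] car_old comp_def)
  next
    case (dfn \<phi>)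
    note p = fun_D[OF dfn]
    from xs obtain a where a: "xs = map emb a" "a \<in> tup M (fdom \<Sigma>2 f)" using p tup_old by auto
    from theI'[OF functional_sem[OF dfn a(2)]] show ?thesis
      using p by (simp add: fint_def[OF dfn] car_old a(1) comp_def)
  next
    case (proj P Ss ps i)
    note p = prod_D(6)[OF proj(1,2)] and q = prod_D(1)[OF proj(1)]
    from xs obtain a where a: "xs = [(0, {a})]" "a \<in> tup M Ss" using p proj by (auto simp: tup_Cons car_prod)
    have "Ss ! i \<in> sorts \<Sigma>1" using q proj(2) by auto
    then show ?thesis using p proj tup_nth[OF a(2) proj(2)] by (simp add: a(1) fint_proj car_old)
  next
    case (inj P Ss rs i)
    note p = coprod_D(6)[OF inj(1,2)] and q = coprod_D(1)[OF inj(1)]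
    have "Ss ! i \<in> sorts \<Sigma>1" using q inj(2) by auto
    then obtain x where a: "xs = [emb x]" "x \<in> car M (Ss ! i)" using xs p inj by (auto simp: tup_Cons car_old)
    then show ?thesis using p inj by (simp add: fint_inj[OF inj(1,2)] car_coprod[OF inj(1)])
  next
    case (sub S S' \<phi>)
    note p = sub_D[OF sub]
    from xs obtain x where a: "xs = [emb x]" "x \<in> car M S'" using p by (auto simp: tup_Cons car_sub[OF sub])
    then show ?thesis using p by (simp add: fint_sub[OF sub] car_old)
  next
    case (quot S S' \<phi>)
    note p = quot_D[OF quot]
    from xs obtain x where a: "xs = [emb x]" "x \<in> car M S'" using p by (auto simp: tup_Cons car_old)
    then show ?thesis using p by (auto simp: fint_quot[OF quot] car_quot[OF quot])
  qed
qed

lemma expand_block: "d \<in> \<D> \<Longrightarrow> block_sat \<Sigma>2 E d"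
proof (cases d)
  case (DefFun f \<phi>)
  assume "d \<in> \<D>"
  then have d: "DefFun f \<phi> \<in> \<D>" by (simp add: DefFun)
  note p = fun_D[OF d]
  have wf: "wf_fm \<Sigma>1 (fdom \<Sigma>2 f @ [fcod \<Sigma>2 f]) \<phi>" using p(1) by (simp add: fm_in_ctx_def)
  show ?thesis
    unfolding DefFun block_sat.simps
  proof (intro ballI)
    fix b y' assume "b \<in> tup E (fdom \<Sigma>2 f)" "y' \<in> car E (fcod \<Sigma>2 f)"
    then obtain a y where a: "b = map emb a" "a \<in> tup M (fdom \<Sigma>2 f)" and y: "y' = emb y" "y \<in> car M (fcod \<Sigma>2 f)"
      using p by (auto simp: tup_old car_old)
    have "fint E f b = y' \<longleftrightarrow> (THE y. y \<in> car M (fcod \<Sigma>2 f) \<and> sat M ((!) (a @ [y])) \<phi>) = y"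
      by (simp add: fint_def[OF d] a(1) y(1) comp_def)
    also have "\<dots> \<longleftrightarrow> sat M ((!) (a @ [y])) \<phi>"
    proof -
      obtain z where z: "z \<in> car M (fcod \<Sigma>2 f) \<and> sat M ((!) (a @ [z])) \<phi>"
        "\<And>z'. z' \<in> car M (fcod \<Sigma>2 f) \<and> sat M ((!) (a @ [z'])) \<phi> \<Longrightarrow> z' = z"
        using functional_sem[OF d a(2)] by (rule ex1E) blast
      have "(THE y. y \<in> car M (fcod \<Sigma>2 f) \<and> sat M ((!) (a @ [y])) \<phi>) = z" by (rule the_equality) (use z in blast)+
      then show ?thesis using z y(2) by metis
    qed
    also have "\<dots> \<longleftrightarrow> sat E ((!) (map emb (a @ [y]))) \<phi>"
      using sat_expand[OF wf, of "a @ [y]"] tup_length[OF a(2)] by simp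
    finally show "fint E f b = y' \<longleftrightarrow> sat E ((!) (b @ [y'])) \<phi>" by (simp add: a(1) y(1))
  qed
next
  case (DefRel R \<phi>)
  assume "d \<in> \<D>"
  then have d: "DefRel R \<phi> \<in> \<D>" by (simp add: DefRel)
  note p = rel_D[OF d]
  have wf: "wf_fm \<Sigma>1 (rdom \<Sigma>2 R) \<phi>" using p(1) by (simp add: fm_in_ctx_def)
  show ?thesis
    using sat_expand[OF wf] p by (auto simp: DefRel tup_old rint_def[OF d] tup_length comp_def)
next
  case (DefProd P Ss ps)
  assume "d \<in> \<D>"
  then have d: "DefProd P Ss ps \<in> \<D>" by (simp add: DefProd)
  note p = prod_D[OF d]
  show ?thesis
    unfolding DefProd block_sat.simps
  proof (intro conjI ballI impI)
    fix b assume "b \<in> tup E Ss"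
    then obtain a where a: "b = map emb a" "a \<in> tup M Ss" using p by (auto simp: tup_old)
    then show "\<exists>q\<in>car E P. \<forall>i<length Ss. fint E (ps ! i) [q] = b ! i"
      by (intro bexI[of _ "(0, {a})"]) (auto simp: car_prod[OF d] fint_proj[OF d] tup_length)
  next
    fix b c assume "b \<in> car E P" "c \<in> car E P" and eq: "\<forall>i<length Ss. fint E (ps ! i) [b] = fint E (ps ! i) [c]"
    then obtain a a' where a: "b = (0, {a})" "a \<in> tup M Ss" "c = (0, {a'})" "a' \<in> tup M Ss"
      by (auto simp: car_prod[OF d])
    have "a = a'" using eq a tup_length[OF a(2)] tup_length[OF a(4)]
      by (intro nth_equalityI) (auto simp: fint_proj[OF d])
    then show "b = c" using a by simp
  qed
next
  case (DefCoprod P Ss rs)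
  assume "d \<in> \<D>"
  then have d: "DefCoprod P Ss rs \<in> \<D>" by (simp add: DefCoprod)
  note p = coprod_D[OF d]
  have c: "car E (Ss ! i) = emb ` car M (Ss ! i)" if "i < length Ss" for i
    using p(1) that by (intro car_old) auto
  show ?thesis
    unfolding DefCoprod block_sat.simps
    by (auto simp: car_coprod[OF d] fint_inj[OF d] c)
next
  case (DefSub S S' \<phi> i)
  assume "d \<in> \<D>"
  then have d: "DefSub S S' \<phi> i \<in> \<D>" by (simp add: DefSub)
  note p = sub_D[OF d]
  have wf: "wf_fm \<Sigma>1 [S'] \<phi>" using p(4) by (simp add: fm_in_ctx_def)
  have s: "sat E ((!) [emb x]) \<phi> \<longleftrightarrow> sat M ((!) [x]) \<phi>" for x using sat_expand[OF wf, of "[x]"] by simp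
  show ?thesis
    unfolding DefSub block_sat.simps fint_sub[OF d] car_old[OF p(1)] car_sub[OF d] by (auto simp: s)
next
  case (DefQuot S S' \<phi> e)
  assume "d \<in> \<D>"
  then have d: "DefQuot S S' \<phi> e \<in> \<D>" by (simp add: DefQuot)
  note p = quot_D[OF d] and eqv = equivalence_sem[OF d]
  have wf: "wf_fm \<Sigma>1 [S', S'] \<phi>" using p(4) by (simp add: fm_in_ctx_def)
  have s: "sat E ((!) [emb x, emb y]) \<phi> \<longleftrightarrow> sat M ((!) [x, y]) \<phi>" for x y using sat_expand[OF wf, of "[x, y]"] by simp
  have "cls S' \<phi> x = cls S' \<phi> y \<longleftrightarrow> sat M ((!) [x, y]) \<phi>" if xy: "x \<in> car M S'" "y \<in> car M S'" for x y
  proof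
    assume "cls S' \<phi> x = cls S' \<phi> y"
    \<comment> \<open>Reflexivity puts \<open>y\<close> into its own class, hence into the class of
      \<open>x\<close>; symmetry and transitivity serve the converse.\<close>
    moreover have "[y] \<in> snd (cls S' \<phi> y)" using xy eqv(1) by simp
    ultimately have "[y] \<in> snd (cls S' \<phi> x)" by simp
    then show "sat M ((!) [x, y]) \<phi>" by simp
  next
    assume "sat M ((!) [x, y]) \<phi>"
    then have "sat M ((!) [x, z]) \<phi> \<longleftrightarrow> sat M ((!) [y, z]) \<phi>" if "z \<in> car M S'" for z
      using eqv(2,3) xy that by blast
    then show "cls S' \<phi> x = cls S' \<phi> y" by blast
  qed
  then show ?thesis
    using p by (auto simp: DefQuot car_old car_quot[OF d] fint_quot[OF d] s)
qed

lemma expand_model: "model T2 E"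
  unfolding model_iff
proof (intro conjI ballI)
  show "is_struct \<Sigma>2 E" by (rule expand_struct)
  fix s assume "s \<in> axs T2"
  then consider "s \<in> axs T1" | d where "d \<in> \<D>" "s \<in> block_axioms \<Sigma>2 d" using axs_T2 by auto
  then show "holds E s"
  proof cases
    case 1
    obtain \<Gamma> \<phi> \<psi> where s: "s = (\<Gamma>, \<phi>, \<psi>)" by (metis surj_pair)
    have wf: "wf_fm \<Sigma>1 \<Gamma> \<phi>" "wf_fm \<Sigma>1 \<Gamma> \<psi>" "set \<Gamma> \<subseteq> sorts \<Sigma>1"
      using 1 T1.coherent by (auto simp: s coherent_theory_def fm_in_ctx_def)
    have "holds M s" using M 1 by (simp add: model_iff)
    then show ?thesis
      by (auto simp: s holds_def tup_old[OF wf(3)] sat_expand[OF wf(1)] sat_expand[OF wf(2)] tup_length)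
  next
    case 2
    then show ?thesis using block_sat_iff[OF valid expand_struct] expand_block new_funs by blast
  qed
qed

end

section \<open>Conservativity of Morita extensions\<close>

text \<open>A model of \<open>T1\<close> over constants is expanded to a model of \<open>T2\<close>
  over another element type; polymorphic soundness applies there and truth of old formulas transfers
  back. The converse direction reads models of \<open>T2\<close> as models of
  \<open>T1\<close>.\<close>

lemma morita_conservative:
  assumes "fm_in_ctx \<Sigma>1 \<Gamma> \<phi>" "fm_in_ctx \<Sigma>1 \<Gamma> \<psi>"
  shows "prov T2 \<Gamma> \<phi> \<psi> \<longleftrightarrow> prov T1 \<Gamma> \<phi> \<psi>"
proof
  assume p: "prov T2 \<Gamma> \<phi> \<psi>"
  show "prov T1 \<Gamma> \<phi> \<psi>"
  proof (rule T1.completeness[OF assms])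
    fix M :: "('s, 'f, 'r, ('s, 'f, 'r) const) struct" and a
    assume M: "model T1 M" and a: "a \<in> tup M \<Gamma>" and s: "sat M ((!) a) \<phi>"
    have "map emb a \<in> tup (expand M) \<Gamma>" using a tup_old[OF M] assms(1) by (simp add: fm_in_ctx_def)
    from soundness[OF T2.coherent expand_model[OF M] p this] show "sat M ((!) a) \<psi>"
      using s sat_expand[OF M, of \<Gamma> \<phi> a] sat_expand[OF M, of \<Gamma> \<psi> a] assms tup_length[OF a] by (simp add: fm_in_ctx_def)
  qed
next
  assume p: "prov T1 \<Gamma> \<phi> \<psi>"
  show "prov T2 \<Gamma> \<phi> \<psi>"
    by (rule T2.completeness[OF fm_in_ctx_mono[OF assms(1) sub] fm_in_ctx_mono[OF assms(2) sub]])
      (rule soundness[OF T1.coherent reduct p])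
qed

lemma morita_translation: "translation T1 T2 id id id"
proof (intro translation.intro translation_axioms.intro T1.coherent_axioms T2.coherent_axioms)
    show "\<exists>G. finite G \<and> (\<forall>(A, g)\<in>G. A \<in> Ob (syn_cat T1) \<and>
          g \<in> hom (syn_cat T2) (map id (fst A), map_fm id id id (snd A)) B) \<and> T2.covers B (snd ` G)"
      if "B \<in> Ob (syn_cat T2)" for B
      using charted.old_covers[OF charted that] by (simp add: fm.map_id)
qed (use morita_conservative charted.old_definable[OF charted] fm_in_ctx_mono[OF _ sub] in \<open>simp_all add: fm.map_id\<close>)

end

section \<open>T-Morita equivalent theories have equivalent classifying toposes\<close>

lemma (in coherent) covers_Ident:
  assumes B: "B \<in> Ob C"
  shows "covers B {Ident C B}"
  using Ident_hom[OF B] by (auto simp: covers_def hom_def)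

text \<open>The case in which every formula of \<open>T2\<close> is literally a translation, so that
  each object is covered by its identity. Injectivity on sorts lets the context of a preimage be
  recovered.\<close>

lemma translationI:
  assumes "coherent T1" "coherent T2"
    and ctx: "\<And>\<Gamma> \<phi>. fm_in_ctx (sig T1) \<Gamma> \<phi> \<Longrightarrow> fm_in_ctx (sig T2) (map hs \<Gamma>) (map_fm hs hf hr \<phi>)"
    and cons: "\<And>\<Gamma> \<phi> \<psi>. fm_in_ctx (sig T1) \<Gamma> \<phi> \<Longrightarrow> fm_in_ctx (sig T1) \<Gamma> \<psi> \<Longrightarrow>
      prov T2 (map hs \<Gamma>) (map_fm hs hf hr \<phi>) (map_fm hs hf hr \<psi>) \<longleftrightarrow> prov T1 \<Gamma> \<phi> \<psi>"
    and inj: "inj_on hs (sorts (sig T1))"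
    and surj: "\<And>\<Delta> \<theta>. fm_in_ctx (sig T2) \<Delta> \<theta> \<Longrightarrow>
      \<exists>\<Gamma> \<chi>. fm_in_ctx (sig T1) \<Gamma> \<chi> \<and> map hs \<Gamma> = \<Delta> \<and> map_fm hs hf hr \<chi> = \<theta>"
  shows "translation T1 T2 hs hf hr"
proof -
  interpret T1: coherent T1 by fact
  interpret T2: coherent T2 by fact
  show ?thesis
  proof (intro translation.intro translation_axioms.intro assms(1,2) ctx cons)
    fix \<Gamma> \<theta> assume \<Gamma>: "set \<Gamma> \<subseteq> sorts (sig T1)" and \<theta>: "fm_in_ctx (sig T2) (map hs \<Gamma>) \<theta>"
    obtain \<Gamma>' \<chi> where \<chi>: "fm_in_ctx (sig T1) \<Gamma>' \<chi>" "map hs \<Gamma>' = map hs \<Gamma>" "map_fm hs hf hr \<chi> = \<theta>"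
      using surj[OF \<theta>] by blast
    have "\<Gamma>' = \<Gamma>"
      using \<chi>(1,2) \<Gamma> inj by (intro map_inj_on[of hs]) (auto simp: fm_in_ctx_def intro: inj_on_subset)
    then show "\<exists>\<chi>. fm_in_ctx (sig T1) \<Gamma> \<chi> \<and> prov T2 (map hs \<Gamma>) (map_fm hs hf hr \<chi>) \<theta> \<and>
        prov T2 (map hs \<Gamma>) \<theta> (map_fm hs hf hr \<chi>)"
      using \<chi> prov.ident[OF \<theta>] by blast
  next
    fix B assume B: "B \<in> Ob (syn_cat T2)"
    obtain \<Gamma> \<chi> where "fm_in_ctx (sig T1) \<Gamma> \<chi>" "map hs \<Gamma> = fst B" "map_fm hs hf hr \<chi> = snd B"
      using surj[of "fst B" "snd B"] B by (auto simp: Ob_syn_cat)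
    then show "\<exists>G. finite G \<and> (\<forall>(A, g)\<in>G. A \<in> Ob (syn_cat T1) \<and>
          g \<in> hom (syn_cat T2) (map hs (fst A), map_fm hs hf hr (snd A)) B) \<and> T2.covers B (snd ` G)"
      using hom_id[OF T2.syn_cat_category B] T2.covers_Ident[OF B]
      by (intro exI[of _ "{((\<Gamma>, \<chi>), Ident (syn_cat T2) B)}"]) (simp add: Ob_syn_cat)
  qed
qed

lemma logically_equivalent_translation:
  assumes "coherent T" "coherent T'" "logically_equivalent T T'"
  shows "translation T T' id id id"
  using assms(3) by (intro translationI assms(1,2)) (auto simp: logically_equivalent_def fm.map_id fm_in_ctx_mono)

section \<open>Renaming of symbols\<close>

definition sig_map :: "('s1, 'f1, 'r1) signature \<Rightarrow> ('s2, 'f2, 'r2) signature \<Rightarrow>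
    ('s1 \<Rightarrow> 's2) \<Rightarrow> ('f1 \<Rightarrow> 'f2) \<Rightarrow> ('r1 \<Rightarrow> 'r2) \<Rightarrow> bool" where
  "sig_map \<Sigma> \<Sigma>' hs hf hr \<longleftrightarrow>
     (\<forall>S\<in>sorts \<Sigma>. hs S \<in> sorts \<Sigma>') \<and>
     (\<forall>f\<in>funs \<Sigma>. hf f \<in> funs \<Sigma>' \<and> fdom \<Sigma>' (hf f) = map hs (fdom \<Sigma> f) \<and> fcod \<Sigma>' (hf f) = hs (fcod \<Sigma> f)) \<and>
     (\<forall>R\<in>rels \<Sigma>. hr R \<in> rels \<Sigma>' \<and> rdom \<Sigma>' (hr R) = map hs (rdom \<Sigma> R))"

lemma wt_map:
  assumes h: "sig_map \<Sigma> \<Sigma>' hs hf hr" and "wt \<Sigma> \<Gamma> t S"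
  shows "wt \<Sigma>' (map hs \<Gamma>) (map_tm hf t) (hs S)"
  using assms(2)
proof induction
  case (Var i)
  then show ?case using wt.Var[of i "map hs \<Gamma>" \<Sigma>'] by simp
next
  case (Fn f ts)
  then show ?case using h wt.Fn[of "hf f" \<Sigma>' "map hs \<Gamma>" "map (map_tm hf) ts"]
    by (auto simp: sig_map_def list_all2_conv_all_nth)
qed

lemma wf_fm_map: "sig_map \<Sigma> \<Sigma>' hs hf hr \<Longrightarrow> wf_fm \<Sigma> \<Gamma> \<phi> \<Longrightarrow> wf_fm \<Sigma>' (map hs \<Gamma>) (map_fm hs hf hr \<phi>)"
proof (induction \<phi> arbitrary: \<Gamma>)
  case (Eq t u)
  then show ?case by (auto dest: wt_map)
next
  case (Rel R ts)
  then show ?case by (auto simp: sig_map_def list_all2_conv_all_nth intro!: wt_map[OF Rel.prems(1)])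
next
  case (Ex S \<phi>)
  then show ?case using Ex.IH[of "S # \<Gamma>"] by (simp add: sig_map_def)
qed auto

lemma fm_in_ctx_map:
  assumes h: "sig_map \<Sigma> \<Sigma>' hs hf hr" and "fm_in_ctx \<Sigma> \<Gamma> \<phi>"
  shows "fm_in_ctx \<Sigma>' (map hs \<Gamma>) (map_fm hs hf hr \<phi>)"
  using assms wf_fm_map[OF h] by (auto simp: fm_in_ctx_def sig_map_def)

text \<open>The reduct of a structure along a map of signatures.\<close>

definition reindex :: "('s2, 'f2, 'r2, 'm) struct \<Rightarrow> ('s1 \<Rightarrow> 's2) \<Rightarrow> ('f1 \<Rightarrow> 'f2) \<Rightarrow> ('r1 \<Rightarrow> 'r2) \<Rightarrow>
    ('s1, 'f1, 'r1, 'm) struct" where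
  "reindex M hs hf hr = \<lparr>car = car M \<circ> hs, fint = fint M \<circ> hf, rint = rint M \<circ> hr\<rparr>"

lemma tup_reindex: "tup (reindex M hs hf hr) \<Gamma> = tup M (map hs \<Gamma>)"
  by (auto simp: tup_def reindex_def list_all2_conv_all_nth)

lemma eval_reindex: "eval (reindex M hs hf hr) e t = eval M e (map_tm hf t)"
  by (induction t) (auto simp: reindex_def comp_def cong: map_cong)

lemma sat_reindex: "sat (reindex M hs hf hr) e \<phi> \<longleftrightarrow> sat M e (map_fm hs hf hr \<phi>)"
proof (induction \<phi> arbitrary: e)
  case (Ex S \<phi>)
  then show ?case by (simp add: reindex_def)
next
  case (Rel R ts)
  have m: "map (eval (reindex M hs hf hr) e) ts = map (eval M e) (map (map_tm hf) ts)" by (simp add: eval_reindex)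
  show ?case unfolding sat.simps fm.map m by (simp add: reindex_def)
qed (auto simp: eval_reindex)

text \<open>By completeness of \<open>T'\<close>: the reduct of any of its models is a model of
  \<open>T\<close>, and truth of a translated formula is truth of the formula in the reduct.\<close>

lemma prov_map:
  assumes T: "coherent T" "coherent T'" and h: "sig_map (sig T) (sig T') hs hf hr"
    and ax: "\<And>\<Gamma> \<phi> \<psi>. (\<Gamma>, \<phi>, \<psi>) \<in> axs T \<Longrightarrow> (map hs \<Gamma>, map_fm hs hf hr \<phi>, map_fm hs hf hr \<psi>) \<in> axs T'"
    and ctx: "fm_in_ctx (sig T) \<Gamma> \<phi>" "fm_in_ctx (sig T) \<Gamma> \<psi>" and p: "prov T \<Gamma> \<phi> \<psi>"
  shows "prov T' (map hs \<Gamma>) (map_fm hs hf hr \<phi>) (map_fm hs hf hr \<psi>)"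
proof (rule coherent.completeness[OF T(2) fm_in_ctx_map[OF h ctx(1)] fm_in_ctx_map[OF h ctx(2)]])
  fix M :: "('d, 'e, 'f, ('d, 'e, 'f) const) struct" and a
  assume M: "model T' M" and a: "a \<in> tup M (map hs \<Gamma>)" and s: "sat M ((!) a) (map_fm hs hf hr \<phi>)"
  let ?M = "reindex M hs hf hr"
  have "is_struct (sig T) ?M"
    unfolding is_struct_def tup_reindex
  proof (intro ballI)
    fix f xs assume f: "f \<in> funs (sig T)" and xs: "xs \<in> tup M (map hs (fdom (sig T) f))"
    have "hf f \<in> funs (sig T')" "fdom (sig T') (hf f) = map hs (fdom (sig T) f)"
      "fcod (sig T') (hf f) = hs (fcod (sig T) f)"
      using h f by (auto simp: sig_map_def)
    then show "fint ?M f xs \<in> car ?M (fcod (sig T) f)" using M xs by (fastforce simp: reindex_def model_def is_struct_def)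
  qed
  moreover have "\<forall>(\<Gamma>, \<phi>, \<psi>)\<in>axs T. \<forall>a\<in>tup ?M \<Gamma>. sat ?M ((!) a) \<phi> \<longrightarrow> sat ?M ((!) a) \<psi>"
    unfolding tup_reindex sat_reindex using M ax by (fastforce simp: model_def)
  ultimately have "model T ?M" by (simp add: model_def)
  from soundness[OF coherent.coherent[OF T(1)] this p, of a] show "sat M ((!) a) (map_fm hs hf hr \<psi>)"
    using a s by (simp add: tup_reindex sat_reindex)
qed

lemma map_tm_cancel:
  assumes "\<And>f. f \<in> funs \<Sigma> \<Longrightarrow> gf (hf f) = f" and "wt \<Sigma> \<Gamma> t S"
  shows "map_tm gf (map_tm hf t) = t"
  using assms(2)
proof induction
  case (Fn f ts)
  then show ?case using assms(1) by (auto simp: list_all2_conv_all_nth comp_def intro!: nth_equalityI)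
qed simp

lemma map_fm_cancel:
  assumes g: "\<And>S. S \<in> sorts \<Sigma> \<Longrightarrow> gs (hs S) = S" "\<And>f. f \<in> funs \<Sigma> \<Longrightarrow> gf (hf f) = f"
    "\<And>R. R \<in> rels \<Sigma> \<Longrightarrow> gr (hr R) = R"
  shows "wf_fm \<Sigma> \<Gamma> \<phi> \<Longrightarrow> map_fm gs gf gr (map_fm hs hf hr \<phi>) = \<phi>"
proof (induction \<phi> arbitrary: \<Gamma>)
  case (Eq t u)
  then show ?case using map_tm_cancel[of \<Sigma> gf hf, OF g(2)] by auto
next
  case (Rel R ts)
  have "map_tm gf (map_tm hf (ts ! i)) = ts ! i" if "i < length ts" for i
    using map_tm_cancel[of \<Sigma> gf hf, OF g(2), of \<Gamma> "ts ! i" "rdom \<Sigma> R ! i"] Rel that by (auto simp: list_all2_conv_all_nth)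
  then show ?case using Rel g(3) by (auto intro!: nth_equalityI)
qed (use g in auto)

lemma map_cancel: "(\<And>S. S \<in> A \<Longrightarrow> g (h S) = S) \<Longrightarrow> set \<Gamma> \<subseteq> A \<Longrightarrow> map g (map h \<Gamma>) = \<Gamma>"
  by (induction \<Gamma>) auto

text \<open>The inverse maps undo the renaming only on symbols of the signatures, so cancellation
  holds for well-formed formulas. Both directions of conservativity are then instances of
  \<open>prov_map\<close>, for the renaming and for its inverse.\<close>

lemma renamed_copy_translation:
  assumes T: "coherent T" "coherent T'" and r: "renamed_copy T T'"
  obtains hs hf hr where "translation T T' hs hf hr"
proof -
  obtain hs hf hr where bij: "bij_betw hs (sorts (sig T)) (sorts (sig T'))"
    "bij_betw hf (funs (sig T)) (funs (sig T'))" "bij_betw hr (rels (sig T)) (rels (sig T'))"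
    and ar: "\<forall>f\<in>funs (sig T). fdom (sig T') (hf f) = map hs (fdom (sig T) f) \<and> fcod (sig T') (hf f) = hs (fcod (sig T) f)"
      "\<forall>R\<in>rels (sig T). rdom (sig T') (hr R) = map hs (rdom (sig T) R)"
    and ax: "axs T' = (\<lambda>(\<Gamma>, \<phi>, \<psi>). (map hs \<Gamma>, map_fm hs hf hr \<phi>, map_fm hs hf hr \<psi>)) ` axs T"
    using r unfolding renamed_copy_def by blast
  define gs gf gr where g: "gs = inv_into (sorts (sig T)) hs" "gf = inv_into (funs (sig T)) hf" "gr = inv_into (rels (sig T)) hr"
  let ?h = "map_fm hs hf hr" and ?g = "map_fm gs gf gr"
  have gh: "\<And>S. S \<in> sorts (sig T) \<Longrightarrow> gs (hs S) = S" "\<And>f. f \<in> funs (sig T) \<Longrightarrow> gf (hf f) = f"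
    "\<And>R. R \<in> rels (sig T) \<Longrightarrow> gr (hr R) = R"
    using bij by (simp_all add: g bij_betw_inv_into_left)
  have hg: "\<And>S. S \<in> sorts (sig T') \<Longrightarrow> hs (gs S) = S" "\<And>f. f \<in> funs (sig T') \<Longrightarrow> hf (gf f) = f"
    "\<And>R. R \<in> rels (sig T') \<Longrightarrow> hr (gr R) = R"
    using bij by (simp_all add: g bij_betw_inv_into_right)
  have dom: "\<And>S. S \<in> sorts (sig T) \<Longrightarrow> hs S \<in> sorts (sig T')" "\<And>f. f \<in> funs (sig T) \<Longrightarrow> hf f \<in> funs (sig T')"
    "\<And>R. R \<in> rels (sig T) \<Longrightarrow> hr R \<in> rels (sig T')"
    "\<And>S. S \<in> sorts (sig T') \<Longrightarrow> gs S \<in> sorts (sig T)" "\<And>f. f \<in> funs (sig T') \<Longrightarrow> gf f \<in> funs (sig T)"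
    "\<And>R. R \<in> rels (sig T') \<Longrightarrow> gr R \<in> rels (sig T)"
    using bij bij[THEN bij_betw_inv_into] by (simp_all add: g bij_betw_apply)
  have wf: "wf_signature (sig T)" and axT: "\<forall>(\<Gamma>, \<phi>, \<psi>)\<in>axs T. fm_in_ctx (sig T) \<Gamma> \<phi> \<and> fm_in_ctx (sig T) \<Gamma> \<psi>"
    using coherent.coherent[OF T(1)] by (auto simp: coherent_theory_def)
  have h: "sig_map (sig T) (sig T') hs hf hr" using dom ar by (simp add: sig_map_def)
  have "fdom (sig T) (gf f) = map gs (fdom (sig T') f) \<and> fcod (sig T) (gf f) = gs (fcod (sig T') f)"
    if "f \<in> funs (sig T')" for f
  proof -
    have "gf f \<in> funs (sig T)" using dom that by blast
    then show ?thesis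
      using ar(1) wf map_cancel[of "sorts (sig T)" gs hs, OF gh(1)] gh(1) hg(2)[OF that]
      by (metis wf_signature_def)
  qed
  moreover have "rdom (sig T) (gr R) = map gs (rdom (sig T') R)" if "R \<in> rels (sig T')" for R
  proof -
    have "gr R \<in> rels (sig T)" using dom that by blast
    then show ?thesis
      using ar(2) wf map_cancel[of "sorts (sig T)" gs hs, OF gh(1)] hg(3)[OF that]
      by (metis wf_signature_def)
  qed
  ultimately have g': "sig_map (sig T') (sig T) gs gf gr" using dom by (simp add: sig_map_def)
  have gh_fm: "map gs (map hs \<Gamma>) = \<Gamma>" "?g (?h \<phi>) = \<phi>" if "fm_in_ctx (sig T) \<Gamma> \<phi>" for \<Gamma> \<phi>
    using that map_cancel[of "sorts (sig T)" gs hs \<Gamma>, OF gh(1)] map_fm_cancel[of "sig T" gs hs gf hf gr hr \<Gamma> \<phi>, OF gh]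
    by (simp_all add: fm_in_ctx_def)
  have "translation T T' hs hf hr"
  proof (rule translationI[OF T])
    fix \<Gamma> \<phi> \<psi> assume ctx: "fm_in_ctx (sig T) \<Gamma> \<phi>" "fm_in_ctx (sig T) \<Gamma> \<psi>"
    show "prov T' (map hs \<Gamma>) (?h \<phi>) (?h \<psi>) \<longleftrightarrow> prov T \<Gamma> \<phi> \<psi>"
    proof
      assume "prov T' (map hs \<Gamma>) (?h \<phi>) (?h \<psi>)"
      moreover have "(map gs \<Gamma>, ?g \<phi>, ?g \<psi>) \<in> axs T" if "(\<Gamma>, \<phi>, \<psi>) \<in> axs T'" for \<Gamma> \<phi> \<psi>
        using that axT gh_fm unfolding ax by fastforce
      ultimately have "prov T (map gs (map hs \<Gamma>)) (?g (?h \<phi>)) (?g (?h \<psi>))"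
        by (intro prov_map[OF T(2,1) g']) (use ctx fm_in_ctx_map[OF h] in auto)
      then show "prov T \<Gamma> \<phi> \<psi>" by (simp only: gh_fm[OF ctx(1)] gh_fm[OF ctx(2)])
    next
      assume "prov T \<Gamma> \<phi> \<psi>"
      then show "prov T' (map hs \<Gamma>) (?h \<phi>) (?h \<psi>)"
        by (intro prov_map[OF T h _ ctx]) (force simp: ax)
    qed
  next
    fix \<Delta> \<theta> assume "fm_in_ctx (sig T') \<Delta> \<theta>"
    then show "\<exists>\<Gamma> \<chi>. fm_in_ctx (sig T) \<Gamma> \<chi> \<and> map hs \<Gamma> = \<Delta> \<and> ?h \<chi> = \<theta>"
      using fm_in_ctx_map[OF g', of \<Delta> \<theta>] map_cancel[of "sorts (sig T')" hs gs \<Delta>, OF hg(1)]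
        map_fm_cancel[of "sig T'" hs gs hf gf hr gr \<Delta> \<theta>, OF hg]
      by (intro exI[of _ "map gs \<Delta>"] exI[of _ "?g \<theta>"]) (simp add: fm_in_ctx_def)
  qed (use fm_in_ctx_map[OF h] bij in \<open>auto simp: bij_betw_def\<close>)
  then show thesis by (rule that)
qed

section \<open>Composing the equivalences of toposes along steps and chains\<close>

lemma j_morita_equivalent_sym: "j_morita_equivalent U T T' \<Longrightarrow> j_morita_equivalent U T' T"
  unfolding j_morita_equivalent_def by (rule equivalent_categories_sym)

lemma j_morita_equivalent_trans:
  "j_morita_equivalent U T T' \<Longrightarrow> j_morita_equivalent U T' T'' \<Longrightarrow> j_morita_equivalent U T T''"
  unfolding j_morita_equivalent_def by (rule equivalent_categories_trans)

lemma j_morita_equivalent_refl: "coherent T \<Longrightarrow> j_morita_equivalent U T T"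
  unfolding j_morita_equivalent_def classifying_topos_def
  by (intro equivalent_categories_refl Sh_category coherent.syn_cat_category)

lemma translation_j_morita_equivalent:
  "small_sets U \<Longrightarrow> translation T T' hs hf hr \<Longrightarrow> j_morita_equivalent U T T'"
  unfolding j_morita_equivalent_def by (rule equivalent_categories_sym) (rule translation.equivalent_toposes)

lemma coherentI: "coherent_theory T \<Longrightarrow> coherent T"
  by (rule coherent.intro)

lemma renamed_copy_j_morita_equivalent:
  assumes "small_sets U" "coherent_theory T" "coherent_theory T'" "renamed_copy T T'"
  shows "j_morita_equivalent U T T'"
  using renamed_copy_translation[OF coherentI coherentI] translation_j_morita_equivalent assms by metis

lemma morita_extension_j_morita_equivalent:
  assumes "small_sets U" "morita_extension T T'"
  shows "j_morita_equivalent U T T'"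
proof -
  obtain \<D> where \<D>: "coherent_theory T" "coherent_theory T'" "subsignature (sig T) (sig T')"
    "\<forall>d\<in>\<D>. valid_block T (sig T') d"
    "\<forall>d\<in>\<D>. new_sorts d \<subseteq> sorts (sig T') - sorts (sig T) \<and> new_funs d \<subseteq> funs (sig T') - funs (sig T) \<and>
       new_rels d \<subseteq> rels (sig T') - rels (sig T)"
    "\<forall>S\<in>sorts (sig T') - sorts (sig T). \<exists>!d. d \<in> \<D> \<and> S \<in> new_sorts d"
    "\<forall>f\<in>funs (sig T') - funs (sig T). \<exists>!d. d \<in> \<D> \<and> f \<in> new_funs d"
    "\<forall>R\<in>rels (sig T') - rels (sig T). \<exists>!d. d \<in> \<D> \<and> R \<in> new_rels d"
    "axs T' = axs T \<union> (\<Union>d\<in>\<D>. block_axioms (sig T') d)"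
    using assms(2) unfolding morita_extension_def by (elim conjE exE) (rule that)
  have "morita T T' \<D>" by (intro morita.intro morita_axioms.intro coherent.intro) (use \<D> in simp_all)
  then show ?thesis by (rule translation_j_morita_equivalent[OF assms(1) morita.morita_translation])
qed

text \<open>Coherence of the last theory is carried along, because a trivial chain provides it only
  through its first theory.\<close>

lemma morita_chain_j_morita_equivalent:
  assumes "small_sets U" "coherent_theory T" "morita_extension\<^sup>*\<^sup>* T T'"
  shows "j_morita_equivalent U T T' \<and> coherent_theory T'"
  using assms(3)
proof induction
  case base
  then show ?case using assms(2) j_morita_equivalent_refl coherentI by blast
next
  case (step T' T'')
  have "coherent_theory T''" using step.hyps(2) by (simp add: morita_extension_def)
  then show ?case
    using step.IH morita_extension_j_morita_equivalent[OF assms(1) step.hyps(2)] j_morita_equivalent_trans by blast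
qed

lemma pre_t_morita_equivalent_j_morita_equivalent:
  assumes "small_sets U" "pre_t_morita_equivalent T T'"
  shows "j_morita_equivalent U T T'"
proof -
  obtain Tn Tm where c: "coherent_theory T" "coherent_theory T'"
    and "morita_extension\<^sup>*\<^sup>* T Tn" "morita_extension\<^sup>*\<^sup>* T' Tm" and eq: "logically_equivalent Tn Tm"
    using assms(2) unfolding pre_t_morita_equivalent_def by blast
  then have n: "j_morita_equivalent U T Tn" "coherent Tn" and m: "j_morita_equivalent U T' Tm" "coherent Tm"
    using morita_chain_j_morita_equivalent[OF assms(1)] coherentI by blast+
  have "j_morita_equivalent U Tn Tm"
    by (rule translation_j_morita_equivalent[OF assms(1) logically_equivalent_translation[OF n(2) m(2) eq]])
  then show ?thesis using n(1) m(1) j_morita_equivalent_trans j_morita_equivalent_sym by blast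
qed

lemma t_morita_step_j_morita_equivalent:
  assumes "small_sets U" "t_morita_step T T'"
  shows "j_morita_equivalent U T T'"
  using assms pre_t_morita_equivalent_j_morita_equivalent renamed_copy_j_morita_equivalent
  unfolding t_morita_step_def by blast

theorem theorem3p10:
  fixes T :: "('s1, 'f1, 'r1) coh_theory"
    and T' :: "('s2, 'f2, 'r2) coh_theory"
    and U :: "'u set set"
  assumes "coherent_theory T"
    and "coherent_theory T'"
    and "t_morita_equivalent TYPE('s \<times> 'f \<times> 'r) T T'"
    and "small_sets U"
  shows "j_morita_equivalent U T T'"
proof -
  obtain A A' :: "('s, 'f, 'r) coh_theory" where r: "renamed_copy T A" "renamed_copy T' A'" and s: "t_morita_step\<^sup>+\<^sup>+ A A'"
    using assms(3) unfolding t_morita_equivalent_def by blast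
  \<comment> \<open>\<open>renamed_copy\<close> by itself does not make a copy coherent; for
    \<open>A\<close> and \<open>A'\<close> this comes from the steps between them, and the outer
    renamings need it.\<close>
  from s have "coherent_theory A \<and> coherent_theory A' \<and> j_morita_equivalent U A A'"
  proof induction
    case (base A')
    then show ?case using t_morita_step_j_morita_equivalent[OF assms(4)] unfolding t_morita_step_def by blast
  next
    case (step A' A'')
    then show ?case
      using t_morita_step_j_morita_equivalent[OF assms(4)] j_morita_equivalent_trans unfolding t_morita_step_def by blast
  qed
  then have "j_morita_equivalent U T A" "j_morita_equivalent U A A'" "j_morita_equivalent U A' T'"
    using renamed_copy_j_morita_equivalent[OF assms(4)] assms(1,2) r j_morita_equivalent_sym by blast+
  then show ?thesis by (rule j_morita_equivalent_trans[OF _ j_morita_equivalent_trans])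
qed

end
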